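(* Let $n\ge 2$. As a right (or as a left) ${}^{D}\Lambda_{n,\mathbb{Q}}^-$-module, $\mathrm{Pol}_{n,\mathbb{Q}}^-$ is free of graded rank $q^{n(n-1)}[n][2n-2]!!$, with a homogeneous basis given by the spin type D Schubert polynomials $\{{}^{D}\mathfrak{s}_w\}_{w\in D_n}$.
   Context: $\mathrm{Pol}_n^-$ is the unital $\mathbb{Z}$-algebra generated by $x_1,\dots,x_n$ subject to $x_ix_j+x_jx_i=0$ for all $i\ne j$, $\mathbb{Z}$-graded with $|x_i|=2$. A subscript $\mathbb{Q}$ denotes $\mathbb{Q}\otimes_{\mathbb{Z}}-$. For $1\le i\le n-1$ let $s_i$ be the algebra endomorphism of $\mathrm{Pol}_n^-$ with $s_i(x_i)=-x_{i+1}$, $s_i(x_{i+1})=-x_i$, $s_i(x_j)=-x_j$ for $j\ne i,i+1$, and let $s_n^D$ be the algebra endomorphism with $s_n^D(x_n)=x_{n-1}$, $s_n^D(x_{n-1})=x_n$, $s_n^D(x_j)=-x_j$ for $j\le n-2$. The type D odd Demazure operators are the $\mathbb{Z}$-linear operators $\partial_i^-$ ($1\le i\le n-1$) and $\partial_n^D$ on $\mathrm{Pol}_n^-$ that kill $1$ and satisfy: $\partial_i^-(x_j)=1$ if $j\in\{i,i+1\}$ and $0$ otherwise; $\partial_n^D(x_n)=-1$, $\partial_n^D(x_{n-1})=1$, $\partial_n^D(x_j)=0$ for $j\le n-2$; and $\partial_i^-(fg)=\partial_i^-(f)g+s_i(f)\partial_i^-(g)$, $\partial_n^D(fg)=\partial_n^D(f)g+s_n^D(f)\partial_n^D(g)$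 for all $f,g$. The ring of spin type D symmetric polynomials is ${}^{D}\Lambda_n^-=\bigcap_{i=1}^{n-1}\ker(\partial_i^-)\cap\ker(\partial_n^D)$. $D_n=\langle s_1,\dots,s_n\rangle$ is the Weyl group of type $D_n$ with simple reflections $s_1,\dots,s_{n-1}$ (generating $S_n$) and $s_n$, where $s_ns_{n-2}s_n=s_{n-2}s_ns_{n-2}$ and $s_n$ commutes with $s_i$ for $i\le n-1$, $i\ne n-2$; $w_n$ is its longest element. Write $\partial_i:=\partial_i^-$ for $i<n$ and $\partial_n:=\partial_n^D$. For each $w\in D_n$ a reduced expression $w=s_{i_1}\cdots s_{i_\ell}$ is chosen and $\partial_w^D:=\partial_{i_1}\cdots\partial_{i_\ell}$ (well defined up to sign). The spin type D Schubert polynomials are ${}^{D}\mathfrak{s}_w=\partial^D_{w^{-1}w_n}(x_1^{2n-2}x_2^{2n-4}\cdots x_{n-1}^2)$, $w\in D_n$. The graded rank of a free graded module with homogeneous basis $\{b\}$ is $\sum_b q^{|b|}$. Here $[m]=\frac{q^m-q^{-m}}{q-q^{-1}}$ and $[2n-2]!!=[2n-2][2n-4]\cdots[4][2]$. *)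

theory Defs
  imports
    "HOL-Algebra.QuotRing"
    "HOL-Algebra.Bij"
    "HOL-Algebra.Generated_Groups"
    "HOL-Combinatorics.Transposition"
    "HOL-Library.Poly_Mapping"
    "HOL-Computational_Algebra.Formal_Laurent_Series"
begin

section \<open>Monoid rings and extension of scalars to the rationals\<close>

definition monoid_ring :: "('a, 'c) monoid_scheme \<Rightarrow> ('a \<Rightarrow>\<^sub>0 int) ring" where
  "monoid_ring M =
    \<lparr>carrier = {p. Poly_Mapping.keys p \<subseteq> carrier M},
     monoid.mult = (\<lambda>p q. \<Sum>a\<in>Poly_Mapping.keys p. \<Sum>b\<in>Poly_Mapping.keys q.
       Poly_Mapping.single (a \<otimes>\<^bsub>M\<^esub> b) (Poly_Mapping.lookup p a * Poly_Mapping.lookup q b)),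
     one = Poly_Mapping.single \<one>\<^bsub>M\<^esub> 1,
     zero = 0,
     add = (+)\<rparr>"

text \<open>
  For a ring \<open>A\<close>, the ring \<open>\<rat> \<otimes>\<^sub>\<int> A\<close> is the free abelian group on \<open>\<rat> \<times> A\<close>, with
  \<open>(q, a) (r, b) = (q r, a b)\<close>, modulo the biadditivity relations. Products of these relations
  with generators \<open>(q, a)\<close> are again such relations, so the additive subgroup they generate
  is already a two-sided ideal. Biadditivity implies that the tensors are \<open>\<int>\<close>-balanced.
\<close>

definition rat_pairs_ring :: "('a, 'c) ring_scheme \<Rightarrow> ((rat \<times> 'a) \<Rightarrow>\<^sub>0 int) ring" where
  "rat_pairs_ring A =
    monoid_ring (\<lparr>carrier = (UNIV :: rat set), monoid.mult = (*), one = 1\<rparr> \<times>\<times> A)"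

definition biadditive_rels :: "('a, 'c) ring_scheme \<Rightarrow> ((rat \<times> 'a) \<Rightarrow>\<^sub>0 int) set" where
  "biadditive_rels A =
    {Poly_Mapping.single (q + r, a) 1 - Poly_Mapping.single (q, a) 1 - Poly_Mapping.single (r, a) 1
      | q r a. a \<in> carrier A} \<union>
    {Poly_Mapping.single (q, a \<oplus>\<^bsub>A\<^esub> b) 1 - Poly_Mapping.single (q, a) 1 - Poly_Mapping.single (q, b) 1
      | q a b. a \<in> carrier A \<and> b \<in> carrier A}"

definition biadditive_ideal :: "('a, 'c) ring_scheme \<Rightarrow> ((rat \<times> 'a) \<Rightarrow>\<^sub>0 int) set" where
  "biadditive_ideal A = genideal (rat_pairs_ring A) (biadditive_rels A)"

definition rat_tensor :: "('a, 'c) ring_scheme \<Rightarrow> ((rat \<times> 'a) \<Rightarrow>\<^sub>0 int) set ring" where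
  "rat_tensor A = rat_pairs_ring A Quot biadditive_ideal A"

definition pure_tensor :: "('a, 'c) ring_scheme \<Rightarrow> rat \<Rightarrow> 'a \<Rightarrow> ((rat \<times> 'a) \<Rightarrow>\<^sub>0 int) set" where
  "pure_tensor A q a =
    biadditive_ideal A +>\<^bsub>rat_pairs_ring A\<^esub> Poly_Mapping.single (q, a) 1"

text \<open>The image of \<open>\<rat> \<otimes> U\<close> in \<open>\<rat> \<otimes> A\<close>, for an additive subgroup \<open>U\<close> of \<open>A\<close>.\<close>

definition rat_tensor_part ::
  "('a, 'c) ring_scheme \<Rightarrow> 'a set \<Rightarrow> ((rat \<times> 'a) \<Rightarrow>\<^sub>0 int) set set" where
  "rat_tensor_part A U =
    {biadditive_ideal A +>\<^bsub>rat_pairs_ring A\<^esub> p | p. Poly_Mapping.keys p \<subseteq> UNIV \<times> U}"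

text \<open>
  The map \<open>\<rat> \<otimes> B \<rightarrow> \<rat> \<otimes> A\<close> induced by the inclusion of a subring \<open>B\<close> of \<open>A\<close>: the class of \<open>p\<close>
  modulo the relations over \<open>B\<close> is sent to the class of the same \<open>p\<close> modulo the relations over \<open>A\<close>.
\<close>

definition rat_tensor_incl ::
  "('a, 'c) ring_scheme \<Rightarrow> ((rat \<times> 'a) \<Rightarrow>\<^sub>0 int) set \<Rightarrow> ((rat \<times> 'a) \<Rightarrow>\<^sub>0 int) set" where
  "rat_tensor_incl A X = biadditive_ideal A <+>\<^bsub>rat_pairs_ring A\<^esub> X"


section \<open>Graded rings and free graded modules\<close>

definition internal_direct_sum :: "('a, 'c) ring_scheme \<Rightarrow> (int \<Rightarrow> 'a set) \<Rightarrow> bool" where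
  "internal_direct_sum R G \<longleftrightarrow>
    (\<forall>d. additive_subgroup (G d) R) \<and>
    (\<forall>x\<in>carrier R. \<exists>!c. (\<forall>d. c d \<in> G d) \<and> finite {d. c d \<noteq> \<zero>\<^bsub>R\<^esub>} \<and>
       x = (\<Oplus>\<^bsub>R\<^esub> d\<in>{d. c d \<noteq> \<zero>\<^bsub>R\<^esub>}. c d))"

definition graded_ring :: "('a, 'c) ring_scheme \<Rightarrow> (int \<Rightarrow> 'a set) \<Rightarrow> bool" where
  "graded_ring R G \<longleftrightarrow>
    ring R \<and> internal_direct_sum R G \<and> \<one>\<^bsub>R\<^esub> \<in> G 0 \<and>
    (\<forall>d e. \<forall>x\<in>G d. \<forall>y\<in>G e. x \<otimes>\<^bsub>R\<^esub> y \<in> G (d + e))"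

definition graded_ring_hom ::
  "('s, 'c) ring_scheme \<Rightarrow> (int \<Rightarrow> 's set) \<Rightarrow> ('a, 'd) ring_scheme \<Rightarrow> (int \<Rightarrow> 'a set) \<Rightarrow> ('s \<Rightarrow> 'a) \<Rightarrow> bool" where
  "graded_ring_hom S H A G \<phi> \<longleftrightarrow>
    graded_ring S H \<and> graded_ring A G \<and> \<phi> \<in> ring_hom S A \<and> (\<forall>d. \<phi> ` H d \<subseteq> G d)"

text \<open>
  A graded ring homomorphism \<open>\<phi>\<close> from \<open>S\<close> to \<open>A\<close> makes \<open>A\<close> a graded right module via
  \<open>a \<cdot> s = a \<phi>(s)\<close> and a graded left module via \<open>s \<cdot> a = \<phi>(s) a\<close>. Bases are families
  indexed by a finite set \<open>W\<close>.
\<close>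

definition homogeneous_right_basis ::
  "('s, 'c) ring_scheme \<Rightarrow> (int \<Rightarrow> 's set) \<Rightarrow> ('a, 'd) ring_scheme \<Rightarrow> (int \<Rightarrow> 'a set) \<Rightarrow> ('s \<Rightarrow> 'a) \<Rightarrow>
    'w set \<Rightarrow> ('w \<Rightarrow> 'a) \<Rightarrow> bool" where
  "homogeneous_right_basis S H A G \<phi> W b \<longleftrightarrow>
    graded_ring_hom S H A G \<phi> \<and> finite W \<and>
    (\<forall>w\<in>W. \<exists>d. b w \<in> G d) \<and>
    (\<forall>x\<in>carrier A. \<exists>!c. c \<in> W \<rightarrow>\<^sub>E carrier S \<and> x = (\<Oplus>\<^bsub>A\<^esub> w\<in>W. b w \<otimes>\<^bsub>A\<^esub> \<phi> (c w)))"

definition homogeneous_left_basis ::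
  "('s, 'c) ring_scheme \<Rightarrow> (int \<Rightarrow> 's set) \<Rightarrow> ('a, 'd) ring_scheme \<Rightarrow> (int \<Rightarrow> 'a set) \<Rightarrow> ('s \<Rightarrow> 'a) \<Rightarrow>
    'w set \<Rightarrow> ('w \<Rightarrow> 'a) \<Rightarrow> bool" where
  "homogeneous_left_basis S H A G \<phi> W b \<longleftrightarrow>
    graded_ring_hom S H A G \<phi> \<and> finite W \<and>
    (\<forall>w\<in>W. \<exists>d. b w \<in> G d) \<and>
    (\<forall>x\<in>carrier A. \<exists>!c. c \<in> W \<rightarrow>\<^sub>E carrier S \<and> x = (\<Oplus>\<^bsub>A\<^esub> w\<in>W. \<phi> (c w) \<otimes>\<^bsub>A\<^esub> b w))"

text \<open>
  The graded rank, read off from a homogeneous basis, with \<open>q\<close> the variable of the field of formal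
  Laurent series. The degree is unique because basis elements are nonzero.
\<close>

definition graded_rank :: "(int \<Rightarrow> 'a set) \<Rightarrow> 'w set \<Rightarrow> ('w \<Rightarrow> 'a) \<Rightarrow> rat fls" where
  "graded_rank G W b = (\<Sum>w\<in>W. fls_X powi (THE d. b w \<in> G d))"

definition quantum_int :: "nat \<Rightarrow> rat fls" where
  "quantum_int m = (fls_X powi int m - fls_X powi (- int m)) / (fls_X - fls_X powi (-1))"


section \<open>Odd polynomials\<close>

definition free_ring :: "nat \<Rightarrow> (nat list \<Rightarrow>\<^sub>0 int) ring" where
  "free_ring n = monoid_ring \<lparr>carrier = lists {1..n}, monoid.mult = (@), one = []\<rparr>"

definition free_var :: "nat \<Rightarrow> nat list \<Rightarrow>\<^sub>0 int" where
  "free_var i = Poly_Mapping.single [i] 1"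

definition odd_ideal :: "nat \<Rightarrow> (nat list \<Rightarrow>\<^sub>0 int) set" where
  "odd_ideal n = genideal (free_ring n)
    {free_var i \<otimes>\<^bsub>free_ring n\<^esub> free_var j \<oplus>\<^bsub>free_ring n\<^esub> free_var j \<otimes>\<^bsub>free_ring n\<^esub> free_var i
      | i j. i \<in> {1..n} \<and> j \<in> {1..n} \<and> i \<noteq> j}"

definition odd_pol :: "nat \<Rightarrow> (nat list \<Rightarrow>\<^sub>0 int) set ring" where
  "odd_pol n = free_ring n Quot odd_ideal n"

definition odd_x :: "nat \<Rightarrow> nat \<Rightarrow> (nat list \<Rightarrow>\<^sub>0 int) set" where
  "odd_x n i = odd_ideal n +>\<^bsub>free_ring n\<^esub> free_var i"

text \<open>The grading, in which each variable has degree 2.\<close>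

definition odd_pol_deg :: "nat \<Rightarrow> int \<Rightarrow> (nat list \<Rightarrow>\<^sub>0 int) set set" where
  "odd_pol_deg n d = {odd_ideal n +>\<^bsub>free_ring n\<^esub> p | p.
    p \<in> carrier (free_ring n) \<and> (\<forall>u\<in>Poly_Mapping.keys p. 2 * int (length u) = d)}"


section \<open>Odd Demazure operators of type D\<close>

text \<open>The index \<open>i = n\<close> always refers to the additional generator of type D.\<close>

definition s_on_var :: "nat \<Rightarrow> nat \<Rightarrow> nat \<Rightarrow> (nat list \<Rightarrow>\<^sub>0 int) set" where
  "s_on_var n i j =
    (if i < n then
       (if j = i then \<ominus>\<^bsub>odd_pol n\<^esub> odd_x n (i + 1)
        else if j = i + 1 then \<ominus>\<^bsub>odd_pol n\<^esub> odd_x n i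
        else \<ominus>\<^bsub>odd_pol n\<^esub> odd_x n j)
     else
       (if j = n then odd_x n (n - 1)
        else if j = n - 1 then odd_x n n
        else \<ominus>\<^bsub>odd_pol n\<^esub> odd_x n j))"

definition s_endo :: "nat \<Rightarrow> nat \<Rightarrow> (nat list \<Rightarrow>\<^sub>0 int) set \<Rightarrow> (nat list \<Rightarrow>\<^sub>0 int) set" where
  "s_endo n i = (THE s.
    s \<in> ring_hom (odd_pol n) (odd_pol n) \<and> s \<in> extensional (carrier (odd_pol n)) \<and>
    (\<forall>j\<in>{1..n}. s (odd_x n j) = s_on_var n i j))"

definition demazure_on_var :: "nat \<Rightarrow> nat \<Rightarrow> nat \<Rightarrow> (nat list \<Rightarrow>\<^sub>0 int) set" where
  "demazure_on_var n i j =
    (if i < n then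
       (if j = i \<or> j = i + 1 then \<one>\<^bsub>odd_pol n\<^esub> else \<zero>\<^bsub>odd_pol n\<^esub>)
     else
       (if j = n then \<ominus>\<^bsub>odd_pol n\<^esub> \<one>\<^bsub>odd_pol n\<^esub>
        else if j = n - 1 then \<one>\<^bsub>odd_pol n\<^esub>
        else \<zero>\<^bsub>odd_pol n\<^esub>))"

definition demazure :: "nat \<Rightarrow> nat \<Rightarrow> (nat list \<Rightarrow>\<^sub>0 int) set \<Rightarrow> (nat list \<Rightarrow>\<^sub>0 int) set" where
  "demazure n i = (THE D.
    D \<in> carrier (odd_pol n) \<rightarrow>\<^sub>E carrier (odd_pol n) \<and>
    (\<forall>f\<in>carrier (odd_pol n). \<forall>g\<in>carrier (odd_pol n).
       D (f \<oplus>\<^bsub>odd_pol n\<^esub> g) = D f \<oplus>\<^bsub>odd_pol n\<^esub> D g) \<and>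
    D \<one>\<^bsub>odd_pol n\<^esub> = \<zero>\<^bsub>odd_pol n\<^esub> \<and>
    (\<forall>j\<in>{1..n}. D (odd_x n j) = demazure_on_var n i j) \<and>
    (\<forall>f\<in>carrier (odd_pol n). \<forall>g\<in>carrier (odd_pol n).
       D (f \<otimes>\<^bsub>odd_pol n\<^esub> g) =
         D f \<otimes>\<^bsub>odd_pol n\<^esub> g \<oplus>\<^bsub>odd_pol n\<^esub> s_endo n i f \<otimes>\<^bsub>odd_pol n\<^esub> D g))"

definition spin_sym :: "nat \<Rightarrow> (nat list \<Rightarrow>\<^sub>0 int) set set" where
  "spin_sym n = {f \<in> carrier (odd_pol n). \<forall>i\<in>{1..n}. demazure n i f = \<zero>\<^bsub>odd_pol n\<^esub>}"

definition spin_sym_ring :: "nat \<Rightarrow> (nat list \<Rightarrow>\<^sub>0 int) set ring" where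
  "spin_sym_ring n = odd_pol n \<lparr>carrier := spin_sym n\<rparr>"


section \<open>The Weyl group of type D and Schubert polynomials\<close>

text \<open>
  The Weyl group of type D acts faithfully by signed permutations on \<open>{\<plusminus>1, \<dots>, \<plusminus>n}\<close>, extended here
  by the identity to all integers, where \<open>-k\<close> stands for the negative of the \<open>k\<close>-th coordinate
  vector. The simple reflection for \<open>i < n\<close> exchanges \<open>i\<close> and \<open>i + 1\<close>; the last one
  exchanges \<open>n - 1\<close> with \<open>-n\<close> and \<open>n\<close> with \<open>-(n - 1)\<close>.
\<close>

definition simple_refl :: "nat \<Rightarrow> nat \<Rightarrow> int \<Rightarrow> int" where
  "simple_refl n i =
    (if i < n then
       Transposition.transpose (int i) (int i + 1) \<circ>
       Transposition.transpose (- int i) (- (int i + 1))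
     else
       Transposition.transpose (int n - 1) (- int n) \<circ>
       Transposition.transpose (int n) (- (int n - 1)))"

definition weyl_D :: "nat \<Rightarrow> (int \<Rightarrow> int) set" where
  "weyl_D n = generate (BijGroup UNIV) (simple_refl n ` {1..n})"

definition word_prod :: "nat \<Rightarrow> nat list \<Rightarrow> int \<Rightarrow> int" where
  "word_prod n is = foldr (\<lambda>i w. simple_refl n i \<circ> w) is id"

definition weyl_length :: "nat \<Rightarrow> (int \<Rightarrow> int) \<Rightarrow> nat" where
  "weyl_length n w = (LEAST l. \<exists>is \<in> lists {1..n}. length is = l \<and> word_prod n is = w)"

definition reduced_expr :: "nat \<Rightarrow> nat list \<Rightarrow> (int \<Rightarrow> int) \<Rightarrow> bool" where
  "reduced_expr n is w \<longleftrightarrow>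
    is \<in> lists {1..n} \<and> word_prod n is = w \<and> length is = weyl_length n w"

definition longest_elt :: "nat \<Rightarrow> int \<Rightarrow> int" where
  "longest_elt n = (THE w. w \<in> weyl_D n \<and> (\<forall>v\<in>weyl_D n. weyl_length n v \<le> weyl_length n w))"

definition demazure_word ::
  "nat \<Rightarrow> nat list \<Rightarrow> (nat list \<Rightarrow>\<^sub>0 int) set \<Rightarrow> (nat list \<Rightarrow>\<^sub>0 int) set" where
  "demazure_word n is f = foldr (demazure n) is f"

text \<open>The monomial \<open>x\<^sub>1\<^bsup>2n-2\<^esup> x\<^sub>2\<^bsup>2n-4\<^esup> \<cdots> x\<^sub>n\<^sub>-\<^sub>1\<^bsup>2\<^esup>\<close>.\<close>

definition top_monomial :: "nat \<Rightarrow> (nat list \<Rightarrow>\<^sub>0 int) set" where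
  "top_monomial n =
    foldr (\<lambda>i f. odd_x n i [^]\<^bsub>odd_pol n\<^esub> (2 * n - 2 * i) \<otimes>\<^bsub>odd_pol n\<^esub> f) [1..<n] \<one>\<^bsub>odd_pol n\<^esub>"

text \<open>The argument \<open>red\<close> is the choice of a reduced expression for every Weyl group element.\<close>

definition schubert :: "nat \<Rightarrow> ((int \<Rightarrow> int) \<Rightarrow> nat list) \<Rightarrow> (int \<Rightarrow> int) \<Rightarrow> (nat list \<Rightarrow>\<^sub>0 int) set" where
  "schubert n red w = demazure_word n (red (inv_into UNIV w \<circ> longest_elt n)) (top_monomial n)"


section \<open>Rational coefficients\<close>

type_synonym odd_pol_rat_elt = "((rat \<times> (nat list \<Rightarrow>\<^sub>0 int) set) \<Rightarrow>\<^sub>0 int) set"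

definition odd_pol_rat :: "nat \<Rightarrow> odd_pol_rat_elt ring" where
  "odd_pol_rat n = rat_tensor (odd_pol n)"

definition odd_pol_rat_deg :: "nat \<Rightarrow> int \<Rightarrow> odd_pol_rat_elt set" where
  "odd_pol_rat_deg n d = rat_tensor_part (odd_pol n) (odd_pol_deg n d)"

definition spin_sym_rat :: "nat \<Rightarrow> odd_pol_rat_elt ring" where
  "spin_sym_rat n = rat_tensor (spin_sym_ring n)"

definition spin_sym_rat_deg :: "nat \<Rightarrow> int \<Rightarrow> odd_pol_rat_elt set" where
  "spin_sym_rat_deg n d = rat_tensor_part (spin_sym_ring n) (spin_sym n \<inter> odd_pol_deg n d)"

definition spin_sym_rat_incl :: "nat \<Rightarrow> odd_pol_rat_elt \<Rightarrow> odd_pol_rat_elt" where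
  "spin_sym_rat_incl n = rat_tensor_incl (odd_pol n)"

definition schubert_rat :: "nat \<Rightarrow> ((int \<Rightarrow> int) \<Rightarrow> nat list) \<Rightarrow> (int \<Rightarrow> int) \<Rightarrow> odd_pol_rat_elt" where
  "schubert_rat n red w = pure_tensor (odd_pol n) 1 (schubert n red w)"

end

theory Submission imports Defs "HOL-Algebra.Subrings" begin

text \<open>
  The monomials \<open>x\<^sub>1\<^bsup>m\<^sub>1\<^esup> \<cdots> x\<^sub>n\<^bsup>m\<^sub>n\<^esup>\<close> span the ring of odd polynomials, and they are independent because
  the sign rule for reordering them is a 2-cocycle: it defines an associative product on finitely
  supported functions of exponents. That concrete rational ring, \<open>oddpoly\<close>, carries the whole
  argument. The presented ring and its rationalisation are identified with the elements of
  \<open>oddpoly\<close> in \<open>x\<^sub>1, \<dots>, x\<^sub>n\<close> with integral and with rational coefficients.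

  The squares \<open>x\<^sub>j\<^sup>2\<close> are central and the operators are divided differences,
  \<open>(x\<^sub>a\<^sup>2 - x\<^sub>b\<^sup>2) \<partial>(f) = (x\<^sub>a - \<epsilon> x\<^sub>b) f - s(f) (x\<^sub>a - \<epsilon> x\<^sub>b)\<close> with \<open>b = a + 1\<close> and \<open>\<epsilon> = \<plusminus>1\<close>
  (\<open>dem_eq\<close>). They satisfy \<open>\<partial>\<^sup>2 = 0\<close> and the braid and commutation relations of type D up to sign.
  With the exchange of descents in the group of even signed permutations this gives the nil-Coxeter
  calculus: reduced words of the same element define the same operator up to sign
  (\<open>reduced_words_agree\<close>), and a word that is not reduced defines \<open>0\<close> (\<open>dems_not_reduced\<close>).

  A particular word of length \<open>n (n - 1)\<close> maps the top monomial to a nonzero constant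
  (\<open>dems_long_word\<close>), so it is a reduced word of the longest element \<open>w\<^sub>0\<close>. Write \<open>\<sigma>\<^sub>u\<close> for the image of
  the top monomial under the operator of \<open>u\<close>. Then, whenever \<open>\<ell>(v) + \<ell>(u) \<ge> \<ell>(w\<^sub>0)\<close>, the operator of \<open>v\<close>
  maps \<open>\<sigma>\<^sub>u\<close> to a nonzero constant if \<open>v u = w\<^sub>0\<close>, and to \<open>0\<close> otherwise (\<open>dems_schub\<close>). All operators
  are right linear over the invariants, so this triangularity allows one to
  subtract multiples of the \<open>\<sigma>\<^sub>u\<close> from a polynomial, in order of length, until every operator kills what is left
  (\<open>schub_expansion_exists\<close>), and it makes the coefficients unique (\<open>schub_expansion_unique\<close>).

  The left module structure reduces to the right one. Conjugation by \<open>x\<^sub>j\<close>, that is \<open>f \<mapsto> x\<^sub>j f x\<^sub>j\<^sup>-\<^sup>1\<close>, acts on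
  monomials by signs, and on an invariant \<open>f\<close> it has the same effect for every \<open>j\<close>
  (\<open>invariant_conj_sign\<close>). It preserves the ring of invariants, so moving an invariant past a
  homogeneous basis element only applies a power of this involution to it
  (\<open>invariant_commute_homog\<close>).

  The basis element of \<open>w\<close> has degree \<open>2 \<ell>(w)\<close>, so the graded rank is the Poincare polynomial of the
  group at \<open>q\<^sup>2\<close>. It factors because an element that fixes \<open>1, \<dots>, k - 1\<close> can send \<open>k\<close> to any of
  \<open>k, \<dots>, n, -n, \<dots>, -k\<close>, and the minimal extra lengths of these choices are known
  (\<open>len_sum_fixer_step\<close>).
\<close>

section \<open>Twisted convolution and skew polynomials\<close>

lemma poly_mapping_decompose:
  "(p :: 'a \<Rightarrow>\<^sub>0 'b::comm_monoid_add) =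
    (\<Sum>a\<in>Poly_Mapping.keys p. Poly_Mapping.single a (Poly_Mapping.lookup p a))"
proof (rule poly_mapping_eqI)
  fix k
  have "(\<Sum>a\<in>Poly_Mapping.keys p. Poly_Mapping.lookup (Poly_Mapping.single a (Poly_Mapping.lookup p a)) k)
     = (\<Sum>a\<in>Poly_Mapping.keys p. if a = k then Poly_Mapping.lookup p a else 0)"
    by (intro sum.cong) (auto simp: lookup_single when_def)
  also have "\<dots> = Poly_Mapping.lookup p k"
    by (simp add: in_keys_iff)
  finally show "Poly_Mapping.lookup p k = Poly_Mapping.lookup
      (\<Sum>a\<in>Poly_Mapping.keys p. Poly_Mapping.single a (Poly_Mapping.lookup p a)) k"
    by (simp add: lookup_sum)
qed

text \<open>
  The premise on the support makes it possible to carry side conditions on the indices through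
  an induction over finitely supported functions.
\<close>

lemma poly_mapping_additive_induct [consumes 1, case_names zero single add]:
  fixes p :: "'a \<Rightarrow>\<^sub>0 'b::comm_monoid_add"
  assumes "Poly_Mapping.keys p \<subseteq> K" and zero: "P 0"
    and single: "\<And>a c. a \<in> K \<Longrightarrow> P (Poly_Mapping.single a c)"
    and add: "\<And>p q. P p \<Longrightarrow> P q \<Longrightarrow> P (p + q)"
  shows "P p"
proof -
  have "P (\<Sum>a\<in>A. Poly_Mapping.single a (Poly_Mapping.lookup p a))"
    if "finite A" "A \<subseteq> K" for A
    using that by (induction rule: finite_induct) (auto intro: assms)
  from this[of "Poly_Mapping.keys p"] show ?thesis
    using assms(1) by (simp flip: poly_mapping_decompose)
qed

lemmas poly_mapping_additive_induct_UNIV =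
  poly_mapping_additive_induct[OF subset_UNIV, case_names zero single add]

definition linear_ext :: "('a \<Rightarrow> 'b \<Rightarrow> 'c::comm_monoid_add) \<Rightarrow> ('a \<Rightarrow>\<^sub>0 'b::zero) \<Rightarrow> 'c" where
  "linear_ext F p = (\<Sum>a\<in>Poly_Mapping.keys p. F a (Poly_Mapping.lookup p a))"

lemma linear_ext_add:
  fixes p q :: "'a \<Rightarrow>\<^sub>0 'b::monoid_add"
  assumes "\<And>a. F a 0 = 0" and "\<And>a c d. F a (c + d) = F a c + F a d"
  shows "linear_ext F (p + q) = linear_ext F p + linear_ext F q"
  unfolding linear_ext_def by (rule setsum_keys_plus_distrib) (use assms in auto)

lemma linear_ext_single: "F a 0 = 0 \<Longrightarrow> linear_ext F (Poly_Mapping.single a c) = F a c"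
  by (simp add: linear_ext_def)

lemma linear_ext_0 [simp]: "linear_ext F 0 = 0"
  by (simp add: linear_ext_def)

text \<open>
  The product for which the basis elements multiply as \<open>a \<cdot> b = t(a, b) (a
  b)\<close>. The sign of a reordering as \<open>t\<close> gives skew polynomials, and \<open>t
  = 1\<close> gives monoid rings; both uses share the proof of associativity.
\<close>

definition twisted_conv ::
  "('a \<Rightarrow> 'a \<Rightarrow> 'a) \<Rightarrow> ('a \<Rightarrow> 'a \<Rightarrow> 'b) \<Rightarrow> ('a \<Rightarrow>\<^sub>0 'b) \<Rightarrow> ('a \<Rightarrow>\<^sub>0 'b) \<Rightarrow> ('a \<Rightarrow>\<^sub>0 'b::comm_ring_1)" where
  "twisted_conv op t p q = linear_ext (\<lambda>a c. linear_ext (\<lambda>b d.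
     Poly_Mapping.single (op a b) (t a b * c * d)) q) p"

lemma twisted_conv_single_single [simp]:
  "twisted_conv op t (Poly_Mapping.single a c) (Poly_Mapping.single b d) =
    Poly_Mapping.single (op a b) (t a b * c * d)"
  by (cases "c = 0"; cases "d = 0") (simp_all add: twisted_conv_def linear_ext_def)

lemma twisted_conv_0 [simp]: "twisted_conv op t 0 q = 0" "twisted_conv op t p 0 = 0"
  by (simp_all add: twisted_conv_def linear_ext_def)

lemma twisted_conv_add_left:
  "twisted_conv op t (p + p') q = twisted_conv op t p q + twisted_conv op t p' q"
  unfolding twisted_conv_def
  by (rule linear_ext_add) (simp_all add: linear_ext_def algebra_simps single_add sum.distrib)

lemma twisted_conv_add_right:
  "twisted_conv op t p (q + q') = twisted_conv op t p q + twisted_conv op t p q'"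
proof -
  have "linear_ext (\<lambda>b d. Poly_Mapping.single (op a b) (t a b * c * d)) (q + q') =
    linear_ext (\<lambda>b d. Poly_Mapping.single (op a b) (t a b * c * d)) q +
    linear_ext (\<lambda>b d. Poly_Mapping.single (op a b) (t a b * c * d)) q'" for a c
    by (rule linear_ext_add) (simp_all add: algebra_simps single_add)
  then show ?thesis
    by (simp add: twisted_conv_def) (simp add: linear_ext_def sum.distrib)
qed

text \<open>
  Associativity only has to be tested on basis elements, where it is associativity of the monoid
  together with the cocycle identity of \<open>t\<close>. The set \<open>K\<close> allows
  monoids that are given by a carrier.
\<close>

lemma twisted_conv_assoc:
  assumes keys: "Poly_Mapping.keys p \<subseteq> K" "Poly_Mapping.keys q \<subseteq> K" "Poly_Mapping.keys r \<subseteq> K"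
    and assoc: "\<And>a b c. a \<in> K \<Longrightarrow> b \<in> K \<Longrightarrow> c \<in> K \<Longrightarrow> op (op a b) c = op a (op b c)"
    and cocycle: "\<And>a b c. a \<in> K \<Longrightarrow> b \<in> K \<Longrightarrow> c \<in> K \<Longrightarrow>
      t (op a b) c * t a b = t a (op b c) * t b c"
  shows "twisted_conv op t (twisted_conv op t p q) r = twisted_conv op t p (twisted_conv op t q r)"
  using keys(1)
proof (induction rule: poly_mapping_additive_induct)
  case (single a c)
  show ?case using keys(2)
  proof (induction rule: poly_mapping_additive_induct)
    case (single b d)
    show ?case using keys(3)
    proof (induction rule: poly_mapping_additive_induct)
      case (single e x)
      have "t (op a b) e * (t a b * c * d) * x = t a (op b e) * c * (t b e * d * x)"
        using cocycle[OF \<open>a \<in> K\<close> \<open>b \<in> K\<close> \<open>e \<in> K\<close>] by (metis mult.commute mult.left_commute)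
      then show ?case using assoc[OF \<open>a \<in> K\<close> \<open>b \<in> K\<close> \<open>e \<in> K\<close>] by simp
    qed (simp_all add: twisted_conv_add_right)
  qed (simp_all add: twisted_conv_add_right twisted_conv_add_left)
qed (simp_all add: twisted_conv_add_left)

lemma keys_twisted_conv:
  "Poly_Mapping.keys (twisted_conv op t p q) \<subseteq>
    {op a b | a b. a \<in> Poly_Mapping.keys p \<and> b \<in> Poly_Mapping.keys q}"
proof
  fix k assume k: "k \<in> Poly_Mapping.keys (twisted_conv op t p q)"
  show "k \<in> {op a b | a b. a \<in> Poly_Mapping.keys p \<and> b \<in> Poly_Mapping.keys q}"
  proof (rule ccontr)
    assume "\<not> ?thesis"
    then have "Poly_Mapping.lookup (twisted_conv op t p q) k = 0"
      unfolding twisted_conv_def linear_ext_def lookup_sum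
      by (intro sum.neutral ballI) (auto simp: lookup_single when_def)
    with k show False by (simp add: in_keys_iff)
  qed
qed

type_synonym expo = "nat \<Rightarrow>\<^sub>0 nat"

text \<open>
  The number of pairs of letters \<open>x\<^sub>i\<close>, \<open>x\<^sub>j\<close> with
  \<open>j < i\<close> that have to be exchanged when the product of the sorted monomials with
  exponents \<open>m\<close> and \<open>k\<close> is sorted. It is biadditive, and this is why
  its parity is a cocycle.
\<close>

definition crossings :: "expo \<Rightarrow> expo \<Rightarrow> nat" where
  "crossings m k = (\<Sum>i\<in>Poly_Mapping.keys m. \<Sum>j\<in>Poly_Mapping.keys k.
     if j < i then Poly_Mapping.lookup m i * Poly_Mapping.lookup k j else 0)"

lemma crossings_eq:
  assumes "finite I" "Poly_Mapping.keys m \<subseteq> I" "Poly_Mapping.keys k \<subseteq> I"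
  shows "crossings m k = (\<Sum>i\<in>I. \<Sum>j\<in>I.
     if j < i then Poly_Mapping.lookup m i * Poly_Mapping.lookup k j else 0)"
proof -
  have "(\<Sum>j\<in>Poly_Mapping.keys k. if j < i then Poly_Mapping.lookup m i * Poly_Mapping.lookup k j else 0)
     = (\<Sum>j\<in>I. if j < i then Poly_Mapping.lookup m i * Poly_Mapping.lookup k j else 0)" for i
    by (rule sum.mono_neutral_left) (use assms in \<open>auto simp: in_keys_iff\<close>)
  then have "crossings m k = (\<Sum>i\<in>Poly_Mapping.keys m. \<Sum>j\<in>I.
     if j < i then Poly_Mapping.lookup m i * Poly_Mapping.lookup k j else 0)"
    by (simp add: crossings_def)
  also have "\<dots> = (\<Sum>i\<in>I. \<Sum>j\<in>I.
     if j < i then Poly_Mapping.lookup m i * Poly_Mapping.lookup k j else 0)"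
    by (rule sum.mono_neutral_left) (use assms in \<open>auto simp: in_keys_iff\<close>)
  finally show ?thesis .
qed

lemma crossings_add_left: "crossings (m + m') k = crossings m k + crossings m' k"
proof -
  let ?I = "Poly_Mapping.keys m \<union> Poly_Mapping.keys m' \<union> Poly_Mapping.keys k"
  have "Poly_Mapping.keys (m + m') \<subseteq> ?I" using keys_add[of m m'] by auto
  then have "crossings (m + m') k = (\<Sum>i\<in>?I. \<Sum>j\<in>?I. if j < i then
      Poly_Mapping.lookup (m + m') i * Poly_Mapping.lookup k j else 0)"
    by (intro crossings_eq) auto
  also have "\<dots> = crossings m k + crossings m' k"
    by (subst (1 2) crossings_eq[of ?I])
      (auto simp: lookup_add algebra_simps simp flip: sum.distrib intro!: sum.cong)
  finally show ?thesis .
qed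

lemma crossings_add_right: "crossings k (m + m') = crossings k m + crossings k m'"
proof -
  let ?I = "Poly_Mapping.keys m \<union> Poly_Mapping.keys m' \<union> Poly_Mapping.keys k"
  have "Poly_Mapping.keys (m + m') \<subseteq> ?I" using keys_add[of m m'] by auto
  then have "crossings k (m + m') = (\<Sum>i\<in>?I. \<Sum>j\<in>?I. if j < i then
      Poly_Mapping.lookup k i * Poly_Mapping.lookup (m + m') j else 0)"
    by (intro crossings_eq) auto
  also have "\<dots> = crossings k m + crossings k m'"
    by (subst (1 2) crossings_eq[of ?I])
      (auto simp: lookup_add algebra_simps simp flip: sum.distrib intro!: sum.cong)
  finally show ?thesis .
qed

lemma crossings_0 [simp]: "crossings 0 k = 0" "crossings m 0 = 0"
  by (simp_all add: crossings_def)

definition crossing_sign :: "expo \<Rightarrow> expo \<Rightarrow> rat" where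
  "crossing_sign m k = (-1) ^ crossings m k"

text \<open>
  Skew polynomials over \<open>\<rat>\<close> in countably many anticommuting variables. One
  type serves all \<open>n\<close>; the variables and coefficients that occur are controlled by
  predicates.
\<close>

typedef oddpoly = "UNIV :: (expo \<Rightarrow>\<^sub>0 rat) set"
  morphisms coeffs Abs_oddpoly ..

instantiation oddpoly :: ring_1
begin
definition "0 = Abs_oddpoly 0"
definition "1 = Abs_oddpoly (Poly_Mapping.single 0 1)"
definition "f + g = Abs_oddpoly (coeffs f + coeffs g)"
definition "- f = Abs_oddpoly (- coeffs f)"
definition "f - g = Abs_oddpoly (coeffs f - coeffs g)"
definition "f * g = Abs_oddpoly (twisted_conv (+) crossing_sign (coeffs f) (coeffs g))"

lemma coeffs_ring_ops:
  "coeffs (Abs_oddpoly p) = p"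
  "coeffs 0 = 0"
  "coeffs 1 = Poly_Mapping.single 0 1"
  "coeffs (f + g) = coeffs f + coeffs g"
  "coeffs (- f) = - coeffs f"
  "coeffs (f - g) = coeffs f - coeffs g"
  "coeffs (f * g) = twisted_conv (+) crossing_sign (coeffs f) (coeffs g)"
  by (simp_all add: Abs_oddpoly_inverse zero_oddpoly_def one_oddpoly_def plus_oddpoly_def
    uminus_oddpoly_def minus_oddpoly_def times_oddpoly_def)

instance
proof
  fix a b c :: oddpoly
  show "a * b * c = a * (b * c)"
    unfolding coeffs_inject[symmetric] coeffs_ring_ops
    by (auto intro!: twisted_conv_assoc[where K = UNIV] simp: add.assoc
      crossing_sign_def crossings_add_left crossings_add_right power_add)
  have "twisted_conv (+) crossing_sign (Poly_Mapping.single 0 1) p = p" for p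
    by (induction p rule: poly_mapping_additive_induct_UNIV)
      (simp_all add: twisted_conv_add_right crossing_sign_def del: single_one)
  then show "1 * a = a"
    unfolding coeffs_inject[symmetric] coeffs_ring_ops by simp
  have "twisted_conv (+) crossing_sign p (Poly_Mapping.single 0 1) = p" for p
    by (induction p rule: poly_mapping_additive_induct_UNIV)
      (simp_all add: twisted_conv_add_left crossing_sign_def del: single_one)
  then show "a * 1 = a"
    unfolding coeffs_inject[symmetric] coeffs_ring_ops by simp
  show "(0::oddpoly) \<noteq> 1"
    unfolding coeffs_inject[symmetric] coeffs_ring_ops
    by (metis lookup_single_eq lookup_zero zero_neq_one)
qed (unfold coeffs_inject[symmetric] coeffs_ring_ops;
    simp add: twisted_conv_add_left twisted_conv_add_right algebra_simps)+
end

definition monomial :: "expo \<Rightarrow> rat \<Rightarrow> oddpoly" where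
  "monomial m c = Abs_oddpoly (Poly_Mapping.single m c)"

lemma coeffs_monomial [simp]: "coeffs (monomial m c) = Poly_Mapping.single m c"
  by (simp add: monomial_def coeffs_ring_ops)

definition var :: "nat \<Rightarrow> oddpoly" where "var j = monomial (Poly_Mapping.single j 1) 1"
definition scal :: "rat \<Rightarrow> oddpoly" where "scal c = monomial 0 c"

lemma monomial_mult: "monomial m c * monomial k d = monomial (m + k) (crossing_sign m k * c * d)"
  unfolding coeffs_inject[symmetric] coeffs_ring_ops by simp

lemma monomial_add: "monomial m (c + d) = monomial m c + monomial m d"
  unfolding coeffs_inject[symmetric] coeffs_ring_ops by (simp add: single_add)

lemma monomial_0 [simp]: "monomial m 0 = 0"
  unfolding coeffs_inject[symmetric] coeffs_ring_ops by simp

lemma oddpoly_monomial_induct [case_names zero monomial add]: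
  assumes "P 0" "\<And>m c. P (monomial m c)" "\<And>f g. P f \<Longrightarrow> P g \<Longrightarrow> P (f + g)"
  shows "P f"
proof -
  have "P (Abs_oddpoly p)" for p
  proof (induction p rule: poly_mapping_additive_induct_UNIV)
    case zero then show ?case using assms(1) by (simp add: zero_oddpoly_def)
  next
    case (single a c) then show ?case using assms(2)[of a c] by (simp add: monomial_def)
  next
    case (add p q) then show ?case using assms(3)[of "Abs_oddpoly p" "Abs_oddpoly q"]
      by (simp add: plus_oddpoly_def coeffs_ring_ops)
  qed
  then show ?thesis by (metis coeffs_inverse)
qed

lemma scal_simps [simp]: "scal 0 = 0" "scal 1 = 1" "scal (- c) = - scal c"
  "scal (c + d) = scal c + scal d" "scal (c - d) = scal c - scal d" "scal (c * d) = scal c * scal d"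
  unfolding scal_def coeffs_inject[symmetric] coeffs_ring_ops
  by (simp_all add: coeffs_ring_ops single_add single_diff single_uminus crossing_sign_def del: single_one)

lemma scal_eq_0_iff [simp]: "scal c = 0 \<longleftrightarrow> c = 0"
  unfolding scal_def
  by (metis coeffs_ring_ops(2) monomial_0 coeffs_monomial lookup_single_eq lookup_zero single_zero)

lemma scal_mult_monomial: "scal c * monomial m d = monomial m (c * d)"
  by (simp add: scal_def monomial_mult crossing_sign_def)

lemma scal_central: "f * scal c = scal c * f"
  by (induction f rule: oddpoly_monomial_induct)
    (simp_all add: scal_def monomial_mult crossing_sign_def algebra_simps)

definition total_degree :: "expo \<Rightarrow> nat" where
  "total_degree m = (\<Sum>i\<in>Poly_Mapping.keys m. Poly_Mapping.lookup m i)"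

lemma total_degree_add: "total_degree (m + k) = total_degree m + total_degree k"
  unfolding total_degree_def
  by (rule setsum_keys_plus_distrib[where f = "\<lambda>_ v. v"]) auto

lemma total_degree_single [simp]: "total_degree (Poly_Mapping.single j c) = c"
  by (simp add: total_degree_def)

lemma total_degree_0 [simp]: "total_degree 0 = 0"
  by (simp add: total_degree_def)

lemma total_degree_eq_0_iff [simp]: "total_degree m = 0 \<longleftrightarrow> m = 0"
proof
  assume "total_degree m = 0"
  then have "\<forall>i\<in>Poly_Mapping.keys m. Poly_Mapping.lookup m i = 0"
    by (simp add: total_degree_def)
  then show "m = 0" by (intro poly_mapping_eqI) (metis in_keys_iff lookup_zero)
qed simp

lemma expo_split:
  assumes "j \<in> Poly_Mapping.keys m"
  obtains m' where "m = Poly_Mapping.single j 1 + m'" "total_degree m = Suc (total_degree m')"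
proof
  show eq: "m = Poly_Mapping.single j 1 + (m - Poly_Mapping.single j 1)"
    using assms by (intro poly_mapping_eqI)
      (auto simp: lookup_add lookup_minus lookup_single when_def in_keys_iff)
  show "total_degree m = Suc (total_degree (m - Poly_Mapping.single j 1))"
    by (subst eq) (simp add: total_degree_add)
qed

text \<open>
  Multiplying by a variable on the left reaches every monomial up to a sign, so a statement that
  is stable under sums can be checked on constants and under \<open>f \<mapsto> x\<^sub>j
  f\<close>. This matches the twisted Leibniz rule, and the relations between operators below
  are proved by it.
\<close>

lemma oddpoly_var_induct [case_names scal var add]:
  assumes scal: "\<And>c. P (scal c)" and var: "\<And>j f. P f \<Longrightarrow> P (var j * f)"
    and add: "\<And>f g. P f \<Longrightarrow> P g \<Longrightarrow> P (f + g)"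
  shows "P f"
proof (induction f rule: oddpoly_monomial_induct)
  case zero then show ?case using scal[of 0] by simp
next
  case (monomial m c)
  show ?case
  proof (induction "total_degree m" arbitrary: m c)
    case 0 then show ?case using scal[of c] by (simp add: scal_def)
  next
    case (Suc d)
    then have "Poly_Mapping.keys m \<noteq> {}" by (auto simp: total_degree_def)
    then obtain j where "j \<in> Poly_Mapping.keys m" by blast
    then obtain m' where m': "m = Poly_Mapping.single j 1 + m'" "total_degree m = Suc (total_degree m')"
      by (rule expo_split)
    let ?s = "crossing_sign (Poly_Mapping.single j 1) m'"
    have "?s * ?s = 1"
      by (simp add: crossing_sign_def flip: power_mult_distrib)
    then have "monomial m c = var j * monomial m' (?s * c)"
      by (simp add: var_def monomial_mult m' flip: mult.assoc)
    moreover have "P (monomial m' (?s * c))" using Suc m' by simp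
    ultimately show ?case using var by simp
  qed
qed (rule add)

section \<open>Algebra endomorphisms\<close>

definition alg_hom :: "(oddpoly \<Rightarrow> oddpoly) \<Rightarrow> bool" where
  "alg_hom F \<longleftrightarrow> (\<forall>f g. F (f + g) = F f + F g) \<and> (\<forall>f g. F (f * g) = F f * F g) \<and>
    (\<forall>c. F (scal c) = scal c)"

lemma alg_homD:
  assumes "alg_hom F"
  shows "F (f + g) = F f + F g" "F (f * g) = F f * F g" "F (scal c) = scal c"
    "F 0 = 0" "F 1 = 1" "F (- f) = - F f" "F (f - g) = F f - F g"
proof -
  have a: "F (f + g) = F f + F g" "F (f * g) = F f * F g" "F (scal c) = scal c" for f g c
    using assms by (simp_all add: alg_hom_def)
  show "F (f + g) = F f + F g" "F (f * g) = F f * F g" "F (scal c) = scal c" by (fact a)+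
  show z: "F 0 = 0" and "F 1 = 1" using a(3)[of 0] a(3)[of 1] by simp_all
  have m: "F (- f) = - F f" for f
    using a(1)[of f "- f"] z by (simp add: eq_neg_iff_add_eq_0 add.commute)
  show "F (- f) = - F f" by (fact m)
  show "F (f - g) = F f - F g" using a(1)[of f "- g"] m by simp
qed

lemma alg_hom_comp: "alg_hom F \<Longrightarrow> alg_hom G \<Longrightarrow> alg_hom (\<lambda>f. F (G f))"
  by (simp add: alg_hom_def)

lemma alg_hom_id: "alg_hom (\<lambda>f. f)"
  by (simp add: alg_hom_def)

lemma alg_hom_eqI:
  assumes "alg_hom F" "alg_hom G" "\<And>j. F (var j) = G (var j)"
  shows "F f = G f"
  by (induction f rule: oddpoly_var_induct) (simp_all add: assms alg_homD)

text \<open>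
  Linear maps that send monomials to multiples of monomials. All endomorphisms that occur are of
  this kind, so they exist without an appeal to a presentation.
\<close>

definition monomial_map :: "(expo \<Rightarrow> expo) \<Rightarrow> (expo \<Rightarrow> rat) \<Rightarrow> oddpoly \<Rightarrow> oddpoly" where
  "monomial_map \<pi> g f = linear_ext (\<lambda>m c. monomial (\<pi> m) (g m * c)) (coeffs f)"

lemma monomial_map_add: "monomial_map \<pi> g (f + f') = monomial_map \<pi> g f + monomial_map \<pi> g f'"
  unfolding monomial_map_def coeffs_ring_ops
  by (rule linear_ext_add) (simp_all add: algebra_simps monomial_add)

lemma monomial_map_monomial [simp]: "monomial_map \<pi> g (monomial m c) = monomial (\<pi> m) (g m * c)"
  by (simp add: monomial_map_def linear_ext_single)

lemma monomial_map_0 [simp]: "monomial_map \<pi> g 0 = 0"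
  by (simp add: monomial_map_def coeffs_ring_ops)

text \<open>
  Compatibility with products is an identity of signs for each pair of exponents.
\<close>

lemma alg_hom_monomial_map:
  assumes add: "\<And>m k. \<pi> (m + k) = \<pi> m + \<pi> k" and [simp]: "\<pi> 0 = 0" "g 0 = 1"
    and cocycle: "\<And>m k. g (m + k) * crossing_sign m k = g m * g k * crossing_sign (\<pi> m) (\<pi> k)"
  shows "alg_hom (monomial_map \<pi> g)"
  unfolding alg_hom_def
proof (intro conjI allI)
  show "monomial_map \<pi> g (f + f') = monomial_map \<pi> g f + monomial_map \<pi> g f'" for f f'
    by (rule monomial_map_add)
  show "monomial_map \<pi> g (scal c) = scal c" for c
    by (simp add: scal_def)
  show "monomial_map \<pi> g (f * f') = monomial_map \<pi> g f * monomial_map \<pi> g f'" for f f'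
  proof (induction f rule: oddpoly_monomial_induct)
    case (monomial m c)
    show ?case
    proof (induction f' rule: oddpoly_monomial_induct)
      case (monomial k d)
      have "g (m + k) * (crossing_sign m k * c * d) = (g (m + k) * crossing_sign m k) * (c * d)"
        by (simp only: mult_ac)
      also have "\<dots> = crossing_sign (\<pi> m) (\<pi> k) * (g m * c) * (g k * d)"
        unfolding cocycle by (simp only: mult_ac)
      finally show ?case by (simp only: monomial_mult monomial_map_monomial add)
    qed (simp_all add: algebra_simps monomial_map_add)
  qed (simp_all add: algebra_simps monomial_map_add)
qed

text \<open>
  Conjugation by \<open>x\<^sub>a\<close>: it fixes \<open>x\<^sub>a\<close> and negates every
  other variable.
\<close>

definition conj_sign :: "nat \<Rightarrow> oddpoly \<Rightarrow> oddpoly" where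
  "conj_sign a = monomial_map (\<lambda>m. m) (\<lambda>m. (-1) ^ (total_degree m + Poly_Mapping.lookup m a))"

lemma alg_hom_conj_sign: "alg_hom (conj_sign a)"
  unfolding conj_sign_def
  by (rule alg_hom_monomial_map) (simp_all add: total_degree_add lookup_add power_add mult_ac)

lemma conj_sign_var: "conj_sign a (var j) = (if j = a then var j else - var j)"
  by (simp add: conj_sign_def var_def lookup_single when_def coeffs_ring_ops single_uminus
      flip: coeffs_inject)

text \<open>
  A letter \<open>x\<^sub>a\<close> crosses each other letter of a monomial either from the left
  or from the right, and does not cross copies of itself.
\<close>

lemma crossings_single_total:
  "crossings (Poly_Mapping.single a 1) m + crossings m (Poly_Mapping.single a 1) +
    Poly_Mapping.lookup m a = total_degree m"
proof (induction m rule: poly_mapping_additive_induct_UNIV)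
  case (single i c)
  have "crossings (Poly_Mapping.single i c) (Poly_Mapping.single j d) = (if j < i then c * d else 0)"
    for i j c d
    by (cases "c = 0"; cases "d = 0") (simp_all add: crossings_def)
  then show ?case by (auto simp: lookup_single when_def)
qed (simp_all add: crossings_add_left crossings_add_right lookup_add total_degree_add)

lemma var_commute: "var a * f = conj_sign a f * var a"
proof (induction f rule: oddpoly_monomial_induct)
  case (monomial m c)
  define p q r where pqr: "p = crossings (Poly_Mapping.single a 1) m"
    "q = crossings m (Poly_Mapping.single a 1)" "r = Poly_Mapping.lookup m a"
  have "total_degree m = p + q + r"
    using crossings_single_total[of a m] by (simp add: pqr)
  moreover have "(-1 :: rat) ^ p = (- 1) ^ (p + q + r + r) * (- 1) ^ q"
    by (simp add: power_add mult.assoc flip: power_mult_distrib) 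
  ultimately have "(-1 :: rat) ^ p = (- 1) ^ (total_degree m + r) * (- 1) ^ q" by simp
  then show ?case
    unfolding var_def conj_sign_def monomial_map_monomial monomial_mult crossing_sign_def pqr
    by (simp add: add.commute mult_ac)
qed (simp_all add: algebra_simps alg_homD[OF alg_hom_conj_sign])

lemma var_anticommute: "i \<noteq> j \<Longrightarrow> var i * var j = - (var j * var i)"
  using var_commute[of i "var j"] by (simp add: conj_sign_var)

lemma conj_sign_involution [simp]: "conj_sign a (conj_sign a f) = f"
  by (rule alg_hom_eqI[OF alg_hom_comp[OF alg_hom_conj_sign alg_hom_conj_sign] alg_hom_id])
    (simp add: conj_sign_var alg_homD[OF alg_hom_conj_sign])

lemma conj_sign_commute: "conj_sign a (conj_sign b f) = conj_sign b (conj_sign a f)"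
  by (rule alg_hom_eqI[where F = "\<lambda>f. conj_sign a (conj_sign b f)"])
    (simp_all add: alg_hom_conj_sign alg_hom_comp conj_sign_var alg_homD[OF alg_hom_conj_sign])

definition sqr :: "nat \<Rightarrow> oddpoly" where "sqr j = var j * var j"

lemma sqr_central: "f * sqr j = sqr j * f"
  unfolding sqr_def
  by (metis conj_sign_involution mult.assoc var_commute)

lemma sqr_mult_monomial: "sqr j * monomial m c = monomial (Poly_Mapping.single j 2 + m) c"
proof -
  have e: "Poly_Mapping.single j (2::nat) = Poly_Mapping.single j 1 + Poly_Mapping.single j 1"
    by (simp add: numeral_2_eq_2 flip: single_add)
  show ?thesis
    unfolding sqr_def var_def e
    by (simp add: monomial_mult crossing_sign_def crossings_add_left crossings_add_right
      add.assoc mult.assoc flip: power_add power_mult_distrib) (simp add: crossings_def)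
qed

lemma lookup_sqr_mult:
  "Poly_Mapping.lookup (coeffs (sqr j * f)) (Poly_Mapping.single j 2 + m) =
    Poly_Mapping.lookup (coeffs f) m"
  by (induction f rule: oddpoly_monomial_induct)
    (simp_all add: sqr_mult_monomial coeffs_ring_ops lookup_single when_def algebra_simps lookup_add)

lemma keys_sqr_mult:
  assumes "k \<in> Poly_Mapping.keys (coeffs (sqr j * f))"
  shows "\<exists>m\<in>Poly_Mapping.keys (coeffs f). k = Poly_Mapping.single j 2 + m"
proof -
  have "coeffs (sqr j) = Poly_Mapping.single (Poly_Mapping.single j 2) 1"
    using sqr_mult_monomial[of j 0 1] by (simp add: coeffs_ring_ops flip: scal_def coeffs_monomial)
  with assms show ?thesis
    using keys_twisted_conv[of "(+)" crossing_sign "coeffs (sqr j)" "coeffs f"]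
    by (auto simp: coeffs_ring_ops)
qed

text \<open>
  Multiplication by \<open>x\<^sub>a\<^sup>2 + e x\<^sub>b\<^sup>2\<close> is injective: among
  the monomials of \<open>f\<close>, one with the largest exponent of \<open>x\<^sub>a\<close>
  is shifted by \<open>x\<^sub>a\<^sup>2\<close> to a monomial that the other summand cannot
  reach. This replaces the absence of zero divisors.
\<close>

lemma sqr_comb_eq_0:
  assumes "(sqr a + scal e * sqr b) * f = 0" and "a \<noteq> b"
  shows "f = 0"
proof (rule ccontr)
  let ?K = "Poly_Mapping.keys (coeffs f)"
  assume "f \<noteq> 0"
  then have K: "finite ?K" "?K \<noteq> {}"
    by (simp_all add: coeffs_ring_ops flip: coeffs_inject)
  obtain m where m: "m \<in> ?K" and max: "\<forall>k\<in>?K. Poly_Mapping.lookup k a \<le> Poly_Mapping.lookup m a"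
    using Max_in[of "(\<lambda>k. Poly_Mapping.lookup k a) ` ?K"] Max_ge[of "(\<lambda>k. Poly_Mapping.lookup k a) ` ?K"] K
    by (smt (verit, best) finite_imageI image_iff image_is_empty)
  let ?m = "Poly_Mapping.single a 2 + m"
  have "?m \<notin> Poly_Mapping.keys (coeffs (sqr b * f))"
    using max assms(2) by (fastforce dest!: keys_sqr_mult arg_cong[where f = "\<lambda>k. Poly_Mapping.lookup k a"]
      simp: lookup_add lookup_single when_def)
  then have "Poly_Mapping.lookup (coeffs (sqr b * f)) ?m = 0" by (simp add: in_keys_iff)
  moreover have "Poly_Mapping.lookup (coeffs (scal e * g)) k = e * Poly_Mapping.lookup (coeffs g) k" for g k
    by (induction g rule: oddpoly_monomial_induct)
      (simp_all add: scal_mult_monomial coeffs_ring_ops lookup_single when_def algebra_simps lookup_add)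
  ultimately have "Poly_Mapping.lookup (coeffs ((sqr a + scal e * sqr b) * f)) ?m =
      Poly_Mapping.lookup (coeffs f) m"
    by (simp add: distrib_right mult.assoc coeffs_ring_ops(4) lookup_add lookup_sqr_mult)
  then show False using assms m by (simp add: coeffs_ring_ops in_keys_iff)
qed

lemma sqr_mult_eq_0: "sqr a * f = 0 \<Longrightarrow> f = 0"
  using sqr_comb_eq_0[of a 0 "Suc a" f] by simp

lemma mult_var_eq_0:
  assumes "f * var a = 0"
  shows "f = 0"
proof (rule sqr_mult_eq_0)
  have "sqr a * f = f * var a * var a" using sqr_central[of f a] by (simp add: sqr_def mult.assoc)
  with assms show "sqr a * f = 0" by simp
qed

section \<open>Reflections and divided differences\<close>

definition swap_expo :: "nat \<Rightarrow> expo \<Rightarrow> expo" where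
  "swap_expo a m = Poly_Mapping.map_key (Transposition.transpose a (Suc a)) m"

lemma lookup_swap_expo:
  "Poly_Mapping.lookup (swap_expo a m) j = Poly_Mapping.lookup m (Transposition.transpose a (Suc a) j)"
  unfolding swap_expo_def by (simp add: map_key.rep_eq)

lemma swap_expo_0 [simp]: "swap_expo a 0 = 0"
  by (rule poly_mapping_eqI) (simp add: lookup_swap_expo)

lemma swap_expo_add: "swap_expo a (m + k) = swap_expo a m + swap_expo a k"
  by (rule poly_mapping_eqI) (simp add: lookup_swap_expo lookup_add)

lemma swap_expo_single:
  "swap_expo a (Poly_Mapping.single j c) = Poly_Mapping.single (Transposition.transpose a (Suc a) j) c"
  by (rule poly_mapping_eqI) (auto simp: lookup_swap_expo lookup_single when_def transpose_eq_iff)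

lemma crossings_single_single:
  "crossings (Poly_Mapping.single i c) (Poly_Mapping.single j d) = (if j < i then c * d else 0)"
  by (cases "c = 0"; cases "d = 0") (simp_all add: crossings_def)

text \<open>
  Exchanging two neighbouring variables changes the number of crossings only through pairs of
  these two variables.
\<close>

lemma crossings_swap:
  "crossings (swap_expo a m) (swap_expo a k) + Poly_Mapping.lookup m (Suc a) * Poly_Mapping.lookup k a =
   crossings m k + Poly_Mapping.lookup m a * Poly_Mapping.lookup k (Suc a)"
proof (induction m rule: poly_mapping_additive_induct_UNIV)
  case (single i c)
  show ?case
  proof (induction k rule: poly_mapping_additive_induct_UNIV)
    case (single j d)
    show ?case
      by (auto simp: swap_expo_single crossings_single_single lookup_single when_def transpose_def)
  qed (simp_all add: crossings_add_right swap_expo_add lookup_add algebra_simps)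
qed (simp_all add: crossings_add_left swap_expo_add lookup_add algebra_simps)

text \<open>
  The reflections of both kinds: \<open>e = 1\<close> gives \<open>s\<^sub>a\<close>, and
  \<open>e = -1\<close> with \<open>a = n - 1\<close> gives the extra reflection of type D. The
  last factor is the sign for sorting \<open>x\<^bsub>a+1\<^esub>\<^sup>p
  x\<^sub>a\<^sup>q\<close>.
\<close>

definition refl_hom :: "nat \<Rightarrow> rat \<Rightarrow> oddpoly \<Rightarrow> oddpoly" where
  "refl_hom a e = monomial_map (swap_expo a) (\<lambda>m. (-1) ^ total_degree m *
     e ^ (Poly_Mapping.lookup m a + Poly_Mapping.lookup m (Suc a)) *
     (-1) ^ (Poly_Mapping.lookup m a * Poly_Mapping.lookup m (Suc a)))"

lemma alg_hom_refl_hom: "alg_hom (refl_hom a e)"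
  unfolding refl_hom_def
proof (rule alg_hom_monomial_map)
  fix m k :: expo
  define p q r s where pq: "p = Poly_Mapping.lookup m a" "q = Poly_Mapping.lookup m (Suc a)"
    "r = Poly_Mapping.lookup k a" "s = Poly_Mapping.lookup k (Suc a)"
  have "(p + r) * (q + s) + crossings m k + 2 * (q * r) =
      p * q + r * s + crossings (swap_expo a m) (swap_expo a k) + 2 * (q * r) + 2 * (q * r)"
    using crossings_swap[of a m k] by (simp add: pq algebra_simps)
  then have "(-1 :: rat) ^ ((p + r) * (q + s) + crossings m k + 2 * (q * r)) =
      (-1) ^ (p * q + r * s + crossings (swap_expo a m) (swap_expo a k) + 2 * (q * r) + 2 * (q * r))"
    by (rule arg_cong)
  then have sign: "(-1 :: rat) ^ ((p + r) * (q + s)) * (-1) ^ crossings m k =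
      (-1) ^ (p * q) * (-1) ^ (r * s) * (-1) ^ crossings (swap_expo a m) (swap_expo a k)"
    by (simp add: power_add power_mult)
  have "(-1) ^ total_degree (m + k) * e ^ (p + r + (q + s)) * (-1) ^ ((p + r) * (q + s)) * crossing_sign m k =
    ((-1) ^ total_degree (m + k) * e ^ (p + r + (q + s))) * ((-1) ^ ((p + r) * (q + s)) * (-1) ^ crossings m k)"
    by (simp add: crossing_sign_def)
  also have "\<dots> = (- 1) ^ total_degree m * e ^ (p + q) * (- 1) ^ (p * q) *
       ((- 1) ^ total_degree k * e ^ (r + s) * (- 1) ^ (r * s)) *
       crossing_sign (swap_expo a m) (swap_expo a k)"
    unfolding sign by (simp add: crossing_sign_def power_add total_degree_add)
  finally show "(- 1) ^ total_degree (m + k) *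
       e ^ (Poly_Mapping.lookup (m + k) a + Poly_Mapping.lookup (m + k) (Suc a)) *
       (- 1) ^ (Poly_Mapping.lookup (m + k) a * Poly_Mapping.lookup (m + k) (Suc a)) *
       crossing_sign m k =
       (- 1) ^ total_degree m *
       e ^ (Poly_Mapping.lookup m a + Poly_Mapping.lookup m (Suc a)) *
       (- 1) ^ (Poly_Mapping.lookup m a * Poly_Mapping.lookup m (Suc a)) *
       ((- 1) ^ total_degree k *
        e ^ (Poly_Mapping.lookup k a + Poly_Mapping.lookup k (Suc a)) *
        (- 1) ^ (Poly_Mapping.lookup k a * Poly_Mapping.lookup k (Suc a))) *
       crossing_sign (swap_expo a m) (swap_expo a k)"
    by (simp add: lookup_add pq)
qed (simp_all add: swap_expo_add)

lemmas refl_hom_simps = alg_homD[OF alg_hom_refl_hom]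

lemma monomial_scal: "monomial m (c * d) = scal c * monomial m d"
  by (simp add: scal_mult_monomial)

lemma refl_hom_var:
  "refl_hom a e (var j) =
    (if j = a then - (scal e * var (Suc a)) else if j = Suc a then - (scal e * var a) else - var j)"
proof -
  have "monomial m (- c) = - monomial m c" for m c
    using monomial_scal[of m "-1" c] by simp
  then show ?thesis
    by (auto simp: refl_hom_def var_def swap_expo_single lookup_single when_def transpose_def
      scal_mult_monomial)
qed

definition sgn_unit :: "rat \<Rightarrow> bool" where "sgn_unit e \<longleftrightarrow> e = 1 \<or> e = -1"

lemma refl_hom_involution:
  assumes "sgn_unit e"
  shows "refl_hom a e (refl_hom a e f) = f"
  by (rule alg_hom_eqI[OF alg_hom_comp[OF alg_hom_refl_hom alg_hom_refl_hom] alg_hom_id])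
    (use assms in \<open>auto simp: sgn_unit_def refl_hom_var refl_hom_simps\<close>)

definition simple_root :: "nat \<Rightarrow> rat \<Rightarrow> oddpoly" where
  "simple_root a e = var a - scal e * var (Suc a)"

definition sqr_diff :: "nat \<Rightarrow> oddpoly" where
  "sqr_diff a = sqr a - sqr (Suc a)"

lemma sqr_diff_central: "f * sqr_diff a = sqr_diff a * f"
  by (simp add: sqr_diff_def right_diff_distrib left_diff_distrib sqr_central)

lemma sqr_diff_cancel: "sqr_diff a * f = sqr_diff a * g \<longleftrightarrow> f = g"
proof
  assume "sqr_diff a * f = sqr_diff a * g"
  then have "(sqr a + scal (-1) * sqr (Suc a)) * (f - g) = 0"
    by (simp add: sqr_diff_def right_diff_distrib)
  then show "f = g" using sqr_comb_eq_0[of a "-1" "Suc a" "f - g"] by simp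
qed simp

definition var_derivative :: "nat \<Rightarrow> rat \<Rightarrow> nat \<Rightarrow> rat" where
  "var_derivative a e j = (if j = a then 1 else if j = Suc a then e else 0)"

text \<open>
  On a variable the twisted commutator with the root is already divisible by the central element
  \<open>x\<^sub>a\<^sup>2 - x\<^bsub>a+1\<^esub>\<^sup>2\<close>, and the quotient is the
  prescribed value of the operator.
\<close>

lemma simple_root_var:
  assumes "sgn_unit e"
  shows "simple_root a e * var j - refl_hom a e (var j) * simple_root a e =
    sqr_diff a * scal (var_derivative a e j)"
proof -
  have sc: "f * (scal c * g) = scal c * (f * g)" for f g c
    by (metis mult.assoc scal_central)
  consider "j = a" | "j = Suc a" | "j \<noteq> a" "j \<noteq> Suc a" by blast
  then show ?thesis
  proof cases
    case 3
    then show ?thesis using var_anticommute[of j a] var_anticommute[of j "Suc a"]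
      by (simp add: simple_root_def refl_hom_var var_derivative_def algebra_simps sc)
  next
    case 1
    then show ?thesis using assms
      by (auto simp: sgn_unit_def simple_root_def refl_hom_var var_derivative_def algebra_simps
          sqr_diff_def sqr_def)
  next
    case 2
    then show ?thesis using assms
      by (auto simp: sgn_unit_def simple_root_def refl_hom_var var_derivative_def algebra_simps
          sqr_diff_def sqr_def)
  qed
qed

text \<open>
  The quotient is unique because \<open>x\<^sub>a\<^sup>2 - x\<^bsub>a+1\<^esub>\<^sup>2\<close>
  can be cancelled. Defining the operators by division makes linearity and the Leibniz rule
  consequences of uniqueness.
\<close>

definition dem :: "nat \<Rightarrow> rat \<Rightarrow> oddpoly \<Rightarrow> oddpoly" where
  "dem a e f = (THE g. sqr_diff a * g = simple_root a e * f - refl_hom a e f * simple_root a e)"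

text \<open>
  Divisibility passes from \<open>f\<close> to \<open>x\<^sub>j f\<close> because the twisted
  commutator satisfies the Leibniz rule.
\<close>

lemma dem_eq:
  assumes e: "sgn_unit e"
  shows "sqr_diff a * dem a e f = simple_root a e * f - refl_hom a e f * simple_root a e"
proof -
  have "\<exists>g. sqr_diff a * g = simple_root a e * f - refl_hom a e f * simple_root a e"
  proof (induction f rule: oddpoly_var_induct)
    case (scal c)
    show ?case by (rule exI[of _ 0]) (simp add: refl_hom_simps scal_central)
  next
    case (var j f)
    then obtain g where g: "sqr_diff a * g = simple_root a e * f - refl_hom a e f * simple_root a e"
      by blast
    have "simple_root a e * (var j * f) - refl_hom a e (var j * f) * simple_root a e =
      (simple_root a e * var j - refl_hom a e (var j) * simple_root a e) * f +
      refl_hom a e (var j) * (simple_root a e * f - refl_hom a e f * simple_root a e)"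
      by (simp add: refl_hom_simps algebra_simps)
    also have "\<dots> = sqr_diff a * (scal (var_derivative a e j) * f + refl_hom a e (var j) * g)"
      unfolding simple_root_var[OF e] g[symmetric]
      by (simp add: distrib_left mult.assoc flip: sqr_diff_central[of "refl_hom a e (var j)"])
        (simp flip: mult.assoc add: sqr_diff_central)
    finally show ?case by metis
  next
    case (add f g)
    then obtain f' g' where
      "sqr_diff a * f' = simple_root a e * f - refl_hom a e f * simple_root a e"
      "sqr_diff a * g' = simple_root a e * g - refl_hom a e g * simple_root a e" by blast
    then show ?case by (intro exI[of _ "f' + g'"]) (simp add: algebra_simps refl_hom_simps)
  qed
  then have "\<exists>!g. sqr_diff a * g = simple_root a e * f - refl_hom a e f * simple_root a e"
    by (metis sqr_diff_cancel)
  from theI'[OF this] show ?thesis unfolding dem_def .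
qed

lemma dem_eqI:
  assumes "sgn_unit e" "sqr_diff a * g = simple_root a e * f - refl_hom a e f * simple_root a e"
  shows "dem a e f = g"
  using dem_eq[OF assms(1), of a f] assms(2) sqr_diff_cancel by metis

lemma dem_mult:
  assumes e: "sgn_unit e"
  shows "dem a e (f * g) = dem a e f * g + refl_hom a e f * dem a e g"
proof (rule dem_eqI[OF e])
  have "sqr_diff a * (dem a e f * g + refl_hom a e f * dem a e g) =
    (sqr_diff a * dem a e f) * g + refl_hom a e f * (sqr_diff a * dem a e g)"
    by (simp add: distrib_left mult.assoc flip: sqr_diff_central[of "refl_hom a e f"])
      (simp flip: mult.assoc add: sqr_diff_central)
  also have "\<dots> = simple_root a e * (f * g) - refl_hom a e (f * g) * simple_root a e"
    unfolding dem_eq[OF e] by (simp add: refl_hom_simps algebra_simps)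
  finally show "sqr_diff a * (dem a e f * g + refl_hom a e f * dem a e g) =
    simple_root a e * (f * g) - refl_hom a e (f * g) * simple_root a e" .
qed

lemma dem_add:
  assumes e: "sgn_unit e"
  shows "dem a e (f + g) = dem a e f + dem a e g"
  by (rule dem_eqI[OF e]) (simp add: distrib_left dem_eq[OF e] refl_hom_simps algebra_simps)

lemma dem_scal: 
  assumes e: "sgn_unit e"
  shows "dem a e (scal c) = 0"
  by (rule dem_eqI[OF e]) (simp add: refl_hom_simps scal_central)

lemma dem_var: 
  assumes e: "sgn_unit e"
  shows "dem a e (var j) = scal (var_derivative a e j)"
  by (rule dem_eqI[OF e]) (simp add: simple_root_var[OF e])

lemma dem_linear:
  assumes e: "sgn_unit e"
  shows "dem a e 0 = 0" "dem a e 1 = 0" "dem a e (- f) = - dem a e f"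
    "dem a e (f - g) = dem a e f - dem a e g" "dem a e (scal c * f) = scal c * dem a e f"
proof -
  show z: "dem a e 0 = 0" and "dem a e 1 = 0"
    using dem_scal[OF e, of a 0] dem_scal[OF e, of a 1] by simp_all
  show s: "dem a e (scal c * f) = scal c * dem a e f" for c f
    by (simp add: dem_mult[OF e] dem_scal[OF e] refl_hom_simps)
  show m: "dem a e (- f) = - dem a e f" for f
    using s[of "-1" f] by simp
  show "dem a e (f - g) = dem a e f - dem a e g"
    using dem_add[OF e, of a f "- g"] m by simp
qed

lemma dem_var_mult:
  assumes e: "sgn_unit e"
  shows "dem a e (var a * f) = f - scal e * (var (Suc a) * dem a e f)"
    "dem a e (var (Suc a) * f) = scal e * (f - var a * dem a e f)"
    "j \<noteq> a \<Longrightarrow> j \<noteq> Suc a \<Longrightarrow> dem a e (var j * f) = - (var j * dem a e f)"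
  by (simp_all add: dem_mult[OF e] dem_var[OF e] var_derivative_def refl_hom_var algebra_simps mult.assoc)

lemmas dem_simps = dem_add dem_scal dem_linear dem_var_mult

text \<open>
  For a product \<open>x\<^sub>j f\<close>, the Leibniz rule expresses the claim through the
  claim for \<open>f\<close>. The next three relations are proved in the same way.
\<close>

lemma dem_square:
  assumes e: "sgn_unit e"
  shows "dem a e (dem a e f) = 0"
proof (induction f rule: oddpoly_var_induct)
  case (var j f)
  consider "j = a" | "j = Suc a" | "j \<noteq> a" "j \<noteq> Suc a" by blast
  then show ?case
    by cases (use var e in \<open>auto simp: sgn_unit_def dem_simps[OF e]\<close>)
qed (simp_all add: dem_simps[OF e])

lemma dem_same_commute:
  assumes e: "sgn_unit e" "sgn_unit e'"
  shows "dem a e (dem a e' f) = dem a e' (dem a e f)"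
proof (induction f rule: oddpoly_var_induct)
  case (var j f)
  consider "j = a" | "j = Suc a" | "j \<noteq> a" "j \<noteq> Suc a" by blast
  then show ?case
    by cases (use var e in \<open>auto simp: sgn_unit_def dem_simps[OF e(1)] dem_simps[OF e(2)] algebra_simps\<close>)
qed (simp_all add: dem_simps[OF e(1)] dem_simps[OF e(2)])

lemma dem_far_anticommute:
  assumes e: "sgn_unit e" "sgn_unit e'" and far: "Suc a < b"
  shows "dem a e (dem b e' f) = - dem b e' (dem a e f)"
proof (induction f rule: oddpoly_var_induct)
  case (var j f)
  consider "j = a" | "j = Suc a" | "j = b" | "j = Suc b" | "j \<notin> {a, Suc a, b, Suc b}" by blast
  then show ?case
    by cases (use var e far in \<open>auto simp: sgn_unit_def dem_simps[OF e(1)] dem_simps[OF e(2)] algebra_simps\<close>)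
qed (simp_all add: dem_simps[OF e(1)] dem_simps[OF e(2)])

text \<open>
  The sign \<open>e\<close> of the second operator is free, so this covers the neighbours
  \<open>i, i + 1\<close> as well as \<open>n - 2, n\<close>. There is no sign in this relation.
\<close>

lemma dem_braid:
  assumes e: "sgn_unit e"
  shows "dem a 1 (dem (Suc a) e (dem a 1 f)) = dem (Suc a) e (dem a 1 (dem (Suc a) e f))"
proof (induction f rule: oddpoly_var_induct)
  have u: "sgn_unit 1" by (simp add: sgn_unit_def)
  case (var j f)
  consider "j = a" | "j = Suc a" | "j = Suc (Suc a)" | "j \<notin> {a, Suc a, Suc (Suc a)}" by blast
  then show ?case
    by cases (use var e in \<open>auto simp: sgn_unit_def dem_simps[OF u] dem_simps[OF e]
      dem_square[OF e] dem_square[OF u] algebra_simps\<close>)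
qed (simp_all add: dem_simps[OF e] dem_simps sgn_unit_def)

section \<open>Degrees and supports\<close>

text \<open>
  Elements with coefficients in \<open>R\<close> and exponents in \<open>K\<close>. Integrality,
  degree, order and the set of variables are all conditions of this form.
\<close>

definition coeff_in :: "rat set \<Rightarrow> expo set \<Rightarrow> oddpoly set" where
  "coeff_in R K = {f. \<forall>m\<in>Poly_Mapping.keys (coeffs f). m \<in> K \<and> Poly_Mapping.lookup (coeffs f) m \<in> R}"

definition additive_coeffs :: "rat set \<Rightarrow> bool" where
  "additive_coeffs R \<longleftrightarrow> 0 \<in> R \<and> 1 \<in> R \<and> (\<forall>c\<in>R. - c \<in> R) \<and> (\<forall>c\<in>R. \<forall>d\<in>R. c + d \<in> R \<and> c * d \<in> R)"

lemma additive_coeffs_UNIV [simp]: "additive_coeffs UNIV"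
  by (simp add: additive_coeffs_def)

lemma additive_coeffs_Ints [simp]: "additive_coeffs \<int>"
  by (simp add: additive_coeffs_def)

lemma coeff_in_0 [simp]: "0 \<in> coeff_in R K"
  by (simp add: coeff_in_def coeffs_ring_ops)

lemma coeff_in_monomial: "additive_coeffs R \<Longrightarrow> monomial m c \<in> coeff_in R K \<longleftrightarrow> c = 0 \<or> (m \<in> K \<and> c \<in> R)"
  by (auto simp: coeff_in_def)

lemma coeff_in_add:
  assumes "additive_coeffs R" "f \<in> coeff_in R K" "g \<in> coeff_in R K"
  shows "f + g \<in> coeff_in R K"
  unfolding coeff_in_def
proof (safe)
  fix m assume m: "m \<in> Poly_Mapping.keys (coeffs (f + g))"
  then have "m \<in> Poly_Mapping.keys (coeffs f) \<union> Poly_Mapping.keys (coeffs g)"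
    using keys_add[of "coeffs f" "coeffs g"] by (auto simp: coeffs_ring_ops)
  then show "m \<in> K" using assms by (auto simp: coeff_in_def)
  have "Poly_Mapping.lookup (coeffs h) m \<in> R" if "h \<in> coeff_in R K" for h
    using that assms(1) by (cases "m \<in> Poly_Mapping.keys (coeffs h)")
      (auto simp: coeff_in_def additive_coeffs_def in_keys_iff)
  then show "Poly_Mapping.lookup (coeffs (f + g)) m \<in> R"
    using assms by (simp add: coeffs_ring_ops lookup_add additive_coeffs_def)
qed

lemma coeff_in_monomial_induct [consumes 1, case_names zero monomial add]:
  assumes "f \<in> coeff_in R K" and "P 0" "\<And>m c. m \<in> K \<Longrightarrow> c \<in> R \<Longrightarrow> P (monomial m c)"
    and add: "\<And>f g. P f \<Longrightarrow> P g \<Longrightarrow> P (f + g)"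
  shows "P f"
proof -
  let ?p = "coeffs f"
  have "P (Abs_oddpoly (\<Sum>a\<in>A. Poly_Mapping.single a (Poly_Mapping.lookup ?p a)))"
    if "finite A" "A \<subseteq> Poly_Mapping.keys ?p" for A
    using that
  proof (induction rule: finite_induct)
    case empty then show ?case using assms(2) by (simp add: zero_oddpoly_def)
  next
    case (insert a A)
    then have "P (monomial a (Poly_Mapping.lookup ?p a) +
        Abs_oddpoly (\<Sum>a\<in>A. Poly_Mapping.single a (Poly_Mapping.lookup ?p a)))"
      using assms(1) by (intro add assms(3)) (auto simp: coeff_in_def)
    then show ?case using insert by (simp add: plus_oddpoly_def coeffs_ring_ops)
  qed
  from this[of "Poly_Mapping.keys ?p"] show ?thesis
    by (simp add: coeffs_inverse flip: poly_mapping_decompose)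
qed

lemma coeff_in_mult:
  assumes R: "additive_coeffs R" and K: "\<And>m k. m \<in> K \<Longrightarrow> k \<in> K' \<Longrightarrow> m + k \<in> K''"
    and "f \<in> coeff_in R K" "g \<in> coeff_in R K'"
  shows "f * g \<in> coeff_in R K''"
  using assms(3,2)
proof (induction rule: coeff_in_monomial_induct)
  case (monomial m c)
  note mc = this
  have "crossing_sign m k \<in> {1, -1}" for k
    by (cases "even (crossings m k)") (simp_all add: crossing_sign_def)
  then have s: "crossing_sign m k * c * d \<in> R" if "d \<in> R" for k d
  proof -
    from that R mc(2) have "c * d \<in> R" "- (c * d) \<in> R" by (auto simp: additive_coeffs_def)
    with \<open>crossing_sign m k \<in> {1, -1}\<close> show ?thesis by (auto simp: mult.assoc)
  qed
  show ?case using assms(4)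
  proof (induction rule: coeff_in_monomial_induct)
    case (monomial k d)
    then show ?case using mc s by (auto simp: monomial_mult coeff_in_monomial[OF R])
  qed (auto simp: algebra_simps intro: coeff_in_add[OF R])
qed (auto simp: algebra_simps intro: coeff_in_add[OF R])

lemma coeff_in_mono: "f \<in> coeff_in R K \<Longrightarrow> K \<subseteq> K' \<Longrightarrow> R \<subseteq> R' \<Longrightarrow> f \<in> coeff_in R' K'"
  by (auto simp: coeff_in_def)

section \<open>Homogeneous elements\<close>

definition homog :: "nat \<Rightarrow> oddpoly set" where
  "homog d = coeff_in UNIV {m. total_degree m = d}"

lemma homog_scal [simp]: "scal c \<in> homog 0"
  by (simp add: homog_def scal_def coeff_in_monomial)

lemma homog_1 [simp]: "1 \<in> homog 0"
  using homog_scal[of 1] by simp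

lemma homog_var [simp]: "var j \<in> homog 1"
  by (simp add: homog_def var_def coeff_in_monomial)

lemma homog_mult: "f \<in> homog d \<Longrightarrow> g \<in> homog d' \<Longrightarrow> f * g \<in> homog (d + d')"
  unfolding homog_def by (erule (1) coeff_in_mult[rotated 2]) (auto simp: total_degree_add)

lemma homog_power: "f \<in> homog d \<Longrightarrow> f ^ k \<in> homog (k * d)"
  by (induction k) (auto intro: homog_mult)

lemma homog_0_scal:
  assumes "f \<in> homog 0"
  obtains c where "f = scal c"
proof -
  from assms have "\<exists>c. f = scal c" unfolding homog_def
  proof (induction rule: coeff_in_monomial_induct)
    case zero show ?case by (rule exI[of _ 0]) simp
  next
    case (add f g) then show ?case by (metis scal_simps(4))
  qed (auto simp: scal_def)
  then show ?thesis using that by blast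
qed

lemma homog_unique:
  assumes "f \<in> homog d" "f \<in> homog d'" "f \<noteq> 0"
  shows "d = d'"
proof -
  have "Poly_Mapping.keys (coeffs f) \<noteq> {}"
    using assms(3) by (simp add: coeffs_ring_ops flip: coeffs_inject)
  then show ?thesis using assms(1,2) by (auto simp: homog_def coeff_in_def)
qed

text \<open>
  The substitution \<open>x\<^sub>j \<mapsto> 2 x\<^sub>j\<close>. Its eigenvectors with
  eigenvalue \<open>2\<^sup>d\<close> are the homogeneous elements of degree \<open>d\<close>,
  and its commutation with the operators shows that they lower the degree by one.
\<close>

definition scale2 :: "oddpoly \<Rightarrow> oddpoly" where
  "scale2 = monomial_map (\<lambda>m. m) (\<lambda>m. 2 ^ total_degree m)"

lemma alg_hom_scale2: "alg_hom scale2"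
  unfolding scale2_def by (rule alg_hom_monomial_map) (simp_all add: total_degree_add power_add)

lemmas scale2_simps = alg_homD[OF alg_hom_scale2]

lemma scale2_var: "scale2 (var j) = scal 2 * var j"
  by (simp add: scale2_def var_def scal_mult_monomial)

lemma lookup_scale2:
  "Poly_Mapping.lookup (coeffs (scale2 f)) m = 2 ^ total_degree m * Poly_Mapping.lookup (coeffs f) m"
proof (induction f rule: oddpoly_monomial_induct)
  case (monomial k c) then show ?case
    by (simp add: scale2_def lookup_single when_def)
qed (simp_all add: scale2_simps coeffs_ring_ops lookup_add algebra_simps)

lemma lookup_scal_mult:
  "Poly_Mapping.lookup (coeffs (scal e * g)) k = e * Poly_Mapping.lookup (coeffs g) k"
  by (induction g rule: oddpoly_monomial_induct)
    (simp_all add: scal_mult_monomial coeffs_ring_ops lookup_single when_def algebra_simps lookup_add)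

lemma homog_iff_scale2: "f \<in> homog d \<longleftrightarrow> scale2 f = scal (2 ^ d) * f"
proof -
  have "scale2 f = scal (2 ^ d) * f \<longleftrightarrow>
    (\<forall>m. 2 ^ total_degree m * Poly_Mapping.lookup (coeffs f) m = 2 ^ d * Poly_Mapping.lookup (coeffs f) m)"
    by (simp add: poly_mapping_eq_iff fun_eq_iff lookup_scale2 lookup_scal_mult flip: coeffs_inject)
  then show ?thesis by (auto simp: homog_def coeff_in_def in_keys_iff)
qed

lemma dem_scale2:
  assumes e: "sgn_unit e"
  shows "dem a e (scale2 f) = scal 2 * scale2 (dem a e f)"
proof (induction f rule: oddpoly_var_induct)
  case (var j f)
  have "scal c * var i = var i * scal c" for c i by (simp add: scal_central)
  then have c: "scal c * (var i * g) = var i * (scal c * g)" for c i g by (metis mult.assoc)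
  consider "j = a" | "j = Suc a" | "j \<noteq> a" "j \<noteq> Suc a" by blast
  then show ?case
    by cases (use var e in \<open>auto simp: sgn_unit_def dem_simps[OF e] scale2_simps scale2_var
      mult.assoc c algebra_simps\<close>)
qed (simp_all add: dem_simps[OF e] scale2_simps algebra_simps)

lemma dem_homog_Suc:
  assumes e: "sgn_unit e" and f: "f \<in> homog (Suc d)"
  shows "dem a e f \<in> homog d"
proof -
  have "scal 2 * scale2 (dem a e f) = dem a e (scal (2 ^ Suc d) * f)"
    using f by (simp add: homog_iff_scale2 flip: dem_scale2[OF e])
  also have "\<dots> = scal 2 * (scal (2 ^ d) * dem a e f)"
    by (simp add: dem_simps[OF e] mult.assoc)
  finally have "scal (1/2) * (scal 2 * scale2 (dem a e f)) = scal (1/2) * (scal 2 * (scal (2 ^ d) * dem a e f))"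
    by simp
  then have "scale2 (dem a e f) = scal (2 ^ d) * dem a e f"
    unfolding mult.assoc[symmetric] scal_simps(6)[symmetric] by simp
  then show ?thesis by (simp add: homog_iff_scale2)
qed

lemma dem_homog_0: "sgn_unit e \<Longrightarrow> f \<in> homog 0 \<Longrightarrow> dem a e f = 0"
  by (metis homog_0_scal dem_scal)

text \<open>
  This serves to discard the terms of high degree in a computation with inhomogeneous
  polynomials.
\<close>

definition order_ge :: "nat \<Rightarrow> oddpoly set" where
  "order_ge d = coeff_in UNIV {m. d \<le> total_degree m}"

lemma dem_order_ge:
  assumes e: "sgn_unit e" and f: "f \<in> order_ge (Suc d)"
  shows "dem a e f \<in> order_ge d"
  using f unfolding order_ge_def
proof (induction rule: coeff_in_monomial_induct)
  case (monomial m c)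
  then obtain d' where d': "total_degree m = Suc d'" "d \<le> d'" by (cases "total_degree m") auto
  then have "monomial m c \<in> homog (Suc d')" by (simp add: homog_def coeff_in_monomial)
  from dem_homog_Suc[OF e this] show ?case
    unfolding homog_def by (rule coeff_in_mono) (use d' in auto)
qed (auto simp: dem_simps[OF e] intro: coeff_in_add)

definition const_coeff :: "oddpoly \<Rightarrow> rat" where
  "const_coeff f = Poly_Mapping.lookup (coeffs f) 0"

lemma const_coeff_simps [simp]:
  "const_coeff (f + g) = const_coeff f + const_coeff g"
  "const_coeff (f - g) = const_coeff f - const_coeff g"
  "const_coeff 0 = 0" "const_coeff (scal c) = c"
  by (simp_all add: const_coeff_def coeffs_ring_ops lookup_add lookup_minus scal_def del: single_one)

lemma const_coeff_1 [simp]: "const_coeff 1 = 1"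
  using const_coeff_simps(4)[of 1] by simp

lemma const_coeff_mult [simp]: "const_coeff (f * g) = const_coeff f * const_coeff g"
proof (induction f rule: oddpoly_monomial_induct)
  case (monomial m c)
  show ?case
  proof (induction g rule: oddpoly_monomial_induct)
    case (monomial k d)
    have "m + k = 0 \<longleftrightarrow> m = 0 \<and> k = 0"
      by (metis add_eq_0_iff_both_eq_0 total_degree_add total_degree_eq_0_iff)
    then show ?case
      by (auto simp: const_coeff_def monomial_mult lookup_single when_def crossing_sign_def)
  qed (simp_all add: algebra_simps)
qed (simp_all add: algebra_simps)

lemma const_coeff_var [simp]: "const_coeff (var j) = 0"
proof -
  have "Poly_Mapping.single j (Suc 0) \<noteq> 0" by (metis lookup_single_eq lookup_zero nat.distinct(1))
  then show ?thesis by (simp add: const_coeff_def var_def lookup_single when_def)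
qed

lemma const_coeff_order_ge: "f \<in> order_ge d \<Longrightarrow> d > 0 \<Longrightarrow> const_coeff f = 0"
  by (force simp: order_ge_def coeff_in_def const_coeff_def not_in_keys_iff_lookup_eq_zero[symmetric])

lemma homog_order_ge: "f \<in> homog d \<Longrightarrow> f \<in> order_ge d"
  unfolding homog_def order_ge_def by (erule coeff_in_mono) auto

lemma order_ge_mult: "f \<in> order_ge d \<Longrightarrow> f * g \<in> order_ge d"
  unfolding order_ge_def
  by (rule coeff_in_mult[where K = "{m. d \<le> total_degree m}" and K' = UNIV])
    (auto simp: total_degree_add coeff_in_def)

section \<open>The operators of type D\<close>

text \<open>
  The generator \<open>i\<close> acts on the variables at positions \<open>pos n i\<close> and
  \<open>pos n i + 1\<close> with the sign \<open>sg n i\<close>; the last generator shares its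
  position with the generator \<open>n - 1\<close>.
\<close>

definition pos :: "nat \<Rightarrow> nat \<Rightarrow> nat" where "pos n i = (if i < n then i else n - 1)"
definition sg :: "nat \<Rightarrow> nat \<Rightarrow> rat" where "sg n i = (if i < n then 1 else -1)"

lemma sgn_unit_sg [simp]: "sgn_unit (sg n i)" by (simp add: sgn_unit_def sg_def)
lemma sgn_unit_1 [simp]: "sgn_unit 1" "sgn_unit (-1)" by (simp_all add: sgn_unit_def)

definition demD :: "nat \<Rightarrow> nat \<Rightarrow> oddpoly \<Rightarrow> oddpoly" where "demD n i = dem (pos n i) (sg n i)"
definition reflD :: "nat \<Rightarrow> nat \<Rightarrow> oddpoly \<Rightarrow> oddpoly" where "reflD n i = refl_hom (pos n i) (sg n i)"

lemma demD_mult: "demD n i (f * g) = demD n i f * g + reflD n i f * demD n i g"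
  by (simp add: demD_def reflD_def dem_mult)

lemma demD_linear: "demD n i (f + g) = demD n i f + demD n i g" "demD n i (scal c) = 0"
  "demD n i 0 = 0" "demD n i 1 = 0" "demD n i (- f) = - demD n i f"
  "demD n i (f - g) = demD n i f - demD n i g" "demD n i (scal c * f) = scal c * demD n i f"
  by (simp_all add: demD_def dem_add dem_scal dem_linear)

lemma demD_square: "demD n i (demD n i f) = 0"
  by (simp add: demD_def dem_square)

lemma demD_homog_Suc: "f \<in> homog (Suc d) \<Longrightarrow> demD n i f \<in> homog d"
  by (simp add: demD_def dem_homog_Suc)

lemma demD_homog_0: "f \<in> homog 0 \<Longrightarrow> demD n i f = 0"
  by (simp add: demD_def dem_homog_0)

text \<open>
  Edges of the Dynkin diagram of type D: a path \<open>1, \<dots>, n - 1\<close>, with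
  \<open>n\<close> attached to \<open>n - 2\<close>.
\<close>

definition adjacent :: "nat \<Rightarrow> nat \<Rightarrow> nat \<Rightarrow> bool" where
  "adjacent n i j \<longleftrightarrow> (if i < n \<and> j < n then Suc i = j \<or> Suc j = i
    else Suc (Suc (min i j)) = n \<and> max i j = n)"

lemma demD_braid_Suc:
  assumes "pos n j = Suc (pos n i)" "sg n i = 1"
  shows "demD n i (demD n j (demD n i f)) = demD n j (demD n i (demD n j f))"
  unfolding demD_def assms by (rule dem_braid) simp

lemma demD_braid:
  assumes "adjacent n i j" "i \<le> n" "j \<le> n"
  shows "demD n i (demD n j (demD n i f)) = demD n j (demD n i (demD n j f))"
proof -
  have "(pos n j = Suc (pos n i) \<and> sg n i = 1) \<or> (pos n i = Suc (pos n j) \<and> sg n j = 1)"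
  proof (cases "i < n"; cases "j < n")
    assume "i < n" "\<not> j < n"
    then have "j = n" "Suc (Suc i) = n" using assms by (auto simp: adjacent_def)
    then show ?thesis by (auto simp: pos_def sg_def)
  next
    assume "\<not> i < n" "j < n"
    then have "i = n" "Suc (Suc j) = n" using assms by (auto simp: adjacent_def)
    then show ?thesis by (auto simp: pos_def sg_def)
  qed (use assms in \<open>auto simp: adjacent_def pos_def sg_def\<close>)
  then show ?thesis
    using demD_braid_Suc[of n j i f] demD_braid_Suc[of n i j f] by metis
qed

text \<open>
  Generators at distant positions anticommute, and the two generators of the fork, which share a
  position, commute; so only a sign is claimed.
\<close>

lemma demD_commute:
  assumes "\<not> adjacent n i j" "1 \<le> i" "i \<le> n" "1 \<le> j" "j \<le> n" "i \<noteq> j"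
  shows "\<exists>c. (c = 1 \<or> c = -1) \<and> (\<forall>f. demD n i (demD n j f) = scal c * demD n j (demD n i f))"
proof -
  have far: "\<exists>c. (c = 1 \<or> c = -1) \<and> (\<forall>f. demD n i (demD n j f) = scal c * demD n j (demD n i f))"
    if "Suc (pos n i) < pos n j \<or> Suc (pos n j) < pos n i"
    using that by (intro exI[of _ "-1"]) (auto simp: demD_def dem_far_anticommute)
  have same: "\<exists>c. (c = 1 \<or> c = -1) \<and> (\<forall>f. demD n i (demD n j f) = scal c * demD n j (demD n i f))"
    if "pos n i = pos n j"
    using that by (intro exI[of _ 1]) (auto simp: demD_def dem_same_commute)
  have "Suc (pos n i) < pos n j \<or> Suc (pos n j) < pos n i \<or> pos n i = pos n j"
  proof (cases "i < n"; cases "j < n")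
    assume "i < n" "j < n" then show ?thesis using assms by (simp add: adjacent_def pos_def) linarith
  next
    assume "i < n" "\<not> j < n"
    then have "j = n" "i \<noteq> n - 2" using assms by (auto simp: adjacent_def)
    with \<open>i < n\<close> show ?thesis by (simp add: pos_def) linarith
  next
    assume "\<not> i < n" "j < n"
    then have "i = n" "j \<noteq> n - 2" using assms by (auto simp: adjacent_def)
    with \<open>j < n\<close> show ?thesis by (simp add: pos_def) linarith
  next
    assume "\<not> i < n" "\<not> j < n" then show ?thesis using assms by simp
  qed
  with far same show ?thesis by blast
qed

definition dems :: "nat \<Rightarrow> nat list \<Rightarrow> oddpoly \<Rightarrow> oddpoly" where
  "dems n is f = foldr (demD n) is f"

lemma dems_simps [simp]: "dems n [] f = f" "dems n (i # is) f = demD n i (dems n is f)"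
  "dems n (is @ js) f = dems n is (dems n js f)"
  by (simp_all add: dems_def)

lemma dems_add: "dems n is (f + g) = dems n is f + dems n is g"
  by (induction "is") (simp_all add: demD_linear)

lemma dems_scal_mult: "dems n is (scal c * f) = scal c * dems n is f"
  by (induction "is") (simp_all add: demD_linear)

lemma dems_0 [simp]: "dems n is 0 = 0"
  by (induction "is") (simp_all add: demD_linear)

lemma dems_homog: "f \<in> homog d \<Longrightarrow> length is \<le> d \<Longrightarrow> dems n is f \<in> homog (d - length is)"
proof (induction "is")
  case (Cons i "is")
  then have "dems n is f \<in> homog (Suc (d - length (i # is)))"
    by (simp add: Suc_diff_Suc)
  then show ?case by (simp add: demD_homog_Suc)
qed simp

lemma dems_homog_zero: "f \<in> homog d \<Longrightarrow> d < length is \<Longrightarrow> dems n is f = 0"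
proof (induction "is")
  case (Cons i "is")
  show ?case
  proof (cases "d < length is")
    case True then show ?thesis using Cons by (simp add: demD_linear)
  next
    case False
    then have "dems n is f \<in> homog 0" using dems_homog[OF Cons.prems(1), of "is"] Cons by auto
    then show ?thesis by (simp add: demD_homog_0)
  qed
qed simp

lemma dems_order_ge: "f \<in> order_ge (d + length is) \<Longrightarrow> dems n is f \<in> order_ge d"
  by (induction "is" arbitrary: d) (auto simp: demD_def intro!: dem_order_ge)

text \<open>
  Elements that all operators of the word see as scalars can be moved out, in particular
  elements in the kernel that are fixed by the reflections.
\<close>

lemma dems_linear_over:
  assumes "\<And>i f. i \<in> set is \<Longrightarrow> demD n i (z * f) = z * demD n i f"
  shows "dems n is (z * f) = z * dems n is f"
  using assms by (induction "is") auto

section \<open>The top monomial\<close>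

text \<open>
  The product \<open>\<Prod> (1 \<plusminus> x\<^sub>j)\<close> over \<open>j = k, \<dots>, k +
  p - 1\<close>, with alternating signs and the largest index on the left. It arises when the
  operators act on the factors of \<open>square_product\<close>.
\<close>

fun linear_product :: "nat \<Rightarrow> nat \<Rightarrow> oddpoly" where
  "linear_product k 0 = 1"
| "linear_product k (Suc p) = (1 + scal ((-1) ^ p) * var (k + p)) * linear_product k p"

text \<open>
  The central product \<open>\<Prod> (1 - x\<^sub>j\<^sup>2)\<close> over \<open>j = i, \<dots>,
  i + m - 1\<close>.
\<close>

fun square_product :: "nat \<Rightarrow> nat \<Rightarrow> oddpoly" where
  "square_product i 0 = 1"
| "square_product i (Suc m) = (1 - sqr i) * square_product (Suc i) m"

lemma dem_linear_product: "sgn_unit e \<Longrightarrow> k + p \<le> a \<Longrightarrow> dem a e (linear_product k p) = 0"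
  by (induction p) (auto simp: dem_mult dem_add dem_linear dem_scal dem_var var_derivative_def)

lemma dem_sqr:
  assumes e: "sgn_unit e"
  shows "dem a e (sqr j) = (if j = a then simple_root a e else if j = Suc a then - simple_root a e else 0)"
  using e by (auto simp: sgn_unit_def sqr_def dem_mult dem_var var_derivative_def refl_hom_var simple_root_def)

lemma refl_hom_sqr:
  assumes e: "sgn_unit e"
  shows "refl_hom a e (sqr j) = sqr (Transposition.transpose a (Suc a) j)"
  using e by (auto simp: sgn_unit_def sqr_def refl_hom_simps refl_hom_var transpose_def)

lemma dem_square_product: "sgn_unit e \<Longrightarrow> Suc a < i \<Longrightarrow> dem a e (square_product i m) = 0"
  by (induction m arbitrary: i) (auto simp: dem_mult dem_linear dem_sqr)

text \<open>
  \<open>square_product\<close> is symmetric in the squares of its variables. If both variables of an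
  operator occur in it, it is fixed by the reflection and killed by the operator, and so behaves
  like a scalar.
\<close>

lemma dem_refl_square_product_full:
  assumes e: "sgn_unit e"
  shows "i \<le> a \<Longrightarrow> Suc a < i + m \<Longrightarrow> dem a e (square_product i m) = 0 \<and> refl_hom a e (square_product i m) = square_product i m"
proof (induction m arbitrary: i)
  case (Suc m)
  show ?case
  proof (cases "i = a")
    case True
    then obtain m' where m: "m = Suc m'" using Suc by (cases m) auto
    have R: "refl_hom a e (square_product (Suc (Suc a)) p) = square_product (Suc (Suc a)) p" for p
    proof -
      have "Suc a < i \<Longrightarrow> refl_hom a e (square_product i p) = square_product i p" for i
        by (induction p arbitrary: i) (auto simp: refl_hom_simps refl_hom_sqr[OF e] transpose_def)
      then show ?thesis by simp
    qed
    have c: "(1 - sqr (Suc a)) * (1 - sqr a) = (1 - sqr a) * (1 - sqr (Suc a))"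
      by (simp add: algebra_simps sqr_central[of "sqr a"])
    have "dem a e ((1 - sqr a) * (1 - sqr (Suc a))) = 0"
      using sqr_central[of "simple_root a e" "Suc a"]
      by (simp only: dem_mult[OF e] dem_linear[OF e] dem_sqr[OF e] refl_hom_simps refl_hom_sqr[OF e])
        (simp add: algebra_simps)
    moreover have "refl_hom a e ((1 - sqr a) * (1 - sqr (Suc a))) = (1 - sqr a) * (1 - sqr (Suc a))"
      using c by (simp add: refl_hom_simps refl_hom_sqr[OF e])
    ultimately show ?thesis
      unfolding True m square_product.simps mult.assoc[symmetric]
      by (simp add: dem_mult[OF e, of _ "(1 - sqr a) * (1 - sqr (Suc a))"] dem_square_product[OF e] refl_hom_simps(2)[of a e "(1 - sqr a) * (1 - sqr (Suc a))"] R)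
  next
    case False
    then have "dem a e (1 - sqr i) = 0" "refl_hom a e (1 - sqr i) = 1 - sqr i"
      using Suc.prems by (simp_all add: dem_linear[OF e] dem_sqr[OF e] refl_hom_simps refl_hom_sqr[OF e] transpose_def)
    moreover have "dem a e (square_product (Suc i) m) = 0 \<and> refl_hom a e (square_product (Suc i) m) = square_product (Suc i) m"
      by (rule Suc.IH) (use Suc.prems False in auto)
    ultimately show ?thesis by (simp add: dem_mult[OF e] refl_hom_simps)
  qed
qed simp

text \<open>
  The step that makes the generating polynomial useful: the factor \<open>1 - x\<^sub>b\<^sup>2
  = (1 - s x\<^sub>b) (1 + s x\<^sub>b)\<close> with \<open>b = a + 1\<close> loses one of its
  two linear factors and the product keeps its shape.
\<close>

lemma dem_square_product_step:
  assumes s: "s = 1 \<or> s = -1"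
  shows "dem a 1 ((1 + scal s * var a) * (1 - sqr (Suc a))) =
    scal s * ((1 + scal (- s) * var (Suc a)) * (1 + scal s * var a))"
  using s by (auto simp: dem_mult dem_linear dem_scal dem_add dem_var var_derivative_def dem_sqr
      refl_hom_simps refl_hom_var simple_root_def sqr_def algebra_simps)

lemma demD_left_factor: "demD n i g = 0 \<Longrightarrow> demD n i (f * g) = demD n i f * g"
  by (simp add: demD_mult)

text \<open>
  The operators \<open>k, k + 1, \<dots>\<close>, applied one after the other, turn the factors
  \<open>1 - x\<^sub>j\<^sup>2\<close> into \<open>1 \<plusminus> x\<^sub>j\<close> from left to
  right.
\<close>

lemma dems_ascend:
  assumes n: "n = k + m"
  shows "p \<le> m \<Longrightarrow> \<exists>c. c \<noteq> 0 \<and> dems n (rev [k..<k + p]) ((1 + var k) * square_product (Suc k) m) =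
    scal c * (linear_product k (Suc p) * square_product (Suc (k + p)) (m - p))"
proof (induction p)
  case 0 show ?case by (rule exI[of _ 1]) simp
next
  case (Suc p)
  then obtain c where c: "c \<noteq> 0" "dems n (rev [k..<k + p]) ((1 + var k) * square_product (Suc k) m) =
    scal c * (linear_product k (Suc p) * square_product (Suc (k + p)) (m - p))" by auto
  let ?a = "k + p" and ?s = "(-1 :: rat) ^ p"
  have lt: "?a < n" using Suc n by simp
  have s: "?s = 1 \<or> ?s = -1" by (cases "even p") auto
  obtain r where r: "m - p = Suc r" using Suc by (metis Suc_diff_Suc Suc_le_lessD)
  let ?Z = "linear_product k p" and ?q = "square_product (Suc (Suc ?a)) r"
  have dq: "demD n ?a ?q = 0" "demD n ?a ?Z = 0" using lt
    by (simp_all add: demD_def pos_def dem_square_product dem_linear_product)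
  then have d: "demD n ?a (?Z * ?q) = 0" by (simp add: demD_mult)
  have cen: "?Z * (1 - sqr (Suc ?a)) = (1 - sqr (Suc ?a)) * ?Z"
    by (simp add: algebra_simps sqr_central)
  have "linear_product k (Suc p) * square_product (Suc (k + p)) (m - p) =
      (1 + scal ?s * var ?a) * (?Z * (1 - sqr (Suc ?a))) * ?q"
    unfolding r by (simp add: mult.assoc)
  also have "\<dots> = ((1 + scal ?s * var ?a) * (1 - sqr (Suc ?a))) * (?Z * ?q)"
    unfolding cen by (simp add: mult.assoc)
  finally have "demD n ?a (linear_product k (Suc p) * square_product (Suc (k + p)) (m - p)) =
      demD n ?a ((1 + scal ?s * var ?a) * (1 - sqr (Suc ?a))) * (?Z * ?q)"
    by (simp only: demD_left_factor[OF d])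
  also have "\<dots> = scal ?s * ((1 + scal (- ?s) * var (Suc ?a)) * (1 + scal ?s * var ?a)) * (?Z * ?q)"
    using lt dem_square_product_step[OF s, of ?a] by (simp add: demD_def pos_def sg_def)
  also have "\<dots> = scal ?s * (linear_product k (Suc (Suc p)) * square_product (Suc (k + Suc p)) (m - Suc p))"
  proof -
    have "m - Suc p = r" using r by arith
    moreover have "Suc (k + Suc p) = Suc (Suc ?a)" by simp
    ultimately show ?thesis by (simp only: linear_product.simps add_Suc_right power_Suc mult.assoc mult_minus_left mult_1_left)
  qed
  finally have "dems n (rev [k..<k + Suc p]) ((1 + var k) * square_product (Suc k) m) =
     scal (c * ?s) * (linear_product k (Suc (Suc p)) * square_product (Suc (k + Suc p)) (m - Suc p))"
    by (simp add: c(2) demD_linear mult.assoc del: linear_product.simps square_product.simps)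
  then show ?case using c(1) by (intro exI[of _ "c * ?s"]) simp
qed

text \<open>
  Going back down the diagram, every operator removes the leading linear factor.
\<close>

lemma dems_descend:
  "k + p \<le> n \<Longrightarrow> \<exists>c. c \<noteq> 0 \<and> dems n [k..<k + p] (linear_product k p) = scal c"
proof (induction p)
  case 0 show ?case by (rule exI[of _ 1]) simp
next
  case (Suc p)
  then obtain c where c: "c \<noteq> 0" "dems n [k..<k + p] (linear_product k p) = scal c" by auto
  let ?a = "k + p" and ?s = "(-1 :: rat) ^ p"
  have lt: "?a < n" using Suc by simp
  have "demD n ?a (linear_product k p) = 0" using lt by (simp add: demD_def pos_def dem_linear_product)
  then have "demD n ?a (linear_product k (Suc p)) = demD n ?a (1 + scal ?s * var ?a) * linear_product k p"
    by (simp add: demD_left_factor)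
  also have "demD n ?a (1 + scal ?s * var ?a) = scal ?s"
    using lt by (simp add: demD_linear) (simp add: demD_def dem_var var_derivative_def pos_def sg_def)
  finally have "dems n [k..<k + Suc p] (linear_product k (Suc p)) = scal (?s * c)"
    by (simp add: c(2) dems_scal_mult del: linear_product.simps)
  then show ?case using c(1) by (intro exI[of _ "?s * c"]) simp
qed

lemma scal_2: "scal 2 = 2"
  using scal_simps(4)[of 1 1] by simp

text \<open>
  At the fork the extra operator removes two linear factors at once; this happens exactly once.
\<close>

lemma dem_fork:
  assumes s: "s = 1 \<or> s = -1"
  shows "dem a (-1) ((1 + scal (- s) * var (Suc a)) * (1 + scal s * var a)) = scal (2 * s)"
  using s by (auto simp: dem_mult dem_linear dem_scal dem_add dem_var var_derivative_def
      refl_hom_simps refl_hom_var scal_2 algebra_simps)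

text \<open>
  The operators for \<open>x\<^sub>k\<close>, read from right to left: up the path from
  \<open>k\<close> to \<open>n - 1\<close>, then \<open>n\<close>, then down from \<open>n -
  2\<close> to \<open>k\<close>. This is a reduced word of the longest minimal coset
  representative for the parabolic subgroup that fixes \<open>1, \<dots>, k\<close>.
\<close>

definition coset_word :: "nat \<Rightarrow> nat \<Rightarrow> nat list" where
  "coset_word n k = [k..<n - 1] @ [n] @ rev [k..<n]"

lemma dems_coset_word_square_product:
  assumes n: "n = k + Suc m"
  shows "\<exists>c. c \<noteq> 0 \<and> dems n (coset_word n k) ((1 + var k) * square_product (Suc k) (Suc m)) = scal c"
proof -
  obtain c where c: "c \<noteq> 0" "dems n (rev [k..<n]) ((1 + var k) * square_product (Suc k) (Suc m)) =
      scal c * linear_product k (Suc (Suc m))"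
    using dems_ascend[OF n, of "Suc m"] unfolding n by auto
  obtain d where d: "d \<noteq> 0" "dems n [k..<n - 1] (linear_product k m) = scal d"
    using dems_descend[of k m n] n by auto
  let ?s = "(-1 :: rat) ^ m"
  have s: "?s = 1 \<or> ?s = -1" by (cases "even m") auto
  have "demD n n (linear_product k m) = 0" using n by (simp add: demD_def pos_def dem_linear_product)
  moreover have "linear_product k (Suc (Suc m)) =
      ((1 + scal (- ?s) * var (Suc (k + m))) * (1 + scal ?s * var (k + m))) * linear_product k m"
    by (simp add: mult.assoc)
  ultimately have "demD n n (linear_product k (Suc (Suc m))) = scal (2 * ?s) * linear_product k m"
    using dem_fork[OF s, of "k + m"] n
    by (simp only: demD_left_factor) (simp add: demD_def pos_def sg_def)
  then have "dems n (coset_word n k) ((1 + var k) * square_product (Suc k) (Suc m)) = scal (c * (2 * ?s * d))"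
    by (simp add: coset_word_def c(2) demD_linear dems_scal_mult d(2)[simplified] mult.assoc
      del: linear_product.simps square_product.simps)
  then show ?thesis using c(1) d(1) by (intro exI[of _ "c * (2 * ?s * d)"]) simp
qed

lemma coset_word_set: "1 \<le> k \<Longrightarrow> k < n \<Longrightarrow> i \<in> set (coset_word n k) \<longleftrightarrow> k \<le> i \<and> i \<le> n"
  by (auto simp: coset_word_def)

lemma length_coset_word: "k < n \<Longrightarrow> length (coset_word n k) = 2 * (n - k)"
  by (simp add: coset_word_def)

lemma homog_sqr_power: "sqr k ^ r \<in> homog (2 * r)"
proof -
  have "sqr k \<in> homog (1 + 1)" unfolding sqr_def by (intro homog_mult homog_var)
  from homog_power[OF this, of r] show ?thesis by (simp add: mult.commute numeral_2_eq_2)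
qed

lemma const_coeff_square_product: "const_coeff (square_product i m) = 1"
  by (induction m arbitrary: i) (simp_all add: sqr_def)

lemma square_product_central: "f * square_product i m = square_product i m * f"
proof (induction m arbitrary: i f)
  case (Suc m)
  have "f * square_product i (Suc m) = (f * (1 - sqr i)) * square_product (Suc i) m" by (simp add: mult.assoc)
  also have "f * (1 - sqr i) = (1 - sqr i) * f"
    by (simp add: left_diff_distrib right_diff_distrib sqr_central)
  finally show ?case by (simp add: mult.assoc Suc)
qed simp

text \<open>
  The identity \<open>1 = (1 - y) (1 + y + \<cdots> + y\<^sup>l) + y\<^bsup>l+1\<^esup>\<close>
  for \<open>y = x\<^sub>k\<^sup>2\<close>, multiplied by \<open>\<Prod> (1 -
  x\<^sub>j\<^sup>2)\<close> over \<open>j > k\<close>.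
\<close>

lemma square_product_geometric:
  "square_product (Suc k) m = square_product k (Suc m) * (\<Sum>r\<le>l. sqr k ^ r) + sqr k ^ Suc l * square_product (Suc k) m"
proof -
  have geo: "(1 - sqr k) * (\<Sum>r\<le>l. sqr k ^ r) = 1 - sqr k ^ Suc l"
  proof (induction l)
    case (Suc l)
    have "(1 - sqr k) * (\<Sum>r\<le>Suc l. sqr k ^ r) =
        (1 - sqr k) * (\<Sum>r\<le>l. sqr k ^ r) + (1 - sqr k) * sqr k ^ Suc l"
      by (simp add: distrib_left)
    then show ?case unfolding Suc by (simp add: left_diff_distrib)
  qed simp
  have "square_product k (Suc m) * (\<Sum>r\<le>l. sqr k ^ r) =
      (1 - sqr k) * (square_product (Suc k) m * (\<Sum>r\<le>l. sqr k ^ r))"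
    by (simp add: mult.assoc)
  also have "\<dots> = ((1 - sqr k) * (\<Sum>r\<le>l. sqr k ^ r)) * square_product (Suc k) m"
    unfolding mult.assoc by (rule arg_cong[OF square_product_central[symmetric], of "\<lambda>z. (1 - sqr k) * z"])
  finally have e: "square_product k (Suc m) * (\<Sum>r\<le>l. sqr k ^ r) = (1 - sqr k ^ Suc l) * square_product (Suc k) m"
    unfolding geo .
  show ?thesis unfolding e by (simp only: left_diff_distrib mult_1_left diff_add_cancel)
qed

lemma dems_sum: "dems n is (\<Sum>a\<in>A. g a) = (\<Sum>a\<in>A. dems n is (g a))"
  by (induction A rule: infinite_finite_induct) (simp_all add: dems_add)

text \<open>
  A direct computation with the power \<open>x\<^sub>k\<^bsup>2(n-k)\<^esup>\<close> is replaced
  by one with \<open>(1 + x\<^sub>k) \<Prod> (1 - x\<^sub>j\<^sup>2)\<close> over \<open>k < j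
  \<le> n\<close>, whose image is a nonzero constant \<open>c\<close>. With the symmetric
  element \<open>P = \<Prod> (1 - x\<^sub>j\<^sup>2)\<close> over \<open>k \<le> j \<le>
  n\<close>, it equals \<open>P (1 + x\<^sub>k) (1 + y + y\<^sup>2 + \<cdots>)\<close> up to
  high order, where \<open>y = x\<^sub>k\<^sup>2\<close>. The operators commute with
  \<open>P\<close>, and a comparison of constant terms leaves only the summand
  \<open>y\<^bsup>n-k\<^esup>\<close>, whose degree is the length of the word.
\<close>

lemma dems_coset_word_power:
  assumes k: "1 \<le> k" "k < n"
  shows "\<exists>c. c \<noteq> 0 \<and> dems n (coset_word n k) (sqr k ^ (n - k)) = scal c"
proof -
  obtain m where n: "n = k + Suc m" using k less_iff_Suc_add by auto
  let ?w = "coset_word n k" and ?P = "square_product k (Suc (Suc m))" and ?q = "square_product (Suc k) (Suc m)"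
  let ?y = "sqr k"
  obtain c where c: "c \<noteq> 0" "dems n ?w ((1 + var k) * ?q) = scal c"
    using dems_coset_word_square_product[OF n] by blast
  have len: "length ?w = 2 * Suc m" using length_coset_word[OF k(2)] n by simp
  have P: "dems n ?w (?P * f) = ?P * dems n ?w f" for f
  proof (rule dems_linear_over)
    fix i f assume "i \<in> set ?w"
    then have i: "k \<le> pos n i" "Suc (pos n i) < k + Suc (Suc m)"
      using k n by (auto simp: coset_word_set pos_def)
    from dem_refl_square_product_full[OF sgn_unit_sg i]
    show "demD n i (?P * f) = ?P * demD n i f"
      by (simp add: demD_mult del: square_product.simps) (simp add: demD_def reflD_def del: square_product.simps)
  qed
  \<comment> \<open>the summands of degree less than the length of the word\<close>
  define low where "low = (\<Sum>r\<le>m. ?y ^ r * (1 + var k))"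
  have y_comm: "(1 + var k) * ?y ^ r = ?y ^ r * (1 + var k)" for r
    by (rule power_commuting_commutes[symmetric]) (rule sqr_central[symmetric])
  have split: "(1 + var k) * ?q = ?P * low + ?P * ?y ^ Suc m + ?P * (?y ^ Suc m * var k)
      + ?y ^ Suc (Suc m) * ((1 + var k) * ?q)"
  proof -
    have "(1 + var k) * ?q = (1 + var k) * (?P * (\<Sum>r\<le>Suc m. ?y ^ r) + ?y ^ Suc (Suc m) * ?q)"
      by (simp only: square_product_geometric[of k "Suc m" "Suc m", symmetric])
    also have "\<dots> = ((1 + var k) * ?P) * (\<Sum>r\<le>Suc m. ?y ^ r) + ((1 + var k) * ?y ^ Suc (Suc m)) * ?q"
      by (simp only: distrib_left mult.assoc)
    also have "\<dots> = ?P * ((1 + var k) * (\<Sum>r\<le>Suc m. ?y ^ r)) + ?y ^ Suc (Suc m) * ((1 + var k) * ?q)"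
      unfolding square_product_central[of "1 + var k" k "Suc (Suc m)"] y_comm by (simp only: mult.assoc)
    also have "(1 + var k) * (\<Sum>r\<le>Suc m. ?y ^ r) = low + ?y ^ Suc m * (1 + var k)"
      unfolding low_def sum_distrib_left y_comm by simp
    finally show ?thesis by (simp only: distrib_left mult_1_right add.assoc)
  qed
  have "dems n ?w (?y ^ r * (1 + var k)) = 0" if "r \<le> m" for r
  proof -
    have h: "?y ^ r * var k \<in> homog (2 * r + 1)"
      by (intro homog_mult homog_sqr_power homog_var)
    show ?thesis using that len dems_homog_zero[OF homog_sqr_power[of k r], of ?w n]
      dems_homog_zero[OF h, of ?w n] by (simp add: distrib_left dems_add)
  qed
  then have low0: "dems n ?w low = 0" by (simp add: low_def dems_sum)
  \<comment> \<open>terms of degree above the length of the word have no constant term after its application\<close>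
  have hi: "const_coeff (dems n ?w f) = 0" if "f \<in> order_ge (Suc d + length ?w)" for f d
    using dems_order_ge[OF that] const_coeff_order_ge by blast
  have "?y ^ Suc m * var k \<in> homog (2 * Suc m + 1)"
    by (intro homog_mult homog_sqr_power homog_var)
  then have h1: "const_coeff (dems n ?w (?y ^ Suc m * var k)) = 0"
    using hi[of _ 0] len homog_order_ge by fastforce
  have "?y ^ Suc (Suc m) * ((1 + var k) * ?q) \<in> order_ge (2 * Suc (Suc m))"
    by (intro order_ge_mult homog_order_ge homog_sqr_power)
  then have h2: "const_coeff (dems n ?w (?y ^ Suc (Suc m) * ((1 + var k) * ?q))) = 0"
    using hi[of _ 1] len by simp
  have "dems n ?w (?y ^ Suc m) \<in> homog (2 * Suc m - length ?w)"
    by (intro dems_homog homog_sqr_power) (simp add: len)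
  then obtain d where d: "dems n ?w (?y ^ Suc m) = scal d"
    using homog_0_scal len by auto
  have "c = const_coeff (dems n ?w ((1 + var k) * ?q))" by (simp add: c(2) del: square_product.simps)
  also have "\<dots> = const_coeff (dems n ?w (?P * low + ?P * ?y ^ Suc m + ?P * (?y ^ Suc m * var k)
      + ?y ^ Suc (Suc m) * ((1 + var k) * ?q)))"
    by (rule arg_cong[OF split, of "\<lambda>z. const_coeff (dems n ?w z)"])
  also have "\<dots> = d"
    unfolding dems_add P low0 const_coeff_simps const_coeff_mult h1 h2 d const_coeff_square_product by simp
  finally show ?thesis using c(1) d n by auto
qed

text \<open>
  The tail of the top monomial in the variables \<open>x\<^sub>k, \<dots>,
  x\<^bsub>n-1\<^esub>\<close>, for an induction that strips off one variable at a time.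
\<close>

definition top_poly :: "nat \<Rightarrow> nat \<Rightarrow> oddpoly" where
  "top_poly n k = foldr (\<lambda>i f. var i ^ (2 * n - 2 * i) * f) [k..<n] 1"

text \<open>
  A factorisation of the longest element along the chain of parabolic subgroups that fix
  \<open>1, \<dots>, k - 1\<close>.
\<close>

definition long_word :: "nat \<Rightarrow> nat \<Rightarrow> nat list" where
  "long_word n k = concat (map (coset_word n) [k..<n])"

text \<open>
  The operators for \<open>x\<^sub>j\<close> with \<open>j > k\<close> treat the even power of
  \<open>x\<^sub>k\<close> as a scalar; they reduce the rest of the monomial to a constant, and
  the remaining operators do the same with the power of \<open>x\<^sub>k\<close>.
\<close>

lemma dems_long_word:
  assumes "1 \<le> k" "k \<le> n"
  shows "\<exists>c. c \<noteq> 0 \<and> dems n (long_word n k) (top_poly n k) = scal c"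
  using assms(2,1)
proof (induction k rule: inc_induct)
  case base show ?case by (rule exI[of _ 1]) (simp add: long_word_def top_poly_def)
next
  case (step k)
  then obtain c where c: "c \<noteq> 0" "dems n (long_word n (Suc k)) (top_poly n (Suc k)) = scal c"
    using step.IH by (metis One_nat_def Suc_le_mono zero_le)
  obtain d where d: "d \<noteq> 0" "dems n (coset_word n k) (sqr k ^ (n - k)) = scal d"
    using dems_coset_word_power[OF step.prems step.hyps(2)] by blast
  have lw: "long_word n k = coset_word n k @ long_word n (Suc k)"
    using upt_conv_Cons[OF step.hyps(2)] by (simp add: long_word_def)
  have "2 * n - 2 * k = 2 * (n - k)" by arith
  then have "var k ^ (2 * n - 2 * k) = sqr k ^ (n - k)"
    by (simp only: power_mult power2_eq_square sqr_def)
  then have tp: "top_poly n k = sqr k ^ (n - k) * top_poly n (Suc k)"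
    using upt_conv_Cons[OF step.hyps(2)] by (simp add: top_poly_def)
  have "dems n (long_word n (Suc k)) (sqr k ^ (n - k) * top_poly n (Suc k)) =
      sqr k ^ (n - k) * dems n (long_word n (Suc k)) (top_poly n (Suc k))"
  proof (rule dems_linear_over)
    fix i f assume "i \<in> set (long_word n (Suc k))"
    then obtain j where j: "Suc k \<le> j" "j < n" "i \<in> set (coset_word n j)" unfolding long_word_def by auto
    then have i: "k < i" "i \<le> n" "Suc k < n" using coset_word_set[of j n i] by auto
    then have p: "k < pos n i" by (auto simp: pos_def)
    then have "demD n i (sqr k) = 0" "reflD n i (sqr k) = sqr k"
      by (auto simp: demD_def reflD_def dem_sqr refl_hom_sqr transpose_def)
    then have s: "demD n i (sqr k * g) = sqr k * demD n i g" for g by (simp add: demD_mult)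
    have "demD n i (sqr k ^ r * f) = sqr k ^ r * demD n i f" for r
      by (induction r) (simp_all add: s mult.assoc)
    then show "demD n i (sqr k ^ (n - k) * f) = sqr k ^ (n - k) * demD n i f" .
  qed
  then have "dems n (long_word n k) (top_poly n k) =
      dems n (coset_word n k) (sqr k ^ (n - k) * scal c)"
    unfolding lw tp dems_simps by (simp only: c(2))
  also have "\<dots> = scal c * dems n (coset_word n k) (sqr k ^ (n - k))"
    unfolding scal_central[of "sqr k ^ (n - k)"] by (rule dems_scal_mult)
  also have "\<dots> = scal (c * d)" unfolding d(2) by simp
  finally have "dems n (long_word n k) (top_poly n k) = scal (c * d)" .
  then show ?case using c(1) d(1) by (intro exI[of _ "c * d"]) simp
qed

lemma length_long_word: "length (long_word n 1) = n * (n - 1)"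
proof -
  have len: "length (long_word n (n - d)) = d * (d + 1)" if "d \<le> n" for d
    using that
  proof (induction d)
    case (Suc d)
    then have "n - Suc d < n" "Suc (n - Suc d) = n - d" by auto
    then have "long_word n (n - Suc d) = coset_word n (n - Suc d) @ long_word n (n - d)"
      by (simp add: long_word_def upt_conv_Cons)
    moreover have "length (coset_word n (n - Suc d)) = 2 * Suc d"
      using length_coset_word[OF \<open>n - Suc d < n\<close>] Suc.prems by simp
    ultimately show ?case using Suc by simp
  qed (simp add: long_word_def)
  show ?thesis
  proof (cases n)
    case 0 then show ?thesis by (simp add: long_word_def)
  next
    case (Suc m) then show ?thesis using len[of m] by simp
  qed
qed

section \<open>Signed permutations\<close>

text \<open>
  The two coordinate vectors that the simple reflection \<open>i\<close> exchanges up to sign: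
  the simple root is the sum of the signed coordinate vectors \<open>rootp n i\<close> and
  \<open>rootq n i\<close>, with \<open>-k\<close> in the place of \<open>-e\<^sub>k\<close>.
\<close>

definition rootp :: "nat \<Rightarrow> nat \<Rightarrow> int" where
  "rootp n i = (if i < n then int i else int n - 1)"
definition rootq :: "nat \<Rightarrow> nat \<Rightarrow> int" where
  "rootq n i = (if i < n then - int i - 1 else int n)"

definition labels :: "nat \<Rightarrow> int set" where "labels n = {k. k \<noteq> 0 \<and> \<bar>k\<bar> \<le> int n}"

text \<open>
  The pairing of a signed coordinate vector with the vector \<open>(n - 1, \<dots>, 1,
  0)\<close>, half the sum of the positive coroots. A root is a sum of two such vectors; its
  height is the sum of the two values, and its sign decides whether the root is positive.
\<close>

definition ht :: "nat \<Rightarrow> int \<Rightarrow> int" where "ht n k = sgn k * (int n - \<bar>k\<bar>)"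

lemma ht_uminus [simp]: "ht n (- k) = - ht n k" by (simp add: ht_def sgn_minus)

lemma labels_uminus [simp]: "- k \<in> labels n \<longleftrightarrow> k \<in> labels n" by (simp add: labels_def)

lemma finite_labels [simp]: "finite (labels n)"
  by (rule finite_subset[of _ "{- int n..int n}"]) (auto simp: labels_def)

lemma simple_refl_eq:
  assumes "1 \<le> i" "i \<le> n" "2 \<le> n"
  shows "simple_refl n i k = (if k = rootp n i then - rootq n i else if k = rootq n i then - rootp n i
    else if k = - rootp n i then rootq n i else if k = - rootq n i then rootp n i else k)"
  using assms by (auto simp: simple_refl_def transpose_def rootp_def rootq_def)

lemma root_facts:
  assumes "1 \<le> i" "i \<le> n" "2 \<le> n"
  shows "rootp n i \<in> labels n" "rootq n i \<in> labels n" "rootp n i \<noteq> rootq n i"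
    "rootp n i \<noteq> - rootq n i" "rootp n i \<noteq> 0" "rootq n i \<noteq> 0" "- rootq n i \<noteq> rootp n i"
    "ht n (rootp n i) + ht n (rootq n i) = 1"
  using assms by (auto simp: rootp_def rootq_def labels_def ht_def sgn_if)

lemma simple_refl_root [simp]:
  assumes "1 \<le> i" "i \<le> n" "2 \<le> n"
  shows "simple_refl n i (rootp n i) = - rootq n i" "simple_refl n i (rootq n i) = - rootp n i"
  using root_facts[OF assms] by (auto simp: simple_refl_eq[OF assms])

lemma simple_refl_uminus:
  assumes "1 \<le> i" "i \<le> n" "2 \<le> n"
  shows "simple_refl n i (- k) = - simple_refl n i k"
  using root_facts[OF assms] by (auto simp: simple_refl_eq[OF assms] minus_equation_iff)

lemma simple_refl_involution:
  assumes "1 \<le> i" "i \<le> n" "2 \<le> n"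
  shows "simple_refl n i (simple_refl n i k) = k"
  using root_facts[OF assms] by (auto simp: simple_refl_eq[OF assms] minus_equation_iff)

lemma simple_refl_labels:
  assumes "1 \<le> i" "i \<le> n" "2 \<le> n"
  shows "simple_refl n i k \<in> labels n \<longleftrightarrow> k \<in> labels n" "k \<notin> labels n \<Longrightarrow> simple_refl n i k = k"
  using root_facts[OF assms] by (auto simp: simple_refl_eq[OF assms])

lemma ht_simple_refl:
  assumes "1 \<le> i" "i \<le> n" "2 \<le> n"
  shows "ht n (simple_refl n i k) = ht n k - (if k \<in> {rootp n i, rootq n i} then 1
    else if - k \<in> {rootp n i, rootq n i} then - 1 else 0)"
proof -
  consider "k \<in> {rootp n i, rootq n i}" | "k = - rootp n i" | "k = - rootq n i"
    | "k \<notin> {rootp n i, rootq n i}" "- k \<notin> {rootp n i, rootq n i}" by force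
  then show ?thesis
    by cases (use root_facts[OF assms] in \<open>auto simp: simple_refl_eq[OF assms]\<close>)
qed

text \<open>
  Every root has nonzero height, so it is positive or negative.
\<close>

lemma ht_sum_nonzero:
  assumes "a \<in> labels n" "b \<in> labels n" "a \<noteq> b" "a \<noteq> - b"
  shows "ht n a + ht n b \<noteq> 0"
  using assms by (auto simp: labels_def ht_def sgn_if split: if_splits)

text \<open>
  A simple reflection changes the sign of exactly one positive root, namely its own. This is the
  usual fact behind the behaviour of the length, here in terms of pairs of signed coordinates.
\<close>

lemma simple_refl_pair_sign:
  assumes i: "1 \<le> i" "i \<le> n" "2 \<le> n"
    and xy: "x \<in> labels n" "y \<in> labels n" "x \<noteq> y" "x \<noteq> - y"
  defines "P \<equiv> {rootp n i, rootq n i}"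
  shows "ht n (simple_refl n i x) + ht n (simple_refl n i y) < 0 \<longleftrightarrow>
    (ht n x + ht n y < 0 \<and> \<not> (- x \<in> P \<and> - y \<in> P)) \<or> (x \<in> P \<and> y \<in> P)"
proof -
  have nz: "ht n x + ht n y \<noteq> 0" by (rule ht_sum_nonzero) (use xy in auto)
  have "simple_refl n i x \<noteq> simple_refl n i y" "simple_refl n i x \<noteq> - simple_refl n i y"
    using xy(3,4) by (metis simple_refl_involution[OF i] simple_refl_uminus[OF i])+
  then have nz': "ht n (simple_refl n i x) + ht n (simple_refl n i y) \<noteq> 0"
    by (intro ht_sum_nonzero) (use xy simple_refl_labels[OF i] in auto)
  \<comment> \<open>the simple root has height 1, and the reflection changes heights of coordinates by at most 1\<close>
  have PP1: "ht n x + ht n y = 1" if "x \<in> P" "y \<in> P" "x \<noteq> y" for x y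
    using root_facts(8)[OF i] that unfolding P_def by auto
  have PP: "x \<in> P \<Longrightarrow> y \<in> P \<Longrightarrow> ht n x + ht n y = 1" "- x \<in> P \<Longrightarrow> - y \<in> P \<Longrightarrow> ht n x + ht n y = - 1"
    using PP1[of x y] PP1[of "- x" "- y"] xy(3) by auto
  have dis: "x \<in> P \<Longrightarrow> - x \<notin> P" for x using root_facts[OF i] unfolding P_def by auto
  from nz nz' PP show ?thesis
    unfolding ht_simple_refl[OF i] P_def[symmetric]
    by (cases "x \<in> P"; cases "y \<in> P"; cases "- x \<in> P"; cases "- y \<in> P"; simp add: dis; fastforce dest: dis)
qed

abbreviation finv :: "(int \<Rightarrow> int) \<Rightarrow> int \<Rightarrow> int" where "finv w \<equiv> inv_into UNIV w"

text \<open>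
  Signed permutations of the labels \<open>\<plusminus>1, \<dots>, \<plusminus>n\<close>,
  without the parity condition of type D.
\<close>

definition signed_perm :: "nat \<Rightarrow> (int \<Rightarrow> int) \<Rightarrow> bool" where
  "signed_perm n w \<longleftrightarrow> bij w \<and> (\<forall>k. w (- k) = - w k) \<and> (\<forall>k. k \<notin> labels n \<longrightarrow> w k = k)"

lemma signed_perm_labels: "signed_perm n w \<Longrightarrow> w k \<in> labels n \<longleftrightarrow> k \<in> labels n"
  unfolding signed_perm_def by (metis bij_pointE)

lemma signed_perm_id: "signed_perm n id" by (simp add: signed_perm_def)

lemma signed_perm_comp: "signed_perm n v \<Longrightarrow> signed_perm n w \<Longrightarrow> signed_perm n (v \<circ> w)"
  unfolding signed_perm_def by (auto intro: bij_comp)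

lemma signed_perm_inv:
  assumes "signed_perm n w" shows "signed_perm n (finv w)"
proof -
  have b: "bij w" using assms by (simp add: signed_perm_def)
  show ?thesis unfolding signed_perm_def
  proof (intro conjI allI impI)
    show "bij (finv w)" using b by (rule bij_imp_bij_inv)
    show "finv w (- k) = - finv w k" for k
      using assms b unfolding signed_perm_def by (metis bij_inv_eq_iff)
    show "finv w k = k" if "k \<notin> labels n" for k
      using assms b that unfolding signed_perm_def by (metis bij_inv_eq_iff)
  qed
qed

lemma signed_perm_simple_refl:
  assumes i: "1 \<le> i" "i \<le> n" "2 \<le> n"
  shows "signed_perm n (simple_refl n i)"
  unfolding signed_perm_def
proof (intro conjI allI impI)
  show "bij (simple_refl n i)"
    by (rule involuntory_imp_bij) (rule simple_refl_involution[OF i])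
qed (use simple_refl_uminus[OF i] simple_refl_labels[OF i] in auto)

text \<open>
  Positive roots that \<open>w\<close> makes negative; the unordered pair of the two signed
  coordinates is represented by its increasing ordering.
\<close>

definition inversions :: "nat \<Rightarrow> (int \<Rightarrow> int) \<Rightarrow> (int \<times> int) set" where
  "inversions n w = {(a, b). a \<in> labels n \<and> b \<in> labels n \<and> a < b \<and> a \<noteq> - b \<and>
     ht n a + ht n b > 0 \<and> ht n (w a) + ht n (w b) < 0}"

definition len :: "nat \<Rightarrow> (int \<Rightarrow> int) \<Rightarrow> nat" where "len n w = card (inversions n w)"

lemma finite_inversions [simp]: "finite (inversions n w)"
  by (rule finite_subset[of _ "labels n \<times> labels n"]) (auto simp: inversions_def)

text \<open>
  The height of the root that \<open>w\<close> maps to the simple root \<open>i\<close>. Its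
  sign tells whether \<open>i\<close> is a left ascent or a left descent of \<open>w\<close>.
\<close>

definition root_height :: "nat \<Rightarrow> (int \<Rightarrow> int) \<Rightarrow> nat \<Rightarrow> int" where
  "root_height n w i = ht n (finv w (rootp n i)) + ht n (finv w (rootq n i))"

lemma root_height_nonzero:
  assumes w: "signed_perm n w" and i: "1 \<le> i" "i \<le> n" "2 \<le> n"
  shows "root_height n w i \<noteq> 0"
proof -
  have v: "signed_perm n (finv w)" by (rule signed_perm_inv[OF w])
  have "bij (finv w)" "\<And>k. finv w (- k) = - finv w k" using v by (auto simp: signed_perm_def)
  then have "finv w (rootp n i) \<noteq> finv w (rootq n i)" "finv w (rootp n i) \<noteq> - finv w (rootq n i)"
    using root_facts[OF i] by (metis bij_is_inj inj_def)+
  then show ?thesis unfolding root_height_def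
    by (intro ht_sum_nonzero) (use root_facts[OF i] signed_perm_labels[OF v] in auto)
qed

text \<open>
  Composition with the reflection adds the one positive root that \<open>w\<close> maps to the
  simple root to the inversions, and changes nothing else.
\<close>

lemma len_simple_refl_up:
  assumes w: "signed_perm n w" and i: "1 \<le> i" "i \<le> n" "2 \<le> n" and up: "root_height n w i > 0"
  shows "len n (simple_refl n i \<circ> w) = Suc (len n w)"
proof -
  define a b where ab: "a = finv w (rootp n i)" "b = finv w (rootq n i)"
  have b: "bij w" and odd: "\<And>k. w (- k) = - w k" using w by (auto simp: signed_perm_def)
  have wab: "w a = rootp n i" "w b = rootq n i" unfolding ab using b by (simp_all add: bij_inv_eq_iff[symmetric] surj_f_inv_f bij_is_surj)
  have lab: "a \<in> labels n" "b \<in> labels n"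
    using root_facts[OF i] signed_perm_labels[OF w] wab by metis+
  have ne: "a \<noteq> b" "a \<noteq> - b" using root_facts[OF i] wab odd by auto
  have pos: "ht n a + ht n b > 0" using up by (simp add: root_height_def ab)
  have inj: "w x = w y \<longleftrightarrow> x = y" for x y using b by (meson bij_is_inj inj_eq)
  have mem: "w x \<in> {rootp n i, rootq n i} \<longleftrightarrow> x = a \<or> x = b" for x
    using inj wab by (metis insertE insertI1 insertI2 singletonD)
  have mem': "- w x \<in> {rootp n i, rootq n i} \<longleftrightarrow> x = - a \<or> x = - b" for x
    using mem[of "- x"] odd by (auto simp: minus_equation_iff)
  have "inversions n (simple_refl n i \<circ> w) = insert (min a b, max a b) (inversions n w)"
  proof -
    have "(x, y) \<in> inversions n (simple_refl n i \<circ> w) \<longleftrightarrow>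
        (x, y) \<in> insert (min a b, max a b) (inversions n w)" for x y
    proof (cases "x \<in> labels n \<and> y \<in> labels n \<and> x < y \<and> x \<noteq> - y \<and> ht n x + ht n y > 0")
      case True
      then have wxy: "w x \<in> labels n" "w y \<in> labels n" "w x \<noteq> w y" "w x \<noteq> - w y"
        using signed_perm_labels[OF w] inj by (auto simp flip: odd)
      have "\<not> (- w x \<in> {rootp n i, rootq n i} \<and> - w y \<in> {rootp n i, rootq n i})"
        unfolding mem' using True pos by (auto simp: algebra_simps)
      then have "(x, y) \<in> inversions n (simple_refl n i \<circ> w) \<longleftrightarrow>
          ht n (w x) + ht n (w y) < 0 \<or> ((x = a \<or> x = b) \<and> (y = a \<or> y = b))"
        using True simple_refl_pair_sign[OF i wxy] unfolding mem by (simp add: inversions_def)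
      moreover have "((x = a \<or> x = b) \<and> (y = a \<or> y = b)) \<longleftrightarrow> (x, y) = (min a b, max a b)"
        using True by (auto simp: min_def max_def)
      ultimately show ?thesis using True by (auto simp: inversions_def)
    next
      case False
      then show ?thesis using lab ne pos by (auto simp: inversions_def min_def max_def add.commute)
    qed
    then show ?thesis by auto
  qed
  moreover have "(min a b, max a b) \<notin> inversions n w"
    using root_facts(8)[OF i] by (auto simp: inversions_def min_def max_def wab add.commute)
  ultimately show ?thesis by (simp add: len_def)
qed

lemma inv_simple_refl_comp:
  assumes w: "signed_perm n w" and i: "1 \<le> i" "i \<le> n" "2 \<le> n"
  shows "finv (simple_refl n i \<circ> w) = finv w \<circ> simple_refl n i"
proof -
  have "finv (simple_refl n i) = simple_refl n i"
    by (rule inv_equality) (auto simp: simple_refl_involution[OF i])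
  then show ?thesis
    using o_inv_distrib[of "simple_refl n i" w] w signed_perm_simple_refl[OF i]
    by (simp add: signed_perm_def)
qed

lemma root_height_simple_refl:
  assumes w: "signed_perm n w" and i: "1 \<le> i" "i \<le> n" "2 \<le> n"
  shows "root_height n (simple_refl n i \<circ> w) i = - root_height n w i"
  using signed_perm_inv[OF w] i
  by (simp add: root_height_def inv_simple_refl_comp[OF w i] signed_perm_def)

lemma simple_refl_cancel:
  assumes i: "1 \<le> i" "i \<le> n" "2 \<le> n"
  shows "simple_refl n i \<circ> (simple_refl n i \<circ> w) = w"
  by (rule ext) (simp add: simple_refl_involution[OF i])

lemma len_simple_refl_down:
  assumes w: "signed_perm n w" and i: "1 \<le> i" "i \<le> n" "2 \<le> n" and down: "root_height n w i < 0"
  shows "len n w = Suc (len n (simple_refl n i \<circ> w))"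
  using len_simple_refl_up[OF signed_perm_comp[OF signed_perm_simple_refl[OF i] w] i] down
  by (simp add: root_height_simple_refl[OF w i] simple_refl_cancel[OF i])

lemma len_id [simp]: "len n id = 0"
proof -
  have "inversions n id = {}" by (auto simp: inversions_def)
  then show ?thesis by (simp add: len_def)
qed

section \<open>The Weyl group of type D\<close>

lemma word_prod_simps [simp]: "word_prod n [] = id"
  "word_prod n (i # is) = simple_refl n i \<circ> word_prod n is"
  by (simp_all add: word_prod_def)

lemma word_prod_append: "word_prod n (is @ js) = word_prod n is \<circ> word_prod n js"
  by (induction "is") (simp_all add: comp_assoc)

context
  fixes n :: nat
  assumes n2: "2 \<le> n"
begin

lemma signed_perm_word: "is \<in> lists {1..n} \<Longrightarrow> signed_perm n (word_prod n is)"
  by (induction "is")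
    (auto simp: signed_perm_id simp del: comp_apply intro!: signed_perm_comp signed_perm_simple_refl n2)

lemma word_prod_rev:
  assumes "is \<in> lists {1..n}"
  shows "word_prod n (rev is) \<circ> word_prod n is = id"
  using assms
proof (induction "is")
  case (Cons i "is")
  have "word_prod n (rev (i # is)) \<circ> word_prod n (i # is) =
    word_prod n (rev is) \<circ> (simple_refl n i \<circ> (simple_refl n i \<circ> word_prod n is))"
    by (simp add: word_prod_append comp_assoc)
  also have "simple_refl n i \<circ> (simple_refl n i \<circ> word_prod n is) = word_prod n is"
    by (rule simple_refl_cancel) (use Cons.hyps n2 in auto)
  also have "word_prod n (rev is) \<circ> word_prod n is = id"
    by (rule Cons.IH)
  finally show ?case .
qed simp

text \<open>
  The generators are involutions, so words suffice and inverses of generators add nothing.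
\<close>

lemma weyl_D_eq: "weyl_D n = word_prod n ` lists {1..n}"
proof -
  let ?G = "BijGroup (UNIV :: int set)"
  have grp: "group ?G" by (rule group_BijGroup)
  have bij: "bij (word_prod n is)" if "is \<in> lists {1..n}" for "is"
    using signed_perm_word[OF that] by (simp add: signed_perm_def)
  have mult: "f \<otimes>\<^bsub>?G\<^esub> g = f \<circ> g" if "bij f" "bij g" for f g
    using that by (simp add: BijGroup_def Bij_def compose_def fun_eq_iff)
  have G_one: "\<one>\<^bsub>?G\<^esub> = id" by (simp add: BijGroup_def fun_eq_iff)
  have car: "f \<in> carrier ?G \<longleftrightarrow> bij f" for f by (simp add: BijGroup_def Bij_def)
  have s_word: "simple_refl n i = word_prod n [i]" for i by simp
  have s_bij: "bij (simple_refl n i)" if "i \<in> {1..n}" for i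
    using signed_perm_simple_refl[of i n] that n2 by (simp add: signed_perm_def)
  have s_inv: "m_inv ?G (simple_refl n i) = simple_refl n i" if "i \<in> {1..n}" for i
  proof (rule group.inv_equality[OF grp])
    show "simple_refl n i \<otimes>\<^bsub>?G\<^esub> simple_refl n i = \<one>\<^bsub>?G\<^esub>"
      unfolding mult[OF s_bij[OF that] s_bij[OF that]] G_one
      using simple_refl_cancel[of i n id] that n2 by simp
  qed (use s_bij[OF that] car in auto)
  have "w \<in> word_prod n ` lists {1..n}" if "w \<in> generate ?G (simple_refl n ` {1..n})" for w
    using that
  proof induction
    case one
    show ?case unfolding G_one by (rule image_eqI[of _ _ "[]"]) auto
  next
    case (incl h)
    then obtain i where "i \<in> {1..n}" "h = word_prod n [i]" by auto
    then show ?case by (intro image_eqI[of _ _ "[i]"]) auto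
  next
    case (inv h)
    then obtain i where "i \<in> {1..n}" "h = simple_refl n i" by auto
    then show ?case using s_inv by (intro image_eqI[of _ _ "[i]"]) auto
  next
    case (eng h1 h2)
    then obtain is1 is2 where "is1 \<in> lists {1..n}" "is2 \<in> lists {1..n}"
      "h1 = word_prod n is1" "h2 = word_prod n is2" by blast
    then show ?case
      by (intro image_eqI[of _ _ "is1 @ is2"]) (auto simp: mult bij word_prod_append)
  qed
  moreover have "word_prod n is \<in> generate ?G (simple_refl n ` {1..n})" if "is \<in> lists {1..n}" for "is"
    using that
  proof (induction "is")
    case Nil
    show ?case unfolding word_prod_simps G_one[symmetric] by (rule generate.one)
  next
    case (Cons i "is")
    then have "simple_refl n i \<otimes>\<^bsub>?G\<^esub> word_prod n is \<in> generate ?G (simple_refl n ` {1..n})"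
      using Cons.hyps(1) Cons.IH by (intro generate.eng[OF generate.incl]) (rule imageI)
    moreover have "simple_refl n i \<otimes>\<^bsub>?G\<^esub> word_prod n is = word_prod n (i # is)"
      unfolding word_prod_simps by (rule mult) (use Cons.hyps s_bij bij in auto)
    ultimately show ?case by (simp only:)
  qed
  ultimately show ?thesis unfolding weyl_D_def by blast
qed

lemma weyl_signed_perm: "w \<in> weyl_D n \<Longrightarrow> signed_perm n w"
  unfolding weyl_D_eq using signed_perm_word by blast

lemma weyl_id: "id \<in> weyl_D n"
  unfolding weyl_D_eq by (rule image_eqI[of _ _ "[]"]) auto

lemma weyl_comp: "v \<in> weyl_D n \<Longrightarrow> w \<in> weyl_D n \<Longrightarrow> v \<circ> w \<in> weyl_D n"
  unfolding weyl_D_eq by (auto intro!: image_eqI[of _ _ "_ @ _"] simp: word_prod_append)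

lemma weyl_simple_refl: "i \<in> {1..n} \<Longrightarrow> simple_refl n i \<in> weyl_D n"
  unfolding weyl_D_eq by (rule image_eqI[of _ _ "[i]"]) auto

lemma finv_word: "is \<in> lists {1..n} \<Longrightarrow> finv (word_prod n is) = word_prod n (rev is)"
  using word_prod_rev[of "rev is"] word_prod_rev[of "is"]
  by (intro inv_equality) (auto simp: fun_eq_iff in_lists_conv_set)

lemma weyl_finv: "w \<in> weyl_D n \<Longrightarrow> finv w \<in> weyl_D n"
proof -
  assume "w \<in> weyl_D n"
  then obtain "is" where w: "is \<in> lists {1..n}" "w = word_prod n is"
    unfolding weyl_D_eq by blast
  then have "finv w = word_prod n (rev is)" using w by (simp only: finv_word)
  moreover have "rev is \<in> lists {1..n}" using w(1) by auto
  ultimately show ?thesis unfolding weyl_D_eq by blast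
qed

text \<open>
  The product of the values on \<open>1, \<dots>, n\<close> is unchanged by each generator. It
  has a fixed sign, and this expresses that elements of type D change an even number of signs.
\<close>

lemma prod_labels_simple_refl:
  assumes odd: "\<And>k. w (- k) = - w k" and i: "i \<in> {1..n}"
  shows "(\<Prod>j=1..n. w (simple_refl n i (int j))) = (\<Prod>j=1..n. w (int j) :: int)"
proof -
  define a where "a = (if i < n then i else n - 1)"
  have a: "1 \<le> a" "Suc a \<le> n" using i n2 by (auto simp: a_def)
  have "{1..n} = {1..n} - {a, Suc a} \<union> {a, Suc a}" using a by auto
  then have split: "(\<Prod>j=1..n. g j) = (\<Prod>j\<in>{1..n} - {a, Suc a}. g j) * (g a * g (Suc a))"
    for g :: "nat \<Rightarrow> int"
    by (subst (1) \<open>{1..n} = _\<close>, subst prod.union_disjoint) (auto simp: mult.commute)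
  have rest: "simple_refl n i (int j) = int j" if "j \<in> {1..n} - {a, Suc a}" for j
    using that i n2 by (auto simp: simple_refl_eq rootp_def rootq_def a_def split: if_splits)
  have two: "w (simple_refl n i (int a)) * w (simple_refl n i (int (Suc a))) = w (int a) * w (int (Suc a))"
    using i n2 odd[of "int a"] odd[of "int (Suc a)"]
    by (auto simp: simple_refl_eq rootp_def rootq_def a_def of_nat_diff split: if_splits)
  show ?thesis unfolding split[of "\<lambda>j. w (simple_refl n i (int j))"] split[of "\<lambda>j. w (int j)"] two
    using rest by simp
qed

lemma weyl_prod_values:
  assumes "w \<in> weyl_D n"
  shows "(\<Prod>j=1..n. w (int j)) = (\<Prod>j=1..n. int j)"
proof -
  obtain "is" where w: "is \<in> lists {1..n}" "w = word_prod n is" using assms by (auto simp: weyl_D_eq)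
  have "(\<Prod>j=1..n. (v \<circ> word_prod n is) (int j)) = (\<Prod>j=1..n. v (int j))" if "signed_perm n v" for v
    using \<open>is \<in> _\<close> that
  proof (induction "is" arbitrary: v)
    case (Cons i "is")
    have s: "signed_perm n (v \<circ> simple_refl n i)"
      using Cons.hyps Cons.prems n2 by (intro signed_perm_comp signed_perm_simple_refl) auto
    have "(\<Prod>j=1..n. (v \<circ> word_prod n (i # is)) (int j)) =
        (\<Prod>j=1..n. ((v \<circ> simple_refl n i) \<circ> word_prod n is) (int j))" by simp
    also have "\<dots> = (\<Prod>j=1..n. (v \<circ> simple_refl n i) (int j))"
      by (rule Cons.IH[OF s])
    also have "\<dots> = (\<Prod>j=1..n. v (int j))"
      using prod_labels_simple_refl[of v i] Cons.prems Cons.hyps by (simp add: signed_perm_def)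
    finally show ?case .
  qed simp
  from this[OF signed_perm_id] show ?thesis by (simp add: w)
qed

text \<open>
  If \<open>u(1), \<dots>, u(n)\<close> have strictly decreasing heights, and the last two have
  positive sum, then the heights are squeezed between the bounds obtained by counting from both
  ends. Only the sign of the last value remains open, because the label \<open>n\<close> has
  height \<open>0\<close>.
\<close>

lemma dominant_values:
  assumes lab: "\<And>i. 1 \<le> i \<Longrightarrow> i \<le> n \<Longrightarrow> u (int i) \<in> labels n"
    and dec: "\<And>i. 1 \<le> i \<Longrightarrow> i < n \<Longrightarrow> ht n (u (int i)) > ht n (u (int (Suc i)))"
    and last: "ht n (u (int (n - 1))) + ht n (u (int n)) > 0"
  shows "1 \<le> i \<Longrightarrow> i < n \<Longrightarrow> u (int i) = int i" "\<bar>u (int n)\<bar> = int n"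
proof -
  have bound: "ht n k \<le> int n - 1" if "k \<in> labels n" for k
    using that by (auto simp: labels_def ht_def sgn_if)
  have up: "1 \<le> i \<Longrightarrow> i \<le> n \<Longrightarrow> ht n (u (int i)) \<le> int n - int i" for i
  proof (induction i rule: nat_induct_at_least)
    case base then show ?case using bound[OF lab[of 1]] n2 by simp
  next
    case (Suc i) then show ?case using dec[of i] by simp
  qed
  have n1: "ht n (u (int (n - 1))) \<ge> 1"
  proof -
    have "1 \<le> n - 1" "n - 1 < n" "Suc (n - 1) = n" using n2 by auto
    from dec[OF this(1,2)] this(3) have "ht n (u (int (n - 1))) > ht n (u (int n))" by simp
    with last show ?thesis by linarith
  qed
  \<comment> \<open>counting down from \<open>n - 1\<close>, written as an induction on the distance from \<open>n\<close>\<close>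
  have *: "ht n (u (int (n - Suc d))) \<ge> int (Suc d)" if "Suc d < n" for d
    using that
  proof (induction d)
    case 0 then show ?case using n1 by simp
  next
    case (Suc d)
    have e: "Suc (n - Suc (Suc d)) = n - Suc d" "1 \<le> n - Suc (Suc d)" "n - Suc (Suc d) < n"
      using Suc.prems by arith+
    have "ht n (u (int (n - Suc d))) \<ge> int (Suc d)"
      by (rule Suc.IH) (rule Suc_lessD[OF Suc.prems])
    moreover have "ht n (u (int (n - Suc (Suc d)))) > ht n (u (int (n - Suc d)))"
      using dec[OF e(2,3)] unfolding e(1) .
    ultimately show ?case by linarith
  qed
  have down: "ht n (u (int i)) \<ge> int n - int i" if "1 \<le> i" "i < n" for i
  proof -
    obtain d where d: "n = i + Suc d" using \<open>i < n\<close> less_iff_Suc_add by auto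
    have "ht n (u (int (n - Suc d))) \<ge> int (Suc d)" by (rule *) (use d that in simp)
    then show ?thesis using d by simp
  qed
  have det: "k = int n - m" if "ht n k = m" "0 < m" "k \<in> labels n" for k m
    using that by (auto simp: labels_def ht_def sgn_if split: if_splits)
  show "u (int i) = int i" if "1 \<le> i" "i < n"
    using det[of "u (int i)" "int n - int i"] up[of i] down[of i] lab[of i] that by simp
  have "ht n (u (int n)) = 0"
  proof -
    have "1 \<le> n - 1" "n - 1 \<le> n" "int n - int (n - 1) = 1" using n2 by auto
    then have "ht n (u (int (n - 1))) \<le> 1" using up by metis
    moreover have "ht n (u (int n)) \<le> 0" using up[of n] n2 by simp
    ultimately show ?thesis using last by linarith
  qed
  then show "\<bar>u (int n)\<bar> = int n"
    using lab[of n] n2 by (auto simp: labels_def ht_def sgn_if split: if_splits)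
qed

end

section \<open>Descents, words and length\<close>

context
  fixes n :: nat
  assumes n2: "2 \<le> n"
begin

lemma signed_perm_ext:
  assumes "signed_perm n v" "signed_perm n w" "\<And>j. 1 \<le> j \<Longrightarrow> j \<le> n \<Longrightarrow> v (int j) = w (int j)"
  shows "v = w"
proof
  fix k :: int
  consider "k \<notin> labels n" | "k \<in> labels n" "k > 0" | "k \<in> labels n" "k < 0"
    by (cases k "0 :: int" rule: linorder_cases) (auto simp: labels_def)
  then show "v k = w k"
  proof cases
    case 1 then show ?thesis using assms(1,2) by (simp add: signed_perm_def)
  next
    case 2
    then have "v (int (nat k)) = w (int (nat k))" by (intro assms(3)) (auto simp: labels_def)
    with 2 show ?thesis by simp
  next
    case 3
    then have "v (int (nat (- k))) = w (int (nat (- k)))" by (intro assms(3)) (auto simp: labels_def)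
    with 3 have "v (- k) = w (- k)" by simp
    then show ?thesis using assms(1,2) by (simp add: signed_perm_def)
  qed
qed

lemma root_height_steps:
  assumes v: "signed_perm n (finv w)"
  shows "1 \<le> i \<Longrightarrow> i < n \<Longrightarrow> root_height n w i = ht n (finv w (int i)) - ht n (finv w (int (Suc i)))"
    "root_height n w n = ht n (finv w (int (n - 1))) + ht n (finv w (int n))"
proof -
  have o: "finv w (- k) = - finv w k" for k using v by (simp add: signed_perm_def)
  have "rootq n i = - int (Suc i)" if "i < n" using that by (simp add: rootq_def)
  then show "1 \<le> i \<Longrightarrow> i < n \<Longrightarrow> root_height n w i = ht n (finv w (int i)) - ht n (finv w (int (Suc i)))"
    by (simp add: root_height_def rootp_def o del: of_nat_Suc)
  show "root_height n w n = ht n (finv w (int (n - 1))) + ht n (finv w (int n))"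
    using n2 by (simp add: root_height_def rootp_def rootq_def of_nat_diff)
qed

text \<open>
  The last value is determined up to sign by the others, and its sign by the invariant product.
\<close>

lemma weyl_determined:
  assumes v: "v \<in> weyl_D n" and w: "w \<in> weyl_D n"
    and eq: "\<And>j. 1 \<le> j \<Longrightarrow> j < n \<Longrightarrow> v (int j) = w (int j)"
  shows "v = w"
proof -
  have sp: "signed_perm n v" "signed_perm n w" using v w weyl_signed_perm[OF n2] by auto
  have split: "(\<Prod>j=1..n. g j) = (\<Prod>j=1..<n. g j) * g n" for g :: "nat \<Rightarrow> int"
  proof -
    have "{1..n} = insert n {1..<n}" using n2 by auto
    then show ?thesis by (simp add: mult.commute)
  qed
  have nz: "(\<Prod>j=1..<n. v (int j)) \<noteq> 0"
  proof -
    have "v (int j) \<noteq> 0" if "1 \<le> j" "j < n" for j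
    proof -
      have "int j \<in> labels n" using that by (simp add: labels_def)
      then have "v (int j) \<in> labels n" by (simp only: signed_perm_labels[OF sp(1)])
      then show ?thesis by (simp add: labels_def)
    qed
    then show ?thesis by simp
  qed
  have "(\<Prod>j=1..n. v (int j)) = (\<Prod>j=1..n. w (int j))"
    using weyl_prod_values[OF n2 v] weyl_prod_values[OF n2 w] by simp
  moreover have "(\<Prod>j=1..<n. w (int j)) = (\<Prod>j=1..<n. v (int j))"
    by (rule prod.cong) (auto simp: eq)
  ultimately have "(\<Prod>j=1..<n. v (int j)) * v (int n) = (\<Prod>j=1..<n. v (int j)) * w (int n)"
    unfolding split[of "\<lambda>j. v (int j)"] split[of "\<lambda>j. w (int j)"] by metis
  then have "v (int n) = w (int n)" using nz by simp
  then have "v (int j) = w (int j)" if "1 \<le> j" "j \<le> n" for j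
    using eq[of j] that by (cases "j = n") auto
  then show ?thesis by (rule signed_perm_ext[OF sp])
qed

text \<open>
  An element without descents preserves the dominant chamber, hence is the identity. All words
  are constructed from this fact, by removing one descent at a time.
\<close>

lemma no_descent_id:
  assumes w: "w \<in> weyl_D n" and up: "\<And>i. 1 \<le> i \<Longrightarrow> i \<le> n \<Longrightarrow> root_height n w i > 0"
  shows "w = id"
proof -
  have v: "finv w \<in> weyl_D n" by (rule weyl_finv[OF n2 w])
  have sv: "signed_perm n (finv w)" by (rule weyl_signed_perm[OF n2 v])
  have "finv w (int i) = int i" if "1 \<le> i" "i < n" for i
  proof (rule dominant_values(1)[OF n2 _ _ _ that, of "finv w"])
    show "finv w (int i) \<in> labels n" if "1 \<le> i" "i \<le> n" for i
      using that signed_perm_labels[OF sv] by (simp add: labels_def)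
    show "ht n (finv w (int (Suc i))) < ht n (finv w (int i))" if "1 \<le> i" "i < n" for i
      using up[of i] root_height_steps(1)[OF sv that] that by simp
    show "0 < ht n (finv w (int (n - 1))) + ht n (finv w (int n))"
      using up[of n] root_height_steps(2)[OF sv] n2 by simp
  qed
  then have "finv w = id" by (intro weyl_determined[OF v weyl_id[OF n2]]) auto
  moreover have "bij w" using weyl_signed_perm[OF n2 w] by (simp add: signed_perm_def)
  ultimately show ?thesis using inv_inv_eq[of w] inv_id by simp
qed

lemma len_word_le: "is \<in> lists {1..n} \<Longrightarrow> len n (word_prod n is) \<le> length is"
proof (induction "is" rule: list.induct)
  case (Cons i "is")
  then have i: "1 \<le> i" "i \<le> n" "2 \<le> n" and l: "is \<in> lists {1..n}" using n2 by auto
  note sp = signed_perm_word[OF n2 l]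
  have "len n (simple_refl n i \<circ> word_prod n is) \<le> Suc (len n (word_prod n is))"
  proof (cases "root_height n (word_prod n is) i > 0")
    case True
    show ?thesis unfolding len_simple_refl_up[OF sp i True] by (rule order_refl)
  next
    case False
    then have "root_height n (word_prod n is) i < 0" using root_height_nonzero[OF sp i] by linarith
    from len_simple_refl_down[OF sp i this] show ?thesis by linarith
  qed
  also have "\<dots> \<le> length (i # is)" using Cons.IH[OF l] by (simp only: list.size)
  finally show ?case unfolding word_prod_simps .
qed simp

text \<open>
  Removing a descent lowers the number of inversions by one, until no descent is left.
\<close>

lemma weyl_reduced_word:
  assumes "w \<in> weyl_D n"
  obtains "is" where "is \<in> lists {1..n}" "word_prod n is = w" "length is = len n w"
proof -
  have "\<exists>is\<in>lists {1..n}. word_prod n is = w \<and> length is = len n w"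
    using assms
  proof (induction "len n w" arbitrary: w rule: less_induct)
    case less
    show ?case
    proof (cases "\<forall>i. 1 \<le> i \<longrightarrow> i \<le> n \<longrightarrow> root_height n w i > 0")
      case True
      then have "w = id" using no_descent_id[OF less.prems] by blast
      then show ?thesis by (intro bexI[of _ "[]"]) auto
    next
      case False
      then obtain i where i: "1 \<le> i" "i \<le> n" and neg: "\<not> root_height n w i > 0" by blast
      note sp = weyl_signed_perm[OF n2 less.prems]
      have "root_height n w i < 0"
        using root_height_nonzero[OF sp i n2] neg by linarith
      then have l: "len n w = Suc (len n (simple_refl n i \<circ> w))"
        by (rule len_simple_refl_down[OF sp i n2])
      have "simple_refl n i \<circ> w \<in> weyl_D n"
        using i by (intro weyl_comp[OF n2] weyl_simple_refl[OF n2] less.prems) auto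
      then obtain "is" where ks: "is \<in> lists {1..n}" "word_prod n is = simple_refl n i \<circ> w"
        "length is = len n (simple_refl n i \<circ> w)"
        using less.hyps[of "simple_refl n i \<circ> w"] l by auto
      show ?thesis
      proof (intro bexI[of _ "i # is"] conjI)
        show "word_prod n (i # is) = w"
          unfolding word_prod_simps ks(2) by (rule simple_refl_cancel[OF i n2])
      qed (use ks i l in auto)
    qed
  qed
  then show ?thesis using that by blast
qed

text \<open>
  The minimal word length is the number of inversions, by the word just constructed and the
  bound \<open>len_word_le\<close>.
\<close>

lemma weyl_length_eq:
  assumes "w \<in> weyl_D n" shows "weyl_length n w = len n w"
  unfolding weyl_length_def
proof (rule Least_equality)
  show "\<exists>is\<in>lists {1..n}. length is = len n w \<and> word_prod n is = w"
    using weyl_reduced_word[OF assms] by metis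
  show "len n w \<le> l" if "\<exists>is\<in>lists {1..n}. length is = l \<and> word_prod n is = w" for l
    using that len_word_le by blast
qed

lemma reduced_expr_iff:
  "reduced_expr n is w \<longleftrightarrow> is \<in> lists {1..n} \<and> word_prod n is = w \<and> length is = len n w"
proof -
  have "is \<in> lists {1..n} \<Longrightarrow> word_prod n is \<in> weyl_D n" by (simp add: weyl_D_eq[OF n2])
  then show ?thesis unfolding reduced_expr_def using weyl_length_eq by metis
qed

lemma len_finv:
  assumes "w \<in> weyl_D n" shows "len n (finv w) = len n w"
proof -
  have le: "len n (finv v) \<le> len n v" if v: "v \<in> weyl_D n" for v
  proof -
    obtain "is" where ks: "is \<in> lists {1..n}" "word_prod n is = v" "length is = len n v"
      by (rule weyl_reduced_word[OF v])
    have "rev is \<in> lists {1..n}" using ks(1) by auto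
    from len_word_le[OF this] show ?thesis
      unfolding ks(2)[symmetric] finv_word[OF n2 ks(1)] using ks by simp
  qed
  have "bij w" using weyl_signed_perm[OF n2 assms] by (simp add: signed_perm_def)
  then have "finv (finv w) = w" by (rule inv_inv_eq)
  then show ?thesis using le[OF assms] le[OF weyl_finv[OF n2 assms]] by simp
qed

section \<open>Braid relations\<close>

text \<open>
  Neighbouring simple roots share one coordinate with opposite signs.
\<close>

lemma adjacent_roots:
  assumes "1 \<le> i" "i \<le> n" "1 \<le> j" "j \<le> n" "adjacent n i j"
  shows "rootq n i = - rootp n j \<or> rootq n j = - rootp n i"
  using assms n2 by (auto simp: adjacent_def rootp_def rootq_def min_def max_def split: if_splits)

lemma adjacent_root_abs:
  assumes i: "1 \<le> i" "i \<le> n" and j: "1 \<le> j" "j \<le> n" and q: "rootq n i = - rootp n j"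
  shows "\<bar>rootp n i\<bar> = int i \<and> \<bar>rootq n i\<bar> = int i + 1 \<and> \<bar>rootq n j\<bar> = int i + 2"
proof -
  have "i < n" using q i j n2 by (cases "i < n"; cases "j < n") (auto simp: rootp_def rootq_def)
  then show ?thesis using q i j n2 by (cases "j < n") (auto simp: rootp_def rootq_def)
qed

lemma adjacent_root_neq:
  assumes i: "1 \<le> i" "i \<le> n" and j: "1 \<le> j" "j \<le> n" and q: "rootq n i = - rootp n j"
  shows "simple_refl n j (rootp n i) = rootp n i" "simple_refl n i (rootq n j) = rootq n j"
    "simple_refl n i (rootp n j) = rootp n i" "simple_refl n j (rootq n i) = rootq n j"
proof -
  have ne: "\<bar>rootp n i\<bar> \<noteq> \<bar>rootq n i\<bar>" "\<bar>rootp n i\<bar> \<noteq> \<bar>rootq n j\<bar>" "\<bar>rootq n i\<bar> \<noteq> \<bar>rootq n j\<bar>"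
    using adjacent_root_abs[OF i j q] by auto
  show "simple_refl n j (rootp n i) = rootp n i" "simple_refl n i (rootq n j) = rootq n j"
    unfolding simple_refl_eq[OF i n2] simple_refl_eq[OF j n2] using ne q by auto
  have "rootp n j = - rootq n i" using q by simp
  then show "simple_refl n i (rootp n j) = rootp n i"
    using i n2 by (simp only: simple_refl_uminus simple_refl_root minus_minus)
  show "simple_refl n j (rootq n i) = rootq n j"
    unfolding q using j n2 by (simp only: simple_refl_uminus simple_refl_root minus_minus)
qed

text \<open>
  Generators without an edge act on disjoint coordinates, except for the fork \<open>n - 1,
  n\<close>, where the roots are \<open>e\<^sub>a - e\<^sub>b\<close> and \<open>e\<^sub>a +
  e\<^sub>b\<close>.
\<close>

lemma nonadjacent_roots:
  assumes "1 \<le> i" "i \<le> n" "1 \<le> j" "j \<le> n" "i \<noteq> j" "\<not> adjacent n i j"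
  shows "(\<bar>rootp n i\<bar> \<noteq> \<bar>rootp n j\<bar> \<and> \<bar>rootp n i\<bar> \<noteq> \<bar>rootq n j\<bar> \<and>
      \<bar>rootq n i\<bar> \<noteq> \<bar>rootp n j\<bar> \<and> \<bar>rootq n i\<bar> \<noteq> \<bar>rootq n j\<bar>) \<or>
    (rootp n i = rootp n j \<and> rootq n i = - rootq n j)"
  using assms n2
proof (cases "i < n"; cases "j < n")
  assume "i < n" "j < n"
  then show ?thesis using assms by (simp add: rootp_def rootq_def adjacent_def; arith)
next
  assume "i < n" "\<not> j < n"
  then have "j = n" "Suc (Suc i) \<noteq> n" using assms by (auto simp: adjacent_def)
  with \<open>i < n\<close> show ?thesis using assms(1) n2 by (simp add: rootp_def rootq_def; arith)
next
  assume "\<not> i < n" "j < n"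
  then have "i = n" "Suc (Suc j) \<noteq> n" using assms by (auto simp: adjacent_def)
  with \<open>j < n\<close> show ?thesis using assms(3) n2 by (simp add: rootp_def rootq_def; arith)
qed (use assms in simp)

lemma simple_refl_outside:
  assumes "1 \<le> i" "i \<le> n" "\<bar>k\<bar> \<noteq> \<bar>rootp n i\<bar>" "\<bar>k\<bar> \<noteq> \<bar>rootq n i\<bar>"
  shows "simple_refl n i k = k"
  using assms(3,4) unfolding simple_refl_eq[OF assms(1,2) n2] by (metis abs_minus_cancel)

lemma nonadjacent_root_fixed:
  assumes i: "1 \<le> i" "i \<le> n" and j: "1 \<le> j" "j \<le> n" and "i \<noteq> j" "\<not> adjacent n i j"
  shows "ht n (v (simple_refl n i (rootp n j))) + ht n (v (simple_refl n i (rootq n j))) =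
    ht n (v (rootp n j)) + ht n (v (rootq n j))"
  using nonadjacent_roots[OF assms]
proof
  assume "rootp n i = rootp n j \<and> rootq n i = - rootq n j"
  then have "simple_refl n i (rootp n j) = rootq n j" "simple_refl n i (rootq n j) = rootp n j"
    using root_facts[OF j n2] unfolding simple_refl_eq[OF i n2] by auto
  then show ?thesis by simp
next
  assume "\<bar>rootp n i\<bar> \<noteq> \<bar>rootp n j\<bar> \<and> \<bar>rootp n i\<bar> \<noteq> \<bar>rootq n j\<bar> \<and>
      \<bar>rootq n i\<bar> \<noteq> \<bar>rootp n j\<bar> \<and> \<bar>rootq n i\<bar> \<noteq> \<bar>rootq n j\<bar>"
  then have "simple_refl n i (rootp n j) = rootp n j" "simple_refl n i (rootq n j) = rootq n j"
    by (simp_all add: simple_refl_outside[OF i])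
  then show ?thesis by simp
qed

lemma simple_refl_commute:
  assumes i: "1 \<le> i" "i \<le> n" and j: "1 \<le> j" "j \<le> n" and "i \<noteq> j" "\<not> adjacent n i j"
  shows "simple_refl n i \<circ> simple_refl n j = simple_refl n j \<circ> simple_refl n i"
proof
  fix k
  have ne: "\<bar>rootp n i\<bar> \<noteq> \<bar>rootq n i\<bar>" "\<bar>rootp n j\<bar> \<noteq> \<bar>rootq n j\<bar>"
    using root_facts[OF i n2] root_facts[OF j n2] by (auto simp: abs_eq_iff)
  show "(simple_refl n i \<circ> simple_refl n j) k = (simple_refl n j \<circ> simple_refl n i) k"
    using nonadjacent_roots[OF assms]
  proof
    assume "rootp n i = rootp n j \<and> rootq n i = - rootq n j"
    then have pq: "rootp n i = rootp n j" "rootq n i = - rootq n j" by auto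
    define p q where "p = rootp n j" "q = rootq n j"
    note d = this pq
    have sj: "simple_refl n j p = - q" "simple_refl n j q = - p"
      "simple_refl n j (- p) = q" "simple_refl n j (- q) = p"
      using j n2 by (simp_all add: d(1,2) simple_refl_uminus)
    have si: "simple_refl n i p = q" "simple_refl n i (- q) = - p"
      "simple_refl n i (- p) = - q" "simple_refl n i q = p"
      using simple_refl_root[OF i n2] unfolding pq d(1,2)[symmetric]
      by (simp_all add: simple_refl_uminus[OF i n2])
    consider "k = p" | "k = q" | "k = - p" | "k = - q" | "k \<notin> {p, q, - p, - q}" by blast
    then show ?thesis
    proof cases
      case 5
      then have "simple_refl n i k = k" "simple_refl n j k = k"
        unfolding simple_refl_eq[OF i n2] simple_refl_eq[OF j n2] pq d(1,2)[symmetric] by auto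
      then show ?thesis by simp
    qed (simp_all add: si sj)
  next
    assume "\<bar>rootp n i\<bar> \<noteq> \<bar>rootp n j\<bar> \<and> \<bar>rootp n i\<bar> \<noteq> \<bar>rootq n j\<bar> \<and>
      \<bar>rootq n i\<bar> \<noteq> \<bar>rootp n j\<bar> \<and> \<bar>rootq n i\<bar> \<noteq> \<bar>rootq n j\<bar>"
    then have dis: "\<bar>m\<bar> \<notin> {\<bar>rootp n j\<bar>, \<bar>rootq n j\<bar>}" if "\<bar>m\<bar> \<in> {\<bar>rootp n i\<bar>, \<bar>rootq n i\<bar>}" for m
      using that by auto
    have outside: "simple_refl n l m = m" if "1 \<le> l" "l \<le> n" "\<bar>m\<bar> \<notin> {\<bar>rootp n l\<bar>, \<bar>rootq n l\<bar>}" for l m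
      using that by (simp add: simple_refl_outside)
    have inside: "\<bar>simple_refl n l m\<bar> \<in> {\<bar>rootp n l\<bar>, \<bar>rootq n l\<bar>}"
      if "1 \<le> l" "l \<le> n" "\<bar>m\<bar> \<in> {\<bar>rootp n l\<bar>, \<bar>rootq n l\<bar>}" for l m
      using that unfolding simple_refl_eq[OF that(1,2) n2] by (auto simp: abs_eq_iff)
    show ?thesis
      unfolding comp_apply using dis outside inside i j by metis
  qed
qed

lemma simple_refl_braid_aux:
  assumes i: "1 \<le> i" "i \<le> n" and j: "1 \<le> j" "j \<le> n" and q: "rootq n i = - rootp n j"
  shows "simple_refl n i \<circ> (simple_refl n j \<circ> simple_refl n i) =
    simple_refl n j \<circ> (simple_refl n i \<circ> simple_refl n j)"
proof
  fix k
  have p: "rootp n j = - rootq n i" using q by simp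
  have ne: "\<bar>rootp n i\<bar> \<noteq> \<bar>rootq n i\<bar>" "\<bar>rootp n i\<bar> \<noteq> \<bar>rootq n j\<bar>" "\<bar>rootq n i\<bar> \<noteq> \<bar>rootq n j\<bar>"
    "rootp n i \<noteq> 0" "rootq n i \<noteq> 0" "rootq n j \<noteq> 0"
    using adjacent_root_abs[OF i j q] i by auto
  show "(simple_refl n i \<circ> (simple_refl n j \<circ> simple_refl n i)) k =
    (simple_refl n j \<circ> (simple_refl n i \<circ> simple_refl n j)) k"
    unfolding comp_apply simple_refl_eq[OF i n2] simple_refl_eq[OF j n2] p
    using ne by (smt (verit))
qed

lemma simple_refl_braid:
  assumes "1 \<le> i" "i \<le> n" "1 \<le> j" "j \<le> n" "adjacent n i j"
  shows "simple_refl n i \<circ> (simple_refl n j \<circ> simple_refl n i) =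
    simple_refl n j \<circ> (simple_refl n i \<circ> simple_refl n j)"
  using adjacent_roots[OF assms] simple_refl_braid_aux assms by metis

text \<open>
  The simple root \<open>j\<close> is fixed by the reflection \<open>i\<close>, so removing the
  descent \<open>i\<close> keeps the descent \<open>j\<close>.
\<close>

lemma descents_commuting:
  assumes w: "signed_perm n w" and i: "1 \<le> i" "i \<le> n" and j: "1 \<le> j" "j \<le> n"
    and "i \<noteq> j" "\<not> adjacent n i j" and "root_height n w j < 0"
  shows "root_height n (simple_refl n i \<circ> w) j < 0"
  using nonadjacent_root_fixed[OF i j assms(6,7), of "finv w"] assms(8)
  by (simp add: root_height_def inv_simple_refl_comp[OF w i n2])

text \<open>
  If two neighbouring generators are descents, so is every step along the longest word \<open>i
  j i\<close> of the subgroup they generate: the roots in question are sums of the two given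
  negative ones or one of these.
\<close>

lemma descents_braid:
  assumes w: "signed_perm n w" and i: "1 \<le> i" "i \<le> n" and j: "1 \<le> j" "j \<le> n"
    and adj: "adjacent n i j" and d: "root_height n w i < 0" "root_height n w j < 0"
  shows "root_height n (simple_refl n i \<circ> w) j < 0"
    "root_height n (simple_refl n j \<circ> (simple_refl n i \<circ> w)) i < 0"
proof -
  have sw: "signed_perm n (simple_refl n i \<circ> w)"
    by (intro signed_perm_comp signed_perm_simple_refl i n2 w)
  have odd: "finv w (- k) = - finv w k" for k
    using signed_perm_inv[OF w] by (simp add: signed_perm_def)
  note [simp] = root_height_def inv_simple_refl_comp[OF w i n2] inv_simple_refl_comp[OF sw j n2]
  have "root_height n (simple_refl n i \<circ> w) j < 0 \<and>
    root_height n (simple_refl n j \<circ> (simple_refl n i \<circ> w)) i < 0"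
  proof (cases "rootq n i = - rootp n j")
    case True
    note r = adjacent_root_neq[OF i j True]
    have "ht n (finv w (rootq n i)) = - ht n (finv w (rootp n j))" unfolding True odd by simp
    with d r i j n2 show ?thesis by (simp add: odd)
  next
    case False
    then have q: "rootq n j = - rootp n i" using adjacent_roots[OF i j adj] by blast
    note r = adjacent_root_neq[OF j i q]
    have "ht n (finv w (rootq n j)) = - ht n (finv w (rootp n i))" unfolding q odd by simp
    with d r i j n2 show ?thesis by (simp add: odd)
  qed
  then show "root_height n (simple_refl n i \<circ> w) j < 0"
    "root_height n (simple_refl n j \<circ> (simple_refl n i \<circ> w)) i < 0" by blast+
qed

end

context
  fixes n :: nat
  assumes n2: "2 \<le> n"
begin

section \<open>The longest element\<close>

text \<open>
  The positive roots of type D, in the encoding used for inversions.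
\<close>

definition positive_pairs :: "(int \<times> int) set" where
  "positive_pairs = {(a, b). a \<in> labels n \<and> b \<in> labels n \<and> a < b \<and> a \<noteq> - b \<and> ht n a + ht n b > 0}"

lemma finite_positive_pairs: "finite positive_pairs"
  by (rule finite_subset[of _ "labels n \<times> labels n"]) (auto simp: positive_pairs_def)

text \<open>
  In a positive root the coordinate of smaller absolute value is positive, and the other one is
  arbitrary. The bound is sharp, as a word with that many inversions shows later.
\<close>

lemma card_positive_pairs_le: "card positive_pairs \<le> n * (n - 1)"
proof -
  let ?B = "\<lambda>i. {b. int i < \<bar>b\<bar> \<and> \<bar>b\<bar> \<le> int n}"
  let ?S = "Sigma {1..n} ?B"
  have B: "?B i = {int i + 1..int n} \<union> {- int n..- int i - 1}" for i by auto
  have cB: "card (?B i) = 2 * (n - i)" for i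
    unfolding B by (subst card_Un_disjoint) auto
  have fB: "finite (?B i)" for i unfolding B by simp
  have sub: "positive_pairs \<subseteq> (\<lambda>(i, b). (min (int i) b, max (int i) b)) ` ?S"
  proof
    fix z assume "z \<in> positive_pairs"
    then obtain a b where z: "z = (a, b)" and ab: "a \<in> labels n" "b \<in> labels n" "a < b" "a \<noteq> - b"
      "ht n a + ht n b > 0" by (auto simp: positive_pairs_def)
    have "\<bar>a\<bar> \<noteq> \<bar>b\<bar>" using ab by (auto simp: abs_eq_iff)
    then consider "\<bar>a\<bar> < \<bar>b\<bar>" | "\<bar>b\<bar> < \<bar>a\<bar>" by linarith
    then show "z \<in> (\<lambda>(i, b). (min (int i) b, max (int i) b)) ` ?S"
    proof cases
      case 1
      then have "a > 0" using ab by (auto simp: labels_def ht_def sgn_if split: if_splits)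
      then show ?thesis using 1 ab z
        by (intro image_eqI[of _ _ "(nat a, b)"]) (auto simp: labels_def min_def max_def)
    next
      case 2
      then have "b > 0" using ab by (auto simp: labels_def ht_def sgn_if split: if_splits)
      then show ?thesis using 2 ab z
        by (intro image_eqI[of _ _ "(nat b, a)"]) (auto simp: labels_def min_def max_def)
    qed
  qed
  have "card positive_pairs \<le> card ((\<lambda>(i, b). (min (int i) b, max (int i) b)) ` ?S)"
    by (rule card_mono[OF _ sub]) (use fB in auto)
  also have "\<dots> \<le> card ?S" by (rule card_image_le) (use fB in auto)
  also have "\<dots> = (\<Sum>i=1..n. 2 * (n - i))" using fB by (simp add: cB)
  also have "\<dots> = (\<Sum>i<n. 2 * i)"
    by (rule sum.reindex_bij_witness[of _ "\<lambda>i. n - i" "\<lambda>i. n - i"]) auto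
  also have "\<dots> = n * (n - 1)"
  proof (induction n)
    case (Suc m) then show ?case by (cases m) auto
  qed simp
  finally show ?thesis .
qed

lemma len_le_pairs: "len n w \<le> card positive_pairs"
  unfolding len_def
  by (rule card_mono[OF finite_positive_pairs]) (auto simp: inversions_def positive_pairs_def)

lemma finite_weyl_D: "finite (weyl_D n)"
proof -
  have "weyl_D n \<subseteq> word_prod n ` {is. set is \<subseteq> {1..n} \<and> length is \<le> card positive_pairs}"
  proof
    fix w assume "w \<in> weyl_D n"
    then obtain "is" where ks: "is \<in> lists {1..n}" "word_prod n is = w" "length is = len n w"
      using weyl_reduced_word[OF n2] by blast
    then show "w \<in> word_prod n ` {is. set is \<subseteq> {1..n} \<and> length is \<le> card positive_pairs}"
      using len_le_pairs[of w] by (intro image_eqI[of _ _ "is"]) auto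
  qed
  then show ?thesis by (rule finite_subset) (intro finite_imageI finite_lists_length_le, simp)
qed

text \<open>
  The negative of the inverse satisfies the hypotheses of \<open>dominant_values\<close>.
\<close>

lemma all_descents_values:
  assumes w: "w \<in> weyl_D n" and down: "\<And>i. 1 \<le> i \<Longrightarrow> i \<le> n \<Longrightarrow> root_height n w i < 0"
  shows "1 \<le> j \<Longrightarrow> j < n \<Longrightarrow> finv w (int j) = - int j" "\<bar>finv w (int n)\<bar> = int n"
proof -
  have v: "finv w \<in> weyl_D n" by (rule weyl_finv[OF n2 w])
  have sv: "signed_perm n (finv w)" by (rule weyl_signed_perm[OF n2 v])
  have A: "- finv w (int i) \<in> labels n" if "1 \<le> i" "i \<le> n" for i
    using that signed_perm_labels[OF sv] by (simp add: labels_def)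
  have B: "ht n (- finv w (int (Suc i))) < ht n (- finv w (int i))" if "1 \<le> i" "i < n" for i
    using down[of i] root_height_steps(1)[OF n2 sv that] that by simp
  have C: "0 < ht n (- finv w (int (n - 1))) + ht n (- finv w (int n))"
    using down[of n] root_height_steps(2)[OF n2 sv] n2 by simp
  show "finv w (int j) = - int j" if "1 \<le> j" "j < n"
    using dominant_values(1)[OF n2 A B C that] by simp
  show "\<bar>finv w (int n)\<bar> = int n"
    using dominant_values(2)[OF n2 A B C] by simp
qed

lemma maximal_all_descents:
  assumes w: "w \<in> weyl_D n" and max: "\<And>v. v \<in> weyl_D n \<Longrightarrow> len n v \<le> len n w"
    and i: "1 \<le> i" "i \<le> n"
  shows "root_height n w i < 0"
proof (rule ccontr)
  note sp = weyl_signed_perm[OF n2 w]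
  assume "\<not> root_height n w i < 0"
  then have "root_height n w i > 0" using root_height_nonzero[OF sp i n2] by linarith
  then have "len n (simple_refl n i \<circ> w) = Suc (len n w)" by (rule len_simple_refl_up[OF sp i n2])
  moreover have "simple_refl n i \<circ> w \<in> weyl_D n"
    using i by (intro weyl_comp[OF n2] weyl_simple_refl[OF n2] w) auto
  ultimately show False using max by fastforce
qed

lemma maximal_unique:
  assumes w: "w \<in> weyl_D n" "\<And>v. v \<in> weyl_D n \<Longrightarrow> len n v \<le> len n w"
    and w': "w' \<in> weyl_D n" "\<And>v. v \<in> weyl_D n \<Longrightarrow> len n v \<le> len n w'"
  shows "w' = w"
proof -
  have "finv w' = finv w"
    using all_descents_values(1)[OF w(1) maximal_all_descents[OF w]]
      all_descents_values(1)[OF w'(1) maximal_all_descents[OF w']]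
    by (intro weyl_determined[OF n2] weyl_finv[OF n2] w w') simp
  moreover have "bij w" "bij w'"
    using weyl_signed_perm[OF n2] w(1) w'(1) by (auto simp: signed_perm_def)
  ultimately show "w' = w" by (metis inv_inv_eq)
qed

text \<open>
  Every element of maximal length has all descents, which determines it.
\<close>

lemma longest_elt_props:
  shows longest_in: "longest_elt n \<in> weyl_D n"
    and longest_max: "v \<in> weyl_D n \<Longrightarrow> len n v \<le> len n (longest_elt n)"
proof -
  obtain w where w: "w \<in> weyl_D n" "\<And>v. v \<in> weyl_D n \<Longrightarrow> len n v \<le> len n w"
    using ex_has_greatest_nat[of "\<lambda>w. w \<in> weyl_D n" id "len n" "Suc (card positive_pairs)"]
      weyl_id[OF n2] len_le_pairs by (auto simp: less_Suc_eq_le)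
  have "longest_elt n = w"
    unfolding longest_elt_def
  proof (rule the_equality)
    show "w \<in> weyl_D n \<and> (\<forall>v\<in>weyl_D n. weyl_length n v \<le> weyl_length n w)"
      using w by (simp add: weyl_length_eq[OF n2])
    fix w' assume w': "w' \<in> weyl_D n \<and> (\<forall>v\<in>weyl_D n. weyl_length n v \<le> weyl_length n w')"
    then have "len n v \<le> len n w'" if "v \<in> weyl_D n" for v
      using that weyl_length_eq[OF n2] by metis
    with w w' show "w' = w" by (intro maximal_unique) auto
  qed
  with w show "longest_elt n \<in> weyl_D n" "v \<in> weyl_D n \<Longrightarrow> len n v \<le> len n (longest_elt n)" by auto
qed

text \<open>
  The longest element negates all coordinates, except possibly the label \<open>n\<close>, which
  has height \<open>0\<close>; so it negates all heights.
\<close>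

lemma ht_longest:
  assumes "k \<in> labels n" shows "ht n (longest_elt n k) = - ht n k"
proof -
  let ?w = "longest_elt n"
  have sp: "signed_perm n ?w" and sv: "signed_perm n (finv ?w)"
    using weyl_signed_perm[OF n2] weyl_finv[OF n2] longest_in by auto
  note val = all_descents_values[OF longest_in maximal_all_descents[OF longest_in longest_max]]
  have odd: "finv ?w (- k) = - finv ?w k" for k using sv by (simp add: signed_perm_def)
  have pos: "ht n (finv ?w k) = - ht n k" if "k \<in> labels n" "k > 0" for k
  proof (cases "k < int n")
    case True
    then have "finv ?w (int (nat k)) = - int (nat k)" using that by (intro val(1)) auto
    then show ?thesis using that by simp
  next
    case False
    then have "k = int n" using that by (simp add: labels_def)
    then show ?thesis using val(2) by (auto simp: ht_def)
  qed
  have H: "ht n (finv ?w k) = - ht n k" if "k \<in> labels n" for k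
  proof (cases "k > 0")
    case False
    then have "- k > 0" using that by (auto simp: labels_def)
    then show ?thesis using pos[of "- k"] that by (simp add: odd)
  qed (use pos that in auto)
  have "bij ?w" using sp by (simp add: signed_perm_def)
  then have "finv ?w (?w k) = k" by (simp add: bij_is_inj)
  moreover have "?w k \<in> labels n" using assms by (simp add: signed_perm_labels[OF sp])
  ultimately show ?thesis using H[of "?w k"] by simp
qed

text \<open>
  The longest element exchanges positive and negative roots, so it complements the set of
  inversions.
\<close>

lemma len_longest_comp:
  assumes v: "v \<in> weyl_D n"
  shows "len n (longest_elt n \<circ> v) + len n v = card positive_pairs"
proof -
  note sp = weyl_signed_perm[OF n2 v]
  have bv: "inj v" and odd: "\<And>k. v (- k) = - v k" using sp by (auto simp: signed_perm_def bij_is_inj)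
  have "(a, b) \<in> inversions n (longest_elt n \<circ> v) \<longleftrightarrow> (a, b) \<in> positive_pairs - inversions n v" for a b
  proof (cases "(a, b) \<in> positive_pairs")
    case True
    then have ab: "a \<in> labels n" "b \<in> labels n" "a < b" "a \<noteq> - b" "ht n a + ht n b > 0"
      by (auto simp: positive_pairs_def)
    then have l: "v a \<in> labels n" "v b \<in> labels n" by (simp_all add: signed_perm_labels[OF sp])
    have "v a \<noteq> v b" "v a \<noteq> - v b"
      using ab bv odd by (metis inj_eq less_irrefl, metis inj_eq)
    from ht_sum_nonzero[OF l this] show ?thesis
      using ab l True by (auto simp: inversions_def ht_longest)
  qed (auto simp: inversions_def positive_pairs_def)
  then have eq: "inversions n (longest_elt n \<circ> v) = positive_pairs - inversions n v" by auto
  have "inversions n v \<subseteq> positive_pairs" by (auto simp: inversions_def positive_pairs_def)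
  then show ?thesis
    unfolding len_def eq using card_Diff_subset[of "inversions n v" positive_pairs]
      card_mono[OF finite_positive_pairs] by fastforce
qed

lemma len_longest: "len n (longest_elt n) = card positive_pairs"
  using len_longest_comp[OF weyl_id[OF n2]] by simp

lemma longest_unique:
  assumes "w \<in> weyl_D n" "len n w = card positive_pairs" shows "w = longest_elt n"
  using maximal_unique[OF longest_in longest_max assms(1)] assms(2) len_le_pairs by simp

section \<open>The length generating function\<close>

text \<open>
  The parabolic subgroup that fixes the first \<open>k - 1\<close> coordinates.
\<close>

definition fixer :: "nat \<Rightarrow> (int \<Rightarrow> int) set" where
  "fixer k = {w \<in> weyl_D n. \<forall>j. 1 \<le> j \<longrightarrow> j < k \<longrightarrow> w (int j) = int j}"

text \<open>
  A left coset inside \<open>fixer k\<close> of the subgroup \<open>fixer (k + 1)\<close>, given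
  by the image \<open>a\<close> of \<open>k\<close>.
\<close>

definition fixer_to :: "nat \<Rightarrow> int \<Rightarrow> (int \<Rightarrow> int) set" where
  "fixer_to k a = {w \<in> fixer k. w (int k) = a}"

definition len_sum :: "'a :: comm_ring_1 \<Rightarrow> (int \<Rightarrow> int) set \<Rightarrow> 'a" where
  "len_sum t A = (\<Sum>w\<in>A. t ^ len n w)"

text \<open>
  Composition with the reflection is a bijection between neighbouring cosets, and it raises
  every length by one: the coordinate \<open>k\<close> is mapped to one coordinate of the root,
  the other one comes from a coordinate of larger absolute value, and so the root in question is
  positive.
\<close>

lemma len_sum_step:
  assumes k: "1 \<le> k" "k < n" and i: "k \<le> i" "i \<le> n" 
    and a: "a \<in> {rootp n i, rootq n i}" "int k \<le> \<bar>a\<bar>"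
  shows "len_sum t (fixer_to k (simple_refl n i a)) = t * len_sum t (fixer_to k a)"
proof -
  have i': "1 \<le> i" "i \<le> n" using k i by auto
  let ?s = "simple_refl n i"
  have fix_small: "?s (int j) = int j" if "1 \<le> j" "j < k" for j
    using that k i by (intro simple_refl_outside[OF n2 i']) (auto simp: rootp_def rootq_def)
  have mem: "?s \<circ> w \<in> fixer_to k (?s b)" if "w \<in> fixer_to k b" for w b
    using that fix_small weyl_comp[OF n2 weyl_simple_refl[OF n2]] i'
    by (auto simp: fixer_to_def fixer_def)
  have up: "len n (?s \<circ> w) = Suc (len n w)" if w: "w \<in> fixer_to k a" for w
  proof (rule len_simple_refl_up[OF _ i' n2])
    have wW: "w \<in> weyl_D n" and wk: "w (int k) = a" and wf: "\<And>j. 1 \<le> j \<Longrightarrow> j < k \<Longrightarrow> w (int j) = int j"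
      using w by (auto simp: fixer_to_def fixer_def)
    show sp: "signed_perm n w" by (rule weyl_signed_perm[OF n2 wW])
    have sv: "signed_perm n (finv w)" by (rule signed_perm_inv[OF sp])
    have bij: "bij w" and odd: "\<And>k. w (- k) = - w k" using sp by (auto simp: signed_perm_def)
    have fa: "finv w a = int k" using wk bij by (metis bij_is_inj inv_f_f)
    obtain b where b: "{rootp n i, rootq n i} = {a, b}" "b \<in> labels n" "\<bar>b\<bar> \<noteq> \<bar>a\<bar>" "int k \<le> \<bar>b\<bar>"
    proof -
      have abs: "\<bar>rootp n i\<bar> \<noteq> \<bar>rootq n i\<bar>" using root_facts[OF i' n2] by (auto simp: abs_eq_iff)
      have ge: "int k \<le> \<bar>rootp n i\<bar>" "int k \<le> \<bar>rootq n i\<bar>"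
        using k i by (auto simp: rootp_def rootq_def)
      show ?thesis
      proof (cases "a = rootp n i")
        case True then show ?thesis using that[of "rootq n i"] abs ge root_facts[OF i' n2] by auto
      next
        case False then show ?thesis using that[of "rootp n i"] abs ge root_facts[OF i' n2] a by auto
      qed
    qed
    \<comment> \<open>the values on \<open>1, \<dots>, k\<close> are \<open>1, \<dots>, k - 1\<close> and \<open>a\<close>, and \<open>b\<close> is none of these up to sign\<close>
    have large: "int k < \<bar>finv w b\<bar>"
    proof (rule ccontr)
      define c where "c = finv w b"
      assume "\<not> int k < \<bar>finv w b\<bar>"
      then have c: "\<bar>c\<bar> \<le> int k" by (simp add: c_def)
      have wc: "w c = b" unfolding c_def using bij by (simp add: bij_is_surj surj_f_inv_f)
      have "c \<noteq> 0" using b(2) signed_perm_labels[OF sp, of c] wc by (auto simp: labels_def)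
      then have "\<bar>w c\<bar> = \<bar>w \<bar>c\<bar>\<bar>" using odd[of c] by (auto simp: abs_if)
      moreover have "w \<bar>c\<bar> = \<bar>c\<bar>" if "\<bar>c\<bar> < int k"
        using wf[of "nat \<bar>c\<bar>"] that \<open>c \<noteq> 0\<close> by auto
      ultimately have "\<bar>b\<bar> < int k \<or> \<bar>b\<bar> = \<bar>a\<bar>"
        using c wc wk by (cases "\<bar>c\<bar> < int k") auto
      with b show False by auto
    qed
    have "finv w b \<in> labels n" using b(2) by (simp add: signed_perm_labels[OF sv])
    then have "ht n (int k) + ht n (finv w b) > 0"
      using large k by (auto simp: labels_def ht_def sgn_if)
    moreover have "root_height n w i = ht n (finv w a) + ht n (finv w b)"
      using b(1) by (auto simp: root_height_def doubleton_eq_iff)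
    ultimately show "root_height n w i > 0" by (simp add: fa)
  qed
  have "len_sum t (fixer_to k (?s a)) = (\<Sum>w\<in>fixer_to k a. t ^ len n (?s \<circ> w))"
    unfolding len_sum_def
  proof (rule sum.reindex_bij_witness[of _ "\<lambda>w. ?s \<circ> w" "\<lambda>w. ?s \<circ> w"])
    show "?s \<circ> w \<in> fixer_to k a" if "w \<in> fixer_to k (?s a)" for w
      using mem[OF that] by (simp add: simple_refl_involution[OF i' n2])
    show "t ^ len n (?s \<circ> (?s \<circ> w)) = t ^ len n w" for w
      unfolding simple_refl_cancel[OF i' n2] ..
  qed (use mem simple_refl_cancel[OF i' n2] in auto)
  also have "\<dots> = t * len_sum t (fixer_to k a)"
    by (simp add: len_sum_def sum_distrib_left up)
  finally show ?thesis .
qed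

text \<open>
  The image of \<open>k\<close> runs through \<open>k, \<dots>, n\<close>, and through
  \<open>-n, \<dots>, -k\<close>, by one simple reflection for each step. The extra generator
  leads from \<open>n - 1\<close> to \<open>-n\<close> and from \<open>n\<close> to \<open>-(n -
  1)\<close>, so \<open>n\<close> and \<open>-n\<close> are at the same distance; this doubles
  the middle term and is the source of the factor \<open>1 + t\<^bsup>n-k\<^esup>\<close>.
\<close>

lemma len_sum_values:
  assumes k: "1 \<le> k" "k < n"
  shows "j \<le> n - k \<Longrightarrow> len_sum t (fixer_to k (int (k + j))) = t ^ j * len_sum t (fixer_to k (int k))"
    and "j \<le> n - k \<Longrightarrow> len_sum t (fixer_to k (- int (n - j))) = t ^ (n - k + j) * len_sum t (fixer_to k (int k))"
proof -
  show up: "j \<le> n - k \<Longrightarrow> len_sum t (fixer_to k (int (k + j))) = t ^ j * len_sum t (fixer_to k (int k))" for j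
  proof (induction j)
    case (Suc j)
    then have i: "k \<le> k + j" "k + j \<le> n" "1 \<le> k + j" "k + j < n" using k by auto
    have "len_sum t (fixer_to k (simple_refl n (k + j) (rootp n (k + j)))) =
        t * len_sum t (fixer_to k (rootp n (k + j)))"
      using i by (intro len_sum_step[OF k i(1,2)]) (auto simp: rootp_def)
    moreover have "rootp n (k + j) = int (k + j)" "simple_refl n (k + j) (rootp n (k + j)) = int (k + Suc j)"
      using i n2 by (auto simp: rootp_def rootq_def simple_refl_eq)
    ultimately show ?case using Suc by (simp add: mult.assoc)
  qed simp
  show "j \<le> n - k \<Longrightarrow> len_sum t (fixer_to k (- int (n - j))) = t ^ (n - k + j) * len_sum t (fixer_to k (int k))"
  proof (induction j)
    case 0
    have "len_sum t (fixer_to k (simple_refl n n (rootp n n))) = t * len_sum t (fixer_to k (rootp n n))"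
      using k by (intro len_sum_step[OF k]) (auto simp: rootp_def)
    moreover have "rootp n n = int (k + (n - k - 1))" "simple_refl n n (rootp n n) = - int n"
      using k n2 by (auto simp: rootp_def rootq_def simple_refl_eq)
    moreover have "t * t ^ (n - k - 1) = t ^ (n - k)"
      using k by (metis Suc_diff_Suc diff_Suc_eq_diff_pred diff_right_commute power_Suc zero_less_diff Suc_pred')
    ultimately show ?case using up[of "n - k - 1"] by (simp flip: mult.assoc)
  next
    case (Suc j)
    show ?case
    proof (cases "j = 0")
      case True
      have "len_sum t (fixer_to k (simple_refl n n (rootq n n))) = t * len_sum t (fixer_to k (rootq n n))"
        using k by (intro len_sum_step[OF k]) (auto simp: rootq_def)
      moreover have "rootq n n = int (k + (n - k))" "simple_refl n n (rootq n n) = - int (n - 1)"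
        using k n2 by (auto simp: rootp_def rootq_def simple_refl_eq of_nat_diff)
      ultimately show ?thesis using up[of "n - k"] True by (simp add: mult.assoc)
    next
      case False
      let ?i = "n - Suc j"
      have i: "k \<le> ?i" "?i \<le> n" "1 \<le> ?i" "?i < n" using k Suc.prems by auto
      have "rootq n ?i = - int ?i - 1" using i by (simp add: rootq_def)
      also have "\<dots> = - int (n - j)" using Suc.prems k by (simp add: of_nat_diff)
      finally have q: "rootq n ?i = - int (n - j)" .
      have p: "rootp n ?i = int ?i" using i by (simp add: rootp_def)
      have "len_sum t (fixer_to k (simple_refl n ?i (rootq n ?i))) = t * len_sum t (fixer_to k (rootq n ?i))"
        using i q Suc.prems by (intro len_sum_step[OF k i(1,2)]) auto
      moreover have "simple_refl n ?i (rootq n ?i) = - int ?i"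
        using simple_refl_root(2)[OF i(3,2) n2] p by simp
      ultimately show ?thesis using Suc q by (simp add: mult.assoc)
    qed
  qed
qed

text \<open>
  The sum over the images of \<open>k\<close> is \<open>(1 + \<cdots> + t\<^bsup>n-k\<^esup>) +
  t\<^bsup>n-k\<^esup> (1 + \<cdots> + t\<^bsup>n-k\<^esup>)\<close>.
\<close>

lemma len_sum_fixer_step:
  assumes k: "1 \<le> k" "k < n"
  shows "len_sum t (fixer k) = (1 + t ^ (n - k)) * (\<Sum>j\<le>n - k. t ^ j) * len_sum t (fixer (Suc k))"
proof -
  have fin: "finite (fixer_to k a)" for a
    by (rule finite_subset[OF _ finite_weyl_D]) (auto simp: fixer_to_def fixer_def)
  let ?P = "(\<lambda>j. int (k + j)) ` {..n - k}" and ?M = "(\<lambda>j. - int (n - j)) ` {..n - k}"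
  have vals: "w (int k) \<in> ?P \<union> ?M" if w: "w \<in> fixer k" for w
  proof -
    have sp: "signed_perm n w" and wf: "\<And>j. 1 \<le> j \<Longrightarrow> j < k \<Longrightarrow> w (int j) = int j"
      using w weyl_signed_perm[OF n2] by (auto simp: fixer_def)
    have "int k \<in> labels n" using k by (simp add: labels_def)
    then have lab: "w (int k) \<in> labels n" by (simp only: signed_perm_labels[OF sp])
    have "inj w" and odd: "\<And>j. w (- j) = - w j" using sp by (auto simp: signed_perm_def bij_is_inj)
    have ge: "int k \<le> \<bar>w (int k)\<bar>"
    proof (rule ccontr)
      define c where "c = \<bar>w (int k)\<bar>"
      assume "\<not> int k \<le> \<bar>w (int k)\<bar>"
      then have c: "c < int k" "c > 0" using lab by (auto simp: c_def labels_def)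
      then have "w c = c" using wf[of "nat c"] by auto
      then have "w c = w (int k) \<or> w (- c) = w (int k)" using odd[of c] by (auto simp: c_def abs_if)
      then have "c = int k \<or> - c = int k" using \<open>inj w\<close> by (metis inj_eq)
      with c show False by auto
    qed
    show ?thesis
    proof (cases "w (int k) > 0")
      case True
      then show ?thesis using ge lab k
        by (intro UnI1 image_eqI[of _ _ "nat (w (int k)) - k"]) (auto simp: labels_def)
    next
      case False
      then show ?thesis using ge lab k
        by (intro UnI2 image_eqI[of _ _ "n - nat (- w (int k))"]) (auto simp: labels_def)
    qed
  qed
  have "len_sum t (fixer k) = (\<Sum>a\<in>?P \<union> ?M. len_sum t (fixer_to k a))"
  proof -
    have "fixer k = (\<Union>a\<in>?P \<union> ?M. fixer_to k a)"
      using vals by (auto simp: fixer_to_def)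
    then show ?thesis unfolding len_sum_def
      by (simp only:) (subst sum.UNION_disjoint, use fin in \<open>auto simp: fixer_to_def\<close>)
  qed
  also have "\<dots> = (\<Sum>a\<in>?P. len_sum t (fixer_to k a)) + (\<Sum>a\<in>?M. len_sum t (fixer_to k a))"
    using k by (intro sum.union_disjoint) auto
  also have "(\<Sum>a\<in>?P. len_sum t (fixer_to k a)) = (\<Sum>j\<le>n - k. len_sum t (fixer_to k (int (k + j))))"
    by (subst sum.reindex) (auto simp: inj_on_def)
  also have "(\<Sum>a\<in>?M. len_sum t (fixer_to k a)) = (\<Sum>j\<le>n - k. len_sum t (fixer_to k (- int (n - j))))"
    by (subst sum.reindex) (auto simp: inj_on_def)
  also have "(\<Sum>j\<le>n - k. len_sum t (fixer_to k (int (k + j)))) =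
      (\<Sum>j\<le>n - k. t ^ j) * len_sum t (fixer_to k (int k))"
    unfolding sum_distrib_right by (rule sum.cong[OF refl], rule len_sum_values(1)[OF k]) simp
  also have "(\<Sum>j\<le>n - k. len_sum t (fixer_to k (- int (n - j)))) =
      t ^ (n - k) * (\<Sum>j\<le>n - k. t ^ j) * len_sum t (fixer_to k (int k))"
    unfolding sum_distrib_right sum_distrib_left
    by (rule sum.cong[OF refl], subst len_sum_values(2)[OF k]) (simp_all add: power_add)
  also have "fixer_to k (int k) = fixer (Suc k)"
    using k by (auto simp: fixer_to_def fixer_def less_Suc_eq)
  finally show ?thesis by (simp add: algebra_simps)
qed

lemma len_sum_weyl:
  "len_sum t (weyl_D n) = (\<Prod>m=1..<n. (1 + t ^ m) * (\<Sum>j\<le>m. t ^ j))"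
proof -
  have "fixer n = {id}"
  proof
    show "fixer n \<subseteq> {id}"
    proof
      fix w assume "w \<in> fixer n"
      then have "w = id"
        by (intro weyl_determined[OF n2] weyl_id[OF n2]) (auto simp: fixer_def)
      then show "w \<in> {id}" by simp
    qed
  qed (use weyl_id[OF n2] in \<open>auto simp: fixer_def\<close>)
  then have base: "len_sum t (fixer n) = 1" by (simp add: len_sum_def)
  have "len_sum t (fixer (n - d)) = (\<Prod>m=1..d. (1 + t ^ m) * (\<Sum>j\<le>m. t ^ j))" if "d < n" for d
    using that
  proof (induction d)
    case 0 then show ?case using base by simp
  next
    case (Suc d)
    then have k: "1 \<le> n - Suc d" "n - Suc d < n" "n - (n - Suc d) = Suc d" "Suc (n - Suc d) = n - d"
      by arith+
    show ?case
      using len_sum_fixer_step[OF k(1,2), of t] Suc unfolding k(3,4)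
      by (simp add: mult_ac)
  qed
  from this[of "n - 1"] have "len_sum t (fixer 1) = (\<Prod>m=1..n - 1. (1 + t ^ m) * (\<Sum>j\<le>m. t ^ j))"
    using n2 by simp
  moreover have "fixer 1 = weyl_D n" by (auto simp: fixer_def)
  moreover have "{1..n - 1} = {1..<n}" using n2 by auto
  ultimately show ?thesis by (simp only:)
qed

end

section \<open>Supports\<close>

definition expos_on :: "nat set \<Rightarrow> expo set" where
  "expos_on V = {m. Poly_Mapping.keys m \<subseteq> V}"

lemma expos_on_add: "m \<in> expos_on V \<Longrightarrow> k \<in> expos_on V \<Longrightarrow> m + k \<in> expos_on V"
  using keys_add[of m k] by (auto simp: expos_on_def)

text \<open>
  Elements in the variables with index in \<open>V\<close> and with coefficients in
  \<open>R\<close>. For \<open>V = {1..n}\<close>, integral and rational coefficients give the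
  images of the two rings of the theorem.
\<close>

abbreviation supp :: "rat set \<Rightarrow> nat set \<Rightarrow> oddpoly set" where
  "supp R V \<equiv> coeff_in R (expos_on V)"

lemma supp_var: "additive_coeffs R \<Longrightarrow> j \<in> V \<Longrightarrow> var j \<in> supp R V"
  unfolding var_def by (subst coeff_in_monomial) (auto simp: expos_on_def additive_coeffs_def)

lemma supp_scal: "additive_coeffs R \<Longrightarrow> c \<in> R \<Longrightarrow> scal c \<in> supp R V"
  unfolding scal_def by (subst coeff_in_monomial) (auto simp: expos_on_def)

lemma supp_add: "additive_coeffs R \<Longrightarrow> f \<in> supp R V \<Longrightarrow> g \<in> supp R V \<Longrightarrow> f + g \<in> supp R V"
  by (rule coeff_in_add)

lemma supp_mult: "additive_coeffs R \<Longrightarrow> f \<in> supp R V \<Longrightarrow> g \<in> supp R V \<Longrightarrow> f * g \<in> supp R V"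
  by (rule coeff_in_mult[OF _ expos_on_add])

lemma supp_1: "additive_coeffs R \<Longrightarrow> 1 \<in> supp R V"
  using supp_scal[of R 1] by (simp add: additive_coeffs_def)

lemma supp_uminus: "additive_coeffs R \<Longrightarrow> f \<in> supp R V \<Longrightarrow> - f \<in> supp R V"
  using supp_mult[OF _ supp_scal[of R "-1" V], of f] by (simp add: additive_coeffs_def)

lemma supp_diff: "additive_coeffs R \<Longrightarrow> f \<in> supp R V \<Longrightarrow> g \<in> supp R V \<Longrightarrow> f - g \<in> supp R V"
  using supp_add[OF _ _ supp_uminus] by fastforce

lemma supp_sum: "additive_coeffs R \<Longrightarrow> (\<And>a. a \<in> A \<Longrightarrow> g a \<in> supp R V) \<Longrightarrow> (\<Sum>a\<in>A. g a) \<in> supp R V"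
  by (induction A rule: infinite_finite_induct) (auto intro: supp_add)

lemma supp_power: "additive_coeffs R \<Longrightarrow> f \<in> supp R V \<Longrightarrow> f ^ k \<in> supp R V"
  by (induction k) (auto intro: supp_mult supp_1)

text \<open>
  The counterpart of \<open>oddpoly_var_induct\<close> that keeps to given variables and
  coefficients; the sign of the reordering is absorbed into the coefficient.
\<close>

lemma supp_var_induct [consumes 2, case_names scal var add]:
  assumes f: "f \<in> supp R V" and R: "additive_coeffs R"
    and scal: "\<And>c. c \<in> R \<Longrightarrow> P (scal c)" and var: "\<And>j f. j \<in> V \<Longrightarrow> P f \<Longrightarrow> P (var j * f)"
    and add: "\<And>f g. P f \<Longrightarrow> P g \<Longrightarrow> P (f + g)"
  shows "P f"
  using f
proof (induction rule: coeff_in_monomial_induct)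
  case zero then show ?case using scal[of 0] R by (simp add: additive_coeffs_def)
next
  case (monomial m c)
  then show ?case
  proof (induction "total_degree m" arbitrary: m c)
    case 0 then show ?case using scal[of c] by (simp add: scal_def)
  next
    case (Suc d)
    then have "Poly_Mapping.keys m \<noteq> {}" by (auto simp: total_degree_def)
    then obtain j where j: "j \<in> Poly_Mapping.keys m" by blast
    then obtain m' where m': "m = Poly_Mapping.single j 1 + m'" "total_degree m = Suc (total_degree m')"
      by (rule expo_split)
    have "Poly_Mapping.keys m' \<subseteq> Poly_Mapping.keys m"
      unfolding m'(1) by (auto simp: in_keys_iff lookup_add)
    then have V: "m' \<in> expos_on V" "j \<in> V" using Suc.prems j by (auto simp: expos_on_def)
    let ?s = "crossing_sign (Poly_Mapping.single j 1) m'"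
    have s: "?s = 1 \<or> ?s = -1" unfolding crossing_sign_def by (metis neg_one_even_power neg_one_odd_power)
    then have "?s * ?s = 1" by auto
    then have "monomial m c = var j * monomial m' (?s * c)"
      by (simp add: var_def monomial_mult m'(1) flip: mult.assoc)
    moreover have "?s * c \<in> R" using s Suc.prems R by (auto simp: additive_coeffs_def)
    then have "P (monomial m' (?s * c))" using Suc m' V by auto
    ultimately show ?case using var[OF V(2)] by simp
  qed
qed (rule add)

lemma unit_coeff: "additive_coeffs R \<Longrightarrow> sgn_unit e \<Longrightarrow> e \<in> R"
  by (auto simp: sgn_unit_def additive_coeffs_def)

lemma refl_hom_supp:
  assumes f: "f \<in> supp R V" and R: "additive_coeffs R" and e: "sgn_unit e" and a: "a \<in> V" "Suc a \<in> V"
  shows "refl_hom a e f \<in> supp R V"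
  using f R
proof (induction rule: supp_var_induct)
  case (var j f)
  have "refl_hom a e (var j) \<in> supp R V"
    using a var(1) unit_coeff[OF R e] R
    by (auto simp: refl_hom_var intro!: supp_uminus supp_mult supp_var supp_scal)
  with var show ?case by (simp add: refl_hom_simps supp_mult R)
qed (auto simp: refl_hom_simps intro: supp_scal supp_add R)

lemma dem_supp:
  assumes f: "f \<in> supp R V" and R: "additive_coeffs R" and e: "sgn_unit e" and a: "a \<in> V" "Suc a \<in> V"
  shows "dem a e f \<in> supp R V"
proof -
  have "dem a e f \<in> supp R V \<and> f \<in> supp R V"
    using f R
  proof (induction rule: supp_var_induct)
    case (var j f)
    have "scal (var_derivative a e j) \<in> supp R V"
      using unit_coeff[OF R e] R by (intro supp_scal) (auto simp: var_derivative_def additive_coeffs_def)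
    moreover have "refl_hom a e (var j) \<in> supp R V"
      by (rule refl_hom_supp[OF supp_var R e a]) (use R var in auto)
    ultimately show ?case using var R
      by (auto simp: dem_mult[OF e] dem_var[OF e] intro!: supp_add supp_mult supp_var)
  qed (auto simp: dem_simps[OF e] intro: supp_scal supp_add R)
  then show ?thesis ..
qed

lemma demD_supp:
  assumes "f \<in> supp R {1..n}" "additive_coeffs R" "2 \<le> n" "i \<in> {1..n}"
  shows "demD n i f \<in> supp R {1..n}" "reflD n i f \<in> supp R {1..n}"
  unfolding demD_def reflD_def
  by (rule dem_supp refl_hom_supp; use assms in \<open>auto simp: pos_def\<close>)+

lemma dems_supp:
  assumes "f \<in> supp R {1..n}" "additive_coeffs R" "2 \<le> n" "is \<in> lists {1..n}"
  shows "dems n is f \<in> supp R {1..n}"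
  using assms(4)
proof (induction "is" rule: lists.induct)
  case (Cons i "is") then show ?case using demD_supp(1)[OF _ assms(2,3)] by simp
qed (use assms in simp)

section \<open>Words of operators\<close>

text \<open>
  The operators of different reduced words differ by a sign that does not depend on the
  argument.
\<close>

definition same_up_to_sign :: "(oddpoly \<Rightarrow> oddpoly) \<Rightarrow> (oddpoly \<Rightarrow> oddpoly) \<Rightarrow> bool" where
  "same_up_to_sign F G \<longleftrightarrow> (\<exists>c. (c = 1 \<or> c = -1) \<and> (\<forall>f. F f = scal c * G f))"

lemma same_up_to_sign_refl: "same_up_to_sign F F"
  unfolding same_up_to_sign_def by (rule exI[of _ 1]) simp

lemma same_up_to_sign_sym: "same_up_to_sign F G \<Longrightarrow> same_up_to_sign G F"
  unfolding same_up_to_sign_def by auto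

lemma same_up_to_sign_trans: "same_up_to_sign F G \<Longrightarrow> same_up_to_sign G H \<Longrightarrow> same_up_to_sign F H"
  unfolding same_up_to_sign_def by auto

lemma same_up_to_sign_demD:
  "same_up_to_sign F G \<Longrightarrow> same_up_to_sign (\<lambda>f. demD n i (F f)) (\<lambda>f. demD n i (G f))"
  unfolding same_up_to_sign_def by (auto simp: demD_linear)

lemma same_up_to_sign_zero: "same_up_to_sign F G \<Longrightarrow> G f = 0 \<Longrightarrow> F f = 0"
  unfolding same_up_to_sign_def by auto

lemma dems_Cons_fun: "dems n (i # is) = (\<lambda>f. demD n i (dems n is f))"
  by (simp add: fun_eq_iff)

context
  fixes n :: nat
  assumes n2: "2 \<le> n"
begin

definition reduced :: "nat list \<Rightarrow> bool" where
  "reduced is \<longleftrightarrow> is \<in> lists {1..n} \<and> length is = len n (word_prod n is)"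

lemma word_in_weyl: "is \<in> lists {1..n} \<Longrightarrow> word_prod n is \<in> weyl_D n"
  unfolding weyl_D_eq[OF n2] by (rule imageI)

lemma reduced_word_exists:
  assumes "w \<in> weyl_D n"
  obtains "is" where "reduced is" "word_prod n is = w"
  using weyl_reduced_word[OF n2 assms] reduced_def by metis

lemma len_cons:
  assumes "i \<in> {1..n}" "w \<in> weyl_D n"
  shows "root_height n w i > 0 \<Longrightarrow> len n (simple_refl n i \<circ> w) = Suc (len n w)"
    "root_height n w i < 0 \<Longrightarrow> len n w = Suc (len n (simple_refl n i \<circ> w))"
    "root_height n w i \<noteq> 0"
  using len_simple_refl_up[OF weyl_signed_perm[OF n2 assms(2)], of i]
    len_simple_refl_down[OF weyl_signed_perm[OF n2 assms(2)], of i]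
    root_height_nonzero[OF weyl_signed_perm[OF n2 assms(2)], of i] assms(1) n2 by auto

lemma reduced_Cons:
  assumes "reduced (i # is)"
  shows "reduced is" "i \<in> {1..n}" "root_height n (word_prod n (i # is)) i < 0"
    "simple_refl n i \<circ> word_prod n (i # is) = word_prod n is"
proof -
  have i: "i \<in> {1..n}" "is \<in> lists {1..n}" and l: "Suc (length is) = len n (simple_refl n i \<circ> word_prod n is)"
    using assms by (auto simp: reduced_def)
  show "i \<in> {1..n}" by (fact i(1))
  note W = word_in_weyl[OF i(2)]
  have le: "len n (word_prod n is) \<le> length is" by (rule len_word_le[OF n2 i(2)])
  have pos: "root_height n (word_prod n is) i > 0"
    using len_cons[OF i(1) W] l le by linarith
  then show "reduced is" using len_cons(1)[OF i(1) W] l i by (simp add: reduced_def)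
  have ii: "1 \<le> i" "i \<le> n" using i by auto
  show "root_height n (word_prod n (i # is)) i < 0"
    unfolding word_prod_simps
    using root_height_simple_refl[OF weyl_signed_perm[OF n2 W] ii n2] pos by linarith
  show "simple_refl n i \<circ> word_prod n (i # is) = word_prod n is"
    unfolding word_prod_simps by (rule simple_refl_cancel[OF ii n2])
qed

lemma reduced_ConsI:
  assumes "reduced is" "i \<in> {1..n}" "w \<in> weyl_D n" "root_height n w i < 0" "word_prod n is = simple_refl n i \<circ> w"
  shows "reduced (i # is)" "word_prod n (i # is) = w"
proof -
  show w: "word_prod n (i # is) = w"
    unfolding word_prod_simps assms(5) using assms(2) n2 by (intro simple_refl_cancel) auto
  show "reduced (i # is)"
    using assms(1,2) len_cons(2)[OF assms(2,3,4)] unfolding reduced_def w by (auto simp: assms(5))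
qed

text \<open>
  Matsumoto's argument, by induction on the length. If the first letters \<open>i\<close> and
  \<open>j\<close> differ, both are descents, hence the element has reduced words that begin
  with \<open>i j \<cdots>\<close> and \<open>j i \<cdots>\<close>, or with \<open>i j i
  \<cdots>\<close> and \<open>j i j \<cdots>\<close>, and continue in the same way. The relation
  between the operators compares these two words, and the induction hypothesis compares each of
  them with one of the given words.
\<close>

lemma reduced_words_agree:
  "reduced is \<Longrightarrow> reduced js \<Longrightarrow> word_prod n is = word_prod n js \<Longrightarrow>
    same_up_to_sign (dems n is) (dems n js)"
proof (induction "length is" arbitrary: "is" js rule: less_induct)
  case less
  define w where "w = word_prod n is"
  have len: "length is = length js" using less.prems by (simp add: reduced_def)
  show ?case
  proof (cases "is")
    case Nil
    then show ?thesis using len by (simp add: same_up_to_sign_refl)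
  next
    case (Cons i is')
    then obtain j js' where js: "js = j # js'" using len by (cases js) auto
    have I: "reduced is'" "i \<in> {1..n}" "root_height n w i < 0" "simple_refl n i \<circ> w = word_prod n is'"
      using reduced_Cons less.prems(1) unfolding Cons w_def by blast+
    have J: "reduced js'" "j \<in> {1..n}" "root_height n w j < 0" "simple_refl n j \<circ> w = word_prod n js'"
      using reduced_Cons less.prems(2) less.prems(3) unfolding js Cons w_def by metis+
    have W: "w \<in> weyl_D n" using less.prems(1) by (simp add: w_def reduced_def word_in_weyl)
    have IH: "same_up_to_sign (dems n ks) (dems n ls)"
      if "length ks = length is'" "reduced ks" "reduced ls" "word_prod n ks = word_prod n ls" for ks ls
      using less.hyps[of ks ls] that by (simp add: Cons)
    have lI: "len n w = Suc (length is')" "length js' = length is'"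
      using less.prems(1) len by (auto simp: reduced_def w_def Cons js)
    have ii: "1 \<le> i" "i \<le> n" "1 \<le> j" "j \<le> n" using I J by auto
    have sI: "simple_refl n i \<in> weyl_D n" "simple_refl n j \<in> weyl_D n"
      using weyl_simple_refl[OF n2] I J by auto
    note c = weyl_comp[OF n2]
    note sp = weyl_signed_perm[OF n2 W]
    consider "i = j" | "i \<noteq> j" "\<not> adjacent n i j" | "i \<noteq> j" "adjacent n i j" by blast
    then show ?thesis
    proof cases
      case 1
      then have "same_up_to_sign (dems n is') (dems n js')"
        by (intro IH I J) (use I J in simp_all)
      from same_up_to_sign_demD[OF this, of n i] show ?thesis
        unfolding Cons js 1 by (simp only: dems_Cons_fun)
    next
      case 2
      let ?wi = "simple_refl n i \<circ> w" and ?wj = "simple_refl n j \<circ> w"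
      let ?w2 = "simple_refl n j \<circ> ?wi"
      have W2: "?w2 \<in> weyl_D n" by (intro c sI W)
      obtain ks where ks: "reduced ks" "word_prod n ks = ?w2" by (rule reduced_word_exists[OF W2])
      have d: "root_height n ?wi j < 0" using descents_commuting[OF n2 sp ii 2 J(3)] .
      have adj': "\<not> adjacent n j i" using 2 by (auto simp: adjacent_def min.commute max.commute)
      have d': "root_height n ?wj i < 0"
        using descents_commuting[OF n2 sp ii(3,4,1,2) 2(1)[symmetric] adj' I(3)] .
      have w2: "?w2 = simple_refl n i \<circ> ?wj"
        using simple_refl_commute[OF n2 ii 2] by (metis comp_assoc)
      have A: "reduced (j # ks)" "word_prod n (j # ks) = ?wi"
        using reduced_ConsI[OF ks(1) J(2) c[OF sI(1) W] d ks(2)] by auto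
      have B: "reduced (i # ks)" "word_prod n (i # ks) = ?wj"
        using reduced_ConsI[OF ks(1) I(2) c[OF sI(2) W] d'] ks(2) w2 by auto
      have "same_up_to_sign (dems n is') (dems n (j # ks))"
        by (rule IH) (use A I in simp_all)
      then have 1: "same_up_to_sign (dems n is) (dems n (i # j # ks))"
        using same_up_to_sign_demD[of "dems n is'" "dems n (j # ks)" n i] unfolding Cons by (simp only: dems_Cons_fun)
      have "same_up_to_sign (dems n js') (dems n (i # ks))"
        by (rule IH) (use B J lI in simp_all)
      then have 2: "same_up_to_sign (dems n js) (dems n (j # i # ks))"
        using same_up_to_sign_demD[of "dems n js'" "dems n (i # ks)" n j] unfolding js by (simp only: dems_Cons_fun)
      have "same_up_to_sign (dems n (i # j # ks)) (dems n (j # i # ks))"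
      proof -
        obtain c where "c = 1 \<or> c = -1" "\<And>f. demD n i (demD n j f) = scal c * demD n j (demD n i f)"
          using demD_commute[of n i j] \<open>\<not> adjacent n i j\<close> \<open>i \<noteq> j\<close> ii by auto
        then show ?thesis unfolding same_up_to_sign_def by (intro exI[of _ c]) simp
      qed
      with 1 2 show ?thesis by (meson same_up_to_sign_trans same_up_to_sign_sym)
    next
      case 3
      let ?wi = "simple_refl n i \<circ> w" and ?wj = "simple_refl n j \<circ> w"
      let ?wji = "simple_refl n j \<circ> ?wi" and ?wij = "simple_refl n i \<circ> ?wj"
      let ?w3 = "simple_refl n i \<circ> ?wji"
      have W3: "?w3 \<in> weyl_D n" by (intro c sI W)
      obtain ks where ks: "reduced ks" "word_prod n ks = ?w3" by (rule reduced_word_exists[OF W3])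
      have adj': "adjacent n j i" using 3 by (auto simp: adjacent_def min.commute max.commute)
      note d = descents_braid[OF n2 sp ii 3(2) I(3) J(3)]
      note d' = descents_braid[OF n2 sp ii(3,4,1,2) adj' J(3) I(3)]
      have w3: "?w3 = simple_refl n j \<circ> ?wij"
        using simple_refl_braid[OF n2 ii 3(2)] by (metis comp_assoc)
      have A1: "reduced (i # ks)" "word_prod n (i # ks) = ?wji"
        using reduced_ConsI[OF ks(1) I(2) c[OF sI(2) c[OF sI(1) W]] d(2) ks(2)] by auto
      have A: "reduced (j # i # ks)" "word_prod n (j # i # ks) = ?wi"
        using reduced_ConsI[OF A1(1) J(2) c[OF sI(1) W] d(1) A1(2)] by auto
      have B1: "reduced (j # ks)" "word_prod n (j # ks) = ?wij"
        using reduced_ConsI[OF ks(1) J(2) c[OF sI(1) c[OF sI(2) W]] d'(2)] ks(2) w3 by auto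
      have B: "reduced (i # j # ks)" "word_prod n (i # j # ks) = ?wj"
        using reduced_ConsI[OF B1(1) I(2) c[OF sI(2) W] d'(1) B1(2)] by auto
      have "same_up_to_sign (dems n is') (dems n (j # i # ks))"
        by (rule IH) (use A I in simp_all)
      then have 1: "same_up_to_sign (dems n is) (dems n (i # j # i # ks))"
        using same_up_to_sign_demD[of "dems n is'" "dems n (j # i # ks)" n i] unfolding Cons by (simp only: dems_Cons_fun)
      have "same_up_to_sign (dems n js') (dems n (i # j # ks))"
        by (rule IH) (use B J lI in simp_all)
      then have 2: "same_up_to_sign (dems n js) (dems n (j # i # j # ks))"
        using same_up_to_sign_demD[of "dems n js'" "dems n (i # j # ks)" n j] unfolding js by (simp only: dems_Cons_fun)
      have "dems n (i # j # i # ks) = dems n (j # i # j # ks)"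
        using demD_braid[OF 3(2)] ii by (simp add: fun_eq_iff)
      with 1 2 show ?thesis by (metis same_up_to_sign_trans same_up_to_sign_sym)
    qed
  qed
qed

text \<open>
  At the first letter \<open>i\<close>, from the right, where the word stops being reduced, the
  rest of it can be replaced by a reduced word that begins with \<open>i\<close>, and
  \<open>\<partial>\<^sub>i\<^sup>2 = 0\<close>.
\<close>

lemma dems_not_reduced:
  assumes "is \<in> lists {1..n}" "\<not> reduced is"
  shows "dems n is f = 0"
  using assms
proof (induction "is" rule: lists.induct)
  case Nil then show ?case by (simp add: reduced_def)
next
  case (Cons i "is")
  show ?case
  proof (cases "reduced is")
    case False then show ?thesis using Cons by (simp add: demD_linear)
  next
    case True
    let ?w = "word_prod n is"
    have W: "?w \<in> weyl_D n" using Cons by (simp add: word_in_weyl)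
    have "\<not> root_height n ?w i > 0"
      using len_cons(1)[OF Cons.hyps(1) W] Cons True by (auto simp: reduced_def)
    then have d: "root_height n ?w i < 0" using len_cons(3)[OF Cons.hyps(1) W] by linarith
    have sW: "simple_refl n i \<circ> ?w \<in> weyl_D n"
      using Cons by (intro weyl_comp[OF n2] weyl_simple_refl[OF n2] W) auto
    obtain ks where ks: "reduced ks" "word_prod n ks = simple_refl n i \<circ> ?w"
      by (rule reduced_word_exists[OF sW])
    from reduced_ConsI[OF ks(1) Cons.hyps(1) W d ks(2)]
    have "same_up_to_sign (dems n is) (dems n (i # ks))"
      by (intro reduced_words_agree True) auto
    from same_up_to_sign_demD[OF this, of n i]
    have "same_up_to_sign (dems n (i # is)) (\<lambda>f. demD n i (demD n i (dems n ks f)))"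
      by (simp only: dems_Cons_fun)
    then show ?thesis by (rule same_up_to_sign_zero) (rule demD_square)
  qed
qed

end

section \<open>Expansion in Schubert polynomials\<close>

text \<open>
  For all variables at once; the ring of the theorem arises by restricting to the variables
  \<open>x\<^sub>1, \<dots>, x\<^sub>n\<close>.
\<close>

definition invariants :: "nat \<Rightarrow> oddpoly set" where
  "invariants n = {f. \<forall>i\<in>{1..n}. demD n i f = 0}"

text \<open>
  In \<open>\<partial>(f g) = \<partial>(f) g + s(f) \<partial>(g)\<close> the second term
  vanishes for an invariant \<open>g\<close>. There is no such formula on the left, which is why
  the left module needs a separate argument.
\<close>

lemma dems_invariant_right:
  assumes "is \<in> lists {1..n}" "g \<in> invariants n"
  shows "dems n is (f * g) = dems n is f * g"
  using assms(1)
  by (induction "is" rule: lists.induct) (use assms(2) in \<open>auto simp: invariants_def demD_left_factor\<close>)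

lemma dems_diff: "dems n is (f - g) = dems n is f - dems n is g"
  by (induction "is") (simp_all add: demD_linear)

lemma invariants_closed:
  "f \<in> invariants n \<Longrightarrow> g \<in> invariants n \<Longrightarrow> f + g \<in> invariants n"
  "f \<in> invariants n \<Longrightarrow> g \<in> invariants n \<Longrightarrow> f * g \<in> invariants n"
  "f \<in> invariants n \<Longrightarrow> g \<in> invariants n \<Longrightarrow> f - g \<in> invariants n"
  "f \<in> invariants n \<Longrightarrow> - f \<in> invariants n"
  "scal c \<in> invariants n" "0 \<in> invariants n" "1 \<in> invariants n"
  by (simp_all add: invariants_def demD_linear demD_mult)

context
  fixes n :: nat and red :: "(int \<Rightarrow> int) \<Rightarrow> nat list"
  assumes n2: "2 \<le> n" and red: "\<And>w. w \<in> weyl_D n \<Longrightarrow> reduced n (red w) \<and> word_prod n (red w) = w"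
begin

definition topp :: oddpoly where "topp = top_poly n 1"
text \<open>
  Indexed by the element whose operator is applied, and not by \<open>w\<close> with \<open>u =
  w\<^sup>-\<^sup>1 w\<^sub>0\<close>; this makes the pairing below a product in the group.
\<close>

definition schub :: "(int \<Rightarrow> int) \<Rightarrow> oddpoly" where "schub u = dems n (red u) topp"
definition wlong :: "int \<Rightarrow> int" where "wlong = longest_elt n"
definition top_len :: nat where "top_len = card (positive_pairs n)"

lemma red_props: "w \<in> weyl_D n \<Longrightarrow> red w \<in> lists {1..n}" "w \<in> weyl_D n \<Longrightarrow> length (red w) = len n w"
  "w \<in> weyl_D n \<Longrightarrow> word_prod n (red w) = w"
  using red reduced_def[OF n2] by auto

lemma wlong_in: "wlong \<in> weyl_D n" unfolding wlong_def by (rule longest_in[OF n2])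

lemma long_word_in: "long_word n 1 \<in> lists {1..n}"
  by (auto simp: long_word_def coset_word_set)

text \<open>
  The explicit word maps the top monomial to a nonzero constant, so it is reduced. Its length
  \<open>n (n - 1)\<close> attains the bound on the number of inversions, and therefore it is a
  word of the longest element.
\<close>

lemma dems_wlong:
  shows "\<exists>c. c \<noteq> 0 \<and> dems n (red wlong) topp = scal c" and top_len_eq: "top_len = n * (n - 1)"
proof -
  obtain c where c: "c \<noteq> 0" "dems n (long_word n 1) topp = scal c"
    using dems_long_word[of 1 n] n2 unfolding topp_def by auto
  then have r: "reduced n (long_word n 1)"
    using dems_not_reduced[OF n2 long_word_in, of topp] by auto
  let ?w = "word_prod n (long_word n 1)"
  have l: "len n ?w = n * (n - 1)"
    using r length_long_word[of n] unfolding reduced_def[OF n2] by simp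
  show t: "top_len = n * (n - 1)"
    using l len_le_pairs[OF n2, of ?w] card_positive_pairs_le[OF n2] by (simp add: top_len_def)
  have "?w = wlong"
    unfolding wlong_def using l t
    by (intro longest_unique[OF n2] word_in_weyl[OF n2] long_word_in) (simp add: top_len_def)
  then have "same_up_to_sign (dems n (red wlong)) (dems n (long_word n 1))"
    using red[OF wlong_in] r by (intro reduced_words_agree[OF n2]) auto
  then obtain s where "s = 1 \<or> s = -1"
    and s: "\<And>f. dems n (red wlong) f = scal s * dems n (long_word n 1) f"
    unfolding same_up_to_sign_def by blast
  moreover have "dems n (red wlong) topp = scal (s * c)" unfolding s c(2) by simp
  ultimately show "\<exists>c. c \<noteq> 0 \<and> dems n (red wlong) topp = scal c" using c(1) by (intro exI[of _ "s * c"]) auto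
qed

lemma len_le_top: "w \<in> weyl_D n \<Longrightarrow> len n w \<le> top_len"
  unfolding top_len_def by (rule len_le_pairs[OF n2])

text \<open>
  The element whose operator pairs \<open>schub u\<close> to a nonzero constant.
\<close>

definition dual :: "(int \<Rightarrow> int) \<Rightarrow> int \<Rightarrow> int" where "dual u = wlong \<circ> finv u"

lemma dual_props:
  assumes "u \<in> weyl_D n"
  shows "dual u \<in> weyl_D n" "len n (dual u) + len n u = top_len" "dual u \<circ> u = wlong"
proof -
  have F: "finv u \<in> weyl_D n" by (rule weyl_finv[OF n2 assms])
  show "dual u \<in> weyl_D n" unfolding dual_def by (rule weyl_comp[OF n2 wlong_in F])
  show "len n (dual u) + len n u = top_len"
    using len_longest_comp[OF n2 F] len_finv[OF n2 assms] by (simp add: dual_def wlong_def top_len_def)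
  have "inj u" using weyl_signed_perm[OF n2 assms] by (simp add: signed_perm_def bij_is_inj)
  then show "dual u \<circ> u = wlong" by (simp add: dual_def comp_assoc)
qed

text \<open>
  The concatenated word is reduced only if \<open>v u\<close> is as long as the two lengths
  together, which for this range of lengths forces \<open>v u = w\<^sub>0\<close>.
\<close>

lemma dems_schub:
  assumes v: "v \<in> weyl_D n" and u: "u \<in> weyl_D n" and l: "len n v + len n u \<ge> top_len"
  shows "v \<circ> u \<noteq> wlong \<Longrightarrow> dems n (red v) (schub u) = 0"
    and "v \<circ> u = wlong \<Longrightarrow> \<exists>c. c \<noteq> 0 \<and> dems n (red v) (schub u) = scal c"
proof -
  let ?is = "red v @ red u"
  have L: "?is \<in> lists {1..n}" using red_props(1)[OF v] red_props(1)[OF u] by simp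
  have W: "word_prod n ?is = v \<circ> u"
    using red_props(3)[OF v] red_props(3)[OF u] by (simp add: word_prod_append)
  have E: "dems n (red v) (schub u) = dems n ?is topp" by (simp add: schub_def)
  have len: "length ?is = len n v + len n u" using red_props(2)[OF v] red_props(2)[OF u] by simp
  have VU: "v \<circ> u \<in> weyl_D n" by (rule weyl_comp[OF n2 v u])
  show "dems n (red v) (schub u) = 0" if ne: "v \<circ> u \<noteq> wlong"
  proof -
    have "\<not> reduced n ?is"
    proof
      assume "reduced n ?is"
      then have "len n v + len n u = len n (v \<circ> u)" using len unfolding reduced_def[OF n2] W by simp
      then have "len n (v \<circ> u) = card (positive_pairs n)"
        using l len_le_top[OF VU] by (simp add: top_len_def)
      with longest_unique[OF n2 VU] ne show False by (simp add: wlong_def)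
    qed
    then show ?thesis unfolding E by (rule dems_not_reduced[OF n2 L])
  qed
  show "\<exists>c. c \<noteq> 0 \<and> dems n (red v) (schub u) = scal c" if eq: "v \<circ> u = wlong"
  proof (cases "reduced n ?is")
    case True
    have "same_up_to_sign (dems n ?is) (dems n (red wlong))"
      using red[OF wlong_in] W eq True by (intro reduced_words_agree[OF n2]) auto
    then obtain s where "s = 1 \<or> s = -1" "dems n ?is topp = scal s * dems n (red wlong) topp"
      unfolding same_up_to_sign_def by auto
    moreover obtain c where "c \<noteq> 0" "dems n (red wlong) topp = scal c" using dems_wlong by blast
    ultimately show ?thesis unfolding E by (intro exI[of _ "s * c"]) auto
  next
    case False
    have "len n (dual u) + len n u = top_len" by (rule dual_props(2)[OF u])
    moreover have "v = dual u"
    proof -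
      have "bij u" using weyl_signed_perm[OF n2 u] by (simp add: signed_perm_def)
      then have "u \<circ> finv u = id" using surj_iff bij_is_surj by blast
      then have "v = v \<circ> u \<circ> finv u" unfolding comp_assoc by simp
      then show ?thesis unfolding eq dual_def .
    qed
    moreover have "len n wlong = top_len" using len_longest[OF n2] by (simp add: wlong_def top_len_def)
    ultimately have "reduced n ?is" using L len unfolding reduced_def[OF n2] W eq by simp
    with False show ?thesis by blast
  qed
qed

lemma dems_dual_schub:
  assumes u: "u \<in> weyl_D n" and u': "u' \<in> weyl_D n" and l: "len n u \<le> len n u'"
  shows "u \<noteq> u' \<Longrightarrow> dems n (red (dual u)) (schub u') = 0"
    and "\<exists>c. c \<noteq> 0 \<and> dems n (red (dual u)) (schub u) = scal c"
proof -
  show "\<exists>c. c \<noteq> 0 \<and> dems n (red (dual u)) (schub u) = scal c"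
    using dual_props[OF u] by (intro dems_schub(2) u) simp_all
  have b: "bij wlong" "bij u" using weyl_signed_perm[OF n2] wlong_in u by (auto simp: signed_perm_def)
  show "dems n (red (dual u)) (schub u') = 0" if ne: "u \<noteq> u'"
  proof (rule dems_schub(1)[OF dual_props(1)[OF u] u'])
    show "top_len \<le> len n (dual u) + len n u'" using dual_props(2)[OF u] l by linarith
    show "dual u \<circ> u' \<noteq> wlong"
    proof
      assume "dual u \<circ> u' = wlong"
      then have "wlong (finv u (u' k)) = wlong k" for k by (metis comp_apply dual_def)
      then have "finv u (u' k) = k" for k using b(1) by (metis bij_is_inj inj_eq)
      then have "u k = u' k" for k using b(2) by (metis bij_inv_eq_iff)
      with ne show False by blast
    qed
  qed
qed

text \<open>
  Induction on length: applying the operator dual to \<open>u\<close> kills all terms of at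
  least the same length except the one for \<open>u\<close>, and the shorter ones are known to
  vanish.
\<close>

lemma schub_expansion_unique:
  assumes lam: "\<And>u. u \<in> weyl_D n \<Longrightarrow> coef u \<in> invariants n"
    and zero: "(\<Sum>u\<in>weyl_D n. schub u * coef u) = 0" and u: "u \<in> weyl_D n"
  shows "coef u = 0"
  using u
proof (induction "len n u" arbitrary: u rule: less_induct)
  case (less u)
  let ?is = "red (dual u)"
  note d = dual_props[OF less.prems]
  have L: "?is \<in> lists {1..n}" by (rule red_props(1)[OF d(1)])
  have other: "dems n ?is (schub u' * coef u') = 0" if "u' \<in> weyl_D n" "u' \<noteq> u" for u'
  proof (cases "len n u' < len n u")
    case True then show ?thesis using less.hyps[OF _ that(1)] by simp
  next
    case False
    then show ?thesis using dems_dual_schub(1)[OF less.prems that(1)] that lam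
      by (simp add: dems_invariant_right[OF L])
  qed
  obtain c where c: "c \<noteq> 0" "dems n ?is (schub u) = scal c"
    using dems_dual_schub(2)[OF less.prems less.prems] by auto
  have "0 = dems n ?is (\<Sum>u\<in>weyl_D n. schub u * coef u)" by (simp add: zero)
  also have "\<dots> = (\<Sum>u'\<in>weyl_D n. dems n ?is (schub u' * coef u'))" by (rule dems_sum)
  also have "\<dots> = (\<Sum>u'\<in>weyl_D n. if u' = u then dems n ?is (schub u * coef u) else 0)"
    by (rule sum.cong) (use other in auto)
  also have "\<dots> = dems n ?is (schub u * coef u)"
    using finite_weyl_D[OF n2] less.prems by simp
  also have "\<dots> = scal c * coef u"
    using dems_invariant_right[OF L lam[OF less.prems]] c by simp
  finally have "scal (1 / c) * (scal c * coef u) = 0" by simp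
  then show ?case using c(1) unfolding mult.assoc[symmetric] scal_simps(6)[symmetric] by simp
qed

abbreviation Pol :: "oddpoly set" where "Pol \<equiv> supp UNIV {1..n}"

lemma topp_supp: "additive_coeffs R \<Longrightarrow> topp \<in> supp R {1..n}"
proof -
  assume R: "additive_coeffs R"
  have *: "set xs \<subseteq> {1..n} \<Longrightarrow> foldr (\<lambda>i f. var i ^ (2 * n - 2 * i) * f) xs 1 \<in> supp R {1..n}" for xs
    by (induction xs) (auto intro!: supp_mult supp_power supp_var supp_1 R)
  show ?thesis unfolding topp_def top_poly_def by (rule *) auto
qed

lemma schub_supp: "u \<in> weyl_D n \<Longrightarrow> additive_coeffs R \<Longrightarrow> schub u \<in> supp R {1..n}"
  unfolding schub_def by (intro dems_supp topp_supp n2 red_props)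

text \<open>
  Multiples are subtracted so that the remainder is killed by the operators of all elements of
  length at least \<open>k\<close>, for \<open>k\<close> decreasing to \<open>0\<close>. If the
  operators of all longer elements kill the remainder, then the image under the operator of an
  element of length \<open>k\<close> is invariant and can serve, up to a constant, as the next
  coefficient. The new terms do not disturb the operators treated before.
\<close>

lemma schub_expansion_exists_aux:
  assumes f: "f \<in> Pol"
  shows "j \<le> Suc top_len \<Longrightarrow> \<exists>coef. (\<forall>u\<in>weyl_D n. coef u \<in> invariants n \<inter> Pol) \<and>
    (\<forall>v\<in>weyl_D n. Suc top_len - j \<le> len n v \<longrightarrow>
      dems n (red v) (f - (\<Sum>u\<in>weyl_D n. schub u * coef u)) = 0)"
proof (induction j)
  case 0
  show ?case
    using len_le_top invariants_closed(6)
    by (intro exI[of _ "\<lambda>u. 0"]) (auto dest: len_le_top)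
next
  case (Suc j)
  define k where "k = top_len - j"
  have k: "Suc top_len - j = Suc k" "Suc top_len - Suc j = k" "k \<le> top_len" using Suc.prems by (auto simp: k_def)
  obtain l where l: "\<And>u. u \<in> weyl_D n \<Longrightarrow> l u \<in> invariants n \<inter> Pol"
    and z: "\<And>v. v \<in> weyl_D n \<Longrightarrow> Suc k \<le> len n v \<Longrightarrow>
      dems n (red v) (f - (\<Sum>u\<in>weyl_D n. schub u * l u)) = 0"
    using Suc unfolding k(1) by auto
  define f' where "f' = f - (\<Sum>u\<in>weyl_D n. schub u * l u)"
  have P: "additive_coeffs (UNIV :: rat set)" by simp
  have f': "f' \<in> Pol" unfolding f'_def
    using l schub_supp[OF _ P] f by (intro supp_diff supp_sum supp_mult P) auto
  \<comment> \<open>one more operator leads to a longer element or to a word that is not reduced\<close>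
  have mu: "dems n (red v) f' \<in> invariants n \<inter> Pol" if v: "v \<in> weyl_D n" "len n v = k" for v
  proof
    show "dems n (red v) f' \<in> Pol" using f' v by (intro dems_supp P n2 red_props)
    show "dems n (red v) f' \<in> invariants n"
      unfolding invariants_def
    proof (intro CollectI ballI)
      fix i assume i: "i \<in> {1..n}"
      have L: "i # red v \<in> lists {1..n}" using i red_props(1)[OF v(1)] by simp
      have "dems n (i # red v) f' = 0"
      proof (cases "reduced n (i # red v)")
        case True
        let ?w = "word_prod n (i # red v)"
        have W: "?w \<in> weyl_D n" by (rule word_in_weyl[OF n2 L])
        have "len n ?w = Suc k"
          using True red_props(2)[OF v(1)] v(2) unfolding reduced_def[OF n2] by simp
        then have "dems n (red ?w) f' = 0" using z[OF W] by (simp add: f'_def)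
        moreover have "same_up_to_sign (dems n (i # red v)) (dems n (red ?w))"
          using True red[OF W] by (intro reduced_words_agree[OF n2]) auto
        ultimately show ?thesis by (blast intro: same_up_to_sign_zero)
      qed (rule dems_not_reduced[OF n2 L])
      then show "demD n i (dems n (red v) f') = 0" by simp
    qed
  qed
  define c where "c u = (SOME c. c \<noteq> 0 \<and> dems n (red (dual u)) (schub u) = scal c)" for u
  have c: "c u \<noteq> 0" "dems n (red (dual u)) (schub u) = scal (c u)" if "u \<in> weyl_D n" for u
    using someI_ex[OF dems_dual_schub(2)[OF that that order_refl]] unfolding c_def by auto
  define d where "d u = (if len n u = top_len - k then scal (1 / c u) * dems n (red (dual u)) f' else 0)" for u
  have d: "d u \<in> invariants n \<inter> Pol" if u: "u \<in> weyl_D n" for u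
  proof (cases "len n u = top_len - k")
    case True
    then have "len n (dual u) = k" using dual_props(2)[OF u] k(3) by linarith
    with mu[OF dual_props(1)[OF u]] True show ?thesis
      using supp_scal[OF P, of "1 / c u" "{1..n}"] unfolding d_def
      by (auto intro: invariants_closed supp_mult[OF P])
  qed (simp add: d_def invariants_closed)
  define l' where "l' u = l u + d u" for u
  have "f - (\<Sum>u\<in>weyl_D n. schub u * l' u) = f' - (\<Sum>u\<in>weyl_D n. schub u * d u)"
    by (simp add: l'_def f'_def distrib_left sum.distrib)
  moreover have "dems n (red v) (f' - (\<Sum>u\<in>weyl_D n. schub u * d u)) = 0"
    if v: "v \<in> weyl_D n" "k \<le> len n v" for v
  proof -
    \<comment> \<open>the index whose dual is \<open>v\<close>\<close>
    define u0 where "u0 = finv v \<circ> wlong"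
    have vb: "bij v" and wb: "bij wlong"
      using weyl_signed_perm[OF n2] v wlong_in by (auto simp: signed_perm_def)
    have u0: "u0 \<in> weyl_D n" unfolding u0_def by (rule weyl_comp[OF n2 weyl_finv[OF n2 v(1)] wlong_in])
    have "finv u0 = finv wlong \<circ> v"
      unfolding u0_def using o_inv_distrib[of "finv v" wlong] vb wb
      by (simp add: bij_imp_bij_inv inv_inv_eq)
    then have dv: "dual u0 = v" unfolding dual_def using wb
      by (simp add: fun_eq_iff bij_is_surj surj_f_inv_f)
    have l0: "len n u0 + len n v = top_len" using dual_props(2)[OF u0] dv by simp
    have L: "red v \<in> lists {1..n}" by (rule red_props(1)[OF v(1)])
    have term0: "dems n (red v) (schub u * d u) = 0" if u: "u \<in> weyl_D n" "u \<noteq> u0 \<or> len n v \<noteq> k" for u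
    proof (cases "len n u = top_len - k")
      case True
      then have "len n u0 \<le> len n u" using l0 v(2) by linarith
      moreover have "u0 \<noteq> u" using u True l0 v(2) k(3) by auto
      ultimately have "dems n (red v) (schub u) = 0"
        using dems_dual_schub(1)[OF u0 u(1)] by (simp add: dv)
      then show ?thesis using d[OF u(1)] by (simp add: dems_invariant_right[OF L])
    qed (simp add: d_def)
    have sum: "dems n (red v) (\<Sum>u\<in>weyl_D n. schub u * d u) = dems n (red v) f'"
    proof (cases "len n v = k")
      case True
      have "dems n (red v) (\<Sum>u\<in>weyl_D n. schub u * d u) =
          (\<Sum>u\<in>weyl_D n. if u = u0 then dems n (red v) (schub u0 * d u0) else 0)"
        unfolding dems_sum by (rule sum.cong) (use term0 in auto)
      also have "\<dots> = dems n (red v) (schub u0 * d u0)"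
        using finite_weyl_D[OF n2] u0 by simp
      also have "\<dots> = scal (c u0) * d u0"
        using d[OF u0] c(2)[OF u0] by (simp add: dems_invariant_right[OF L] dv)
      also have "\<dots> = scal (c u0) * (scal (1 / c u0) * dems n (red v) f')"
      proof -
        have "len n u0 = top_len - k" using True l0 by linarith
        then show ?thesis by (simp add: d_def dv)
      qed
      also have "\<dots> = dems n (red v) f'"
        using c(1)[OF u0] unfolding mult.assoc[symmetric] scal_simps(6)[symmetric] by simp
      finally show ?thesis .
    next
      case False
      then have "dems n (red v) f' = 0" using z[OF v(1)] v(2) by (simp add: f'_def)
      moreover have "dems n (red v) (\<Sum>u\<in>weyl_D n. schub u * d u) = 0"
        unfolding dems_sum by (rule sum.neutral) (use term0 False in auto)
      ultimately show ?thesis by simp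
    qed
    show ?thesis by (simp add: dems_diff sum)
  qed
  moreover have "l' u \<in> invariants n \<inter> Pol" if "u \<in> weyl_D n" for u
    using l[OF that] d[OF that] unfolding l'_def by (auto intro: invariants_closed supp_add[OF P])
  ultimately show ?case unfolding k(2) by (intro exI[of _ l']) simp
qed

text \<open>
  The identity has the empty word, so its operator is the identity map, and the last remainder
  is zero.
\<close>

lemma schub_expansion_exists:
  assumes "f \<in> Pol"
  shows "\<exists>coef. (\<forall>u\<in>weyl_D n. coef u \<in> invariants n \<inter> Pol) \<and> f = (\<Sum>u\<in>weyl_D n. schub u * coef u)"
proof -
  obtain l where l: "\<forall>u\<in>weyl_D n. l u \<in> invariants n \<inter> Pol"
    and z: "\<forall>v\<in>weyl_D n. dems n (red v) (f - (\<Sum>u\<in>weyl_D n. schub u * l u)) = 0"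
    using schub_expansion_exists_aux[OF assms, of "Suc top_len"] by auto
  have i: "id \<in> weyl_D n" by (rule weyl_id[OF n2])
  then have "red id = []" using red_props(2)[OF i] by simp
  with z i have "f - (\<Sum>u\<in>weyl_D n. schub u * l u) = 0" by fastforce
  with l show ?thesis by auto
qed

lemma schub_homog:
  assumes u: "u \<in> weyl_D n"
  shows "schub u \<in> homog (top_len - len n u)" "schub u \<noteq> 0"
proof -
  have "top_poly n k \<in> homog ((n - k) * (n - k + 1))" if "k \<le> n" for k
    using that
  proof (induction k rule: inc_induct)
    case base then show ?case by (simp add: top_poly_def)
  next
    case (step k)
    have "top_poly n k = var k ^ (2 * n - 2 * k) * top_poly n (Suc k)"
      using upt_conv_Cons[OF step.hyps(2)] by (simp add: top_poly_def)
    moreover have "var k ^ (2 * n - 2 * k) \<in> homog ((2 * n - 2 * k) * 1)"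
      by (intro homog_power homog_var)
    ultimately have "top_poly n k \<in> homog ((2 * n - 2 * k) * 1 + (n - Suc k) * (n - Suc k + 1))"
      using homog_mult step.IH by metis
    moreover obtain e where "n = Suc (k + e)" using step.hyps(2) less_imp_Suc_add by blast
    then have "(2 * n - 2 * k) * 1 + (n - Suc k) * (n - Suc k + 1) = (n - k) * (n - k + 1)"
      by (simp add: algebra_simps)
    ultimately show ?case by simp
  qed
  from this[of 1] have "topp \<in> homog top_len"
    using n2 unfolding topp_def top_len_eq by (simp add: mult.commute)
  then show "schub u \<in> homog (top_len - len n u)"
    using dems_homog[of topp top_len "red u" n] red_props(2)[OF u] len_le_top[OF u] by (simp add: schub_def)
  show "schub u \<noteq> 0"
    using dems_dual_schub(2)[OF u u] by auto
qed

end

section \<open>Commuting invariants past the variables\<close>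

lemmas conj_sign_simps = alg_homD[OF alg_hom_conj_sign]

lemma scal_half_cancel: "f + f = (0 :: oddpoly) \<Longrightarrow> f = 0"
proof -
  assume "f + f = 0"
  then have "scal (1/2) * (scal 2 * f) = 0" by (simp add: scal_2 mult_2)
  then show "f = 0" unfolding mult.assoc[symmetric] scal_simps(6)[symmetric] by simp
qed

text \<open>
  Adding and subtracting the two hypotheses gives \<open>x\<^sub>a f = - g x\<^sub>b\<close> and
  \<open>x\<^sub>b f = - g x\<^sub>a\<close>. Hence \<open>x\<^sub>a\<^sup>2 (x\<^sub>a f
  x\<^sub>b)\<close> and \<open>x\<^sub>b\<^sup>2 (x\<^sub>b f x\<^sub>a)\<close> are equal. By
  the oddness of \<open>f\<close> under the product of the two conjugations, \<open>x\<^sub>a f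
  x\<^sub>b\<close> and \<open>x\<^sub>b f x\<^sub>a\<close> coincide, so
  \<open>x\<^sub>a\<^sup>2 - x\<^sub>b\<^sup>2\<close> kills this element.
\<close>

lemma odd_part_vanishes:
  assumes ab: "a \<noteq> b" and odd: "conj_sign a (conj_sign b f) = - f"
    and minus: "(var a - var b) * f = g * (var a - var b)"
    and plus: "(var a + var b) * f = - (g * (var a + var b))"
  shows "f = 0"
proof -
  have gr1: "(p + s) + (p + s) = ((p - q) - (r - s)) + ((p + q) + (r + s))" for p q r s :: oddpoly
    by (simp add: algebra_simps)
  have gr2: "(q + r) + (q + r) = ((p + q) + (r + s)) - ((p - q) - (r - s))" for p q r s :: oddpoly
    by (simp add: algebra_simps)
  have z1: "(var a - var b) * f - g * (var a - var b) = 0" unfolding minus by (rule diff_self)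
  have z2: "(var a + var b) * f + g * (var a + var b) = 0" unfolding plus by (rule add.left_inverse)
  have "(var a * f + g * var b) + (var a * f + g * var b) =
      ((var a - var b) * f - g * (var a - var b)) + ((var a + var b) * f + g * (var a + var b))"
    unfolding left_diff_distrib right_diff_distrib distrib_left distrib_right by (rule gr1)
  then have "var a * f + g * var b = 0" unfolding z1 z2 add_0_left by (rule scal_half_cancel)
  then have A: "var a * f = - (g * var b)" by (simp only: eq_neg_iff_add_eq_0)
  have "(var b * f + g * var a) + (var b * f + g * var a) =
      ((var a + var b) * f + g * (var a + var b)) - ((var a - var b) * f - g * (var a - var b))"
    unfolding left_diff_distrib right_diff_distrib distrib_left distrib_right by (rule gr2)
  then have "var b * f + g * var a = 0" unfolding z1 z2 diff_self by (rule scal_half_cancel)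
  then have B: "var b * f = - (g * var a)" by (simp only: eq_neg_iff_add_eq_0)
  let ?h = "conj_sign a f"
  have hb: "conj_sign b f = - ?h"
  proof -
    have "conj_sign b f = conj_sign a (conj_sign a (conj_sign b f))" by simp
    then show ?thesis unfolding odd by (simp add: conj_sign_simps)
  qed
  have "sqr a * (?h * var a * var b) = sqr a * (var a * f * var b)"
    by (simp add: var_commute[of a f])
  also have "\<dots> = - (sqr a * (g * sqr b))" unfolding A by (simp add: sqr_def mult.assoc)
  also have "sqr a * (g * sqr b) = sqr b * (g * sqr a)"
    by (metis mult.assoc sqr_central)
  also have "- (sqr b * (g * sqr a)) = sqr b * (var b * f * var a)"
    unfolding B by (simp add: sqr_def mult.assoc)
  also have "\<dots> = sqr b * (?h * var a * var b)"
    using var_anticommute[OF ab] by (simp add: var_commute[of b f] hb mult.assoc)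
  finally have "(sqr a + scal (-1) * sqr b) * (?h * var a * var b) = 0"
    by (simp add: algebra_simps)
  then have "?h * var a * var b = 0" by (rule sqr_comb_eq_0[OF _ ab])
  then have "?h = 0" using mult_var_eq_0 by blast
  then have "conj_sign a ?h = 0" by (simp add: conj_sign_simps)
  then show ?thesis by simp
qed

text \<open>
  Being invariant means that the root can be moved past the element at the cost of the
  reflection.
\<close>

lemma dem_zero_iff:
  assumes "sgn_unit e"
  shows "dem a e f = 0 \<longleftrightarrow> simple_root a e * f = refl_hom a e f * simple_root a e"
  using dem_eq[OF assms, of a f] dem_eqI[OF assms, of a 0 f] by auto

text \<open>
  Conjugation by two neighbouring variables has the same effect on an invariant
  \<open>f\<close>. The difference \<open>\<mu>\<close> of \<open>f\<close> and its image under
  both conjugations is odd under them and commutes, up to the reflection, with the root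
  \<open>x\<^sub>a - x\<^bsub>a+1\<^esub>\<close>. A second relation, with \<open>x\<^sub>a +
  x\<^bsub>a+1\<^esub>\<close>, makes it vanish. For \<open>a = n - 1\<close> this comes from
  the extra generator, and for smaller \<open>a\<close> from conjugating by the next two
  variables, so the proof goes downwards.
\<close>

lemma invariant_conj_sign:
  assumes n2: "2 \<le> n" and f: "f \<in> invariants n" and j: "1 \<le> j" "j < n"
  shows "conj_sign j f = conj_sign (Suc j) f"
proof -
  have ker: "simple_root a 1 * f = refl_hom a 1 f * simple_root a 1" if "1 \<le> a" "a < n" for a
  proof -
    have "demD n a f = 0" using f that by (simp add: invariants_def)
    then show ?thesis using that by (simp add: demD_def pos_def sg_def dem_zero_iff)
  qed
  have "demD n n f = 0" using f n2 by (simp add: invariants_def)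
  then have kerD: "simple_root (n - 1) (-1) * f = refl_hom (n - 1) (-1) f * simple_root (n - 1) (-1)"
    by (simp add: demD_def pos_def sg_def dem_zero_iff)
  have conj_refl1: "conj_sign a (conj_sign (Suc a) (refl_hom a 1 g)) = refl_hom a (-1) g" for a g
    by (rule alg_hom_eqI[OF alg_hom_comp[OF alg_hom_conj_sign alg_hom_comp[OF alg_hom_conj_sign alg_hom_refl_hom]] alg_hom_refl_hom])
      (simp add: refl_hom_var conj_sign_var conj_sign_simps refl_hom_simps)
  have conj_refl1': "refl_hom a 1 (conj_sign a (conj_sign (Suc a) g)) = refl_hom a (-1) g" for a g
    by (rule alg_hom_eqI[OF alg_hom_comp[OF alg_hom_refl_hom alg_hom_comp[OF alg_hom_conj_sign alg_hom_conj_sign]] alg_hom_refl_hom])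
      (simp add: refl_hom_var conj_sign_var conj_sign_simps refl_hom_simps)
  note conj_refl = conj_refl1 conj_refl1'
  have conj_refl2: "conj_sign (Suc a) (conj_sign (Suc (Suc a)) (refl_hom a 1 g)) =
      refl_hom a 1 (conj_sign a (conj_sign (Suc (Suc a)) g))" for a g
    by (rule alg_hom_eqI[OF alg_hom_comp[OF alg_hom_conj_sign alg_hom_comp[OF alg_hom_conj_sign alg_hom_refl_hom]] alg_hom_comp[OF alg_hom_refl_hom alg_hom_comp[OF alg_hom_conj_sign alg_hom_conj_sign]]])
      (simp add: refl_hom_var conj_sign_var conj_sign_simps refl_hom_simps)
  have root: "conj_sign a (conj_sign (Suc a) (simple_root a 1)) = - simple_root a 1" for a
    by (simp add: simple_root_def conj_sign_simps conj_sign_var)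
  \<comment> \<open>the part of \<open>f\<close> that changes sign, up to a factor 2\<close>
  define \<mu> where "\<mu> a = f - conj_sign a (conj_sign (Suc a) f)" for a
  have mu_odd: "conj_sign a (conj_sign (Suc a) (\<mu> a)) = - \<mu> a" for a
    by (simp add: \<mu>_def conj_sign_simps conj_sign_commute[of a "Suc a"])
  have mu_ker: "simple_root a 1 * \<mu> a = refl_hom a 1 (\<mu> a) * simple_root a 1" if "1 \<le> a" "a < n" for a
  proof -
    have "conj_sign a (conj_sign (Suc a) (simple_root a 1 * f)) =
        conj_sign a (conj_sign (Suc a) (refl_hom a 1 f * simple_root a 1))"
      by (simp only: ker[OF that])
    then have "simple_root a 1 * conj_sign a (conj_sign (Suc a) f) =
        refl_hom a 1 (conj_sign a (conj_sign (Suc a) f)) * simple_root a 1"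
      by (simp add: conj_sign_simps root conj_refl)
    with ker[OF that] show ?thesis by (simp add: \<mu>_def algebra_simps refl_hom_simps)
  qed
  have finish: "conj_sign a f = conj_sign (Suc a) f" if "\<mu> a = 0" for a
  proof -
    have "f = conj_sign a (conj_sign (Suc a) f)" using that by (simp add: \<mu>_def)
    then have "conj_sign a f = conj_sign a (conj_sign a (conj_sign (Suc a) f))" by simp
    then show ?thesis by simp
  qed
  have "j \<le> n - 1" using j by simp
  then show ?thesis using j(1)
  proof (induction j rule: inc_induct)
    case base
    let ?a = "n - 1"
    have a: "1 \<le> ?a" "?a < n" using n2 by auto
    have "conj_sign ?a (conj_sign (Suc ?a) (simple_root ?a (-1) * f)) =
        conj_sign ?a (conj_sign (Suc ?a) (refl_hom ?a (-1) f * simple_root ?a (-1)))"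
      by (simp only: kerD)
    moreover have rootD: "conj_sign ?a (conj_sign (Suc ?a) (simple_root ?a (-1))) = - simple_root ?a (-1)"
      by (simp add: simple_root_def conj_sign_simps conj_sign_var)
    moreover have "conj_sign ?a (conj_sign (Suc ?a) (refl_hom ?a (-1) f)) =
        refl_hom ?a (-1) (conj_sign ?a (conj_sign (Suc ?a) f))"
      by (simp only: conj_refl1'[of ?a f, symmetric] conj_refl1)
    ultimately have "simple_root ?a (-1) * conj_sign ?a (conj_sign (Suc ?a) f) =
        refl_hom ?a (-1) (conj_sign ?a (conj_sign (Suc ?a) f)) * simple_root ?a (-1)"
      by (simp add: conj_sign_simps)
    with kerD have muD: "simple_root ?a (-1) * \<mu> ?a = refl_hom ?a (-1) (\<mu> ?a) * simple_root ?a (-1)"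
      by (simp add: \<mu>_def algebra_simps refl_hom_simps)
    have "refl_hom ?a (-1) (\<mu> ?a) = - refl_hom ?a 1 (\<mu> ?a)"
      unfolding conj_refl(2)[symmetric] mu_odd by (simp add: refl_hom_simps)
    with muD mu_ker[OF a] mu_odd[of ?a] have "\<mu> ?a = 0"
      by (intro odd_part_vanishes[of ?a "Suc ?a" _ "refl_hom ?a 1 (\<mu> ?a)"]) (simp_all add: simple_root_def)
    then show ?case by (rule finish)
  next
    case (step a)
    have a: "1 \<le> a" "a < n" using step by auto
    let ?c = "Suc (Suc a)"
    have IH: "conj_sign (Suc a) f = conj_sign ?c f" using step by simp
    then have IH': "conj_sign (Suc a) (conj_sign ?c f) = f" by (metis conj_sign_involution)
    have bc: "conj_sign (Suc a) (conj_sign ?c (\<mu> a)) = \<mu> a"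
      unfolding \<mu>_def conj_sign_simps IH'
      by (metis IH' conj_sign_commute)
    have "conj_sign (Suc a) (conj_sign ?c (simple_root a 1 * \<mu> a)) =
        conj_sign (Suc a) (conj_sign ?c (refl_hom a 1 (\<mu> a) * simple_root a 1))"
      by (simp only: mu_ker[OF a])
    moreover have "conj_sign (Suc a) (conj_sign ?c (simple_root a 1)) = var a + var (Suc a)"
      by (simp add: simple_root_def conj_sign_simps conj_sign_var)
    moreover have "conj_sign a (conj_sign ?c (\<mu> a)) = - \<mu> a"
      by (metis bc conj_sign_involution mu_odd)
    ultimately have "(var a + var (Suc a)) * \<mu> a = - (refl_hom a 1 (\<mu> a) * (var a + var (Suc a)))"
      by (simp add: conj_sign_simps bc conj_refl2 refl_hom_simps)
    with mu_ker[OF a] mu_odd[of a] have "\<mu> a = 0"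
      by (intro odd_part_vanishes[of a "Suc a" _ "refl_hom a 1 (\<mu> a)"]) (simp_all add: simple_root_def)
    then show ?case by (rule finish)
  qed
qed

context
  fixes n :: nat
  assumes n2: "2 \<le> n"
begin

lemma invariant_conj_sign_all:
  assumes f: "f \<in> invariants n" and j: "j \<in> {1..n}"
  shows "conj_sign j f = conj_sign 1 f"
proof -
  have "1 \<le> j" using j by simp
  then show ?thesis using j
  proof (induction j rule: nat_induct_at_least)
    case (Suc j) then show ?case using invariant_conj_sign[OF n2 f, of j] by simp
  qed simp
qed

text \<open>
  By \<open>invariant_conj_sign_all\<close> the choice of the variable does not affect the
  values on invariants.
\<close>

definition twist :: "oddpoly \<Rightarrow> oddpoly" where "twist f = conj_sign 1 f"

lemma twist_twist [simp]: "twist (twist f) = f" by (simp add: twist_def)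

lemma twist_var:
  assumes "f \<in> invariants n" "j \<in> {1..n}"
  shows "var j * f = twist f * var j" "f * var j = var j * twist f"
proof -
  have e: "conj_sign j f = twist f" using invariant_conj_sign_all[OF assms] by (simp add: twist_def)
  then show "var j * f = twist f * var j" by (simp add: var_commute)
  have "conj_sign j (twist f) = f" using e by (metis conj_sign_involution)
  then show "f * var j = var j * twist f" by (simp add: var_commute)
qed

text \<open>
  Both \<open>s\<^sub>i f\<close> and the twist of \<open>f\<close> describe how the root moves
  past \<open>f\<close>, and the root is not a zero divisor because its square is
  \<open>x\<^sub>a\<^sup>2 + x\<^bsub>a+1\<^esub>\<^sup>2\<close>. So they agree, and the twist
  inherits invariance from \<open>f\<close>.
\<close>

lemma twist_invariant:
  assumes f: "f \<in> invariants n"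
  shows "twist f \<in> invariants n"
  unfolding invariants_def
proof (intro CollectI ballI)
  fix i assume i: "i \<in> {1..n}"
  let ?a = "pos n i" and ?e = "sg n i"
  let ?r = "simple_root ?a ?e"
  have a: "?a \<in> {1..n}" "Suc ?a \<in> {1..n}" using i n2 by (auto simp: pos_def)
  have sc: "g * (scal c * h) = scal c * (g * h)" for g c h by (metis mult.assoc scal_central)
  have R: "?r * f = twist f * ?r" "f * ?r = ?r * twist f"
    using twist_var[OF f a(1)] twist_var[OF f a(2)]
    by (simp_all add: simple_root_def left_diff_distrib right_diff_distrib sc mult.assoc)
  have ker: "?r * f = refl_hom ?a ?e f * ?r"
    using f i dem_zero_iff[of ?e ?a f] by (simp add: invariants_def demD_def)
  have "(refl_hom ?a ?e f - twist f) * ?r = 0" using ker R(1) by (simp add: left_diff_distrib)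
  then have "(refl_hom ?a ?e f - twist f) * (?r * ?r) = 0" by (simp flip: mult.assoc)
  moreover have "?r * ?r = sqr ?a + scal 1 * sqr (Suc ?a)"
    using var_anticommute[of ?a "Suc ?a"]
    by (auto simp: simple_root_def sg_def sqr_def algebra_simps)
  ultimately have "(sqr ?a + scal 1 * sqr (Suc ?a)) * (refl_hom ?a ?e f - twist f) = 0"
    by (simp add: distrib_left distrib_right sqr_central)
  then have "refl_hom ?a ?e f - twist f = 0" by (rule sqr_comb_eq_0) simp
  then have s: "refl_hom ?a ?e f = twist f" by simp
  have "refl_hom ?a ?e (twist f) = f" using refl_hom_involution[of ?e ?a f] by (simp add: s)
  then show "demD n i (twist f) = 0"
    using R(2) by (simp add: demD_def dem_zero_iff)
qed

lemma twist_supp: "additive_coeffs R \<Longrightarrow> f \<in> supp R {1..n} \<Longrightarrow> twist f \<in> supp R {1..n}"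
proof -
  assume R: "additive_coeffs R" and f: "f \<in> supp R {1..n}"
  from f R show "twist f \<in> supp R {1..n}"
    unfolding twist_def
  proof (induction rule: supp_var_induct)
    case (var j f) 
    have "conj_sign 1 (var j) \<in> supp R {1..n}"
      using var R by (auto simp: conj_sign_var intro!: supp_var supp_uminus)
    with var R show ?case by (simp add: conj_sign_simps supp_mult)
  qed (auto simp: conj_sign_simps intro: R supp_scal supp_add)
qed

definition twist_pow :: "nat \<Rightarrow> oddpoly \<Rightarrow> oddpoly" where
  "twist_pow d f = (if even d then f else twist f)"

lemma twist_pow_twist_pow [simp]: "twist_pow d (twist_pow d f) = f"
  by (simp add: twist_pow_def)

lemma twist_pow_in:
  "f \<in> invariants n \<inter> supp UNIV {1..n} \<Longrightarrow> twist_pow d f \<in> invariants n \<inter> supp UNIV {1..n}"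
  using twist_invariant[of f] twist_supp[OF additive_coeffs_UNIV, of f] by (auto simp: twist_pow_def)

text \<open>
  Every variable that an invariant passes contributes one twist, so past an element of degree
  \<open>d\<close> only the parity of \<open>d\<close> matters.
\<close>

lemma invariant_commute_homog:
  assumes g: "g \<in> homog d" "g \<in> supp UNIV {1..n}" and f: "f \<in> invariants n"
  shows "f * g = g * twist_pow d f"
proof -
  have mono: "f * monomial m c = monomial m c * twist_pow (total_degree m) f"
    if "m \<in> expos_on {1..n}" "f \<in> invariants n" for m c f
    using that
  proof (induction "total_degree m" arbitrary: m c f)
    case 0
    then show ?case by (simp add: twist_pow_def scal_central flip: scal_def)
  next
    case (Suc d)
    then have "Poly_Mapping.keys m \<noteq> {}" by (auto simp: total_degree_def)
    then obtain j where j: "j \<in> Poly_Mapping.keys m" by blast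
    then obtain m' where m': "m = Poly_Mapping.single j 1 + m'" "total_degree m = Suc (total_degree m')"
      by (rule expo_split)
    have "Poly_Mapping.keys m' \<subseteq> Poly_Mapping.keys m"
      unfolding m'(1) by (auto simp: in_keys_iff lookup_add)
    then have V: "m' \<in> expos_on {1..n}" "j \<in> {1..n}" using Suc.prems j by (auto simp: expos_on_def)
    let ?s = "crossing_sign (Poly_Mapping.single j 1) m'"
    have "?s * ?s = 1" by (simp add: crossing_sign_def flip: power_mult_distrib)
    then have M: "monomial m c = var j * monomial m' (?s * c)"
      by (simp add: var_def monomial_mult m'(1) flip: mult.assoc)
    have "f * monomial m c = (f * var j) * monomial m' (?s * c)" by (simp add: M mult.assoc)
    also have "\<dots> = var j * (twist f * monomial m' (?s * c))"
      by (simp add: twist_var(2)[OF Suc.prems(2) V(2)] mult.assoc)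
    also have "twist f * monomial m' (?s * c) = monomial m' (?s * c) * twist_pow (total_degree m') (twist f)"
      using Suc m' V twist_invariant by auto
    also have "twist_pow (total_degree m') (twist f) = twist_pow (total_degree m) f"
      by (simp add: twist_pow_def m'(2))
    finally show ?case by (simp add: M mult.assoc)
  qed
  have "g \<in> coeff_in UNIV {m. total_degree m = d \<and> m \<in> expos_on {1..n}}"
    using g by (auto simp: homog_def coeff_in_def)
  then show ?thesis
  proof (induction rule: coeff_in_monomial_induct)
    case (monomial m c) then show ?case using mono[of m f c] f by auto
  qed (simp_all add: algebra_simps)
qed

end

section \<open>Monoid rings and their quotients\<close>

lemma monoid_ring_mult: "p \<otimes>\<^bsub>monoid_ring M\<^esub> q = twisted_conv (\<lambda>a b. a \<otimes>\<^bsub>M\<^esub> b) (\<lambda>a b. 1) p q"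
  by (simp add: monoid_ring_def twisted_conv_def linear_ext_def)

lemma monoid_ring_simps [simp]:
  "p \<oplus>\<^bsub>monoid_ring M\<^esub> q = p + q" "\<zero>\<^bsub>monoid_ring M\<^esub> = 0"
  "\<one>\<^bsub>monoid_ring M\<^esub> = Poly_Mapping.single \<one>\<^bsub>M\<^esub> 1"
  "p \<in> carrier (monoid_ring M) \<longleftrightarrow> Poly_Mapping.keys p \<subseteq> carrier M"
  by (simp_all add: monoid_ring_def)

lemma monoid_ring_single_mult [simp]:
  "Poly_Mapping.single a c \<otimes>\<^bsub>monoid_ring M\<^esub> Poly_Mapping.single b d =
    Poly_Mapping.single (a \<otimes>\<^bsub>M\<^esub> b) (c * d)"
  by (simp add: monoid_ring_mult)

lemma (in monoid) monoid_ring_ring: "ring (monoid_ring G)"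
proof (rule ringI)
  show "abelian_group (monoid_ring G)"
  proof (rule abelian_groupI)
    fix x y z assume "x \<in> carrier (monoid_ring G)" "y \<in> carrier (monoid_ring G)"
    then show "x \<oplus>\<^bsub>monoid_ring G\<^esub> y \<in> carrier (monoid_ring G)"
      using keys_add[of x y] by auto
    show "\<exists>y\<in>carrier (monoid_ring G). y \<oplus>\<^bsub>monoid_ring G\<^esub> x = \<zero>\<^bsub>monoid_ring G\<^esub>"
      using \<open>x \<in> _\<close> by (intro bexI[of _ "- x"]) auto
  qed (auto simp: algebra_simps)
  show "monoid (monoid_ring G)"
  proof (rule monoidI)
    fix x y z assume xy: "x \<in> carrier (monoid_ring G)" "y \<in> carrier (monoid_ring G)"
    show "x \<otimes>\<^bsub>monoid_ring G\<^esub> y \<in> carrier (monoid_ring G)"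
      using xy keys_twisted_conv[of "(\<otimes>)" "\<lambda>a b. 1" x y] by (fastforce simp: monoid_ring_mult)
    assume z: "z \<in> carrier (monoid_ring G)"
    show "x \<otimes>\<^bsub>monoid_ring G\<^esub> y \<otimes>\<^bsub>monoid_ring G\<^esub> z = x \<otimes>\<^bsub>monoid_ring G\<^esub> (y \<otimes>\<^bsub>monoid_ring G\<^esub> z)"
      unfolding monoid_ring_mult
      by (rule twisted_conv_assoc[where K = "carrier G"]) (use xy z in \<open>auto simp: m_assoc\<close>)
  next
    fix x assume "x \<in> carrier (monoid_ring G)"
    then have k: "Poly_Mapping.keys x \<subseteq> carrier G" by simp
    show "\<one>\<^bsub>monoid_ring G\<^esub> \<otimes>\<^bsub>monoid_ring G\<^esub> x = x"
      unfolding monoid_ring_mult monoid_ring_simps using k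
      by (induction x rule: poly_mapping_additive_induct) (auto simp: twisted_conv_add_right)
    show "x \<otimes>\<^bsub>monoid_ring G\<^esub> \<one>\<^bsub>monoid_ring G\<^esub> = x"
      unfolding monoid_ring_mult monoid_ring_simps using k
      by (induction x rule: poly_mapping_additive_induct) (auto simp: twisted_conv_add_left)
  qed auto
qed (simp_all add: monoid_ring_mult twisted_conv_add_left twisted_conv_add_right)

lemma (in monoid) monoid_ring_uminus:
  assumes "p \<in> carrier (monoid_ring G)"
  shows "\<ominus>\<^bsub>monoid_ring G\<^esub> p = - p"
  using ring.ring_simprules(3)[OF monoid_ring_ring]
  by (intro abelian_group.minus_equality[OF ring.is_abelian_group[OF monoid_ring_ring]]) (use assms in auto)

lemma (in monoid) monoid_ring_minus:
  assumes "p \<in> carrier (monoid_ring G)" "q \<in> carrier (monoid_ring G)"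
  shows "p \<ominus>\<^bsub>monoid_ring G\<^esub> q = p - q"
  using assms by (simp add: a_minus_def monoid_ring_uminus)

definition ev :: "('a \<Rightarrow> oddpoly) \<Rightarrow> ('a \<Rightarrow>\<^sub>0 int) \<Rightarrow> oddpoly" where
  "ev f p = linear_ext (\<lambda>a c. of_int c * f a) p"

lemma ev_add: "ev f (p + q) = ev f p + ev f q"
  unfolding ev_def by (rule linear_ext_add) (simp_all add: algebra_simps)

lemma ev_single [simp]: "ev f (Poly_Mapping.single a c) = of_int c * f a"
  unfolding ev_def by (rule linear_ext_single) simp

lemma ev_0 [simp]: "ev f 0 = 0" by (simp add: ev_def)

lemma ev_uminus: "ev f (- p) = - ev f p"
  using ev_add[of f p "- p"] by (simp add: eq_neg_iff_add_eq_0 add.commute)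

lemma ev_diff: "ev f (p - q) = ev f p - ev f q"
  using ev_add[of f p "- q"] by (simp add: ev_uminus)

lemma ev_mult:
  assumes "p \<in> carrier (monoid_ring M)" "q \<in> carrier (monoid_ring M)"
    and f: "\<And>a b. a \<in> carrier M \<Longrightarrow> b \<in> carrier M \<Longrightarrow> f (a \<otimes>\<^bsub>M\<^esub> b) = f a * f b"
  shows "ev f (p \<otimes>\<^bsub>monoid_ring M\<^esub> q) = ev f p * ev f q"
proof -
  have k: "Poly_Mapping.keys p \<subseteq> carrier M" "Poly_Mapping.keys q \<subseteq> carrier M" using assms by auto
  show ?thesis unfolding monoid_ring_mult using k(1)
  proof (induction p rule: poly_mapping_additive_induct)
    case (single a c)
    note a = this
    show ?case using k(2)
    proof (induction q rule: poly_mapping_additive_induct)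
      case (single b d)
      have "of_int c * f a * (of_int d * f b) = of_int c * of_int d * (f a * f b)"
        by (metis mult.assoc mult_of_int_commute)
      then show ?case using f[OF a single] by simp
    qed (simp_all add: twisted_conv_add_right ev_add distrib_left)
  qed (simp_all add: twisted_conv_add_left ev_add distrib_right)
qed

text \<open>
  A faithful representation of a ring in the concrete ring; statements about the presented rings
  are transported along such maps.
\<close>

definition represents :: "('a, 'c) ring_scheme \<Rightarrow> ('a \<Rightarrow> oddpoly) \<Rightarrow> bool" where
  "represents A \<theta> \<longleftrightarrow> ring A \<and> inj_on \<theta> (carrier A) \<and> \<theta> \<one>\<^bsub>A\<^esub> = 1 \<and>
    (\<forall>x\<in>carrier A. \<forall>y\<in>carrier A. \<theta> (x \<oplus>\<^bsub>A\<^esub> y) = \<theta> x + \<theta> y \<and> \<theta> (x \<otimes>\<^bsub>A\<^esub> y) = \<theta> x * \<theta> y)"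

lemma representsD:
  assumes "represents A \<theta>"
  shows "ring A" "inj_on \<theta> (carrier A)" "\<theta> \<one>\<^bsub>A\<^esub> = 1" "\<theta> \<zero>\<^bsub>A\<^esub> = 0"
    "x \<in> carrier A \<Longrightarrow> y \<in> carrier A \<Longrightarrow> \<theta> (x \<oplus>\<^bsub>A\<^esub> y) = \<theta> x + \<theta> y"
    "x \<in> carrier A \<Longrightarrow> y \<in> carrier A \<Longrightarrow> \<theta> (x \<otimes>\<^bsub>A\<^esub> y) = \<theta> x * \<theta> y"
    "x \<in> carrier A \<Longrightarrow> \<theta> (\<ominus>\<^bsub>A\<^esub> x) = - \<theta> x"
proof -
  show R: "ring A" and "inj_on \<theta> (carrier A)" "\<theta> \<one>\<^bsub>A\<^esub> = 1"
    and add: "\<And>x y. x \<in> carrier A \<Longrightarrow> y \<in> carrier A \<Longrightarrow> \<theta> (x \<oplus>\<^bsub>A\<^esub> y) = \<theta> x + \<theta> y"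
    and "x \<in> carrier A \<Longrightarrow> y \<in> carrier A \<Longrightarrow> \<theta> (x \<otimes>\<^bsub>A\<^esub> y) = \<theta> x * \<theta> y" for x y
    using assms by (auto simp: represents_def)
  interpret ring A by (fact R)
  have "\<theta> \<zero>\<^bsub>A\<^esub> + \<theta> \<zero>\<^bsub>A\<^esub> = \<theta> \<zero>\<^bsub>A\<^esub>" using add[of "\<zero>\<^bsub>A\<^esub>" "\<zero>\<^bsub>A\<^esub>"] by simp
  then show z: "\<theta> \<zero>\<^bsub>A\<^esub> = 0" by simp
  show "\<theta> (\<ominus>\<^bsub>A\<^esub> x) = - \<theta> x" if "x \<in> carrier A"
    using add[of "\<ominus>\<^bsub>A\<^esub> x" x] that z by (simp add: l_neg eq_neg_iff_add_eq_0)
qed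

lemma represents_finsum:
  assumes rep: "represents A \<theta>" and "finite I" "\<And>i. i \<in> I \<Longrightarrow> x i \<in> carrier A"
  shows "\<theta> (\<Oplus>\<^bsub>A\<^esub>i\<in>I. x i) = (\<Sum>i\<in>I. \<theta> (x i))"
proof -
  interpret ring A by (rule representsD[OF rep])
  show ?thesis using assms(2,3)
  proof (induction I rule: finite_induct)
    case (insert i I)
    then have "x \<in> I \<rightarrow> carrier A" "x i \<in> carrier A" by auto
    then show ?case using insert by (simp add: finsum_insert representsD[OF rep] finsum_closed)
  qed (simp add: representsD[OF rep])
qed

text \<open>
  The common value of all members of a coset.
\<close>

definition coset_value :: "('a \<Rightarrow> oddpoly) \<Rightarrow> ('a \<Rightarrow>\<^sub>0 int) set \<Rightarrow> oddpoly" where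
  "coset_value f X = the_elem (ev f ` X)"

text \<open>
  Once the ideal is known to be the kernel of the evaluation, the quotient of the monoid ring is
  represented faithfully. This is used for the presentation of odd polynomials and for the
  tensor product with \<open>\<rat>\<close>.
\<close>

lemma coset_representation:
  assumes M: "monoid M" and I: "ideal I (monoid_ring M)"
    and f: "\<And>a b. a \<in> carrier M \<Longrightarrow> b \<in> carrier M \<Longrightarrow> f (a \<otimes>\<^bsub>M\<^esub> b) = f a * f b" and f1: "f \<one>\<^bsub>M\<^esub> = 1"
    and ker: "\<And>p. p \<in> carrier (monoid_ring M) \<Longrightarrow> p \<in> I \<longleftrightarrow> ev f p = 0"
  shows "p \<in> carrier (monoid_ring M) \<Longrightarrow> coset_value f (I +>\<^bsub>monoid_ring M\<^esub> p) = ev f p"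
    and "represents (monoid_ring M Quot I) (coset_value f)"
    and "X \<in> carrier (monoid_ring M Quot I) \<longleftrightarrow>
      (\<exists>p\<in>carrier (monoid_ring M). X = I +>\<^bsub>monoid_ring M\<^esub> p)"
proof -
  let ?R = "monoid_ring M"
  interpret R: ring ?R by (rule monoid.monoid_ring_ring[OF M])
  interpret ideal I ?R by (rule I)
  have IC: "I \<subseteq> carrier ?R" by (rule a_subset)
  show val: "coset_value f (I +>\<^bsub>?R\<^esub> p) = ev f p" if p: "p \<in> carrier ?R" for p
  proof -
    have "ev f ` (I +>\<^bsub>?R\<^esub> p) = {ev f p}"
    proof -
      have "ev f (i \<oplus>\<^bsub>?R\<^esub> p) = ev f p" if "i \<in> I" for i
        using ker[of i] that IC by (auto simp: ev_add)
      moreover have "\<zero>\<^bsub>?R\<^esub> \<in> I" by (rule zero_closed)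
      ultimately show ?thesis unfolding a_r_coset_defs by auto
    qed
    then show ?thesis by (simp add: coset_value_def)
  qed
  show mem: "X \<in> carrier (?R Quot I) \<longleftrightarrow> (\<exists>p\<in>carrier ?R. X = I +>\<^bsub>?R\<^esub> p)" for X
    unfolding FactRing_def A_RCOSETS_defs a_r_coset_defs by simp
  show "represents (?R Quot I) (coset_value f)"
    unfolding represents_def
  proof (intro conjI ballI inj_onI)
    show "ring (?R Quot I)" by (rule quotient_is_ring)
    show "coset_value f \<one>\<^bsub>?R Quot I\<^esub> = 1"
      using val[of "\<one>\<^bsub>?R\<^esub>"] R.one_closed by (simp add: FactRing_def f1)
  next
    fix X Y assume "X \<in> carrier (?R Quot I)" "Y \<in> carrier (?R Quot I)"
    then obtain p q where pq: "p \<in> carrier ?R" "q \<in> carrier ?R" "X = I +>\<^bsub>?R\<^esub> p" "Y = I +>\<^bsub>?R\<^esub> q"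
      unfolding mem by blast
    have "X \<oplus>\<^bsub>?R Quot I\<^esub> Y = I +>\<^bsub>?R\<^esub> (p \<oplus>\<^bsub>?R\<^esub> q)"
      using pq by (simp add: FactRing_def a_rcos_sum)
    then show "coset_value f (X \<oplus>\<^bsub>?R Quot I\<^esub> Y) = coset_value f X + coset_value f Y"
      using val[of "p \<oplus>\<^bsub>?R\<^esub> q"] val[OF pq(1)] val[OF pq(2)] R.a_closed[OF pq(1,2)] pq(3,4) by (simp add: ev_add)
    have "X \<otimes>\<^bsub>?R Quot I\<^esub> Y = I +>\<^bsub>?R\<^esub> (p \<otimes>\<^bsub>?R\<^esub> q)"
      using pq by (simp add: FactRing_def rcoset_mult_add)
    then show "coset_value f (X \<otimes>\<^bsub>?R Quot I\<^esub> Y) = coset_value f X * coset_value f Y"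
      using val[of "p \<otimes>\<^bsub>?R\<^esub> q"] val[OF pq(1)] val[OF pq(2)] R.m_closed[OF pq(1,2)] pq(3,4)
        ev_mult[OF pq(1,2) f] by simp
    assume eq: "coset_value f X = coset_value f Y"
    then have "ev f (p \<ominus>\<^bsub>?R\<^esub> q) = 0"
      using val[OF pq(1)] val[OF pq(2)] pq by (simp add: monoid.monoid_ring_minus[OF M] ev_diff)
    then have "p \<ominus>\<^bsub>?R\<^esub> q \<in> I" using ker R.minus_closed[OF pq(1,2)] by blast
    then have "p \<in> I +>\<^bsub>?R\<^esub> q" using a_rcos_module_minus[OF R.ring_axioms pq(2,1)] by simp
    then show "X = Y" using a_repr_independence' pq by simp
  qed
qed

lemma (in monoid) monoid_ring_ideal:
  assumes "ideal I (monoid_ring G)"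
  shows "I \<subseteq> carrier (monoid_ring G)" "0 \<in> I" "p \<in> I \<Longrightarrow> q \<in> I \<Longrightarrow> p + q \<in> I" "p \<in> I \<Longrightarrow> - p \<in> I"
    "p \<in> I \<Longrightarrow> q \<in> I \<Longrightarrow> p - q \<in> I"
    "p \<in> I \<Longrightarrow> q \<in> carrier (monoid_ring G) \<Longrightarrow> q \<otimes>\<^bsub>monoid_ring G\<^esub> p \<in> I"
    "p \<in> I \<Longrightarrow> q \<in> carrier (monoid_ring G) \<Longrightarrow> p \<otimes>\<^bsub>monoid_ring G\<^esub> q \<in> I"
proof -
  note um = monoid_ring_uminus
  interpret ideal I "monoid_ring G" by (rule assms)
  show sub: "I \<subseteq> carrier (monoid_ring G)" by (rule a_subset)
  have "\<zero>\<^bsub>monoid_ring G\<^esub> \<in> I" by (rule additive_subgroup.zero_closed[OF ideal.axioms(1)[OF assms]])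
  then show "0 \<in> I" by simp
  show add: "p \<in> I \<Longrightarrow> q \<in> I \<Longrightarrow> p + q \<in> I" for p q
    using additive_subgroup.a_closed[OF ideal.axioms(1)[OF assms], of p q] by simp
  show neg: "- p \<in> I" if p: "p \<in> I" for p
  proof -
    have "\<ominus>\<^bsub>monoid_ring G\<^esub> p = - p" by (rule um) (rule subsetD[OF sub p])
    then show ?thesis using additive_subgroup.a_inv_closed[OF ideal.axioms(1)[OF assms] p] by simp
  qed
  show "p \<in> I \<Longrightarrow> q \<in> I \<Longrightarrow> p - q \<in> I" using add[OF _ neg, of p q] by simp
  show "p \<in> I \<Longrightarrow> q \<in> carrier (monoid_ring G) \<Longrightarrow> q \<otimes>\<^bsub>monoid_ring G\<^esub> p \<in> I" by (rule I_l_closed)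
  show "p \<in> I \<Longrightarrow> q \<in> carrier (monoid_ring G) \<Longrightarrow> p \<otimes>\<^bsub>monoid_ring G\<^esub> q \<in> I" by (rule I_r_closed)
qed

text \<open>
  This bounds an ideal given by generators from above: it suffices that the generators evaluate
  to zero.
\<close>

lemma ev_kernel_ideal:
  assumes M: "monoid M"
    and f: "\<And>a b. a \<in> carrier M \<Longrightarrow> b \<in> carrier M \<Longrightarrow> f (a \<otimes>\<^bsub>M\<^esub> b) = f a * f b"
  shows "ideal {p \<in> carrier (monoid_ring M). ev f p = 0} (monoid_ring M)"
proof -
  interpret R: ring "monoid_ring M" by (rule monoid.monoid_ring_ring[OF M])
  have s: "subgroup {p \<in> carrier (monoid_ring M). ev f p = 0} (add_monoid (monoid_ring M))"
  proof (rule R.add.subgroupI)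
    show "{p \<in> carrier (monoid_ring M). ev f p = 0} \<noteq> {}" by (auto intro!: exI[of _ 0])
  next
    fix a assume a: "a \<in> {p \<in> carrier (monoid_ring M). ev f p = 0}"
    then have "a \<in> carrier (monoid_ring M)" by blast
    then show "\<ominus>\<^bsub>monoid_ring M\<^esub> a \<in> {p \<in> carrier (monoid_ring M). ev f p = 0}"
      using monoid.monoid_ring_uminus[OF M, of a] a R.a_inv_closed[of a]
      by (simp add: ev_uminus del: monoid_ring_simps)
  next
    fix a b assume "a \<in> {p \<in> carrier (monoid_ring M). ev f p = 0}" "b \<in> {p \<in> carrier (monoid_ring M). ev f p = 0}"
    then show "a \<oplus>\<^bsub>monoid_ring M\<^esub> b \<in> {p \<in> carrier (monoid_ring M). ev f p = 0}"
      using R.a_closed[of a b] by (simp add: ev_add)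
  qed auto
  show ?thesis
  proof (rule idealI[OF R.ring_axioms s])
    fix a x assume a: "a \<in> {p \<in> carrier (monoid_ring M). ev f p = 0}" and x: "x \<in> carrier (monoid_ring M)"
    then have a': "a \<in> carrier (monoid_ring M)" "ev f a = 0" by blast+
    show "x \<otimes>\<^bsub>monoid_ring M\<^esub> a \<in> {p \<in> carrier (monoid_ring M). ev f p = 0}"
      using R.m_closed[OF x a'(1)] ev_mult[OF x a'(1) f] a'(2) by simp
    show "a \<otimes>\<^bsub>monoid_ring M\<^esub> x \<in> {p \<in> carrier (monoid_ring M). ev f p = 0}"
      using R.m_closed[OF a'(1) x] ev_mult[OF a'(1) x f] a'(2) by simp
  qed
qed

section \<open>The presentation by generators and relations\<close>

definition word_monoid :: "nat \<Rightarrow> nat list monoid" where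
  "word_monoid n = \<lparr>carrier = lists {1..n}, monoid.mult = (@), one = []\<rparr>"

lemma free_ring_eq: "free_ring n = monoid_ring (word_monoid n)"
  by (simp add: free_ring_def word_monoid_def)

lemma word_monoid_simps [simp]: "carrier (word_monoid n) = lists {1..n}"
  "u \<otimes>\<^bsub>word_monoid n\<^esub> v = u @ v" "\<one>\<^bsub>word_monoid n\<^esub> = []"
  by (simp_all add: word_monoid_def)

lemma monoid_word_monoid: "monoid (word_monoid n)"
  by (rule monoidI) auto

definition word_value :: "nat list \<Rightarrow> oddpoly" where "word_value u = prod_list (map var u)"

lemma word_value_simps [simp]: "word_value [] = 1" "word_value (i # u) = var i * word_value u"
  "word_value (u @ v) = word_value u * word_value v"
  by (simp_all add: word_value_def)

text \<open>
  The word \<open>1 \<cdots> 1 2 \<cdots> 2 \<cdots> n \<cdots> n\<close>, the normal form of a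
  monomial; sorted words represent the residue classes of words up to sign.
\<close>

definition sorted_word :: "nat \<Rightarrow> expo \<Rightarrow> nat list" where
  "sorted_word n m = concat (map (\<lambda>i. replicate (Poly_Mapping.lookup m i) i) [1..<Suc n])"

lemma sorted_word_in: "sorted_word n m \<in> lists {1..n}"
  by (auto simp: sorted_word_def)

lemma word_value_replicate: "word_value (replicate c i) = monomial (Poly_Mapping.single i c) 1"
proof (induction c)
  case 0 then show ?case by (simp add: scal_def[symmetric])
next
  case (Suc c)
  have "Poly_Mapping.single i (Suc c) = Poly_Mapping.single i 1 + Poly_Mapping.single i c"
    by (simp flip: single_add)
  then show ?case using Suc
    by (simp add: var_def monomial_mult crossing_sign_def crossings_single_single)
qed

lemma word_value_sorted:
  assumes "m \<in> expos_on {1..n}"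
  shows "word_value (sorted_word n m) = monomial m 1"
proof -
  define r where "r k = (\<Sum>i\<in>{1..<k}. Poly_Mapping.single i (Poly_Mapping.lookup m i))" for k :: nat
  have cr: "crossings (r k) (Poly_Mapping.single k c) = 0" for k c
  proof -
    have *: "crossings (\<Sum>i\<in>A. Poly_Mapping.single i (Poly_Mapping.lookup m i)) (Poly_Mapping.single k c) = 0"
      if "finite A" "A \<subseteq> {..<k}" for A
      using that by (induction A rule: finite_induct) (auto simp: crossings_add_left crossings_single_single)
    show ?thesis unfolding r_def by (rule *) auto
  qed
  have "word_value (concat (map (\<lambda>i. replicate (Poly_Mapping.lookup m i) i) [1..<k])) = monomial (r k) 1"
    if "k \<ge> 1" for k
    using that
  proof (induction k rule: nat_induct_at_least)
    case base then show ?case by (simp add: r_def scal_def[symmetric])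
  next
    case (Suc k)
    have "r (Suc k) = r k + Poly_Mapping.single k (Poly_Mapping.lookup m k)"
      using Suc.hyps by (simp add: r_def add.commute)
    then show ?case using Suc
      by (simp add: word_value_replicate monomial_mult crossing_sign_def cr)
  qed
  moreover have "r (Suc n) = m"
  proof (rule poly_mapping_eqI)
    fix k
    have "Poly_Mapping.lookup (r (Suc n)) k = (\<Sum>i\<in>{1..n}. if i = k then Poly_Mapping.lookup m i else 0)"
      unfolding r_def lookup_sum by (rule sum.cong) (auto simp: lookup_single when_def)
    also have "\<dots> = Poly_Mapping.lookup m k"
      using assms by (auto simp: expos_on_def in_keys_iff)
    finally show "Poly_Mapping.lookup (r (Suc n)) k = Poly_Mapping.lookup m k" .
  qed
  ultimately show ?thesis unfolding sorted_word_def by (simp del: upt_Suc)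
qed

lemma length_sorted_word:
  assumes "m \<in> expos_on {1..n}"
  shows "length (sorted_word n m) = total_degree m"
proof -
  have h: "word_value u \<in> homog (length u)" for u
  proof (induction u)
    case (Cons i u) then show ?case using homog_mult[OF homog_var[of i] Cons] by simp
  qed simp
  have "monomial m 1 \<in> homog (total_degree m)" by (simp add: homog_def coeff_in_monomial)
  moreover have "monomial m 1 \<in> homog (length (sorted_word n m))"
    using h[of "sorted_word n m"] word_value_sorted[OF assms] by simp
  moreover have "monomial m 1 \<noteq> 0"
    by (metis coeffs_monomial coeffs_ring_ops(2) lookup_single_eq lookup_zero zero_neq_one)
  ultimately show ?thesis using homog_unique by blast
qed

context
  fixes n :: nat
begin

lemma odd_ideal_props:
  shows odd_ideal_ideal: "ideal (odd_ideal n) (free_ring n)"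
    and odd_ideal_rel: "i \<in> {1..n} \<Longrightarrow> j \<in> {1..n} \<Longrightarrow> i \<noteq> j \<Longrightarrow>
      Poly_Mapping.single [i, j] 1 + Poly_Mapping.single [j, i] 1 \<in> odd_ideal n"
    and odd_ideal_ev: "p \<in> odd_ideal n \<Longrightarrow> ev word_value p = 0"
proof -
  let ?R = "monoid_ring (word_monoid n)"
  interpret R: ring ?R by (rule monoid.monoid_ring_ring[OF monoid_word_monoid])
  let ?S = "{free_var i \<otimes>\<^bsub>free_ring n\<^esub> free_var j \<oplus>\<^bsub>free_ring n\<^esub> free_var j \<otimes>\<^bsub>free_ring n\<^esub> free_var i
      | i j. i \<in> {1..n} \<and> j \<in> {1..n} \<and> i \<noteq> j}"
  have S: "?S = {Poly_Mapping.single [i, j] 1 + Poly_Mapping.single [j, i] 1 | i j.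
      i \<in> {1..n} \<and> j \<in> {1..n} \<and> i \<noteq> j}"
    by (simp add: free_ring_eq free_var_def)
  have sub: "?S \<subseteq> carrier ?R"
  proof
    fix p assume "p \<in> ?S"
    then obtain i j where ij: "i \<in> {1..n}" "j \<in> {1..n}"
      and p: "p = Poly_Mapping.single [i, j] 1 + Poly_Mapping.single [j, i] (1::int)" unfolding S by blast
    have "Poly_Mapping.keys p \<subseteq> {[i, j], [j, i]}" unfolding p by (rule order_trans[OF keys_add]) auto
    then show "p \<in> carrier ?R" using ij by auto
  qed
  show "ideal (odd_ideal n) (free_ring n)"
    unfolding odd_ideal_def free_ring_eq using R.genideal_ideal[OF sub] by (simp add: free_ring_eq)
  show "Poly_Mapping.single [i, j] 1 + Poly_Mapping.single [j, i] 1 \<in> odd_ideal n"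
    if "i \<in> {1..n}" "j \<in> {1..n}" "i \<noteq> j"
    using R.genideal_self[OF sub] that S unfolding odd_ideal_def free_ring_eq by blast
  have "?S \<subseteq> {p \<in> carrier ?R. ev word_value p = 0}"
  proof
    fix p assume p: "p \<in> ?S"
    then obtain i j where "i \<noteq> j" and p': "p = Poly_Mapping.single [i, j] 1 + Poly_Mapping.single [j, i] (1::int)"
      unfolding S by blast
    then have "ev word_value p = 0" using var_anticommute[of i j] by (simp add: ev_add)
    with p sub show "p \<in> {p \<in> carrier ?R. ev word_value p = 0}" by blast
  qed
  then have "odd_ideal n \<subseteq> {p \<in> carrier ?R. ev word_value p = 0}"
    unfolding odd_ideal_def free_ring_eq
    by (intro R.genideal_minimal ev_kernel_ideal monoid_word_monoid) (simp_all add: free_ring_eq)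
  then show "ev word_value p = 0" if "p \<in> odd_ideal n" using that by blast
qed

abbreviation odd_cong :: "(nat list \<Rightarrow>\<^sub>0 int) \<Rightarrow> (nat list \<Rightarrow>\<^sub>0 int) \<Rightarrow> bool" where
  "odd_cong p q \<equiv> p - q \<in> odd_ideal n"

lemmas oi = monoid.monoid_ring_ideal[OF monoid_word_monoid odd_ideal_ideal[unfolded free_ring_eq]]

lemma odd_cong_trans: "odd_cong p q \<Longrightarrow> odd_cong q r \<Longrightarrow> odd_cong p r"
  using oi(3)[of "p - q" "q - r"] by simp

lemma odd_cong_uminus: "odd_cong p q \<Longrightarrow> odd_cong (- p) (- q)"
  using oi(4)[of "p - q"] by simp

lemma odd_cong_Cons:
  assumes "i \<in> {1..n}" and "odd_cong (Poly_Mapping.single u c) (Poly_Mapping.single v d)"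
  shows "odd_cong (Poly_Mapping.single (i # u) c) (Poly_Mapping.single (i # v) d)"
  using oi(6)[OF assms(2), of "Poly_Mapping.single [i] 1"] assms(1)
  by (simp add: monoid_ring_mult) (simp add: twisted_conv_add_right[of _ _ _ _ "- _", simplified]
      flip: diff_conv_add_uminus single_uminus add: diff_conv_add_uminus twisted_conv_add_right)

text \<open>
  A letter can be moved past letters different from it by the anticommutation relations.
\<close>

lemma odd_cong_move:
  assumes "j \<in> {1..n}" "u \<in> lists {1..n}" "v \<in> lists {1..n}" "j \<notin> set u"
  shows "\<exists>e. (e = 1 \<or> e = -1) \<and>
    odd_cong (Poly_Mapping.single (j # u @ v) 1) (Poly_Mapping.single (u @ j # v) e)"
  using assms(2,4)
proof (induction u rule: lists.induct)
  case Nil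
  show ?case by (rule exI[of _ 1]) (simp add: oi(2))
next
  case (Cons a u)
  then obtain e where e: "e = 1 \<or> e = -1"
    "odd_cong (Poly_Mapping.single (j # u @ v) 1) (Poly_Mapping.single (u @ j # v) e)" by auto
  have 1: "odd_cong (Poly_Mapping.single (a # j # u @ v) 1) (Poly_Mapping.single (a # u @ j # v) e)"
    by (rule odd_cong_Cons[OF Cons.hyps(1) e(2)])
  have "(Poly_Mapping.single [j, a] 1 + Poly_Mapping.single [a, j] 1) \<otimes>\<^bsub>monoid_ring (word_monoid n)\<^esub>
      Poly_Mapping.single (u @ v) 1 \<in> odd_ideal n"
    using Cons assms by (intro oi(7) odd_ideal_rel) auto
  then have 2: "Poly_Mapping.single (j # a # u @ v) 1 + Poly_Mapping.single (a # j # u @ v) (1::int) \<in> odd_ideal n"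
    by (simp add: monoid_ring_mult twisted_conv_add_left)
  have "Poly_Mapping.single (j # a # u @ v) 1 + Poly_Mapping.single (a # u @ j # v) e \<in> odd_ideal n"
    using oi(5)[OF 2 1] by simp
  then show ?case using e(1) by (intro exI[of _ "- e"]) (auto simp: single_uminus)
qed

text \<open>
  Insertion sort: the first letter is moved to the first position of its block.
\<close>

lemma odd_cong_sorted:
  assumes "u \<in> lists {1..n}"
  shows "\<exists>e m. (e = 1 \<or> e = -1) \<and> m \<in> expos_on {1..n} \<and>
    odd_cong (Poly_Mapping.single u 1) (Poly_Mapping.single (sorted_word n m) e)"
  using assms
proof (induction u rule: lists.induct)
  case Nil
  have "sorted_word n 0 = []" by (simp add: sorted_word_def)
  then show ?case by (intro exI[of _ 1] exI[of _ 0]) (simp add: expos_on_def oi(2))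
next
  case (Cons j u)
  then obtain e m where e: "e = 1 \<or> e = -1" and m: "m \<in> expos_on {1..n}"
    and c: "odd_cong (Poly_Mapping.single u 1) (Poly_Mapping.single (sorted_word n m) e)" by blast
  let ?f = "\<lambda>m i. replicate (Poly_Mapping.lookup m i) i"
  let ?A = "concat (map (?f m) [1..<j])" and ?B = "concat (map (?f m) [j..<Suc n])"
  have upt: "[1..<Suc n] = [1..<j] @ [j..<Suc n]" "[j..<Suc n] = j # [Suc j..<Suc n]"
    using Cons.hyps(1) upt_add_eq_append[of 1 j "Suc n - j"] upt_conv_Cons[of j "Suc n"]
    by (simp_all del: upt_Suc)
  let ?m = "Poly_Mapping.single j 1 + m"
  \<comment> \<open>the sorted words before and after the insertion are split in front of the block of \<open>j\<close>\<close>
  have w: "sorted_word n m = ?A @ ?B" unfolding sorted_word_def upt(1) by simp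
  have m1: "map (?f ?m) [1..<j] = map (?f m) [1..<j]"
    and m2: "map (?f ?m) [Suc j..<Suc n] = map (?f m) [Suc j..<Suc n]"
    by (auto simp: lookup_add lookup_single when_def)
  have m3: "?f ?m j = j # ?f m j" by (simp add: lookup_add)
  have "sorted_word n ?m = concat (map (?f ?m) [1..<j]) @ ?f ?m j @ concat (map (?f ?m) [Suc j..<Suc n])"
    unfolding sorted_word_def upt(1) unfolding upt(2) by (simp only: map_append concat_append list.map concat.simps)
  moreover have "?B = ?f m j @ concat (map (?f m) [Suc j..<Suc n])"
    unfolding upt(2) by (simp only: list.map concat.simps)
  ultimately have w': "sorted_word n ?m = ?A @ j # ?B" unfolding m1 m2 m3 by (simp only: append.simps)
  have "?A \<in> lists {1..n}" "?B \<in> lists {1..n}" "j \<notin> set ?A" using Cons.hyps(1) by auto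
  then obtain e' where e': "e' = 1 \<or> e' = -1"
    "odd_cong (Poly_Mapping.single (j # sorted_word n m) 1) (Poly_Mapping.single (sorted_word n ?m) e')"
    unfolding w w' using odd_cong_move[OF Cons.hyps(1)] by blast
  have a: "odd_cong (Poly_Mapping.single (j # u) 1) (Poly_Mapping.single (j # sorted_word n m) e)"
    by (rule odd_cong_Cons[OF Cons.hyps(1) c])
  have "odd_cong (Poly_Mapping.single (j # sorted_word n m) e) (Poly_Mapping.single (sorted_word n ?m) (e * e'))"
    using e e'(2) odd_cong_uminus[OF e'(2)] by (auto simp: single_uminus)
  from odd_cong_trans[OF a this] have
    "odd_cong (Poly_Mapping.single (j # u) 1) (Poly_Mapping.single (sorted_word n ?m) (e * e'))" .
  moreover have "?m \<in> expos_on {1..n}"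
    using Cons.hyps(1) m by (intro expos_on_add) (auto simp: expos_on_def)
  ultimately show ?case using e e'(1) by (intro exI[of _ "e * e'"] exI[of _ ?m]) auto
qed

definition sorted_lift :: "(expo \<Rightarrow>\<^sub>0 int) \<Rightarrow> nat list \<Rightarrow>\<^sub>0 int" where
  "sorted_lift h = linear_ext (\<lambda>m c. Poly_Mapping.single (sorted_word n m) c) h"

lemma sorted_lift_add: "sorted_lift (h + h') = sorted_lift h + sorted_lift h'"
  unfolding sorted_lift_def by (rule linear_ext_add) (simp_all add: single_add)

lemma sorted_lift_diff: "sorted_lift (h - h') = sorted_lift h - sorted_lift h'"
  using sorted_lift_add[of "h - h'" h'] by simp

lemma sorted_lift_0 [simp]: "sorted_lift 0 = 0"
  by (simp add: sorted_lift_def)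

lemma sorted_lift_single: "sorted_lift (Poly_Mapping.single m c) = Poly_Mapping.single (sorted_word n m) c"
  unfolding sorted_lift_def by (rule linear_ext_single) simp

lemma of_int_monomial: "of_int c * monomial m d = monomial m (of_int c * d)"
proof -
  have "scal (of_int c) = of_int c"
  proof (induction c rule: int_induct[where k = 0])
    case (step1 i) then show ?case by simp
  next
    case (step2 i) then show ?case by simp
  qed simp
  then show ?thesis by (metis scal_mult_monomial)
qed

lemma lookup_ev_sorted_lift:
  assumes "Poly_Mapping.keys h \<subseteq> expos_on {1..n}"
  shows "Poly_Mapping.lookup (coeffs (ev word_value (sorted_lift h))) m = of_int (Poly_Mapping.lookup h m)"
  using assms
proof (induction h rule: poly_mapping_additive_induct)
  case (single k c)
  then show ?case
    by (simp add: sorted_lift_single word_value_sorted of_int_monomial lookup_single when_def)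
qed (simp_all add: sorted_lift_add ev_add coeffs_ring_ops lookup_add sorted_lift_0)

lemma odd_cong_lift:
  assumes "Poly_Mapping.keys p \<subseteq> lists {1..n}"
  shows "\<exists>h. Poly_Mapping.keys h \<subseteq> expos_on {1..n} \<and> odd_cong p (sorted_lift h)"
  using assms
proof (induction p rule: frag_induction)
  case zero
  show ?case by (rule exI[of _ 0]) (simp add: sorted_lift_def oi(2))
next
  case (one u)
  obtain e m where "m \<in> expos_on {1..n}"
    "odd_cong (Poly_Mapping.single u 1) (Poly_Mapping.single (sorted_word n m) e)"
    using odd_cong_sorted[of u] one by auto
  then show ?case
    by (intro exI[of _ "Poly_Mapping.single m e"]) (auto simp: sorted_lift_single)
next
  case (diff p q)
  then obtain h h' where h: "Poly_Mapping.keys h \<subseteq> expos_on {1..n}" "odd_cong p (sorted_lift h)"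
    "Poly_Mapping.keys h' \<subseteq> expos_on {1..n}" "odd_cong q (sorted_lift h')" by auto
  have "odd_cong (p - q) (sorted_lift (h - h'))"
    using oi(5)[OF h(2,4)] by (simp add: sorted_lift_diff algebra_simps)
  moreover have "Poly_Mapping.keys (h - h') \<subseteq> expos_on {1..n}" using keys_diff[of h h'] h by blast
  ultimately show ?case by blast
qed

text \<open>
  Modulo the relations every element is a combination of sorted words. These evaluate to
  distinct monomials, so an element that evaluates to zero has only zero coefficients.
\<close>

lemma odd_ideal_iff:
  assumes p: "p \<in> carrier (free_ring n)"
  shows "p \<in> odd_ideal n \<longleftrightarrow> ev word_value p = 0"
proof
  assume 0: "ev word_value p = 0"
  obtain h where h: "Poly_Mapping.keys h \<subseteq> expos_on {1..n}" "odd_cong p (sorted_lift h)"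
    using odd_cong_lift[of p] p by (auto simp: free_ring_eq)
  have "ev word_value (sorted_lift h) = 0" using odd_ideal_ev[OF h(2)] 0 by (simp add: ev_diff)
  then have "of_int (Poly_Mapping.lookup h m) = (0 :: rat)" for m
    using lookup_ev_sorted_lift[OF h(1), of m] by (simp add: coeffs_ring_ops)
  then have "h = 0" by (intro poly_mapping_eqI) simp
  then show "p \<in> odd_ideal n" using h(2) by (simp add: sorted_lift_def)
qed (rule odd_ideal_ev)

definition odd_value :: "(nat list \<Rightarrow>\<^sub>0 int) set \<Rightarrow> oddpoly" where
  "odd_value = coset_value word_value"

lemma odd_pol_representation:
  shows odd_value_coset: "p \<in> carrier (free_ring n) \<Longrightarrow> odd_value (odd_ideal n +>\<^bsub>free_ring n\<^esub> p) = ev word_value p"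
    and odd_pol_represents: "represents (odd_pol n) odd_value"
    and odd_pol_mem: "X \<in> carrier (odd_pol n) \<longleftrightarrow> (\<exists>p\<in>carrier (free_ring n). X = odd_ideal n +>\<^bsub>free_ring n\<^esub> p)"
  using coset_representation[OF monoid_word_monoid odd_ideal_ideal[unfolded free_ring_eq], of word_value]
    odd_ideal_iff
  unfolding odd_value_def odd_pol_def free_ring_eq by auto

lemma odd_value_image: "odd_value ` carrier (odd_pol n) = supp \<int> {1..n}"
proof
  show "odd_value ` carrier (odd_pol n) \<subseteq> supp \<int> {1..n}"
  proof
    fix f assume "f \<in> odd_value ` carrier (odd_pol n)"
    then obtain p where p: "p \<in> carrier (free_ring n)" "f = ev word_value p"
      using odd_pol_mem odd_value_coset by auto
    obtain h where h: "Poly_Mapping.keys h \<subseteq> expos_on {1..n}" "odd_cong p (sorted_lift h)"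
      using odd_cong_lift[of p] p by (auto simp: free_ring_eq)
    have "f = ev word_value (sorted_lift h)" using odd_ideal_ev[OF h(2)] p(2) by (simp add: ev_diff)
    then have l: "Poly_Mapping.lookup (coeffs f) m = of_int (Poly_Mapping.lookup h m)" for m
      using lookup_ev_sorted_lift[OF h(1)] by simp
    show "f \<in> supp \<int> {1..n}"
      unfolding coeff_in_def
    proof (intro CollectI ballI conjI)
      fix m assume "m \<in> Poly_Mapping.keys (coeffs f)"
      then have "m \<in> Poly_Mapping.keys h" by (simp add: in_keys_iff l)
      then show "m \<in> expos_on {1..n}" using h(1) by blast
    qed (simp add: l)
  qed
  show "supp \<int> {1..n} \<subseteq> odd_value ` carrier (odd_pol n)"
  proof
    fix f assume f: "f \<in> supp \<int> {1..n}"
    then have "f \<in> (ev word_value) ` carrier (free_ring n)"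
    proof (induction rule: coeff_in_monomial_induct)
      case zero show ?case by (rule image_eqI[of _ _ 0]) (simp_all add: free_ring_eq)
    next
      case (monomial m c)
      then obtain k where "c = of_int k" by (elim Ints_cases)
      then show ?case
        using monomial sorted_word_in[of n m]
        by (intro image_eqI[of _ _ "Poly_Mapping.single (sorted_word n m) k"])
          (auto simp: free_ring_eq word_value_sorted of_int_monomial)
    next
      case (add f g)
      then obtain p q where "p \<in> carrier (free_ring n)" "q \<in> carrier (free_ring n)"
        "f = ev word_value p" "g = ev word_value q" by blast
      then show ?case using keys_add[of p q]
        by (intro image_eqI[of _ _ "p + q"]) (auto simp: ev_add free_ring_eq)
    qed
    then show "f \<in> odd_value ` carrier (odd_pol n)"
      using odd_pol_mem odd_value_coset by (metis (no_types, lifting) image_iff)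
  qed
qed

text \<open>
  Indexed by integers and with variables of degree \<open>2\<close>, as in the grading of the
  presented ring; odd and negative degrees give only \<open>0\<close>.
\<close>

definition homogZ :: "int \<Rightarrow> oddpoly set" where
  "homogZ d = coeff_in UNIV {m. 2 * int (total_degree m) = d}"

text \<open>
  A class is homogeneous if its value is: the combination of sorted words that represents it
  contains only words of the length prescribed by its value.
\<close>

lemma odd_pol_deg_eq: "odd_pol_deg n d = {X \<in> carrier (odd_pol n). odd_value X \<in> homogZ d}"
proof
  show "odd_pol_deg n d \<subseteq> {X \<in> carrier (odd_pol n). odd_value X \<in> homogZ d}"
  proof
    fix X assume "X \<in> odd_pol_deg n d"
    then obtain p where p: "p \<in> carrier (free_ring n)" "X = odd_ideal n +>\<^bsub>free_ring n\<^esub> p"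
      "\<forall>u\<in>Poly_Mapping.keys p. 2 * int (length u) = d" unfolding odd_pol_deg_def by blast
    have hw: "word_value u \<in> homog (length u)" for u
    proof (induction u)
      case (Cons i u) then show ?case using homog_mult[OF homog_var[of i] Cons] by simp
    qed simp
    have "Poly_Mapping.keys p \<subseteq> {u. 2 * int (length u) = d}" using p(3) by blast
    then have "ev word_value p \<in> homogZ d"
    proof (induction p rule: poly_mapping_additive_induct)
      case (single u c)
      have "of_int c * word_value u \<in> homog (length u)"
      proof -
        have "of_int c * monomial 0 1 = monomial 0 (of_int c)" by (simp add: of_int_monomial)
        then have "of_int c \<in> homog 0" using homog_scal[of "of_int c"] by (simp add: scal_def) (metis mult_1_right scal_def scal_simps(2))
        from homog_mult[OF this hw[of u]] show ?thesis by simp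
      qed
      then show ?case using single by (auto simp: homog_def homogZ_def coeff_in_def)
    qed (auto simp: homogZ_def ev_add intro: coeff_in_add)
    then show "X \<in> {X \<in> carrier (odd_pol n). odd_value X \<in> homogZ d}"
      using p odd_pol_mem odd_value_coset by auto
  qed
  show "{X \<in> carrier (odd_pol n). odd_value X \<in> homogZ d} \<subseteq> odd_pol_deg n d"
  proof
    fix X assume X: "X \<in> {X \<in> carrier (odd_pol n). odd_value X \<in> homogZ d}"
    then obtain p where p: "p \<in> carrier (free_ring n)" "X = odd_ideal n +>\<^bsub>free_ring n\<^esub> p"
      using odd_pol_mem by blast
    obtain h where h: "Poly_Mapping.keys h \<subseteq> expos_on {1..n}" "odd_cong p (sorted_lift h)"
      using odd_cong_lift[of p] p by (auto simp: free_ring_eq)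
    let ?q = "sorted_lift h"
    have kq: "Poly_Mapping.keys ?q \<subseteq> sorted_word n ` Poly_Mapping.keys h"
      unfolding sorted_lift_def linear_ext_def by (rule order_trans[OF keys_sum]) auto
    then have q: "?q \<in> carrier (free_ring n)" using sorted_word_in[of n] by (auto simp: free_ring_eq)
    have v: "ev word_value p = ev word_value ?q" using odd_ideal_ev[OF h(2)] by (simp add: ev_diff)
    then have "odd_value X = odd_value (odd_ideal n +>\<^bsub>free_ring n\<^esub> ?q)"
      using p q by (simp add: odd_value_coset)
    then have Xq: "X = odd_ideal n +>\<^bsub>free_ring n\<^esub> ?q"
      using representsD(2)[OF odd_pol_represents] X q odd_pol_mem by (auto dest: inj_onD)
    have "2 * int (total_degree m) = d" if "m \<in> Poly_Mapping.keys h" for m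
    proof -
      have "Poly_Mapping.lookup (coeffs (odd_value X)) m \<noteq> 0"
        using that v p by (simp add: odd_value_coset lookup_ev_sorted_lift[OF h(1)] in_keys_iff)
      then show ?thesis using X by (auto simp: homogZ_def coeff_in_def in_keys_iff)
    qed
    then have "\<forall>u\<in>Poly_Mapping.keys ?q. 2 * int (length u) = d"
      using kq h(1) by (auto simp: length_sorted_word subset_iff)
    with q Xq show "X \<in> odd_pol_deg n d" unfolding odd_pol_deg_def by blast
  qed
qed

end

section \<open>Extension of scalars\<close>

lemma scal_of_nat_mult: "scal (of_nat k) * f = of_nat k * f"
  by (induction k) (simp_all add: distrib_right)

lemma scal_of_int_mult: "scal (of_int k) * f = of_int k * f"
  by (cases k rule: int_cases2) (simp_all add: scal_of_nat_mult)

definition pair_monoid :: "('a, 'c) ring_scheme \<Rightarrow> (rat \<times> 'a) monoid" where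
  "pair_monoid A = \<lparr>carrier = (UNIV :: rat set), monoid.mult = (*), one = 1\<rparr> \<times>\<times> A"

lemma rat_pairs_ring_eq: "rat_pairs_ring A = monoid_ring (pair_monoid A)"
  by (simp add: rat_pairs_ring_def pair_monoid_def)

lemma pair_monoid_simps [simp]: "carrier (pair_monoid A) = UNIV \<times> carrier A"
  "(q, a) \<otimes>\<^bsub>pair_monoid A\<^esub> (r, b) = (q * r, a \<otimes>\<^bsub>A\<^esub> b)" "\<one>\<^bsub>pair_monoid A\<^esub> = (1, \<one>\<^bsub>A\<^esub>)"
  by (simp_all add: pair_monoid_def DirProd_def)

definition pair_value :: "('a \<Rightarrow> oddpoly) \<Rightarrow> rat \<times> 'a \<Rightarrow> oddpoly" where
  "pair_value \<theta> = (\<lambda>(q, a). scal q * \<theta> a)"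

definition tensor_value :: "('a \<Rightarrow> oddpoly) \<Rightarrow> ((rat \<times> 'a) \<Rightarrow>\<^sub>0 int) set \<Rightarrow> oddpoly" where
  "tensor_value \<theta> = coset_value (pair_value \<theta>)"

context
  fixes A :: "('a, 'c) ring_scheme" and \<theta> :: "'a \<Rightarrow> oddpoly"
  assumes rep: "represents A \<theta>"
begin

lemmas repD = representsD[OF rep]

lemma monoid_pair_monoid: "monoid (pair_monoid A)"
proof -
  interpret ring A by (rule repD(1))
  show ?thesis by (rule monoidI) (auto simp: m_assoc)
qed

lemma pair_value_mult:
  assumes "x \<in> carrier (pair_monoid A)" "y \<in> carrier (pair_monoid A)"
  shows "pair_value \<theta> (x \<otimes>\<^bsub>pair_monoid A\<^esub> y) = pair_value \<theta> x * pair_value \<theta> y"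
proof -
  obtain q a r b where xy: "x = (q, a)" "y = (r, b)" "a \<in> carrier A" "b \<in> carrier A"
    using assms by auto
  have "scal q * scal r * (\<theta> a * \<theta> b) = scal q * \<theta> a * (scal r * \<theta> b)"
    by (metis mult.assoc scal_central)
  then show ?thesis using xy by (simp add: pair_value_def repD)
qed

lemma pair_value_one: "pair_value \<theta> \<one>\<^bsub>pair_monoid A\<^esub> = 1"
  by (simp add: pair_value_def repD)

lemma biadditive_ideal_props:
  shows biadditive_ideal_ideal: "ideal (biadditive_ideal A) (rat_pairs_ring A)"
    and biadditive_left: "a \<in> carrier A \<Longrightarrow> Poly_Mapping.single (q + r, a) 1 - Poly_Mapping.single (q, a) 1 -
      Poly_Mapping.single (r, a) 1 \<in> biadditive_ideal A"
    and biadditive_right: "a \<in> carrier A \<Longrightarrow> b \<in> carrier A \<Longrightarrow> Poly_Mapping.single (q, a \<oplus>\<^bsub>A\<^esub> b) 1 -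
      Poly_Mapping.single (q, a) 1 - Poly_Mapping.single (q, b) 1 \<in> biadditive_ideal A"
    and biadditive_ideal_ev: "p \<in> biadditive_ideal A \<Longrightarrow> ev (pair_value \<theta>) p = 0"
proof -
  let ?R = "monoid_ring (pair_monoid A)"
  interpret R: ring ?R by (rule monoid.monoid_ring_ring[OF monoid_pair_monoid])
  interpret A: ring A by (rule repD(1))
  have kd: "Poly_Mapping.keys (Poly_Mapping.single x (1::int) - Poly_Mapping.single y 1 - Poly_Mapping.single z 1)
      \<subseteq> {x, y, z}" for x y z :: "rat \<times> 'a"
    using keys_diff[of "Poly_Mapping.single x (1::int) - Poly_Mapping.single y 1" "Poly_Mapping.single z 1"]
      keys_diff[of "Poly_Mapping.single x (1::int)" "Poly_Mapping.single y 1"] by auto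
  have sub: "biadditive_rels A \<subseteq> {p \<in> carrier ?R. ev (pair_value \<theta>) p = 0}"
  proof
    fix p assume "p \<in> biadditive_rels A"
    then consider q r a where "a \<in> carrier A"
        "p = Poly_Mapping.single (q + r, a) 1 - Poly_Mapping.single (q, a) 1 - Poly_Mapping.single (r, a) 1"
      | q a b where "a \<in> carrier A" "b \<in> carrier A"
        "p = Poly_Mapping.single (q, a \<oplus>\<^bsub>A\<^esub> b) 1 - Poly_Mapping.single (q, a) 1 - Poly_Mapping.single (q, b) 1"
      unfolding biadditive_rels_def by blast
    then show "p \<in> {p \<in> carrier ?R. ev (pair_value \<theta>) p = 0}"
    proof cases
      case 1
      then have "Poly_Mapping.keys p \<subseteq> {(q + r, a), (q, a), (r, a)}" using kd by blast
      then show ?thesis using 1 by (auto simp: ev_diff pair_value_def distrib_right)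
    next
      case 2
      then have "Poly_Mapping.keys p \<subseteq> {(q, a \<oplus>\<^bsub>A\<^esub> b), (q, a), (q, b)}" using kd by blast
      then show ?thesis using 2 by (auto simp: ev_diff pair_value_def distrib_left repD)
    qed
  qed
  then have sub': "biadditive_rels A \<subseteq> carrier ?R" by blast
  show "ideal (biadditive_ideal A) (rat_pairs_ring A)"
    unfolding biadditive_ideal_def rat_pairs_ring_eq by (rule R.genideal_ideal[OF sub'])
  have self: "biadditive_rels A \<subseteq> biadditive_ideal A"
    unfolding biadditive_ideal_def rat_pairs_ring_eq by (rule R.genideal_self[OF sub'])
  show "Poly_Mapping.single (q + r, a) 1 - Poly_Mapping.single (q, a) 1 -
      Poly_Mapping.single (r, a) 1 \<in> biadditive_ideal A" if "a \<in> carrier A"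
    by (rule subsetD[OF self], unfold biadditive_rels_def, rule UnI1, rule CollectI)
      (intro exI[of _ q] exI[of _ r] exI[of _ a] conjI refl that)
  show "Poly_Mapping.single (q, a \<oplus>\<^bsub>A\<^esub> b) 1 - Poly_Mapping.single (q, a) 1 -
      Poly_Mapping.single (q, b) 1 \<in> biadditive_ideal A" if "a \<in> carrier A" "b \<in> carrier A"
    by (rule subsetD[OF self], unfold biadditive_rels_def, rule UnI2, rule CollectI)
      (intro exI[of _ q] exI[of _ a] exI[of _ b] conjI refl that)
  have "biadditive_ideal A \<subseteq> {p \<in> carrier ?R. ev (pair_value \<theta>) p = 0}"
    unfolding biadditive_ideal_def rat_pairs_ring_eq
    by (rule R.genideal_minimal[OF ev_kernel_ideal[OF monoid_pair_monoid pair_value_mult] sub])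
  then show "ev (pair_value \<theta>) p = 0" if "p \<in> biadditive_ideal A" using that by blast
qed

lemmas bi = monoid.monoid_ring_ideal[OF monoid_pair_monoid biadditive_ideal_ideal[unfolded rat_pairs_ring_eq]]

abbreviation tcong :: "((rat \<times> 'a) \<Rightarrow>\<^sub>0 int) \<Rightarrow> ((rat \<times> 'a) \<Rightarrow>\<^sub>0 int) \<Rightarrow> bool" where
  "tcong p q \<equiv> p - q \<in> biadditive_ideal A"

abbreviation pr :: "rat \<Rightarrow> 'a \<Rightarrow> (rat \<times> 'a) \<Rightarrow>\<^sub>0 int" where "pr q a \<equiv> Poly_Mapping.single (q, a) 1"

lemma tcong_refl: "tcong p p" using bi(2) by simp
lemma tcong_sym: "tcong p q \<Longrightarrow> tcong q p" using bi(4)[of "p - q"] by simp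
lemma tcong_trans: "tcong p q \<Longrightarrow> tcong q r \<Longrightarrow> tcong p r" using bi(3)[of "p - q" "q - r"] by simp
lemma tcong_diff:
  assumes "tcong p q" "tcong p' q'" shows "tcong (p - p') (q - q')"
proof -
  have "p - p' - (q - q') = (p - q) - (p' - q')" by (simp add: algebra_simps)
  then show ?thesis by (simp only: bi(5)[OF assms])
qed

lemma tcong_add:
  assumes "tcong p q" "tcong p' q'" shows "tcong (p + p') (q + q')"
proof -
  have "p + p' - (q + q') = (p - q) + (p' - q')" by (simp add: algebra_simps)
  then show ?thesis by (simp only: bi(3)[OF assms])
qed

lemma tcong_add_left: "a \<in> carrier A \<Longrightarrow> tcong (pr (q + r) a) (pr q a + pr r a)"
  unfolding diff_diff_eq[symmetric] by (rule biadditive_left)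

lemma tcong_add_right: "a \<in> carrier A \<Longrightarrow> b \<in> carrier A \<Longrightarrow> tcong (pr q (a \<oplus>\<^bsub>A\<^esub> b)) (pr q a + pr q b)"
  unfolding diff_diff_eq[symmetric] by (rule biadditive_right)

lemma tcong_zero_left: "a \<in> carrier A \<Longrightarrow> tcong (pr 0 a) 0"
  using bi(4)[OF biadditive_left[of a 0 0]] by simp

lemma tcong_zero_right: "tcong (pr q \<zero>\<^bsub>A\<^esub>) 0"
proof -
  interpret ring A by (rule repD(1))
  show ?thesis using bi(4)[OF biadditive_right[of "\<zero>\<^bsub>A\<^esub>" "\<zero>\<^bsub>A\<^esub>" q]] by simp
qed

text \<open>
  Integer multiples move across the tensor sign by biadditivity.
\<close>

lemma tcong_of_nat:
  assumes "a \<in> carrier A"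
  shows "\<exists>b\<in>carrier A. tcong (pr (of_nat k * q) a) (pr q b)"
proof (induction k)
  interpret ring A by (rule repD(1))
  case 0
  show ?case using tcong_trans[OF tcong_zero_left[OF assms] tcong_sym[OF tcong_zero_right[of q]]]
    by (intro bexI[of _ "\<zero>\<^bsub>A\<^esub>"]) auto
next
  interpret ring A by (rule repD(1))
  case (Suc k)
  then obtain b where b: "b \<in> carrier A" "tcong (pr (of_nat k * q) a) (pr q b)" by blast
  have "tcong (pr (q + of_nat k * q) a) (pr q a + pr (of_nat k * q) a)" by (rule tcong_add_left[OF assms])
  moreover have "tcong (pr q a + pr (of_nat k * q) a) (pr q a + pr q b)"
    by (rule tcong_add[OF tcong_refl b(2)])
  moreover have "tcong (pr q a + pr q b) (pr q (a \<oplus>\<^bsub>A\<^esub> b))"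
    by (rule tcong_sym[OF tcong_add_right[OF assms b(1)]])
  ultimately have "tcong (pr (q + of_nat k * q) a) (pr q (a \<oplus>\<^bsub>A\<^esub> b))"
    by (meson tcong_trans)
  moreover have "q + of_nat k * q = of_nat (Suc k) * q" by (simp add: algebra_simps)
  ultimately show ?case using b(1) assms by (intro bexI[of _ "a \<oplus>\<^bsub>A\<^esub> b"]) auto
qed

lemma tcong_minus:
  assumes "a \<in> carrier A"
  shows "tcong (pr (- q) a) (pr q (\<ominus>\<^bsub>A\<^esub> a))"
proof -
  interpret ring A by (rule repD(1))
  have 1: "tcong 0 (pr (- q) a + pr q a)"
    using tcong_trans[OF tcong_sym[OF tcong_zero_left[OF assms]], of "pr (- q) a + pr q a"]
      tcong_add_left[OF assms, of "- q" q] by simp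
  have 2: "tcong 0 (pr q (\<ominus>\<^bsub>A\<^esub> a) + pr q a)"
    using tcong_trans[OF tcong_sym[OF tcong_zero_right[of q]], of "pr q (\<ominus>\<^bsub>A\<^esub> a) + pr q a"]
      tcong_add_right[OF a_inv_closed[OF assms] assms, of q] by (simp add: l_neg assms)
  have "pr (- q) a - pr q (\<ominus>\<^bsub>A\<^esub> a) = (0 - (pr q (\<ominus>\<^bsub>A\<^esub> a) + pr q a)) - (0 - (pr (- q) a + pr q a))"
    by (simp add: algebra_simps)
  then show ?thesis by (simp only: bi(5)[OF 2 1])
qed

text \<open>
  With a common denominator \<open>N\<close> every tensor is congruent to a pure one \<open>(1 /
  N) \<otimes> a\<close>. This is the reason why \<open>\<rat> \<otimes> A\<close> is a
  localisation, and why the biadditivity relations generate the whole kernel of the evaluation.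
\<close>

lemma tcong_pure:
  assumes "Poly_Mapping.keys p \<subseteq> UNIV \<times> carrier A"
  shows "\<exists>N a. N > 0 \<and> a \<in> carrier A \<and> tcong p (pr (1 / of_nat N) a)"
  using assms
proof (induction p rule: frag_induction)
  interpret ring A by (rule repD(1))
  case zero
  show ?case using tcong_sym[OF tcong_zero_right] by (intro exI[of _ 1] exI[of _ "\<zero>\<^bsub>A\<^esub>"]) auto
next
  interpret ring A by (rule repD(1))
  case (one x)
  then obtain q a where x: "x = (q, a)" "a \<in> carrier A" by auto
  obtain z w where zw: "q = of_int z / of_int w" "w > 0" by (metis Rat_cases Fract_of_int_quotient of_int_eq_iff)
  define N where "N = nat w"
  have N: "N > 0" "of_int w = (of_nat N :: rat)" using zw(2) by (auto simp: N_def)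
  define k where "k = nat \<bar>z\<bar>"
  obtain b where b: "b \<in> carrier A" "tcong (pr (of_nat k * (1 / of_nat N)) a) (pr (1 / of_nat N) b)"
    using tcong_of_nat[OF x(2)] by blast
  show ?case
  proof (cases "z \<ge> 0")
    case True
    then have "q = of_nat k * (1 / of_nat N)" using zw N by (simp add: k_def)
    with b N x show ?thesis by auto
  next
    case False
    then have q: "q = of_nat k * (- (1 / of_nat N))" using zw N by (simp add: k_def)
    obtain c where c: "c \<in> carrier A" "tcong (pr (of_nat k * (- (1 / of_nat N))) a) (pr (- (1 / of_nat N)) c)"
      using tcong_of_nat[OF x(2)] by blast
    have "tcong (pr q a) (pr (1 / of_nat N) (\<ominus>\<^bsub>A\<^esub> c))"
      using tcong_trans[OF c(2) tcong_minus[OF c(1)]] by (simp add: q)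
    with c N x show ?thesis by (auto intro!: exI[of _ N] exI[of _ "\<ominus>\<^bsub>A\<^esub> c"])
  qed
next
  interpret ring A by (rule repD(1))
  case (diff p p')
  then obtain N a N' a' where N: "N > 0" "a \<in> carrier A" "tcong p (pr (1 / of_nat N) a)"
    "N' > 0" "a' \<in> carrier A" "tcong p' (pr (1 / of_nat N') a')" by blast
  let ?M = "N * N'"
  obtain b where b: "b \<in> carrier A" "tcong (pr (of_nat N' * (1 / of_nat ?M)) a) (pr (1 / of_nat ?M) b)"
    using tcong_of_nat[OF N(2)] by blast
  obtain b' where b': "b' \<in> carrier A" "tcong (pr (of_nat N * (1 / of_nat ?M)) a') (pr (1 / of_nat ?M) b')"
    using tcong_of_nat[OF N(5)] by blast
  have e: "(1 / of_nat N :: rat) = of_nat N' * (1 / of_nat ?M)" "(1 / of_nat N' :: rat) = of_nat N * (1 / of_nat ?M)"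
    using N(1,4) by (simp_all add: field_simps)
  have 1: "tcong p (pr (1 / of_nat ?M) b)" using tcong_trans[OF N(3)[unfolded e(1)] b(2)] .
  have 2: "tcong p' (pr (1 / of_nat ?M) b')" using tcong_trans[OF N(6)[unfolded e(2)] b'(2)] .
  have "tcong (pr (1 / of_nat ?M) (b \<ominus>\<^bsub>A\<^esub> b')) (pr (1 / of_nat ?M) b - pr (1 / of_nat ?M) b')"
  proof -
    have "b = (b \<ominus>\<^bsub>A\<^esub> b') \<oplus>\<^bsub>A\<^esub> b'"
      using b(1) b'(1) by (simp add: a_minus_def a_assoc l_neg)
    then have "tcong (pr (1 / of_nat ?M) b) (pr (1 / of_nat ?M) (b \<ominus>\<^bsub>A\<^esub> b') + pr (1 / of_nat ?M) b')"
      using tcong_add_right[OF minus_closed[OF b(1) b'(1)] b'(1)] by metis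
    moreover have "x - (y - z) = (x + z) - y" for x y z :: "(rat \<times> 'a) \<Rightarrow>\<^sub>0 int"
      by (simp add: algebra_simps)
    ultimately show ?thesis using tcong_sym by (simp only:)
  qed
  from tcong_trans[OF tcong_diff[OF 1 2] tcong_sym[OF this]]
  have "tcong (p - p') (pr (1 / of_nat ?M) (b \<ominus>\<^bsub>A\<^esub> b'))" .
  then show ?case using N(1,4) minus_closed[OF b(1) b'(1)]
    by (intro exI[of _ ?M] exI[of _ "b \<ominus>\<^bsub>A\<^esub> b'"]) simp
qed

text \<open>
  If \<open>(1 / N) \<otimes> a\<close> evaluates to zero then \<open>a\<close> does, hence
  \<open>a = 0\<close> because the representation of \<open>A\<close> is faithful.
\<close>

lemma biadditive_ideal_iff:
  assumes p: "p \<in> carrier (rat_pairs_ring A)"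
  shows "p \<in> biadditive_ideal A \<longleftrightarrow> ev (pair_value \<theta>) p = 0"
proof
  interpret ring A by (rule repD(1))
  assume 0: "ev (pair_value \<theta>) p = 0"
  obtain N a where N: "N > 0" "a \<in> carrier A" "tcong p (pr (1 / of_nat N) a)"
    using tcong_pure[of p] p by (auto simp: rat_pairs_ring_eq)
  have "scal (1 / of_nat N) * \<theta> a = 0"
    using biadditive_ideal_ev[OF N(3)] 0 by (simp add: ev_diff pair_value_def)
  then have "scal (of_nat N) * (scal (1 / of_nat N) * \<theta> a) = 0" by simp
  then have "\<theta> a = 0" using N(1) unfolding mult.assoc[symmetric] scal_simps(6)[symmetric] by simp
  then have "a = \<zero>\<^bsub>A\<^esub>" using inj_onD[OF repD(2), of a "\<zero>\<^bsub>A\<^esub>"] N(2) by (simp add: repD(4))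
  then have "tcong p 0" using tcong_trans[OF N(3)] tcong_zero_right by blast
  then show "p \<in> biadditive_ideal A" by simp
qed (rule biadditive_ideal_ev)

lemma tensor_representation:
  shows tensor_value_coset: "p \<in> carrier (rat_pairs_ring A) \<Longrightarrow>
      tensor_value \<theta> (biadditive_ideal A +>\<^bsub>rat_pairs_ring A\<^esub> p) = ev (pair_value \<theta>) p"
    and tensor_represents: "represents (rat_tensor A) (tensor_value \<theta>)"
    and tensor_mem: "X \<in> carrier (rat_tensor A) \<longleftrightarrow>
      (\<exists>p\<in>carrier (rat_pairs_ring A). X = biadditive_ideal A +>\<^bsub>rat_pairs_ring A\<^esub> p)"
  using coset_representation[OF monoid_pair_monoid biadditive_ideal_ideal[unfolded rat_pairs_ring_eq],
      of "pair_value \<theta>"] pair_value_mult pair_value_one biadditive_ideal_iff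
  unfolding tensor_value_def rat_tensor_def rat_pairs_ring_eq by auto

lemma pr_in: "a \<in> carrier A \<Longrightarrow> pr q a \<in> carrier (rat_pairs_ring A)"
  by (simp add: rat_pairs_ring_eq)

lemma tensor_value_pure:
  assumes "a \<in> carrier A"
  shows "pure_tensor A q a \<in> carrier (rat_tensor A)" "tensor_value \<theta> (pure_tensor A q a) = scal q * \<theta> a"
  using tensor_value_coset[OF pr_in[OF assms]] tensor_mem pr_in[OF assms]
  by (auto simp: pure_tensor_def pair_value_def)

lemma tensor_pure:
  assumes "X \<in> carrier (rat_tensor A)"
  obtains N a where "N > 0" "a \<in> carrier A" "X = pure_tensor A (1 / of_nat N) a"
    "tensor_value \<theta> X = scal (1 / of_nat N) * \<theta> a"
proof -
  obtain p where p: "p \<in> carrier (rat_pairs_ring A)" "X = biadditive_ideal A +>\<^bsub>rat_pairs_ring A\<^esub> p"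
    using assms tensor_mem by blast
  obtain N a where N: "N > 0" "a \<in> carrier A" "tcong p (pr (1 / of_nat N) a)"
    using tcong_pure[of p] p by (auto simp: rat_pairs_ring_eq)
  have v: "tensor_value \<theta> X = scal (1 / of_nat N) * \<theta> a"
    using biadditive_ideal_ev[OF N(3)] tensor_value_coset[OF p(1)] p(2) by (simp add: ev_diff pair_value_def)
  have "X = pure_tensor A (1 / of_nat N) a"
    using inj_onD[OF representsD(2)[OF tensor_represents], of X] assms v tensor_value_pure[OF N(2)] by simp
  with that N v show ?thesis by blast
qed

lemma rat_tensor_part_eq:
  assumes U: "U = {a \<in> carrier A. \<theta> a \<in> H}"
    and H: "0 \<in> H" "\<And>f g. f \<in> H \<Longrightarrow> g \<in> H \<Longrightarrow> f + g \<in> H" "\<And>c f. f \<in> H \<Longrightarrow> scal c * f \<in> H"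
  shows "rat_tensor_part A U = {X \<in> carrier (rat_tensor A). tensor_value \<theta> X \<in> H}"
proof
  show "rat_tensor_part A U \<subseteq> {X \<in> carrier (rat_tensor A). tensor_value \<theta> X \<in> H}"
  proof
    fix X assume "X \<in> rat_tensor_part A U"
    then obtain p where X: "X = biadditive_ideal A +>\<^bsub>rat_pairs_ring A\<^esub> p"
      and p: "Poly_Mapping.keys p \<subseteq> UNIV \<times> U" unfolding rat_tensor_part_def by blast
    have pc: "p \<in> carrier (rat_pairs_ring A)" using p unfolding U rat_pairs_ring_eq by auto
    have "ev (pair_value \<theta>) p \<in> H" using p
    proof (induction p rule: poly_mapping_additive_induct)
      case (single x c)
      then obtain q a where "x = (q, a)" "\<theta> a \<in> H" by (auto simp: U)
      then show ?case using H(3) by (simp add: pair_value_def flip: scal_of_int_mult)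
    qed (auto simp: ev_add H)
    then show "X \<in> {X \<in> carrier (rat_tensor A). tensor_value \<theta> X \<in> H}"
      using tensor_value_coset[OF pc] tensor_mem pc X by auto
  qed
  show "{X \<in> carrier (rat_tensor A). tensor_value \<theta> X \<in> H} \<subseteq> rat_tensor_part A U"
  proof
    fix X assume X: "X \<in> {X \<in> carrier (rat_tensor A). tensor_value \<theta> X \<in> H}"
    then obtain N a where N: "N > 0" "a \<in> carrier A" "X = pure_tensor A (1 / of_nat N) a"
      "tensor_value \<theta> X = scal (1 / of_nat N) * \<theta> a" using tensor_pure by blast
    have "\<theta> a = scal (of_nat N) * tensor_value \<theta> X"
      unfolding N(4) mult.assoc[symmetric] scal_simps(6)[symmetric] using N(1) by simp
    then have "\<theta> a \<in> H" using X H(3) by simp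
    then have "a \<in> U" using N(2) by (simp add: U)
    then show "X \<in> rat_tensor_part A U"
      unfolding rat_tensor_part_def N(3) pure_tensor_def by (intro CollectI exI[of _ "pr (1 / of_nat N) a"]) auto
  qed
qed

end

text \<open>
  The induced map is given by the sum of a coset and the larger ideal; on representatives it is
  the identity, so values are preserved.
\<close>

lemma rat_tensor_incl_value:
  assumes repA: "represents A \<theta>" and repB: "represents B \<theta>" and sub: "carrier B \<subseteq> carrier A"
    and X: "X \<in> carrier (rat_tensor B)"
  shows "rat_tensor_incl A X \<in> carrier (rat_tensor A)"
    "tensor_value \<theta> (rat_tensor_incl A X) = tensor_value \<theta> X"
proof -
  obtain p where p: "p \<in> carrier (rat_pairs_ring B)" "X = biadditive_ideal B +>\<^bsub>rat_pairs_ring B\<^esub> p"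
    using X tensor_mem[OF repB] by blast
  have car: "carrier (rat_pairs_ring B) \<subseteq> carrier (rat_pairs_ring A)"
  proof
    fix x assume "x \<in> carrier (rat_pairs_ring B)"
    then have "Poly_Mapping.keys x \<subseteq> UNIV \<times> carrier B" by (simp add: rat_pairs_ring_eq)
    then have "Poly_Mapping.keys x \<subseteq> UNIV \<times> carrier A" using sub by blast
    then show "x \<in> carrier (rat_pairs_ring A)" by (simp add: rat_pairs_ring_eq)
  qed
  have IB: "biadditive_ideal B \<subseteq> biadditive_ideal A"
  proof
    fix x assume x: "x \<in> biadditive_ideal B"
    then have "x \<in> carrier (rat_pairs_ring A)"
      using bi(1)[OF repB] car by (auto simp only: rat_pairs_ring_eq)
    then show "x \<in> biadditive_ideal A"
      using biadditive_ideal_iff[OF repA] biadditive_ideal_ev[OF repB x] by blast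
  qed
  have "rat_tensor_incl A X = biadditive_ideal A +>\<^bsub>rat_pairs_ring A\<^esub> p"
  proof -
    have "{h + k | h k. h \<in> biadditive_ideal A \<and> k \<in> X} = {h + p | h. h \<in> biadditive_ideal A}"
    proof
      show "{h + k | h k. h \<in> biadditive_ideal A \<and> k \<in> X} \<subseteq> {h + p | h. h \<in> biadditive_ideal A}"
      proof
        fix y assume "y \<in> {h + k | h k. h \<in> biadditive_ideal A \<and> k \<in> X}"
        then obtain h j where "y = h + (j + p)" "h \<in> biadditive_ideal A" "j \<in> biadditive_ideal B"
          using p(2) by (auto simp: a_r_coset_defs rat_pairs_ring_eq)
        then show "y \<in> {h + p | h. h \<in> biadditive_ideal A}"
          using bi(3)[OF repA, of h j] IB by (intro CollectI exI[of _ "h + j"]) (auto simp: add.assoc)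
      qed
      have "p \<in> X" using p(2) bi(2)[OF repB] by (force simp: a_r_coset_defs rat_pairs_ring_eq)
      then show "{h + p | h. h \<in> biadditive_ideal A} \<subseteq> {h + k | h k. h \<in> biadditive_ideal A \<and> k \<in> X}"
        by blast
    qed
    then show ?thesis
      unfolding rat_tensor_incl_def set_add_defs a_r_coset_defs
      by (simp add: rat_pairs_ring_eq) blast
  qed
  then show "rat_tensor_incl A X \<in> carrier (rat_tensor A)"
    "tensor_value \<theta> (rat_tensor_incl A X) = tensor_value \<theta> X"
    using tensor_mem[OF repA] tensor_value_coset[OF repA, of p] tensor_value_coset[OF repB p(1)] p car by auto
qed

section \<open>Gradings\<close>

text \<open>
  The homogeneous component of degree \<open>d\<close>, where the variables have degree
  \<open>2\<close>.
\<close>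

definition compZ :: "int \<Rightarrow> oddpoly \<Rightarrow> oddpoly" where
  "compZ d = monomial_map (\<lambda>m. m) (\<lambda>m. if 2 * int (total_degree m) = d then 1 else 0)"

lemma lookup_compZ: "Poly_Mapping.lookup (coeffs (compZ d f)) m =
    (if 2 * int (total_degree m) = d then Poly_Mapping.lookup (coeffs f) m else 0)"
proof (induction f rule: oddpoly_monomial_induct)
  case (monomial k c) then show ?case by (simp add: compZ_def lookup_single when_def)
qed (simp_all add: compZ_def monomial_map_add coeffs_ring_ops lookup_add)

lemma oddpoly_eqI: "(\<And>m. Poly_Mapping.lookup (coeffs f) m = Poly_Mapping.lookup (coeffs g) m) \<Longrightarrow> f = g"
  by (simp add: poly_mapping_eqI flip: coeffs_inject)

lemma lookup_coeffs_sum: "Poly_Mapping.lookup (coeffs (\<Sum>a\<in>A. g a)) m = (\<Sum>a\<in>A. Poly_Mapping.lookup (coeffs (g a)) m)"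
  by (induction A rule: infinite_finite_induct) (simp_all add: coeffs_ring_ops lookup_add)

lemma homogZ_iff: "f \<in> homogZ d \<longleftrightarrow> (\<forall>m. 2 * int (total_degree m) \<noteq> d \<longrightarrow> Poly_Mapping.lookup (coeffs f) m = 0)"
  by (auto simp: homogZ_def coeff_in_def in_keys_iff)

lemma compZ_homogZ: "compZ d f \<in> homogZ d"
  by (simp add: homogZ_iff lookup_compZ)

lemma finite_compZ: "finite {d. compZ d f \<noteq> 0}"
proof (rule finite_subset)
  show "{d. compZ d f \<noteq> 0} \<subseteq> (\<lambda>m. 2 * int (total_degree m)) ` Poly_Mapping.keys (coeffs f)"
  proof
    fix d assume "d \<in> {d. compZ d f \<noteq> 0}"
    then obtain m where "Poly_Mapping.lookup (coeffs (compZ d f)) m \<noteq> 0"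
      using oddpoly_eqI[of "compZ d f" 0] by (auto simp: coeffs_ring_ops)
    then show "d \<in> (\<lambda>m. 2 * int (total_degree m)) ` Poly_Mapping.keys (coeffs f)"
      by (auto simp: lookup_compZ in_keys_iff split: if_splits)
  qed
qed simp

text \<open>
  The decomposition into homogeneous summands is unique: the coefficient of a monomial is seen
  only by the summand of its degree.
\<close>

lemma homogZ_sum_component:
  assumes "finite D" "\<And>d. d \<in> D \<Longrightarrow> g d \<in> homogZ d" "\<And>d. d \<notin> D \<Longrightarrow> g d = 0" "f = (\<Sum>d\<in>D. g d)"
  shows "g d = compZ d f"
proof (rule oddpoly_eqI)
  fix m
  have "Poly_Mapping.lookup (coeffs f) m = (\<Sum>d\<in>D. if d = 2 * int (total_degree m)
      then Poly_Mapping.lookup (coeffs (g d)) m else 0)"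
    unfolding assms(4) lookup_coeffs_sum by (rule sum.cong) (use assms(2) in \<open>auto simp: homogZ_iff\<close>)
  also have "\<dots> = Poly_Mapping.lookup (coeffs (g (2 * int (total_degree m)))) m"
    using assms(1,3) by (simp add: coeffs_ring_ops)
  moreover have "Poly_Mapping.lookup (coeffs (g d)) m = 0" if "2 * int (total_degree m) \<noteq> d"
  proof (cases "d \<in> D")
    case True then show ?thesis using assms(2) that by (auto simp: homogZ_iff)
  qed (use assms(3) in \<open>simp add: coeffs_ring_ops\<close>)
  ultimately show "Poly_Mapping.lookup (coeffs (g d)) m = Poly_Mapping.lookup (coeffs (compZ d f)) m"
    by (auto simp: lookup_compZ)
qed

lemma compZ_sum: "f = (\<Sum>d\<in>{d. compZ d f \<noteq> 0}. compZ d f)"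
proof (rule oddpoly_eqI)
  fix m
  let ?d = "2 * int (total_degree m)"
  have "(\<Sum>d\<in>{d. compZ d f \<noteq> 0}. Poly_Mapping.lookup (coeffs (compZ d f)) m) =
      (\<Sum>d\<in>{d. compZ d f \<noteq> 0}. if d = ?d then Poly_Mapping.lookup (coeffs f) m else 0)"
    by (rule sum.cong) (auto simp: lookup_compZ)
  also have "\<dots> = (if compZ ?d f \<noteq> 0 then Poly_Mapping.lookup (coeffs f) m else 0)"
    using finite_compZ[of f] by simp
  also have "\<dots> = Poly_Mapping.lookup (coeffs f) m"
    using lookup_compZ[of ?d f m] by (auto simp: coeffs_ring_ops)
  finally show "Poly_Mapping.lookup (coeffs f) m =
      Poly_Mapping.lookup (coeffs (\<Sum>d\<in>{d. compZ d f \<noteq> 0}. compZ d f)) m"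
    by (simp add: lookup_coeffs_sum)
qed

lemma homogZ_add: "f \<in> homogZ d \<Longrightarrow> g \<in> homogZ d \<Longrightarrow> f + g \<in> homogZ d"
  by (simp add: homogZ_iff coeffs_ring_ops lookup_add)

lemma homogZ_0 [simp]: "0 \<in> homogZ d" by (simp add: homogZ_iff coeffs_ring_ops)

lemma homogZ_scal: "f \<in> homogZ d \<Longrightarrow> scal c * f \<in> homogZ d"
  by (simp add: homogZ_iff lookup_scal_mult)

lemma homogZ_mult: "f \<in> homogZ d \<Longrightarrow> g \<in> homogZ e \<Longrightarrow> f * g \<in> homogZ (d + e)"
  unfolding homogZ_def
  by (erule (1) coeff_in_mult[rotated 2]) (auto simp: total_degree_add)

lemma homog_homogZ: "homogZ (2 * int d) = homog d"
  by (simp add: homogZ_def homog_def)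

lemma compZ_supp: "f \<in> supp R V \<Longrightarrow> compZ d f \<in> supp R V"
  by (auto simp: coeff_in_def in_keys_iff lookup_compZ)

text \<open>
  The operators lower degrees by \<open>2\<close>, so the components of \<open>\<partial>(f) =
  0\<close> are the images of the components of \<open>f\<close>.
\<close>

lemma compZ_invariant:
  assumes f: "f \<in> invariants n"
  shows "compZ d f \<in> invariants n"
  unfolding invariants_def
proof (intro CollectI ballI)
  fix i assume i: "i \<in> {1..n}"
  have dh: "demD n i (compZ d f) \<in> homogZ (d - 2)" for d
  proof (cases "\<exists>k. d = 2 * int (Suc k)")
    case True
    then obtain k where k: "d = 2 * int (Suc k)" by blast
    have "compZ d f \<in> homog (Suc k)" using compZ_homogZ[of d f] unfolding k homog_homogZ .
    then have "demD n i (compZ d f) \<in> homog k" by (rule demD_homog_Suc)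
    moreover have "d - 2 = 2 * int k" using k by simp
    ultimately show ?thesis using homog_homogZ by metis
  next
    case False
    have "compZ d f \<in> homog 0"
    proof -
      have "compZ d f = 0 \<or> d = 0"
      proof (rule ccontr)
        assume "\<not> ?thesis"
        then obtain m where "Poly_Mapping.lookup (coeffs (compZ d f)) m \<noteq> 0" "d \<noteq> 0"
          using oddpoly_eqI[of "compZ d f" 0] by (auto simp: coeffs_ring_ops)
        then have "d = 2 * int (total_degree m)" "total_degree m \<noteq> 0"
          by (auto simp: lookup_compZ split: if_splits)
        then show False using False by (metis not0_implies_Suc)
      qed
      moreover have "homogZ 0 = homog 0" using homog_homogZ[of 0] by simp
      ultimately show ?thesis using compZ_homogZ[of 0 f] homogZ_0[of 0] by metis
    qed
    then show ?thesis by (simp add: demD_homog_0)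
  qed
  define g where "g d = demD n i (compZ (d + 2) f)" for d
  let ?D = "{d. compZ d f \<noteq> 0}"
  have "g (d - 2) = compZ (d - 2) 0"
  proof (rule homogZ_sum_component[where D = "(\<lambda>d. d - 2) ` ?D"])
    show "finite ((\<lambda>d. d - 2) ` ?D)" using finite_compZ by blast
    show "g d \<in> homogZ d" for d using dh[of "d + 2"] by (simp add: g_def)
    show "g d = 0" if "d \<notin> (\<lambda>d. d - 2) ` ?D" for d
    proof -
      have "compZ (d + 2) f = 0" using that by (metis (mono_tags, lifting) add_diff_cancel_right' imageI mem_Collect_eq)
      then show ?thesis by (simp add: g_def demD_linear)
    qed
    have s: "demD n i (\<Sum>d\<in>D. h d) = (\<Sum>d\<in>D. demD n i (h d))" for D :: "int set" and h
      by (induction D rule: infinite_finite_induct) (simp_all add: demD_linear)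
    have "0 = demD n i f" using f i by (simp add: invariants_def)
    also have "\<dots> = (\<Sum>d\<in>?D. demD n i (compZ d f))" by (subst compZ_sum) (rule s)
    also have "\<dots> = (\<Sum>d\<in>(\<lambda>d. d - 2) ` ?D. g d)"
      by (subst sum.reindex) (auto simp: inj_on_def g_def)
    finally show "0 = (\<Sum>d\<in>(\<lambda>d. d - 2) ` ?D. g d)" .
  qed
  then show "demD n i (compZ d f) = 0" by (simp add: g_def compZ_def)
qed

text \<open>
  A subring of the concrete ring that contains the homogeneous components of its elements is
  graded, and the grading is pulled back along the representation.
\<close>

lemma graded_ring_representation:
  fixes R (structure)
  assumes rep: "represents R \<Psi>"
    and comp: "\<And>f d. f \<in> \<Psi> ` carrier R \<Longrightarrow> compZ d f \<in> \<Psi> ` carrier R"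
    and G: "\<And>d. G d = {X \<in> carrier R. \<Psi> X \<in> homogZ d}"
  shows "graded_ring R G"
proof -
  note D = representsD[OF rep]
  interpret ring R by (rule D(1))
  have inj: "X = Y" if "X \<in> carrier R" "Y \<in> carrier R" "\<Psi> X = \<Psi> Y" for X Y
    using inj_onD[OF D(2)] that by blast
  have sub: "additive_subgroup (G d) R" for d
  proof (rule additive_subgroupI, rule add.subgroupI)
    show "G d \<subseteq> carrier R" by (auto simp: G)
    show "G d \<noteq> {}" using zero_closed D(4) by (auto simp: G)
    show "\<ominus> X \<in> G d" if "X \<in> G d" for X
      using that homogZ_scal[of "\<Psi> X" d "-1"] by (auto simp: G D)
    show "X \<oplus> Y \<in> G d" if "X \<in> G d" "Y \<in> G d" for X Y
      using that by (auto simp: G D homogZ_add)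
  qed
  have "\<exists>!c. (\<forall>d. c d \<in> G d) \<and> finite {d. c d \<noteq> \<zero>} \<and> X = (\<Oplus>d\<in>{d. c d \<noteq> \<zero>}. c d)"
    if X: "X \<in> carrier R" for X
  proof (rule ex1I)
    define c where "c d = inv_into (carrier R) \<Psi> (compZ d (\<Psi> X))" for d
    have im: "compZ d (\<Psi> X) \<in> \<Psi> ` carrier R" for d using comp X by blast
    have c: "c d \<in> carrier R" "\<Psi> (c d) = compZ d (\<Psi> X)" for d
      using inv_into_into[OF im[of d]] f_inv_into_f[OF im[of d]] by (auto simp: c_def)
    have z: "c d \<noteq> \<zero> \<longleftrightarrow> compZ d (\<Psi> X) \<noteq> 0" for d
      using inj[OF c(1)[of d] zero_closed] c(2)[of d] D(4) by metis
    have "\<Psi> (\<Oplus>d\<in>{d. c d \<noteq> \<zero>}. c d) = (\<Sum>d\<in>{d. c d \<noteq> \<zero>}. \<Psi> (c d))"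
      using finite_compZ[of "\<Psi> X"] c(1) unfolding z by (intro represents_finsum[OF rep]) auto
    also have "\<dots> = \<Psi> X" unfolding z c(2) by (rule compZ_sum[symmetric])
    finally have "X = (\<Oplus>d\<in>{d. c d \<noteq> \<zero>}. c d)"
      using c(1) X by (intro inj finsum_closed) auto
    moreover have "finite {d. c d \<noteq> \<zero>}" unfolding z by (rule finite_compZ)
    ultimately show "(\<forall>d. c d \<in> G d) \<and> finite {d. c d \<noteq> \<zero>} \<and> X = (\<Oplus>d\<in>{d. c d \<noteq> \<zero>}. c d)"
      using c compZ_homogZ by (auto simp: G)
    fix c' assume c': "(\<forall>d. c' d \<in> G d) \<and> finite {d. c' d \<noteq> \<zero>} \<and> X = (\<Oplus>d\<in>{d. c' d \<noteq> \<zero>}. c' d)"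
    then have c'G: "c' d \<in> carrier R" "\<Psi> (c' d) \<in> homogZ d" for d by (auto simp: G)
    have "\<Psi> X = (\<Sum>d\<in>{d. c' d \<noteq> \<zero>}. \<Psi> (c' d))"
      using c' c'G(1) represents_finsum[OF rep, of "{d. c' d \<noteq> \<zero>}" c'] by metis
    then have "\<Psi> (c' d) = compZ d (\<Psi> X)" for d
      using c' c'G D(4) by (intro homogZ_sum_component[where D = "{d. c' d \<noteq> \<zero>}"]) auto
    then show "c' = c" using inj c c'G(1) by (intro ext) simp
  qed
  moreover have "\<one> \<in> G 0" using homog_1 homog_homogZ[of 0] by (simp add: G D)
  moreover have "X \<otimes> Y \<in> G (d + e)" if "X \<in> G d" "Y \<in> G e" for X Y d e
    using that by (auto simp: G D homogZ_mult)
  ultimately show ?thesis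
    using sub ring_axioms unfolding graded_ring_def internal_direct_sum_def by blast
qed

text \<open>
  Existence and uniqueness of coefficients are transported along the representations of the big
  ring \<open>A\<close> and the ring of coefficients \<open>S\<close>; \<open>t\<close> is
  multiplication of a basis element by a coefficient from the left or from the right, and
  \<open>\<tau>\<close> is its counterpart on values.
\<close>

lemma unique_expansion_transfer:
  assumes repA: "represents A \<Psi>" and repS: "represents S \<Psi>'" and W: "finite W"
    and t: "\<And>w s. w \<in> W \<Longrightarrow> s \<in> carrier S \<Longrightarrow> t w s \<in> carrier A \<and> \<Psi> (t w s) = \<tau> w (\<Psi>' s)"
    and ex: "\<And>f. f \<in> \<Psi> ` carrier A \<Longrightarrow> \<exists>c. (\<forall>w\<in>W. c w \<in> \<Psi>' ` carrier S) \<and> f = (\<Sum>w\<in>W. \<tau> w (c w))"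
    and uniq: "\<And>c c'. (\<forall>w\<in>W. c w \<in> \<Psi>' ` carrier S) \<Longrightarrow> (\<forall>w\<in>W. c' w \<in> \<Psi>' ` carrier S) \<Longrightarrow>
      (\<Sum>w\<in>W. \<tau> w (c w)) = (\<Sum>w\<in>W. \<tau> w (c' w)) \<Longrightarrow> \<forall>w\<in>W. c w = c' w"
  shows "\<forall>x\<in>carrier A. \<exists>!c. c \<in> W \<rightarrow>\<^sub>E carrier S \<and> x = (\<Oplus>\<^bsub>A\<^esub>w\<in>W. t w (c w))"
proof
  fix x assume x: "x \<in> carrier A"
  interpret A: ring A by (rule representsD[OF repA])
  note injA = inj_onD[OF representsD(2)[OF repA]] and injS = inj_onD[OF representsD(2)[OF repS]]
  have val: "\<Psi> (\<Oplus>\<^bsub>A\<^esub>w\<in>W. t w (c w)) = (\<Sum>w\<in>W. \<tau> w (\<Psi>' (c w)))" "(\<Oplus>\<^bsub>A\<^esub>w\<in>W. t w (c w)) \<in> carrier A"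
    if "c \<in> W \<rightarrow>\<^sub>E carrier S" for c
  proof -
    have cS: "c w \<in> carrier S" if "w \<in> W" for w using \<open>c \<in> _\<close> that by blast
    have "\<Psi> (\<Oplus>\<^bsub>A\<^esub>w\<in>W. t w (c w)) = (\<Sum>w\<in>W. \<Psi> (t w (c w)))"
      using t cS by (intro represents_finsum[OF repA W]) auto
    also have "\<dots> = (\<Sum>w\<in>W. \<tau> w (\<Psi>' (c w)))" by (rule sum.cong) (use t cS in auto)
    finally show "\<Psi> (\<Oplus>\<^bsub>A\<^esub>w\<in>W. t w (c w)) = (\<Sum>w\<in>W. \<tau> w (\<Psi>' (c w)))" .
    show "(\<Oplus>\<^bsub>A\<^esub>w\<in>W. t w (c w)) \<in> carrier A" using t cS by (intro A.finsum_closed) auto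
  qed
  obtain d where d: "\<forall>w\<in>W. d w \<in> \<Psi>' ` carrier S" "\<Psi> x = (\<Sum>w\<in>W. \<tau> w (d w))"
    using ex[of "\<Psi> x"] x by blast
  define c where "c = (\<lambda>w\<in>W. inv_into (carrier S) \<Psi>' (d w))"
  have c: "c \<in> W \<rightarrow>\<^sub>E carrier S" "\<forall>w\<in>W. \<Psi>' (c w) = d w"
    using d(1) inv_into_into[of _ \<Psi>' "carrier S"] f_inv_into_f[of _ \<Psi>' "carrier S"] by (auto simp: c_def)
  have vc: "\<Psi> x = (\<Sum>w\<in>W. \<tau> w (\<Psi>' (c w)))" unfolding d(2) by (rule sum.cong) (use c(2) in auto)
  show "\<exists>!c. c \<in> W \<rightarrow>\<^sub>E carrier S \<and> x = (\<Oplus>\<^bsub>A\<^esub>w\<in>W. t w (c w))"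
  proof (rule ex1I[of _ c])
    show "c \<in> W \<rightarrow>\<^sub>E carrier S \<and> x = (\<Oplus>\<^bsub>A\<^esub>w\<in>W. t w (c w))"
      using c(1) injA[of x] x val[OF c(1)] vc by simp
    fix c' assume c': "c' \<in> W \<rightarrow>\<^sub>E carrier S \<and> x = (\<Oplus>\<^bsub>A\<^esub>w\<in>W. t w (c' w))"
    then have c'E: "c' \<in> W \<rightarrow>\<^sub>E carrier S" by blast
    have "(\<Sum>w\<in>W. \<tau> w (\<Psi>' (c' w))) = (\<Sum>w\<in>W. \<tau> w (\<Psi>' (c w)))"
      using val(1)[OF c'E] c' vc by simp
    then have "\<forall>w\<in>W. \<Psi>' (c' w) = \<Psi>' (c w)"
      using c'E c(1) by (intro uniq[of "\<lambda>w. \<Psi>' (c' w)" "\<lambda>w. \<Psi>' (c w)"]) (auto simp: PiE_mem)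
    then have "\<forall>w\<in>W. c' w = c w" using injS c'E c(1) by (metis PiE_mem)
    then show "c' = c" using c'E c(1) by (intro PiE_ext) auto
  qed
qed

section \<open>The graded rank\<close>

text \<open>
  The symmetric form \<open>[m]\<close> is a geometric sum in \<open>q\<^sup>2\<close>, up to a
  shift of the exponent.
\<close>

lemma quantum_int_eq:
  "quantum_int m = fls_X powi (1 - int m) * (\<Sum>j<m. (fls_X\<^sup>2) ^ j)"
proof -
  let ?X = "fls_X :: rat fls"
  have X0: "?X \<noteq> 0" by simp
  have inv: "?X powi (-1) = inverse ?X" by (simp add: power_int_minus)
  have ne: "?X - ?X powi (-1) \<noteq> 0"
  proof
    assume "?X - ?X powi (-1) = 0"
    then have "?X * ?X = 1" using X0 unfolding inv by (metis eq_iff_diff_eq_0 right_inverse)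
    then have "fls_subdegree (?X * ?X) = 0" by simp
    then show False by (simp add: fls_subdegree_mult)
  qed
  have geo: "(?X\<^sup>2 - 1) * (\<Sum>j<m. (?X\<^sup>2) ^ j) = (?X\<^sup>2) ^ m - 1"
    by (rule power_diff_1_eq[symmetric])
  have "(?X - ?X powi (-1)) * (?X powi (1 - int m) * (\<Sum>j<m. (?X\<^sup>2) ^ j)) =
      ?X powi (- int m) * ((?X\<^sup>2 - 1) * (\<Sum>j<m. (?X\<^sup>2) ^ j))"
  proof -
    have "?X powi (1 - int m) = ?X * ?X powi (- int m)"
      using X0 power_int_add[of ?X 1 "- int m"] by simp
    then have "(?X - ?X powi (-1)) * ?X powi (1 - int m) = ?X powi (- int m) * (?X\<^sup>2 - 1)"
      using X0 unfolding inv by (simp add: algebra_simps power2_eq_square)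
    then show ?thesis by (simp add: mult.assoc[symmetric])
  qed
  also have "\<dots> = ?X powi int m - ?X powi (- int m)"
  proof -
    have "?X powi (- int m) * (?X\<^sup>2) ^ m = ?X powi (- int m) * ?X powi (2 * int m)"
      by (metis power_int_of_nat of_nat_mult of_nat_numeral power_mult)
    also have "\<dots> = ?X powi (- int m + 2 * int m)" using X0 by (metis power_int_add)
    also have "- int m + 2 * int m = int m" by simp
    finally show ?thesis unfolding geo by (simp add: right_diff_distrib)
  qed
  finally show ?thesis using ne unfolding quantum_int_def by (simp add: divide_eq_eq mult.commute)
qed

text \<open>
  With \<open>b(m) = 1 + t + \<cdots> + t\<^bsup>m-1\<^esup>\<close> and \<open>t =
  q\<^sup>2\<close>, the factor \<open>[2k]\<close> contributes \<open>b(2k) = (1 + t\<^sup>k)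
  b(k)\<close>. The product of all \<open>b(k)\<close> for \<open>k < n\<close> together with
  \<open>b(n)\<close> is the product of the \<open>b(m + 1)\<close>, and the shifts add up to
  \<open>q\<^bsup>-n(n-1)\<^esup>\<close>.
\<close>

lemma quantum_rank_product:
  assumes "1 \<le> n"
  shows "fls_X powi int (n * (n - 1)) * quantum_int n * (\<Prod>k=1..n-1. quantum_int (2 * k)) =
    (\<Prod>m=1..<n. (1 + (fls_X\<^sup>2) ^ m) * (\<Sum>j\<le>m. (fls_X\<^sup>2) ^ j))"
proof -
  let ?X = "fls_X :: rat fls"
  let ?t = "?X\<^sup>2"
  define b where "b m = (\<Sum>j<m. ?t ^ j)" for m
  have X0: "?X \<noteq> 0" by simp
  have q: "quantum_int m = ?X powi (1 - int m) * b m" for m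
    unfolding b_def by (rule quantum_int_eq)
  have b2: "b (2 * k) = (1 + ?t ^ k) * b k" for k
  proof -
    have "b (k + l) = b k + ?t ^ k * b l" for l
      by (induction l) (simp_all add: b_def algebra_simps power_add)
    from this[of k] show ?thesis unfolding mult_2 distrib_right by simp
  qed
  have P1: "(\<Prod>k=1..l. quantum_int (2 * k)) = ?X powi (- int (l * l)) * (\<Prod>k=1..l. b (2 * k))" for l
  proof (induction l)
    case (Suc l)
    have "?X powi (- int (Suc l * Suc l)) = ?X powi (- int (l * l)) * ?X powi (1 - int (2 * Suc l))"
    proof -
      have "- int (Suc l * Suc l) = - int (l * l) + (1 - int (2 * Suc l))" by simp
      then show ?thesis using X0 by (metis power_int_add)
    qed
    then show ?case using Suc by (simp add: q mult_ac del: of_nat_mult of_nat_Suc)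
  qed simp
  have P2: "b (Suc l) * (\<Prod>k=1..l. b (2 * k)) = (\<Prod>m=1..<Suc l. (1 + ?t ^ m) * b (Suc m))" for l
  proof (induction l)
    case 0 show ?case by (simp add: b_def)
  next
    case (Suc l)
    have "b (Suc (Suc l)) * (\<Prod>k=1..Suc l. b (2 * k)) =
        (1 + ?t ^ Suc l) * b (Suc (Suc l)) * (b (Suc l) * (\<Prod>k=1..l. b (2 * k)))"
    proof -
      have "(\<Prod>k=1..Suc l. b (2 * k)) = (\<Prod>k=1..l. b (2 * k)) * b (2 * Suc l)" by simp
      then show ?thesis unfolding b2[of "Suc l"] by (simp only: mult_ac)
    qed
    then show ?case unfolding Suc by (simp add: mult_ac)
  qed
  obtain l where l: "n = Suc l" using assms by (cases n) auto
  have "?X powi int (n * (n - 1)) * ?X powi (1 - int n) * ?X powi (- int (l * l)) = 1"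
  proof -
    have "int (n * (n - 1)) + (1 - int n) + (- int (l * l)) = 0" by (simp add: l algebra_simps)
    then have "?X powi 0 = ?X powi int (n * (n - 1)) * ?X powi (1 - int n) * ?X powi (- int (l * l))"
      using X0 by (metis power_int_add)
    then show ?thesis by (simp only: power_int_0_right)
  qed
  then have "?X powi int (n * (n - 1)) * quantum_int n * (\<Prod>k=1..n-1. quantum_int (2 * k)) =
      b n * (\<Prod>k=1..l. b (2 * k))"
  proof -
    assume e: "?X powi int (n * (n - 1)) * ?X powi (1 - int n) * ?X powi (- int (l * l)) = 1"
    have "?X powi int (n * (n - 1)) * quantum_int n * (\<Prod>k=1..n-1. quantum_int (2 * k)) =
      (?X powi int (n * (n - 1)) * ?X powi (1 - int n) * ?X powi (- int (l * l))) * (b n * (\<Prod>k=1..l. b (2 * k)))"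
    proof -
      have "n - 1 = l" by (simp add: l)
      then have "(\<Prod>k=1..n-1. quantum_int (2 * k)) = ?X powi (- int (l * l)) * (\<Prod>k=1..l. b (2 * k))"
        using P1[of l] by simp
      then show ?thesis unfolding q[of n] by (simp only: mult_ac)
    qed
    then show ?thesis unfolding e by simp
  qed
  also have "\<dots> = (\<Prod>m=1..<n. (1 + ?t ^ m) * b (Suc m))" unfolding l by (rule P2)
  also have "\<dots> = (\<Prod>m=1..<n. (1 + ?t ^ m) * (\<Sum>j\<le>m. ?t ^ j))"
    by (simp add: b_def lessThan_Suc_atMost)
  finally show ?thesis .
qed

section \<open>The operators on the presented ring\<close>

context
  fixes n :: nat
  assumes n2: "2 \<le> n"
begin

abbreviation R where "R \<equiv> odd_pol n"
abbreviation \<theta> where "\<theta> \<equiv> odd_value"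

lemmas oD = representsD[OF odd_pol_represents[of n]]

lemma odd_inj: "X \<in> carrier R \<Longrightarrow> Y \<in> carrier R \<Longrightarrow> \<theta> X = \<theta> Y \<Longrightarrow> X = Y"
  using inj_onD[OF oD(2)] by blast

lemma odd_closed:
  "X \<in> carrier R \<Longrightarrow> Y \<in> carrier R \<Longrightarrow> X \<oplus>\<^bsub>R\<^esub> Y \<in> carrier R"
  "X \<in> carrier R \<Longrightarrow> Y \<in> carrier R \<Longrightarrow> X \<otimes>\<^bsub>R\<^esub> Y \<in> carrier R"
  "X \<in> carrier R \<Longrightarrow> \<ominus>\<^bsub>R\<^esub> X \<in> carrier R" "\<one>\<^bsub>R\<^esub> \<in> carrier R" "\<zero>\<^bsub>R\<^esub> \<in> carrier R"
proof -
  interpret ring R by (rule oD(1))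
  show "X \<in> carrier R \<Longrightarrow> Y \<in> carrier R \<Longrightarrow> X \<oplus>\<^bsub>R\<^esub> Y \<in> carrier R"
    "X \<in> carrier R \<Longrightarrow> Y \<in> carrier R \<Longrightarrow> X \<otimes>\<^bsub>R\<^esub> Y \<in> carrier R"
    "X \<in> carrier R \<Longrightarrow> \<ominus>\<^bsub>R\<^esub> X \<in> carrier R" "\<one>\<^bsub>R\<^esub> \<in> carrier R" "\<zero>\<^bsub>R\<^esub> \<in> carrier R" by auto
qed

lemma odd_x_value:
  assumes "i \<in> {1..n}"
  shows "odd_x n i \<in> carrier R" "\<theta> (odd_x n i) = var i"
proof -
  have f: "free_var i \<in> carrier (free_ring n)" using assms by (simp add: free_ring_eq free_var_def)
  then show "odd_x n i \<in> carrier R" unfolding odd_x_def odd_pol_mem by blast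
  show "\<theta> (odd_x n i) = var i" unfolding odd_x_def odd_value_coset[OF f] by (simp add: free_var_def)
qed

text \<open>
  The ring is generated by the variables, in a form that fits maps with a Leibniz rule. It shows
  that endomorphisms and operators are determined by their values on variables.
\<close>

lemma odd_pol_induct [consumes 1, case_names one var diff]:
  assumes X: "X \<in> carrier R" and one: "P \<one>\<^bsub>R\<^esub>"
    and var: "\<And>i Y. i \<in> {1..n} \<Longrightarrow> Y \<in> carrier R \<Longrightarrow> P Y \<Longrightarrow> P (odd_x n i \<otimes>\<^bsub>R\<^esub> Y)"
    and diff: "\<And>X Y. X \<in> carrier R \<Longrightarrow> Y \<in> carrier R \<Longrightarrow> P X \<Longrightarrow> P Y \<Longrightarrow> P (X \<oplus>\<^bsub>R\<^esub> \<ominus>\<^bsub>R\<^esub> Y)"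
  shows "P X"
proof -
  let ?\<iota> = "\<lambda>p. odd_ideal n +>\<^bsub>free_ring n\<^esub> p"
  have \<iota>: "?\<iota> p \<in> carrier R" "\<theta> (?\<iota> p) = ev word_value p" if "p \<in> carrier (free_ring n)" for p
    using that odd_pol_mem odd_value_coset by auto
  have car: "p \<in> carrier (free_ring n) \<longleftrightarrow> Poly_Mapping.keys p \<subseteq> lists {1..n}" for p
    by (simp add: free_ring_eq)
  have w: "P (?\<iota> (Poly_Mapping.single u 1))" if "u \<in> lists {1..n}" for u
    using that
  proof (induction u rule: lists.induct)
    case Nil
    have "?\<iota> (Poly_Mapping.single [] 1) = \<one>\<^bsub>R\<^esub>"
      by (rule odd_inj) (simp_all add: \<iota> car oD odd_closed del: single_one)
    then show ?case using one by simp
  next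
    case (Cons i u)
    have u: "Poly_Mapping.single u 1 \<in> carrier (free_ring n)"
      and iu: "Poly_Mapping.single (i # u) 1 \<in> carrier (free_ring n)" using Cons by (simp_all add: car)
    have "?\<iota> (Poly_Mapping.single (i # u) 1) = odd_x n i \<otimes>\<^bsub>R\<^esub> ?\<iota> (Poly_Mapping.single u 1)"
      using odd_x_value[OF Cons.hyps(1)] \<iota>[OF u] \<iota>[OF iu] by (intro odd_inj) (simp_all add: oD odd_closed)
    then show ?case using var[OF Cons.hyps(1) \<iota>(1)[OF u] Cons.IH] by simp
  qed
  obtain p where p: "p \<in> carrier (free_ring n)" "X = ?\<iota> p" using X odd_pol_mem by blast
  have "Poly_Mapping.keys p \<subseteq> lists {1..n} \<and> P (?\<iota> p)"
    using p(1)[unfolded car]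
  proof (induction p rule: frag_induction)
    case zero
    have "?\<iota> 0 = \<one>\<^bsub>R\<^esub> \<oplus>\<^bsub>R\<^esub> \<ominus>\<^bsub>R\<^esub> \<one>\<^bsub>R\<^esub>"
      by (rule odd_inj) (simp_all add: \<iota> car oD odd_closed)
    then show ?case using diff[OF odd_closed(4,4) one one] by simp
  next
    case (one u) then show ?case using w by simp
  next
    case (diff p q)
    then have pq: "p \<in> carrier (free_ring n)" "q \<in> carrier (free_ring n)" by (simp_all add: car)
    have k: "Poly_Mapping.keys (p - q) \<subseteq> lists {1..n}" using keys_diff[of p q] diff by blast
    then have d: "p - q \<in> carrier (free_ring n)" by (simp add: car)
    have "?\<iota> (p - q) = ?\<iota> p \<oplus>\<^bsub>R\<^esub> \<ominus>\<^bsub>R\<^esub> ?\<iota> q"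
      using \<iota>[OF pq(1)] \<iota>[OF pq(2)] \<iota>[OF d] by (intro odd_inj) (simp_all add: oD odd_closed ev_diff)
    then show ?case using k assms(4)[OF \<iota>(1)[OF pq(1)] \<iota>(1)[OF pq(2)]] diff by simp
  qed
  then show ?thesis using p(2) by simp
qed

text \<open>
  A map of the concrete ring, carried over to the presented ring. Outside the carrier it takes
  the default value, as the maps in the definitions of the endomorphisms and operators do.
\<close>

definition transport :: "(oddpoly \<Rightarrow> oddpoly) \<Rightarrow> (nat list \<Rightarrow>\<^sub>0 int) set \<Rightarrow> (nat list \<Rightarrow>\<^sub>0 int) set" where
  "transport F = (\<lambda>X\<in>carrier R. inv_into (carrier R) \<theta> (F (\<theta> X)))"

lemma transport_value:
  assumes "X \<in> carrier R" "\<And>f. f \<in> supp \<int> {1..n} \<Longrightarrow> F f \<in> supp \<int> {1..n}"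
  shows "transport F X \<in> carrier R" "\<theta> (transport F X) = F (\<theta> X)"
proof -
  have "F (\<theta> X) \<in> \<theta> ` carrier R" using assms odd_value_image[of n] by blast
  then show "transport F X \<in> carrier R" "\<theta> (transport F X) = F (\<theta> X)"
    using assms(1) by (simp_all add: transport_def inv_into_into f_inv_into_f)
qed

context
  fixes i :: nat
  assumes i: "i \<in> {1..n}"
begin

lemma reflD_supp: "f \<in> supp \<int> {1..n} \<Longrightarrow> reflD n i f \<in> supp \<int> {1..n}"
  using demD_supp(2)[OF _ additive_coeffs_Ints n2 i] by blast

lemma demD_supp_Ints: "f \<in> supp \<int> {1..n} \<Longrightarrow> demD n i f \<in> supp \<int> {1..n}"
  using demD_supp(1)[OF _ additive_coeffs_Ints n2 i] by blast

lemma transport_reflD: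
  assumes "X \<in> carrier R"
  shows "transport (reflD n i) X \<in> carrier R" "\<theta> (transport (reflD n i) X) = reflD n i (\<theta> X)"
  by (rule transport_value[OF assms], rule reflD_supp, assumption)+

lemma transport_demD:
  assumes "X \<in> carrier R"
  shows "transport (demD n i) X \<in> carrier R" "\<theta> (transport (demD n i) X) = demD n i (\<theta> X)"
  by (rule transport_value[OF assms], rule demD_supp_Ints, assumption)+

lemma s_on_var_value:
  assumes j: "j \<in> {1..n}"
  shows "s_on_var n i j \<in> carrier R" "\<theta> (s_on_var n i j) = reflD n i (var j)"
proof -
  have neg: "\<ominus>\<^bsub>R\<^esub> odd_x n k \<in> carrier R \<and> \<theta> (\<ominus>\<^bsub>R\<^esub> odd_x n k) = - var k" if "k \<in> {1..n}" for k
    using odd_x_value[OF that] by (simp add: oD odd_closed)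
  have k: "i < n \<Longrightarrow> i + 1 \<in> {1..n}" "n - 1 \<in> {1..n}" "n \<in> {1..n}" using i n2 by auto
  have "s_on_var n i j \<in> carrier R \<and> \<theta> (s_on_var n i j) = reflD n i (var j)"
  proof (cases "i < n")
    case True
    then show ?thesis using neg[OF j] neg[OF k(1)] neg[OF i]
      by (simp add: s_on_var_def reflD_def refl_hom_var pos_def sg_def)
  next
    case False
    then have "i = n" using i by simp
    then show ?thesis using neg[OF j] odd_x_value[OF k(2)] odd_x_value[OF k(3)] n2
      by (auto simp: s_on_var_def reflD_def refl_hom_var pos_def sg_def)
  qed
  then show "s_on_var n i j \<in> carrier R" "\<theta> (s_on_var n i j) = reflD n i (var j)" by auto
qed

lemma demazure_on_var_value:
  assumes j: "j \<in> {1..n}"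
  shows "demazure_on_var n i j \<in> carrier R" "\<theta> (demazure_on_var n i j) = demD n i (var j)"
proof -
  have "demazure_on_var n i j \<in> carrier R \<and> \<theta> (demazure_on_var n i j) = demD n i (var j)"
  proof (cases "i < n")
    case True
    then show ?thesis
      by (simp add: demazure_on_var_def demD_def dem_var var_derivative_def pos_def sg_def oD odd_closed)
  next
    case False
    then have "i = n" using i by simp
    then show ?thesis using n2
      by (auto simp: demazure_on_var_def demD_def dem_var var_derivative_def pos_def sg_def oD odd_closed)
  qed
  then show "demazure_on_var n i j \<in> carrier R" "\<theta> (demazure_on_var n i j) = demD n i (var j)" by auto
qed

text \<open>
  The transported reflection has the required values on variables, and by
  \<open>odd_pol_induct\<close> it is the only such endomorphism.
\<close>

lemma s_endo_eq: "s_endo n i = transport (reflD n i)"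
  unfolding s_endo_def
proof (rule the_equality)
  note T = transport_reflD
  have h: "reflD n i (f + g) = reflD n i f + reflD n i g" "reflD n i (f * g) = reflD n i f * reflD n i g"
    "reflD n i 1 = 1" for f g by (simp_all add: reflD_def refl_hom_simps)
  show "transport (reflD n i) \<in> ring_hom R R \<and> transport (reflD n i) \<in> extensional (carrier R) \<and>
    (\<forall>j\<in>{1..n}. transport (reflD n i) (odd_x n j) = s_on_var n i j)"
  proof (intro conjI ballI)
    show "transport (reflD n i) \<in> ring_hom R R"
    proof (rule ring_hom_memI)
      fix X Y assume XY: "X \<in> carrier R" "Y \<in> carrier R"
      show "transport (reflD n i) X \<in> carrier R" by (rule T(1)[OF XY(1)])
      show "transport (reflD n i) (X \<otimes>\<^bsub>R\<^esub> Y) = transport (reflD n i) X \<otimes>\<^bsub>R\<^esub> transport (reflD n i) Y"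
        using XY by (intro odd_inj) (simp_all add: T oD odd_closed h)
      show "transport (reflD n i) (X \<oplus>\<^bsub>R\<^esub> Y) = transport (reflD n i) X \<oplus>\<^bsub>R\<^esub> transport (reflD n i) Y"
        using XY by (intro odd_inj) (simp_all add: T oD odd_closed h)
    next
      show "transport (reflD n i) \<one>\<^bsub>R\<^esub> = \<one>\<^bsub>R\<^esub>"
        by (intro odd_inj) (simp_all add: T oD odd_closed h)
    qed
    show "transport (reflD n i) \<in> extensional (carrier R)" by (simp add: transport_def)
    show "transport (reflD n i) (odd_x n j) = s_on_var n i j" if "j \<in> {1..n}" for j
      using that by (intro odd_inj) (simp_all add: T s_on_var_value odd_x_value)
  qed
  fix s assume s: "s \<in> ring_hom R R \<and> s \<in> extensional (carrier R) \<and> (\<forall>j\<in>{1..n}. s (odd_x n j) = s_on_var n i j)"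
  then have hom: "s \<in> ring_hom R R" by blast
  have sc: "s X \<in> carrier R" if "X \<in> carrier R" for X using ring_hom_closed[OF hom that] .
  have neg: "s (\<ominus>\<^bsub>R\<^esub> Y) = \<ominus>\<^bsub>R\<^esub> s Y" if Y: "Y \<in> carrier R" for Y
  proof -
    interpret ring R by (rule oD(1))
    have z: "s \<zero>\<^bsub>R\<^esub> = \<zero>\<^bsub>R\<^esub>"
      using ring_hom_add[OF hom zero_closed zero_closed] sc[OF zero_closed] by (simp add: add.l_cancel_one')
    have "s (\<ominus>\<^bsub>R\<^esub> Y) \<oplus>\<^bsub>R\<^esub> s Y = \<zero>\<^bsub>R\<^esub>"
      using ring_hom_add[OF hom a_inv_closed[OF Y] Y] Y z by (simp add: l_neg)
    then show ?thesis using minus_equality[of "s (\<ominus>\<^bsub>R\<^esub> Y)" "s Y"] sc Y by simp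
  qed
  have "s X \<in> carrier R \<and> \<theta> (s X) = reflD n i (\<theta> X)" if "X \<in> carrier R" for X
    using that
  proof (induction X rule: odd_pol_induct)
    case one then show ?case using ring_hom_one[OF hom] by (simp add: oD odd_closed h)
  next
    case (var j Y)
    then show ?case using ring_hom_mult[OF hom odd_x_value(1)[OF var(1)] var(2)] s s_on_var_value[OF var(1)] odd_x_value[OF var(1)]
      by (simp add: oD odd_closed h)
  next
    case (diff X Y)
    then show ?case using ring_hom_add[OF hom diff(1) odd_closed(3)[OF diff(2)]] neg[OF diff(2)]
      by (simp add: oD odd_closed h) (simp add: reflD_def refl_hom_simps)
  qed
  then have "s X = transport (reflD n i) X" if "X \<in> carrier R" for X
    using that T by (intro odd_inj) auto
  then show "s = transport (reflD n i)"
    using s by (intro extensionalityI[where A = "carrier R"]) (auto simp: transport_def)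
qed

text \<open>
  As for the endomorphisms; the Leibniz rule determines the operator from its values on
  variables and on \<open>1\<close>.
\<close>

lemma demazure_eq: "demazure n i = transport (demD n i)"
  unfolding demazure_def
proof (rule the_equality)
  note T = transport_demD
  note S = transport_reflD[folded s_endo_eq]
  show "transport (demD n i) \<in> carrier R \<rightarrow>\<^sub>E carrier R \<and>
    (\<forall>f\<in>carrier R. \<forall>g\<in>carrier R. transport (demD n i) (f \<oplus>\<^bsub>R\<^esub> g) =
      transport (demD n i) f \<oplus>\<^bsub>R\<^esub> transport (demD n i) g) \<and>
    transport (demD n i) \<one>\<^bsub>R\<^esub> = \<zero>\<^bsub>R\<^esub> \<and>
    (\<forall>j\<in>{1..n}. transport (demD n i) (odd_x n j) = demazure_on_var n i j) \<and>
    (\<forall>f\<in>carrier R. \<forall>g\<in>carrier R. transport (demD n i) (f \<otimes>\<^bsub>R\<^esub> g) =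
      transport (demD n i) f \<otimes>\<^bsub>R\<^esub> g \<oplus>\<^bsub>R\<^esub> s_endo n i f \<otimes>\<^bsub>R\<^esub> transport (demD n i) g)"
  proof (intro conjI ballI)
    show "transport (demD n i) \<in> carrier R \<rightarrow>\<^sub>E carrier R"
      using T(1) by (auto simp: PiE_def transport_def)
  next
    fix f g assume fg: "f \<in> carrier R" "g \<in> carrier R"
    show "transport (demD n i) (f \<oplus>\<^bsub>R\<^esub> g) = transport (demD n i) f \<oplus>\<^bsub>R\<^esub> transport (demD n i) g"
      using fg by (intro odd_inj) (simp_all add: T oD odd_closed demD_linear)
    show "transport (demD n i) (f \<otimes>\<^bsub>R\<^esub> g) =
      transport (demD n i) f \<otimes>\<^bsub>R\<^esub> g \<oplus>\<^bsub>R\<^esub> s_endo n i f \<otimes>\<^bsub>R\<^esub> transport (demD n i) g"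
      using fg by (intro odd_inj) (simp_all add: T S oD odd_closed demD_mult)
  next
    show "transport (demD n i) \<one>\<^bsub>R\<^esub> = \<zero>\<^bsub>R\<^esub>"
      by (intro odd_inj) (simp_all add: T oD odd_closed demD_linear)
    show "transport (demD n i) (odd_x n j) = demazure_on_var n i j" if "j \<in> {1..n}" for j
      using that by (intro odd_inj) (simp_all add: T demazure_on_var_value odd_x_value)
  qed
  fix D assume D: "D \<in> carrier R \<rightarrow>\<^sub>E carrier R \<and>
    (\<forall>f\<in>carrier R. \<forall>g\<in>carrier R. D (f \<oplus>\<^bsub>R\<^esub> g) = D f \<oplus>\<^bsub>R\<^esub> D g) \<and> D \<one>\<^bsub>R\<^esub> = \<zero>\<^bsub>R\<^esub> \<and>
    (\<forall>j\<in>{1..n}. D (odd_x n j) = demazure_on_var n i j) \<and>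
    (\<forall>f\<in>carrier R. \<forall>g\<in>carrier R. D (f \<otimes>\<^bsub>R\<^esub> g) = D f \<otimes>\<^bsub>R\<^esub> g \<oplus>\<^bsub>R\<^esub> s_endo n i f \<otimes>\<^bsub>R\<^esub> D g)"
  have Dc: "D X \<in> carrier R" if "X \<in> carrier R" for X using D that by blast
  have add: "D (X \<oplus>\<^bsub>R\<^esub> Y) = D X \<oplus>\<^bsub>R\<^esub> D Y" if "X \<in> carrier R" "Y \<in> carrier R" for X Y
    using D that by blast
  have neg: "\<theta> (D (\<ominus>\<^bsub>R\<^esub> Y)) = - \<theta> (D Y)" if Y: "Y \<in> carrier R" for Y
  proof -
    interpret ring R by (rule oD(1))
    have "\<theta> (D \<zero>\<^bsub>R\<^esub>) + \<theta> (D \<zero>\<^bsub>R\<^esub>) = \<theta> (D \<zero>\<^bsub>R\<^esub>)"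
      using add[OF zero_closed zero_closed] oD(5)[OF Dc[OF zero_closed] Dc[OF zero_closed]] by simp
    then have "\<theta> (D (\<ominus>\<^bsub>R\<^esub> Y)) + \<theta> (D Y) = 0"
      using add[OF a_inv_closed[OF Y] Y] oD(5)[OF Dc[OF a_inv_closed[OF Y]] Dc[OF Y]] Y by (simp add: l_neg)
    then show ?thesis by (simp add: eq_neg_iff_add_eq_0)
  qed
  have "\<theta> (D X) = demD n i (\<theta> X)" if "X \<in> carrier R" for X
    using that
  proof (induction X rule: odd_pol_induct)
    case one then show ?case using D by (simp add: oD demD_linear)
  next
    case (var j Y)
    have x: "odd_x n j \<in> carrier R" by (rule odd_x_value(1)[OF var(1)])
    have "D (odd_x n j \<otimes>\<^bsub>R\<^esub> Y) = demazure_on_var n i j \<otimes>\<^bsub>R\<^esub> Y \<oplus>\<^bsub>R\<^esub> s_endo n i (odd_x n j) \<otimes>\<^bsub>R\<^esub> D Y"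
      using D x var by simp
    then show ?case using var x S[OF x] Dc[OF var(2)] demazure_on_var_value[OF var(1)] odd_x_value[OF var(1)]
      by (simp add: oD odd_closed demD_mult)
  next
    case (diff X Y)
    then show ?case using add[OF diff(1) odd_closed(3)[OF diff(2)]] neg[OF diff(2)] Dc
      by (simp add: oD odd_closed demD_linear)
  qed
  then have "D X = transport (demD n i) X" if "X \<in> carrier R" for X
    using that T Dc by (intro odd_inj) auto
  then show "D = transport (demD n i)"
    using D by (intro extensionalityI[where A = "carrier R"]) (auto simp: transport_def PiE_def)
qed

lemmas demazure_value = transport_demD[folded demazure_eq]

end

lemma spin_sym_eq: "spin_sym n = {X \<in> carrier R. \<theta> X \<in> invariants n}"
proof -
  have "demazure n i X = \<zero>\<^bsub>R\<^esub> \<longleftrightarrow> demD n i (\<theta> X) = 0" if "X \<in> carrier R" "i \<in> {1..n}" for X i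
    using odd_inj[OF demazure_value(1)[OF that(2,1)] odd_closed(5)] demazure_value(2)[OF that(2,1)] oD(4) by auto
  then show ?thesis unfolding spin_sym_def invariants_def by blast
qed

lemma spin_sym_represents: "represents (spin_sym_ring n) \<theta>"
proof -
  interpret ring R by (rule oD(1))
  have "subring (spin_sym n) R"
    by (rule subringI) (auto simp: spin_sym_eq oD invariants_closed)
  from subring_is_ring[OF this] have "ring (spin_sym_ring n)" by (simp add: spin_sym_ring_def)
  then show ?thesis
    using oD unfolding represents_def
    by (auto simp: spin_sym_ring_def spin_sym_eq inj_on_def)
qed

lemma demazure_word_value:
  assumes "is \<in> lists {1..n}" "X \<in> carrier R"
  shows "demazure_word n is X \<in> carrier R \<and> \<theta> (demazure_word n is X) = dems n is (\<theta> X)"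
  using assms(1)
  by (induction "is" rule: lists.induct) (use assms(2) demazure_value in \<open>auto simp: demazure_word_def\<close>)

lemma top_monomial_value: "top_monomial n \<in> carrier R \<and> \<theta> (top_monomial n) = top_poly n 1"
proof -
  interpret ring R by (rule oD(1))
  have p: "odd_x n i [^]\<^bsub>R\<^esub> k \<in> carrier R \<and> \<theta> (odd_x n i [^]\<^bsub>R\<^esub> k) = var i ^ k" if "i \<in> {1..n}" for i and k :: nat
    by (induction k) (use odd_x_value[OF that] in \<open>auto simp: oD power_commutes\<close>)
  have "foldr (\<lambda>i f. odd_x n i [^]\<^bsub>R\<^esub> (2 * n - 2 * i) \<otimes>\<^bsub>R\<^esub> f) xs \<one>\<^bsub>R\<^esub> \<in> carrier R \<and>
    \<theta> (foldr (\<lambda>i f. odd_x n i [^]\<^bsub>R\<^esub> (2 * n - 2 * i) \<otimes>\<^bsub>R\<^esub> f) xs \<one>\<^bsub>R\<^esub>) =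
      foldr (\<lambda>i f. var i ^ (2 * n - 2 * i) * f) xs 1" if "set xs \<subseteq> {1..n}" for xs
    using that by (induction xs) (use p in \<open>auto simp: oD\<close>)
  from this[of "[1..<n]"] have *: "top_monomial n \<in> carrier R \<and>
      \<theta> (top_monomial n) = foldr (\<lambda>i f. var i ^ (2 * n - 2 * i) * f) [1..<n] 1"
    unfolding top_monomial_def by fastforce
  then show ?thesis unfolding top_poly_def by simp
qed

end

section \<open>The basis theorem\<close>

context
  fixes n :: nat and red :: "(int \<Rightarrow> int) \<Rightarrow> nat list"
  assumes n2: "2 \<le> n" and red: "\<forall>w\<in>weyl_D n. reduced_expr n (red w) w"
begin

lemma red': "w \<in> weyl_D n \<Longrightarrow> reduced n (red w) \<and> word_prod n (red w) = w"
  using red reduced_expr_iff[OF n2] reduced_def[OF n2] by metis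

abbreviation W where "W \<equiv> weyl_D n"
abbreviation P where "P \<equiv> supp UNIV {1..n}"
abbreviation L where "L \<equiv> invariants n \<inter> supp UNIV {1..n}"
abbreviation \<Psi> where "\<Psi> \<equiv> tensor_value odd_value"

text \<open>
  The index \<open>u = w\<^sup>-\<^sup>1 w\<^sub>0\<close> of the polynomial that the theorem
  attaches to \<open>w\<close>.
\<close>

definition basis_index :: "(int \<Rightarrow> int) \<Rightarrow> int \<Rightarrow> int" where "basis_index w = finv w \<circ> longest_elt n"

definition basis_poly :: "(int \<Rightarrow> int) \<Rightarrow> oddpoly" where "basis_poly w = schub n red (basis_index w)"

text \<open>
  \<open>\<ell>(w\<^sup>-\<^sup>1 w\<^sub>0) = \<ell>(w\<^sub>0) - \<ell>(w)\<close>, so the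
  degree of the polynomial attached to \<open>w\<close> is \<open>2 \<ell>(w)\<close>; the
  inverse of the change of index is \<open>u \<mapsto> w\<^sub>0 u\<^sup>-\<^sup>1\<close>.
\<close>

lemma basis_index_props:
  assumes w: "w \<in> W"
  shows "basis_index w \<in> W" "len n w + len n (basis_index w) = top_len n" "dual n (basis_index w) = w"
proof -
  have b: "bij w" "bij (longest_elt n)"
    using weyl_signed_perm[OF n2] w longest_in[OF n2] by (auto simp: signed_perm_def)
  show u: "basis_index w \<in> W"
    unfolding basis_index_def by (intro weyl_comp[OF n2] weyl_finv[OF n2] w longest_in[OF n2])
  have "finv (basis_index w) = finv (longest_elt n) \<circ> w"
    unfolding basis_index_def using o_inv_distrib[of "finv w" "longest_elt n"] b
    by (simp add: bij_imp_bij_inv inv_inv_eq)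
  then show d: "dual n (basis_index w) = w"
    using b by (simp add: dual_def[OF n2 red'] wlong_def[OF n2 red'] fun_eq_iff bij_is_surj surj_f_inv_f)
  show "len n w + len n (basis_index w) = top_len n"
    using dual_props(2)[OF n2 red' u] d by simp
qed

lemma bij_basis_index: "bij_betw basis_index W W"
proof (rule bij_betw_byWitness[where f' = "dual n"])
  show "\<forall>u\<in>W. basis_index (dual n u) = u"
  proof
    fix u assume u: "u \<in> W"
    have b: "bij u" "bij (longest_elt n)"
      using weyl_signed_perm[OF n2] u longest_in[OF n2] by (auto simp: signed_perm_def)
    have "finv (longest_elt n \<circ> finv u) = u \<circ> finv (longest_elt n)"
      using o_inv_distrib[of "longest_elt n" "finv u"] b by (simp add: bij_imp_bij_inv inv_inv_eq)
    then show "basis_index (dual n u) = u"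
      using b by (simp add: basis_index_def dual_def[OF n2 red'] wlong_def[OF n2 red'] fun_eq_iff bij_is_inj)
  qed
qed (use basis_index_props dual_props(1)[OF n2 red'] in auto)

lemma basis_poly_homog:
  assumes "w \<in> W"
  shows "basis_poly w \<in> homog (len n w)" "basis_poly w \<noteq> 0" "basis_poly w \<in> P"
proof -
  have "top_len n - len n (basis_index w) = len n w" using basis_index_props(2)[OF assms] by simp
  then show "basis_poly w \<in> homog (len n w)" "basis_poly w \<noteq> 0" "basis_poly w \<in> P"
    using schub_homog[OF n2 red' basis_index_props(1)[OF assms]]
      schub_supp[OF n2 red' basis_index_props(1)[OF assms] additive_coeffs_UNIV]
    by (simp_all add: basis_poly_def)
qed

lemma right_expansion:
  assumes "f \<in> P"
  shows "\<exists>c. (\<forall>w\<in>W. c w \<in> L) \<and> f = (\<Sum>w\<in>W. basis_poly w * c w)"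
proof -
  obtain c where c: "\<forall>u\<in>W. c u \<in> L" "f = (\<Sum>u\<in>W. schub n red u * c u)"
    using schub_expansion_exists[OF n2 red' assms] by blast
  have "f = (\<Sum>w\<in>W. basis_poly w * c (basis_index w))"
    unfolding c(2) basis_poly_def by (rule sum.reindex_bij_betw[OF bij_basis_index, symmetric])
  then show ?thesis using c(1) basis_index_props(1) by (intro exI[of _ "\<lambda>w. c (basis_index w)"]) auto
qed

lemma right_unique:
  assumes "\<forall>w\<in>W. c w \<in> L" "\<forall>w\<in>W. c' w \<in> L"
    and eq: "(\<Sum>w\<in>W. basis_poly w * c w) = (\<Sum>w\<in>W. basis_poly w * c' w)"
  shows "\<forall>w\<in>W. c w = c' w"
proof
  fix w assume w: "w \<in> W"
  define d where "d u = c (dual n u) - c' (dual n u)" for u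
  have "(\<Sum>u\<in>W. schub n red u * d u) = (\<Sum>w\<in>W. basis_poly w * d (basis_index w))"
    unfolding basis_poly_def by (rule sum.reindex_bij_betw[OF bij_basis_index, symmetric])
  also have "\<dots> = (\<Sum>w\<in>W. basis_poly w * c w - basis_poly w * c' w)"
    by (rule sum.cong) (auto simp: d_def basis_index_props right_diff_distrib)
  also have "\<dots> = 0" using eq by (simp add: sum_subtractf)
  finally have z: "(\<Sum>u\<in>W. schub n red u * d u) = 0" .
  have "d u \<in> invariants n" if "u \<in> W" for u
    using assms(1,2) dual_props(1)[OF n2 red' that] by (auto simp: d_def intro: invariants_closed)
  from schub_expansion_unique[OF n2 red' this z basis_index_props(1)[OF w]]
  show "c w = c' w" by (simp add: d_def basis_index_props(3)[OF w])
qed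

lemma left_right:
  assumes "w \<in> W" "f \<in> L"
  shows "f * basis_poly w = basis_poly w * twist_pow (len n w) f"
  using assms basis_poly_homog[OF assms(1)] by (intro invariant_commute_homog[OF n2]) auto

text \<open>
  The coefficients of the right expansion, twisted according to the degree of the basis element
  they belong to.
\<close>

lemma left_expansion:
  assumes "f \<in> P"
  shows "\<exists>c. (\<forall>w\<in>W. c w \<in> L) \<and> f = (\<Sum>w\<in>W. c w * basis_poly w)"
proof -
  obtain c where c: "\<forall>w\<in>W. c w \<in> L" "f = (\<Sum>w\<in>W. basis_poly w * c w)"
    using right_expansion[OF assms] by blast
  have t: "twist_pow (len n w) (c w) \<in> L" if "w \<in> W" for w
    using c(1) that twist_pow_in[OF n2] by blast
  have "f = (\<Sum>w\<in>W. twist_pow (len n w) (c w) * basis_poly w)"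
    unfolding c(2) by (rule sum.cong) (use left_right[OF _ t] twist_pow_twist_pow[OF n2] in auto)
  then show ?thesis using t by (intro exI[of _ "\<lambda>w. twist_pow (len n w) (c w)"]) auto
qed

lemma left_unique:
  assumes c: "\<forall>w\<in>W. c w \<in> L" "\<forall>w\<in>W. c' w \<in> L"
    and eq: "(\<Sum>w\<in>W. c w * basis_poly w) = (\<Sum>w\<in>W. c' w * basis_poly w)"
  shows "\<forall>w\<in>W. c w = c' w"
proof -
  have s: "(\<Sum>w\<in>W. d w * basis_poly w) = (\<Sum>w\<in>W. basis_poly w * twist_pow (len n w) (d w))"
    if "\<forall>w\<in>W. d w \<in> L" for d
    by (rule sum.cong) (use left_right that in auto)
  have "\<forall>w\<in>W. twist_pow (len n w) (c w) = twist_pow (len n w) (c' w)"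
    using eq c twist_pow_in[OF n2] unfolding s[OF c(1)] s[OF c(2)] by (intro right_unique) auto
  then show ?thesis by (metis twist_pow_twist_pow[OF n2])
qed

text \<open>
  A rational polynomial has finitely many coefficients, hence a common denominator.
\<close>

lemma clear_denominators:
  assumes "f \<in> P"
  shows "\<exists>N>0. scal (of_nat N) * f \<in> supp \<int> {1..n}"
  using assms
proof (induction rule: coeff_in_monomial_induct)
  case (monomial m c)
  obtain a b where ab: "c = of_int a / of_int b" "b > 0"
    by (metis Rat_cases Fract_of_int_quotient of_int_eq_iff)
  then have "of_nat (nat b) * c = of_int a" by simp
  then have "scal (of_nat (nat b)) * monomial m c \<in> supp \<int> {1..n}"
    using monomial unfolding scal_mult_monomial by (simp add: coeff_in_monomial)
  then show ?case using ab(2) by (intro exI[of _ "nat b"]) simp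
next
  case (add f g)
  then obtain N M where NM: "N > 0" "scal (of_nat N) * f \<in> supp \<int> {1..n}"
    "M > 0" "scal (of_nat M) * g \<in> supp \<int> {1..n}" by blast
  have "scal (of_nat (N * M)) * (f + g) =
      scal (of_nat M) * (scal (of_nat N) * f) + scal (of_nat N) * (scal (of_nat M) * g)"
    unfolding mult.assoc[symmetric] scal_simps(6)[symmetric] by (simp add: distrib_left mult.commute)
  also have "\<dots> \<in> supp \<int> {1..n}"
    by (intro supp_add supp_mult supp_scal NM) auto
  finally show ?case using NM(1,3) by (intro exI[of _ "N * M"]) simp
qed (auto intro: exI[of _ 1])

text \<open>
  Rational elements with a property \<open>H\<close> that is stable under scaling come from
  integral ones with this property by division. With \<open>H\<close> the set of invariants,
  this says that passing to \<open>\<rat>\<close> commutes with taking kernels of the operators.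
\<close>

lemma tensor_image:
  assumes rep: "represents B odd_value" and B: "odd_value ` carrier B = supp \<int> {1..n} \<inter> H"
    and H: "\<And>c f. f \<in> H \<Longrightarrow> scal c * f \<in> H"
  shows "\<Psi> ` carrier (rat_tensor B) = P \<inter> H"
proof
  show "\<Psi> ` carrier (rat_tensor B) \<subseteq> P \<inter> H"
  proof
    fix f assume "f \<in> \<Psi> ` carrier (rat_tensor B)"
    then obtain X where X: "X \<in> carrier (rat_tensor B)" "f = \<Psi> X" by blast
    obtain N a where a: "a \<in> carrier B" "f = scal (1 / of_nat N) * odd_value a"
      using tensor_pure[OF rep X(1)] unfolding X(2) by blast
    then have "odd_value a \<in> supp \<int> {1..n} \<inter> H" using B by blast
    then show "f \<in> P \<inter> H" unfolding a(2)
      using H by (auto intro!: supp_mult supp_scal intro: coeff_in_mono)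
  qed
  show "P \<inter> H \<subseteq> \<Psi> ` carrier (rat_tensor B)"
  proof
    fix f assume f: "f \<in> P \<inter> H"
    then obtain N where N: "N > 0" "scal (of_nat N) * f \<in> supp \<int> {1..n}"
      using clear_denominators by blast
    then have "scal (of_nat N) * f \<in> odd_value ` carrier B" unfolding B using f H by blast
    then obtain a where a: "a \<in> carrier B" "scal (of_nat N) * f = odd_value a" by blast
    have "\<Psi> (pure_tensor B (1 / of_nat N) a) = scal (1 / of_nat N) * (scal (of_nat N) * f)"
      unfolding a(2) by (rule tensor_value_pure(2)[OF rep a(1)])
    also have "\<dots> = f" using N(1) unfolding mult.assoc[symmetric] scal_simps(6)[symmetric] by simp
    finally show "f \<in> \<Psi> ` carrier (rat_tensor B)"
      using tensor_value_pure(1)[OF rep a(1)] by (auto simp: image_iff)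
  qed
qed

lemmas repR = odd_pol_represents[of n]
lemmas repS = spin_sym_represents[OF n2]

lemma repA: "represents (odd_pol_rat n) \<Psi>"
  unfolding odd_pol_rat_def by (rule tensor_represents[OF repR])

lemma repB: "represents (spin_sym_rat n) \<Psi>"
  unfolding spin_sym_rat_def by (rule tensor_represents[OF repS])

lemma imageA: "\<Psi> ` carrier (odd_pol_rat n) = P"
  using tensor_image[OF repR, of UNIV] odd_value_image[of n] unfolding odd_pol_rat_def by simp

lemma imageB: "\<Psi> ` carrier (spin_sym_rat n) = L"
proof -
  have "odd_value ` carrier (spin_sym_ring n) = supp \<int> {1..n} \<inter> invariants n"
    using odd_value_image[of n] by (auto simp: spin_sym_ring_def spin_sym_eq[OF n2])
  from tensor_image[OF repS this] show ?thesis
    unfolding spin_sym_rat_def by (auto simp: invariants_closed)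
qed

lemma degA: "odd_pol_rat_deg n d = {X \<in> carrier (odd_pol_rat n). \<Psi> X \<in> homogZ d}"
  unfolding odd_pol_rat_deg_def odd_pol_rat_def
  by (rule rat_tensor_part_eq[OF repR odd_pol_deg_eq]) (auto intro: homogZ_add homogZ_scal)

lemma degB: "spin_sym_rat_deg n d = {X \<in> carrier (spin_sym_rat n). \<Psi> X \<in> homogZ d}"
  unfolding spin_sym_rat_deg_def spin_sym_rat_def
proof (rule rat_tensor_part_eq[OF repS])
  show "spin_sym n \<inter> odd_pol_deg n d = {a \<in> carrier (spin_sym_ring n). odd_value a \<in> homogZ d}"
    by (auto simp: odd_pol_deg_eq spin_sym_ring_def spin_sym_eq[OF n2])
qed (auto intro: homogZ_add homogZ_scal)

lemma gradedA: "graded_ring (odd_pol_rat n) (odd_pol_rat_deg n)"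
  by (rule graded_ring_representation[OF repA _ degA]) (simp add: imageA compZ_supp)

lemma gradedB: "graded_ring (spin_sym_rat n) (spin_sym_rat_deg n)"
  by (rule graded_ring_representation[OF repB _ degB]) (simp add: imageB compZ_supp compZ_invariant)

lemma incl_value:
  assumes "X \<in> carrier (spin_sym_rat n)"
  shows "spin_sym_rat_incl n X \<in> carrier (odd_pol_rat n)" "\<Psi> (spin_sym_rat_incl n X) = \<Psi> X"
proof -
  have "carrier (spin_sym_ring n) \<subseteq> carrier (odd_pol n)" by (auto simp: spin_sym_ring_def spin_sym_def)
  from rat_tensor_incl_value[OF repR repS this] assms
  show "spin_sym_rat_incl n X \<in> carrier (odd_pol_rat n)" "\<Psi> (spin_sym_rat_incl n X) = \<Psi> X"
    by (simp_all add: spin_sym_rat_incl_def odd_pol_rat_def spin_sym_rat_def)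
qed

lemma graded_incl:
  "graded_ring_hom (spin_sym_rat n) (spin_sym_rat_deg n) (odd_pol_rat n) (odd_pol_rat_deg n) (spin_sym_rat_incl n)"
proof -
  note DA = representsD[OF repA] and DB = representsD[OF repB]
  interpret A: ring "odd_pol_rat n" by (rule DA(1))
  interpret B: ring "spin_sym_rat n" by (rule DB(1))
  have inj: "X = Y" if "X \<in> carrier (odd_pol_rat n)" "Y \<in> carrier (odd_pol_rat n)" "\<Psi> X = \<Psi> Y" for X Y
    using inj_onD[OF DA(2)] that by blast
  have "spin_sym_rat_incl n \<in> ring_hom (spin_sym_rat n) (odd_pol_rat n)"
  proof (rule ring_hom_memI)
    fix X Y assume XY: "X \<in> carrier (spin_sym_rat n)" "Y \<in> carrier (spin_sym_rat n)"
    show "spin_sym_rat_incl n X \<in> carrier (odd_pol_rat n)" by (rule incl_value(1)[OF XY(1)])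
    show "spin_sym_rat_incl n (X \<otimes>\<^bsub>spin_sym_rat n\<^esub> Y) =
        spin_sym_rat_incl n X \<otimes>\<^bsub>odd_pol_rat n\<^esub> spin_sym_rat_incl n Y"
      using XY by (intro inj) (simp_all add: incl_value DA DB)
    show "spin_sym_rat_incl n (X \<oplus>\<^bsub>spin_sym_rat n\<^esub> Y) =
        spin_sym_rat_incl n X \<oplus>\<^bsub>odd_pol_rat n\<^esub> spin_sym_rat_incl n Y"
      using XY by (intro inj) (simp_all add: incl_value DA DB)
  next
    show "spin_sym_rat_incl n \<one>\<^bsub>spin_sym_rat n\<^esub> = \<one>\<^bsub>odd_pol_rat n\<^esub>"
      by (intro inj) (simp_all add: incl_value DA DB)
  qed
  moreover have "spin_sym_rat_incl n ` spin_sym_rat_deg n d \<subseteq> odd_pol_rat_deg n d" for d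
    by (auto simp: degA degB incl_value)
  ultimately show ?thesis unfolding graded_ring_hom_def using gradedA gradedB by blast
qed

lemma schubert_value:
  assumes w: "w \<in> W"
  shows "schubert_rat n red w \<in> carrier (odd_pol_rat n)" "\<Psi> (schubert_rat n red w) = basis_poly w"
proof -
  have wd: "red (basis_index w) \<in> lists {1..n}"
    using red'[OF basis_index_props(1)[OF w]] reduced_def[OF n2] by blast
  have s: "schubert n red w \<in> carrier (odd_pol n)" "odd_value (schubert n red w) = basis_poly w"
    using demazure_word_value[OF n2 wd] top_monomial_value[OF n2]
    by (simp_all add: schubert_def basis_poly_def schub_def[OF n2 red'] topp_def[OF n2 red'] flip: basis_index_def)
  show "schubert_rat n red w \<in> carrier (odd_pol_rat n)" "\<Psi> (schubert_rat n red w) = basis_poly w"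
    using tensor_value_pure[OF repR s(1), of 1] s(2) by (simp_all add: schubert_rat_def odd_pol_rat_def)
qed

text \<open>
  The polynomial is nonzero, so its degree is unique and the description in the graded rank
  picks it out.
\<close>

lemma schubert_deg:
  assumes w: "w \<in> W"
  shows "schubert_rat n red w \<in> odd_pol_rat_deg n d \<longleftrightarrow> d = 2 * int (len n w)"
proof
  have h: "basis_poly w \<in> homogZ (2 * int (len n w))"
    using basis_poly_homog(1)[OF w] by (simp add: homog_homogZ)
  show "schubert_rat n red w \<in> odd_pol_rat_deg n d" if "d = 2 * int (len n w)"
    using that h by (simp add: degA schubert_value[OF w])
  assume "schubert_rat n red w \<in> odd_pol_rat_deg n d"
  then have h': "basis_poly w \<in> homogZ d" by (simp add: degA schubert_value[OF w])
  obtain m where "Poly_Mapping.lookup (coeffs (basis_poly w)) m \<noteq> 0"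
    using oddpoly_eqI[of "basis_poly w" 0] basis_poly_homog(2)[OF w] by (auto simp: coeffs_ring_ops)
  with h h' show "d = 2 * int (len n w)" unfolding homogZ_iff by metis
qed

lemma right_basis:
  "homogeneous_right_basis (spin_sym_rat n) (spin_sym_rat_deg n) (odd_pol_rat n) (odd_pol_rat_deg n)
    (spin_sym_rat_incl n) W (schubert_rat n red)"
  unfolding homogeneous_right_basis_def
proof (intro conjI)
  interpret A: ring "odd_pol_rat n" by (rule representsD[OF repA])
  show "\<forall>x\<in>carrier (odd_pol_rat n). \<exists>!c. c \<in> W \<rightarrow>\<^sub>E carrier (spin_sym_rat n) \<and>
      x = (\<Oplus>\<^bsub>odd_pol_rat n\<^esub>w\<in>W. schubert_rat n red w \<otimes>\<^bsub>odd_pol_rat n\<^esub> spin_sym_rat_incl n (c w))"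
    by (rule unique_expansion_transfer[OF repA repB finite_weyl_D[OF n2],
          where \<tau> = "\<lambda>w f. basis_poly w * f"])
      (use right_expansion right_unique in \<open>auto simp: imageA imageB schubert_value incl_value representsD[OF repA]\<close>)
qed (use graded_incl finite_weyl_D[OF n2] schubert_deg in auto)

lemma left_basis:
  "homogeneous_left_basis (spin_sym_rat n) (spin_sym_rat_deg n) (odd_pol_rat n) (odd_pol_rat_deg n)
    (spin_sym_rat_incl n) W (schubert_rat n red)"
  unfolding homogeneous_left_basis_def
proof (intro conjI)
  interpret A: ring "odd_pol_rat n" by (rule representsD[OF repA])
  show "\<forall>x\<in>carrier (odd_pol_rat n). \<exists>!c. c \<in> W \<rightarrow>\<^sub>E carrier (spin_sym_rat n) \<and>
      x = (\<Oplus>\<^bsub>odd_pol_rat n\<^esub>w\<in>W. spin_sym_rat_incl n (c w) \<otimes>\<^bsub>odd_pol_rat n\<^esub> schubert_rat n red w)"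
    by (rule unique_expansion_transfer[OF repA repB finite_weyl_D[OF n2],
          where \<tau> = "\<lambda>w f. f * basis_poly w"])
      (use left_expansion left_unique in \<open>auto simp: imageA imageB schubert_value incl_value representsD[OF repA]\<close>)
qed (use graded_incl finite_weyl_D[OF n2] schubert_deg in auto)

lemma rank_formula:
  "graded_rank (odd_pol_rat_deg n) W (schubert_rat n red) =
    fls_X powi int (n * (n - 1)) * quantum_int n * (\<Prod>k=1..n-1. quantum_int (2 * k))"
proof -
  have "graded_rank (odd_pol_rat_deg n) W (schubert_rat n red) = (\<Sum>w\<in>W. (fls_X\<^sup>2) ^ len n w)"
    unfolding graded_rank_def
  proof (rule sum.cong)
    fix w assume w: "w \<in> W"
    have "(THE d. schubert_rat n red w \<in> odd_pol_rat_deg n d) = int (2 * len n w)"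
      by (simp add: schubert_deg[OF w])
    then show "fls_X powi (THE d. schubert_rat n red w \<in> odd_pol_rat_deg n d) = (fls_X\<^sup>2) ^ len n w"
      by (simp only: power_int_of_nat power_mult)
  qed simp
  also have "\<dots> = len_sum n (fls_X\<^sup>2) W" by (simp add: len_sum_def[OF n2])
  also have "\<dots> = (\<Prod>m=1..<n. (1 + (fls_X\<^sup>2) ^ m) * (\<Sum>j\<le>m. (fls_X\<^sup>2) ^ j))"
    by (rule len_sum_weyl[OF n2])
  also have "\<dots> = fls_X powi int (n * (n - 1)) * quantum_int n * (\<Prod>k=1..n-1. quantum_int (2 * k))"
    using n2 by (intro quantum_rank_product[symmetric]) simp
  finally show ?thesis .
qed

end

theorem proposition5p8:
  fixes n :: nat and red :: "(int \<Rightarrow> int) \<Rightarrow> nat list"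
  assumes "n \<ge> 2"
    and "\<forall>w\<in>weyl_D n. reduced_expr n (red w) w"
  shows "homogeneous_right_basis
           (spin_sym_rat n) (spin_sym_rat_deg n) (odd_pol_rat n) (odd_pol_rat_deg n)
           (spin_sym_rat_incl n) (weyl_D n) (schubert_rat n red)
       \<and> homogeneous_left_basis
           (spin_sym_rat n) (spin_sym_rat_deg n) (odd_pol_rat n) (odd_pol_rat_deg n)
           (spin_sym_rat_incl n) (weyl_D n) (schubert_rat n red)
       \<and> graded_rank (odd_pol_rat_deg n) (weyl_D n) (schubert_rat n red)
           = fls_X powi int (n * (n - 1)) * quantum_int n * (\<Prod>k=1..n-1. quantum_int (2 * k))"
  using right_basis[OF assms] left_basis[OF assms] rank_formula[OF assms] by blast

end
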